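(* Assume $d\le V/2$ and that XYZ-Sketch is used with the public random relabeling. For all constants $\varepsilon,\delta>0$ there exist fixed parameters $k,\ell$ such that, for all sufficiently large $d$, XYZ-Sketch (with suitable choices of the number of cells $M$ and the coupling parameter $z$) solves every instance with $|(A\setminus B)\cup(B\setminus A)|\le d$ with probability at least $1-\delta$ and satisfies: (i) $O(1)$ per-item update time and expected $O(d\log V)$ decoding time; (ii) at most $\lceil(1+\varepsilon)d\log_2V\rceil$ bits of communication, i.e. $\mathfrak C(d)\le(1+\varepsilon)d$. The constants hidden in the $O(\cdot)$ notation may depend on $\varepsilon$ and $\delta$, but not on $d$ or $V$.
   Context: **Problem.** $\mathcal U=\mathbb F_p$ with $p$ prime, $V=p$, $\mathcal U^*=\mathcal U\setminus\{0\}$, $[n]=\{1,\dots,n\}$. Two parties hold $A,B\subseteq\mathcal U^*$ with $|(A\setminus B)\cup(B\setminus A)|\le d$, $d$ known. Each encodes its set (elements arriving one at a time) into a sketch using shared public randomness; one sketch is communicated and a decoder given both sketches must output $(A\setminus B,B\setminus A)$ exactly ("solves the instance"). A sketch has communication cost $\mathfrak C(d)$ if, as $V\to\infty$, it occupies $(\mathfrak C(d)+o(1))\log_2V$ bits; public randomness is excluded from communication. An arithmetic operation on a field element, or an evaluation of a public random function, costs $O(1)$ time; factoring constant-degree polynomials over $\mathbb F_p$ is done by a standard randomized root-finding routine in $\Theta(\log V)$ expected time. **XYZ-Sketch.** Parameters: constants $k,\ell$; number of cells $M$; coupling parameter $z>0$; a fixed fingerprint modulus $q$ (odd $q\ge3$,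 or $q=1$ for no fingerprint). Public mutually independent uniform random functions $g_0:\mathcal U^*\to[0,z)$, $g_1,\dots,g_k:\mathcal U^*\to[0,1)$, and $h_{\mathrm{fp}}:\mathcal U^*\to\mathbb Z_q$. The support of $x$ is $\Gamma(x)=\{h'_1(x),\dots,h'_k(x)\}\subseteq[M]$ with $h'_i(x)=1+\lfloor\frac{g_0(x)+g_i(x)}{z+1}M\rfloor$. A cell representing $f:\mathcal U^*\to\{-1,0,1\}$ stores $\sum_x f(x)\bmod(2\ell+1)$, the polynomial $\prod_x(Z-x)^{f(x)}\bmod Z^\ell\in\mathbb F_p[Z]/(Z^\ell)$ (as $\ell$ coefficients), and $\sum_xf(x)h_{\mathrm{fp}}(x)\in\mathbb Z_q$. In the sketch of a set $S$, cell $j$ represents the indicator function of $\{x\in S:j\in\Gamma(x)\}$; inserting $x$ updates the cells in $\Gamma(x)$. *Decoding*: subtract the sketches cellwise (subtract counts and fingerprints, divide polynomials mod $Z^\ell$). To decode a cell $j$ with count $c$ and polynomial $P$: let $m\in[-\ell,\ell]$, $m\equiv c\pmod{2\ell+1}$; find the (unique, if existing) monic coprime $F,G\in\mathbb F_p[Z]$ with $G(0)\ne0$, $\deg F+\deg G\le\ell$, $\deg F-\deg G=m$, $F\equiv GP\pmod{Z^\ell}$; reject if none exists or if $F$ or $G$ is not a product of distinct linear factors with nonzero roots; the candidate consists of the roots of $F$ with sign $+1$ and of $G$ with sign $-1$; accept iff every candidate element $x$ has $j\in\Gamma(x)$ and the signed sum of the candidates' fingerprints equals the stored one. A queue initially contains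 all cells; cells are popped and tried; for each accepted signed element $(x,\sigma)$, record it, remove its contribution from all cells in $\Gamma(x)$ and push these cells. Fail if more than $M+kd$ pops occur; when the queue is empty, output the recorded sets ($+1$ elements, $-1$ elements) if all cells are empty (count $0$, polynomial $1$, fingerprint $0$), otherwise fail. **Public random relabeling.** A public uniformly random bijection $\phi:\mathcal U^*\to\mathcal U^*$, independent of all other randomness, is applied to all elements before sketching and $\phi^{-1}$ after decoding. Probability is over all public randomness; expected decoding time is over the root-finding routine's randomness. *)

theory Defs
  imports
    "HOL-Probability.Probability"
    "HOL-Number_Theory.Modular_Inverse"
    "HOL-Library.Monad_Syntax"
begin

section \<open>Cost model\<close>

text \<open>
  Programs carry the number of unit-cost operations they perform: arithmetic operations on field
  elements, counters and fingerprints, comparisons, evaluations of public random functions, and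
  accesses to a cell or to the queue.
\<close>

datatype 'a timed = Timed (val: 'a) (cost: nat)

definition ret :: "'a \<Rightarrow> 'a timed" where
  "ret v = Timed v 0"

definition steps :: "nat \<Rightarrow> 'a \<Rightarrow> 'a timed" where
  "steps n v = Timed v n"

abbreviation step :: "'a \<Rightarrow> 'a timed" where
  "step \<equiv> steps 1"

definition bind_timed :: "'a timed \<Rightarrow> ('a \<Rightarrow> 'b timed) \<Rightarrow> 'b timed" where
  "bind_timed m f =
     (case m of Timed v c \<Rightarrow> (case f v of Timed v' c' \<Rightarrow> Timed v' (c + c')))"

adhoc_overloading Monad_Syntax.bind \<rightleftharpoons> bind_timed

lemma timed_simps [simp]:
  "val (ret v) = v" "cost (ret v) = 0"
  "val (steps n v) = v" "cost (steps n v) = n"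
  "val (bind_timed m f) = val (f (val m))"
  "cost (bind_timed m f) = cost m + cost (f (val m))"
  by (simp_all add: ret_def steps_def bind_timed_def split: timed.split)

fun map_timed :: "('a \<Rightarrow> 'b timed) \<Rightarrow> 'a list \<Rightarrow> 'b list timed" where
  "map_timed f [] = ret []"
| "map_timed f (x # xs) = do { y \<leftarrow> f x; ys \<leftarrow> map_timed f xs; ret (y # ys) }"

fun fold_timed :: "('a \<Rightarrow> 'b \<Rightarrow> 'b timed) \<Rightarrow> 'a list \<Rightarrow> 'b \<Rightarrow> 'b timed" where
  "fold_timed f [] s = ret s"
| "fold_timed f (x # xs) s = do { s' \<leftarrow> f x s; fold_timed f xs s' }"

lemma val_map_timed [simp]: "val (map_timed f xs) = map (\<lambda>x. val (f x)) xs"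
  by (induction xs) simp_all

text \<open>Randomized programs: a distribution over pairs of a result and a cost.\<close>

datatype 'a rtimed = RTimed (run: "'a timed pmf")

definition det :: "'a timed \<Rightarrow> 'a rtimed" where
  "det m = RTimed (return_pmf m)"

definition bind_rtimed :: "'a rtimed \<Rightarrow> ('a \<Rightarrow> 'b rtimed) \<Rightarrow> 'b rtimed" where
  "bind_rtimed m f = RTimed (bind_pmf (run m) (\<lambda>r.
     map_pmf (\<lambda>r'. Timed (val r') (cost r + cost r')) (run (f (val r)))))"

adhoc_overloading Monad_Syntax.bind \<rightleftharpoons> bind_rtimed


section \<open>Polynomials over the prime field\<close>

text \<open>
  Elements of the prime field are represented by the integers in \<open>{0..<p}\<close>, polynomials over it by
  integer polynomials with such coefficients; \<open>cong_trunc p n\<close> is congruence modulo \<open>Z ^ n\<close> in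
  \<open>F\<^sub>p[Z]\<close>.
\<close>

definition reduced :: "nat \<Rightarrow> int poly \<Rightarrow> bool" where
  "reduced p F \<longleftrightarrow> (\<forall>i. coeff F i \<in> {0..<int p})"

definition cong_poly :: "nat \<Rightarrow> int poly \<Rightarrow> int poly \<Rightarrow> bool" where
  "cong_poly p F G \<longleftrightarrow> (\<forall>i. [coeff F i = coeff G i] (mod int p))"

definition cong_trunc :: "nat \<Rightarrow> nat \<Rightarrow> int poly \<Rightarrow> int poly \<Rightarrow> bool" where
  "cong_trunc p n F G \<longleftrightarrow> (\<forall>i<n. [coeff F i = coeff G i] (mod int p))"

definition dvd_mod :: "nat \<Rightarrow> int poly \<Rightarrow> int poly \<Rightarrow> bool" where
  "dvd_mod p D F \<longleftrightarrow> (\<exists>Q. cong_poly p F (D * Q))"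

definition coprime_mod :: "nat \<Rightarrow> int poly \<Rightarrow> int poly \<Rightarrow> bool" where
  "coprime_mod p F G \<longleftrightarrow> (\<forall>D. dvd_mod p D F \<longrightarrow> dvd_mod p D G \<longrightarrow> dvd_mod p D 1)"

definition linear_prod :: "int set \<Rightarrow> int poly" where
  "linear_prod X = (\<Prod>x\<in>X. [:- x, 1:])"

text \<open>
  The pair \<open>(F, G)\<close> which a cell with polynomial \<open>A\<close> (given by \<open>l\<close> coefficients) and signed
  count \<open>m\<close> is decoded to.
\<close>

definition decoding_pair ::
    "nat \<Rightarrow> nat \<Rightarrow> int \<Rightarrow> int list \<Rightarrow> int poly \<Rightarrow> int poly \<Rightarrow> bool" where
  "decoding_pair p l m A F G \<longleftrightarrow>
     reduced p F \<and> reduced p G \<and> lead_coeff F = 1 \<and> lead_coeff G = 1 \<and> coprime_mod p F G \<and>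
     coeff G 0 \<noteq> 0 \<and> degree F + degree G \<le> l \<and> int (degree F) - int (degree G) = m \<and>
     cong_trunc p l F (G * Poly A)"


subsection \<open>Arithmetic on coefficient lists, constant term first\<close>

fun mul_linear :: "nat \<Rightarrow> int \<Rightarrow> int \<Rightarrow> int list \<Rightarrow> int list timed" where
  "mul_linear p x prev [] = ret []"
| "mul_linear p x prev (c # cs) = do {
     t \<leftarrow> step (x * c mod int p);
     b \<leftarrow> step ((prev - t) mod int p);
     bs \<leftarrow> mul_linear p x c cs;
     ret (b # bs) }"

fun div_linear :: "nat \<Rightarrow> int \<Rightarrow> int \<Rightarrow> int list \<Rightarrow> int list timed" where
  "div_linear p xinv prev [] = ret []"
| "div_linear p xinv prev (c # cs) = do {
     t \<leftarrow> step ((prev - c) mod int p);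
     b \<leftarrow> step (t * xinv mod int p);
     bs \<leftarrow> div_linear p xinv b cs;
     ret (b # bs) }"

text \<open>\<open>c \<mapsto> c * (Z - x) ^ \<sigma>\<close> modulo \<open>Z ^ length c\<close>, for \<open>\<sigma> = 1\<close> and \<open>\<sigma> = - 1\<close>.\<close>

definition mul_power_linear :: "nat \<Rightarrow> int \<Rightarrow> int \<Rightarrow> int list \<Rightarrow> int list timed" where
  "mul_power_linear p x \<sigma> c =
     (if \<sigma> = 1 then mul_linear p x 0 c
      else do { xinv \<leftarrow> step (modular_inverse (int p) x); div_linear p xinv 0 c })"

definition sub_scaled :: "nat \<Rightarrow> int \<Rightarrow> int list \<Rightarrow> int list \<Rightarrow> int list timed" where
  "sub_scaled p a us vs =
     map_timed (\<lambda>(u, v). do { t \<leftarrow> step (a * v mod int p); step ((u - t) mod int p) }) (zip us vs)"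

fun div_series_aux :: "nat \<Rightarrow> int \<Rightarrow> int list \<Rightarrow> nat \<Rightarrow> int list \<Rightarrow> int list timed" where
  "div_series_aux p binv bs 0 as = ret []"
| "div_series_aux p binv bs (Suc n) as = do {
     c \<leftarrow> step (hd as * binv mod int p);
     as' \<leftarrow> sub_scaled p c (tl as) (tl bs);
     cs \<leftarrow> div_series_aux p binv bs n as';
     ret (c # cs) }"

definition div_series :: "nat \<Rightarrow> int list \<Rightarrow> int list \<Rightarrow> int list timed" where
  "div_series p as bs = do {
     binv \<leftarrow> step (modular_inverse (int p) (hd bs));
     div_series_aux p binv bs (length as) as }"


subsection \<open>Computing the decoding pair\<close>

text \<open>
  Gaussian elimination for \<open>n\<close> unknowns; a row lists the \<open>n\<close> coefficients of an equation followed
  by its right-hand side.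
\<close>

fun find_pivot :: "int list list \<Rightarrow> (int list \<times> int list list) option timed" where
  "find_pivot [] = ret None"
| "find_pivot (r # rs) = do {
     nz \<leftarrow> step (hd r \<noteq> 0);
     if nz then ret (Some (r, rs))
     else do {
       res \<leftarrow> find_pivot rs;
       ret (map_option (\<lambda>(piv, rest). (piv, r # rest)) res) } }"

fun solve :: "nat \<Rightarrow> nat \<Rightarrow> int list list \<Rightarrow> int list option timed" where
  "solve p 0 eqs = do {
     ok \<leftarrow> steps (length eqs) (\<forall>r\<in>set eqs. hd r = 0);
     ret (if ok then Some [] else None) }"
| "solve p (Suc n) eqs = do {
     piv \<leftarrow> find_pivot eqs;
     case piv of
       None \<Rightarrow> do {
         eqs' \<leftarrow> steps (length eqs) (map tl eqs);
         sol \<leftarrow> solve p n eqs';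
         ret (map_option (\<lambda>xs. 0 # xs) sol) }
     | Some (r, rs) \<Rightarrow> do {
         rinv \<leftarrow> step (modular_inverse (int p) (hd r));
         r' \<leftarrow> map_timed (\<lambda>a. step (a * rinv mod int p)) (tl r);
         rs' \<leftarrow> map_timed (\<lambda>row. sub_scaled p (hd row) (tl row) r') rs;
         sol \<leftarrow> solve p n rs';
         case sol of
           None \<Rightarrow> ret None
         | Some xs \<Rightarrow> do {
             x \<leftarrow> fold_timed (\<lambda>(a, y) s. do {
                    t \<leftarrow> step (a * y mod int p); step ((s - t) mod int p) }) (zip r' xs) (last r');
             ret (Some (x # xs)) } } }"

text \<open>
  For fixed degrees \<open>a\<close> of \<open>F\<close> and \<open>b\<close> of \<open>G\<close>, both monic, \<open>F = G * A\<close> modulo \<open>Z ^ l\<close> is a linear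
  system for the \<open>a + b\<close> lower coefficients of \<open>F\<close> and \<open>G\<close>; row \<open>i\<close> compares the coefficients of
  \<open>Z ^ i\<close>.
\<close>

definition pair_row :: "nat \<Rightarrow> int list \<Rightarrow> nat \<Rightarrow> nat \<Rightarrow> nat \<Rightarrow> int list" where
  "pair_row p A a b i =
     map (\<lambda>s. if s = i then 1 else 0) [0..<a] @
     map (\<lambda>t. if t \<le> i then (- (A ! (i - t))) mod int p else 0) [0..<b] @
     [((if b \<le> i then A ! (i - b) else 0) - (if i = a then 1 else 0)) mod int p]"

fun first_pair ::
    "nat \<Rightarrow> int list \<Rightarrow> (nat \<times> nat) list \<Rightarrow> (int list \<times> int list) option timed" where
  "first_pair p A [] = ret None"
| "first_pair p A ((a, b) # degs) = do {
     eqs \<leftarrow> map_timed (\<lambda>i. steps (a + b + 2) (pair_row p A a b i)) [0..<length A];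
     sol \<leftarrow> solve p (a + b) eqs;
     case sol of
       None \<Rightarrow> first_pair p A degs
     | Some xs \<Rightarrow> do {
         nz \<leftarrow> step (hd (drop a xs @ [1]) \<noteq> 0);
         ret (if nz then Some (take a xs @ [1], drop a xs @ [1]) else None) } }"

definition degree_pairs :: "nat \<Rightarrow> int \<Rightarrow> (nat \<times> nat) list" where
  "degree_pairs l m =
     map (\<lambda>b. (nat (int b + m), b))
       (filter (\<lambda>b. 0 \<le> int b + m \<and> nat (int b + m) + b \<le> l) [0..<Suc l])"

definition find_pair :: "nat \<Rightarrow> int \<Rightarrow> int list \<Rightarrow> (int list \<times> int list) option timed" where
  "find_pair p m A = do {
     degs \<leftarrow> steps (Suc (length A)) (degree_pairs (length A) m);
     first_pair p A degs }"


subsection \<open>\<open>find_pair\<close> computes the decoding pair\<close>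

lemma prime_int_coprime: "prime p \<Longrightarrow> c \<in> {0..<int p} \<Longrightarrow> c \<noteq> 0 \<Longrightarrow> coprime c (int p)"
  by (metis atLeastLessThan_iff coprime_commute order.not_eq_order_implies_strict prime_imp_coprime
      prime_nat_int_transfer zdvd_not_zless)

definition row_dot :: "int list \<Rightarrow> int list \<Rightarrow> int" where
  "row_dot r xs = (\<Sum>(a, y)\<leftarrow>zip r xs. a * y)"

definition row_sat :: "nat \<Rightarrow> int list \<Rightarrow> int list \<Rightarrow> bool" where
  "row_sat p r xs \<longleftrightarrow> [row_dot r xs = last r] (mod int p)"

lemma row_dot_simps [simp]: "row_dot (a # r) (y # ys) = a * y + row_dot r ys" "row_dot r [] = 0" "row_dot [] ys = 0"
  by (simp_all add: row_dot_def)

lemma val_sub_scaled: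
  "val (sub_scaled p a us vs) = map (\<lambda>(u, v). (u - a * v mod int p) mod int p) (zip us vs)"
  by (auto simp: sub_scaled_def)

lemma lin_sub_scaled:
  "length us = length vs \<Longrightarrow>
   [row_dot (val (sub_scaled p a us vs)) ys = row_dot us ys - a * row_dot vs ys] (mod int p)"
proof (induction us vs arbitrary: ys rule: list_induct2)
  case Nil
  then show ?case by (simp add: val_sub_scaled)
next
  case (Cons u us v vs)
  show ?case
  proof (cases ys)
    case (Cons y ys')
    have "[(u - a * v mod int p) mod int p * y = (u - a * v) * y] (mod int p)"
      by (simp add: Cong.cong_def mod_simps)
    from cong_add[OF this Cons.IH[of ys']] show ?thesis
      using Cons by (simp add: val_sub_scaled algebra_simps)
  qed simp
qed

lemma last_sub_scaled:
  "length us = length vs \<Longrightarrow> us \<noteq> [] \<Longrightarrow>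
   [last (val (sub_scaled p a us vs)) = last us - a * last vs] (mod int p)"
  by (induction us vs rule: list_induct2) (auto simp: val_sub_scaled Cong.cong_def mod_simps)

lemma sat_sub_scaled:
  assumes "length us = length vs" "us \<noteq> []"
  shows "row_sat p (val (sub_scaled p a us vs)) ys \<longleftrightarrow>
    [row_dot us ys - a * row_dot vs ys = last us - a * last vs] (mod int p)"
  unfolding row_sat_def using lin_sub_scaled[OF assms(1)] last_sub_scaled[OF assms]
  by (metis cong_sym cong_trans)

lemma lin_map_scale:
  "[row_dot (map (\<lambda>a. a * c mod int p) r) ys = c * row_dot r ys] (mod int p)"
proof (induction r arbitrary: ys)
  case (Cons a r)
  show ?case
  proof (cases ys)
    case (Cons y ys')
    have "[a * c mod int p * y = c * (a * y)] (mod int p)"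
      by (simp add: Cong.cong_def mod_simps algebra_simps)
    from cong_add[OF this Cons.IH[of ys']] show ?thesis
      using Cons by (simp add: algebra_simps)
  qed simp
qed simp

lemma last_map_scale:
  "r \<noteq> [] \<Longrightarrow> [last (map (\<lambda>a. a * c mod int p) r) = c * last r] (mod int p)"
  by (simp add: last_map Cong.cong_def mult.commute)

lemma val_back_subst:
  assumes "s \<in> {0..<int p}" "p > 0"
  shows "val (fold_timed (\<lambda>(a, y) s. do {
           t \<leftarrow> step (a * y mod int p); step ((s - t) mod int p) }) (zip r ys) s) \<in> {0..<int p} \<and>
         [val (fold_timed (\<lambda>(a, y) s. do {
           t \<leftarrow> step (a * y mod int p); step ((s - t) mod int p) }) (zip r ys) s) = s - row_dot r ys]
         (mod int p)"
  using assms(1)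
proof (induction r arbitrary: ys s)
  case (Cons a r)
  show ?case
  proof (cases ys)
    case (Cons y ys')
    have mem: "(s - a * y mod int p) mod int p \<in> {0..<int p}" using assms(2) by simp
    have "[(s - a * y mod int p) mod int p - row_dot r ys' = s - a * y - row_dot r ys'] (mod int p)"
      by (simp add: Cong.cong_def mod_simps)
    then show ?thesis using Cons.IH[OF mem, of ys'] Cons
      by (auto simp: algebra_simps intro: cong_trans)
  qed (use Cons.prems in simp)
qed simp

lemma find_pivot_None: "val (find_pivot rs) = None \<longleftrightarrow> (\<forall>r\<in>set rs. hd r = 0)"
  by (induction rs) auto

lemma find_pivot_Some:
  "val (find_pivot rs) = Some (r, rs') \<Longrightarrow> hd r \<noteq> 0 \<and> set rs = insert r (set rs')"
  by (induction rs arbitrary: r rs') (auto split: if_splits)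

lemma solve_correct:
  assumes p: "prime p"
  shows "(\<And>r. r \<in> set eqs \<Longrightarrow> length r = Suc n \<and> set r \<subseteq> {0..<int p}) \<Longrightarrow>
    (case val (solve p n eqs) of
       None \<Rightarrow> \<not> (\<exists>xs. length xs = n \<and> (\<forall>r\<in>set eqs. row_sat p r xs))
     | Some xs \<Rightarrow> length xs = n \<and> set xs \<subseteq> {0..<int p} \<and> (\<forall>r\<in>set eqs. row_sat p r xs))"
proof (induction n arbitrary: eqs)
  case 0
  have "row_sat p r [] \<longleftrightarrow> hd r = 0" if "r \<in> set eqs" for r
    using 0[OF that] by (cases r) (auto simp: row_sat_def Cong.cong_def)
  then show ?case by (auto simp: Let_def)
next
  case (Suc n)
  have p0: "p > 0" using p prime_gt_0_nat by blast
  show ?case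
  proof (cases "val (find_pivot eqs)")
    case None
    then have hd0: "hd r = 0" if "r \<in> set eqs" for r using that find_pivot_None by blast
    have pre: "length r = Suc n \<and> set r \<subseteq> {0..<int p}" if "r \<in> set (map tl eqs)" for r
    proof -
      from that obtain r' where "r' \<in> set eqs" "r = tl r'" by auto
      moreover from this have "length r' = Suc (Suc n)" "set r' \<subseteq> {0..<int p}"
        using Suc.prems[of r'] by auto
      ultimately show ?thesis by (metis length_tl diff_Suc_1 list.set_sel(2) list.size(3) nat.distinct(1) subset_iff)
    qed
    have row_sat: "row_sat p r (x # xs) \<longleftrightarrow> row_sat p (tl r) xs" if "r \<in> set eqs" for r x xs
      using Suc.prems[OF that] hd0[OF that] by (cases r) (auto simp: row_sat_def)
    show ?thesis
    proof (cases "val (solve p n (map tl eqs))")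
      case None': None
      then have "\<not> (\<exists>xs. length xs = n \<and> (\<forall>r\<in>set eqs. row_sat p (tl r) xs))"
        using Suc.IH[of "map tl eqs"] pre by simp
      then have "\<not> (\<exists>xs. length xs = Suc n \<and> (\<forall>r\<in>set eqs. row_sat p r xs))"
        using row_sat by (metis length_Suc_conv)
      then show ?thesis using None None' by simp
    next
      case (Some xs)
      then show ?thesis using Suc.IH[of "map tl eqs"] pre None p0 row_sat by simp
    qed
  next
    case (Some piv)
    obtain r rs where piv: "piv = (r, rs)" by force
    from find_pivot_Some[of eqs r rs] Some piv
    have hr: "hd r \<noteq> 0" and eqs: "set eqs = insert r (set rs)" by auto
    define c where "c = hd r"
    define t where "t = tl r"
    define ci where "ci = modular_inverse (int p) c"
    define r' where "r' = map (\<lambda>a. a * ci mod int p) t"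
    have rr: "length r = Suc (Suc n)" "set r \<subseteq> {0..<int p}" using Suc.prems[of r] eqs by auto
    have r: "r = c # t" and lt: "length t = Suc n" using rr by (cases r; simp add: c_def t_def)+
    have tne: "t \<noteq> []" using lt by auto
    have cop: "coprime c (int p)"
      using prime_int_coprime[OF p] rr hr by (cases r) (auto simp: c_def)
    have ci: "[c * ci = 1] (mod int p)"
      unfolding ci_def by (rule cong_modular_inverse1[OF cop])
    have lr': "length r' = Suc n" by (simp add: r'_def lt)
    have r'ne: "r' \<noteq> []" using lr' by auto
    have r'mem: "set r' \<subseteq> {0..<int p}" using p0 by (auto simp: r'_def)
    define rs' where "rs' = map (\<lambda>row. val (sub_scaled p (hd row) (tl row) r')) rs"
    have row: "length row = Suc (Suc n)" if "row \<in> set rs" for row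
      using Suc.prems[of row] that eqs by auto
    have pre: "length s = Suc n \<and> set s \<subseteq> {0..<int p}" if "s \<in> set rs'" for s
    proof -
      from that obtain w where w: "w \<in> set rs" "s = val (sub_scaled p (hd w) (tl w) r')"
        by (auto simp: rs'_def)
      then show ?thesis using row[OF w(1)] lr' p0 by (auto simp: val_sub_scaled)
    qed
    have lr: "[row_dot r' ys = ci * row_dot t ys] (mod int p)" for ys
      unfolding r'_def by (rule lin_map_scale)
    have las: "[last r' = ci * last t] (mod int p)"
      unfolding r'_def by (rule last_map_scale[OF tne])
    have cong_c: "[c * row_dot r' ys = row_dot t ys] (mod int p)" "[c * last r' = last t] (mod int p)" for ys
    proof -
      have "[c * (ci * v) = v] (mod int p)" for v
        using cong_scalar_right[OF ci, of v] by (simp add: mult.assoc)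
      then show "[c * row_dot r' ys = row_dot t ys] (mod int p)" "[c * last r' = last t] (mod int p)"
        using cong_scalar_left[OF lr, of c] cong_scalar_left[OF las, of c] cong_trans by blast+
    qed
    have satr: "row_sat p r (x # ys) \<longleftrightarrow> [x + row_dot r' ys = last r'] (mod int p)" for x ys
    proof -
      have "row_sat p r (x # ys) \<longleftrightarrow> [c * x + row_dot t ys = last t] (mod int p)"
        using tne by (simp add: row_sat_def r)
      also have "\<dots> \<longleftrightarrow> [c * x + c * row_dot r' ys = c * last r'] (mod int p)"
        using cong_c by (meson cong_add_lcancel cong_sym cong_trans)
      also have "\<dots> \<longleftrightarrow> [x + row_dot r' ys = last r'] (mod int p)"
        using cong_mult_lcancel[OF cop, of "x + row_dot r' ys" "last r'"] by (simp add: distrib_left)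
      finally show ?thesis .
    qed
    have satw: "row_sat p w (x # ys) \<longleftrightarrow> row_sat p (val (sub_scaled p (hd w) (tl w) r')) ys"
      if w: "w \<in> set rs" and x: "[x + row_dot r' ys = last r'] (mod int p)" for w x ys
    proof -
      obtain a u where au: "w = a # u" "length u = Suc n" using row[OF w] by (cases w) auto
      have une: "u \<noteq> []" using au by auto
      have "row_sat p w (x # ys) \<longleftrightarrow> [a * x + row_dot u ys = last u] (mod int p)"
        using une by (simp add: row_sat_def au)
      also have "\<dots> \<longleftrightarrow>
          [a * x + row_dot u ys - a * (x + row_dot r' ys) = last u - a * last r'] (mod int p)"
        using cong_scalar_left[OF x, of a]
        by (smt (verit, best) cong_diff cong_add diff_add_cancel)
      also have "\<dots> \<longleftrightarrow> row_sat p (val (sub_scaled p (hd w) (tl w) r')) ys"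
        using sat_sub_scaled[of u r' p a ys] une au lr' by (simp add: algebra_simps)
      finally show ?thesis .
    qed
    show ?thesis
    proof (cases "val (solve p n rs')")
      case None': None
      have no: "\<not> (\<exists>ys. length ys = n \<and> (\<forall>s\<in>set rs'. row_sat p s ys))"
        using Suc.IH[of rs'] pre None' by simp
      have "\<not> (\<exists>xs. length xs = Suc n \<and> (\<forall>s\<in>set eqs. row_sat p s xs))"
      proof
        assume "\<exists>xs. length xs = Suc n \<and> (\<forall>s\<in>set eqs. row_sat p s xs)"
        then obtain x ys where xy: "length ys = n" "\<forall>s\<in>set eqs. row_sat p s (x # ys)"
          by (metis length_Suc_conv)
        then have "[x + row_dot r' ys = last r'] (mod int p)" using satr eqs by auto
        then have "\<forall>s\<in>set rs'. row_sat p s ys" using satw xy eqs by (auto simp: rs'_def)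
        then show False using no xy by blast
      qed
      then show ?thesis using Some piv None'
        by (simp add: rs'_def r'_def ci_def c_def t_def)
    next
      case Some': (Some ys)
      have ys: "length ys = n" "set ys \<subseteq> {0..<int p}" "\<forall>s\<in>set rs'. row_sat p s ys"
        using Suc.IH[of rs'] pre Some' by simp_all
      have lm: "last r' \<in> {0..<int p}" using r'mem r'ne last_in_set by blast
      define x where "x = val (fold_timed (\<lambda>(a, y) s. do {
           t \<leftarrow> step (a * y mod int p); step ((s - t) mod int p) }) (zip r' ys) (last r'))"
      have x: "x \<in> {0..<int p}" "[x = last r' - row_dot r' ys] (mod int p)"
        using val_back_subst[OF lm p0, of r' ys] by (simp_all add: x_def)
      have x': "[x + row_dot r' ys = last r'] (mod int p)"
        using cong_add[OF x(2) cong_refl[of "row_dot r' ys"]] by simp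
      have "val (solve p (Suc n) eqs) = Some (x # ys)"
        using Some piv Some' unfolding x_def by (simp add: rs'_def r'_def ci_def c_def t_def)
      moreover have "\<forall>s\<in>set eqs. row_sat p s (x # ys)"
        using satr satw ys x' eqs by (auto simp: rs'_def)
      ultimately show ?thesis using ys x by auto
    qed
  qed
qed


lemma cong_poly_iff_dvd: "cong_poly p F G \<longleftrightarrow> [:int p:] dvd F - G"
  by (simp add: cong_poly_def const_poly_dvd_iff cong_iff_dvd_diff)

lemma cong_poly_refl [simp, intro!]: "cong_poly p F F"
  by (simp add: cong_poly_def)

lemma cong_poly_sym: "cong_poly p F G \<Longrightarrow> cong_poly p G F"
  by (simp add: cong_poly_def cong_sym)

lemma cong_poly_trans [trans]: "cong_poly p F G \<Longrightarrow> cong_poly p G H \<Longrightarrow> cong_poly p F H"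
  by (meson cong_poly_def cong_trans)

lemma cong_poly_mult: "cong_poly p F G \<Longrightarrow> cong_poly p F' G' \<Longrightarrow> cong_poly p (F * F') (G * G')"
proof -
  assume "cong_poly p F G" "cong_poly p F' G'"
  then have "[:int p:] dvd (F - G) * F' + G * (F' - G')"
    by (simp add: cong_poly_iff_dvd)
  then show ?thesis by (simp add: cong_poly_iff_dvd algebra_simps)
qed

lemma cong_poly_diff: "cong_poly p F G \<Longrightarrow> cong_poly p F' G' \<Longrightarrow> cong_poly p (F - F') (G - G')"
  by (simp add: cong_poly_def cong_diff)

lemma cong_poly_add: "cong_poly p F G \<Longrightarrow> cong_poly p F' G' \<Longrightarrow> cong_poly p (F + F') (G + G')"
  by (simp add: cong_poly_def cong_add)

lemma cong_poly_diff_0: "cong_poly p (F - G) 0 \<longleftrightarrow> cong_poly p F G"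
  by (simp add: cong_poly_iff_dvd)

lemma cong_poly_mult_0:
  assumes "prime p" "cong_poly p (F * G) 0"
  shows "cong_poly p F 0 \<or> cong_poly p G 0"
proof -
  have "prime_elem [:int p:]" using assms(1) by (simp add: prime_elem_const_poly_iff)
  then show ?thesis using assms(2) by (simp add: cong_poly_iff_dvd prime_elem_dvd_mult_iff)
qed

lemma not_cong_monic_0:
  assumes "prime p" "lead_coeff F = 1" shows "\<not> cong_poly p F 0"
proof
  assume "cong_poly p F 0"
  then have "[1 = 0] (mod int p)" using assms(2) unfolding cong_poly_def by (metis coeff_0)
  then show False using assms(1)
    by (metis cong_0_iff int_dvd_int_iff not_prime_unit of_nat_1)
qed

definition reduce_poly :: "nat \<Rightarrow> int poly \<Rightarrow> int poly" where
  "reduce_poly p F = map_poly (\<lambda>c. c mod int p) F"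

lemma coeff_red [simp]: "coeff (reduce_poly p F) i = coeff F i mod int p"
  by (simp add: reduce_poly_def coeff_map_poly)

lemma red_cong: "cong_poly p (reduce_poly p F) F" "cong_poly p F (reduce_poly p F)"
  by (simp_all add: cong_poly_def Cong.cong_def)

lemma reduced_red: "p > 0 \<Longrightarrow> reduced p (reduce_poly p F)"
  by (simp add: reduced_def)

lemma degree_red: "degree (reduce_poly p F) \<le> degree F"
  by (rule degree_le) (simp add: coeff_eq_0)

lemma reduced_cong_eq:
  assumes "reduced p F" "reduced p G" "cong_poly p F G" shows "F = G"
proof (rule poly_eqI)
  fix i show "coeff F i = coeff G i"
    using assms unfolding reduced_def cong_poly_def Cong.cong_def
    by (metis atLeastLessThan_iff mod_pos_pos_trivial)
qed

lemma red_lead: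
  assumes "p > 0" "\<not> cong_poly p F 0"
  shows "lead_coeff (reduce_poly p F) \<in> {0<..<int p}"
proof -
  have "reduce_poly p F \<noteq> 0" using assms red_cong by metis
  then have "lead_coeff (reduce_poly p F) \<noteq> 0" by (simp del: coeff_red)
  moreover have "lead_coeff (reduce_poly p F) \<in> {0..<int p}"
    using assms(1) reduced_red[of p F] unfolding reduced_def by blast
  ultimately show ?thesis by auto
qed

lemma not_cong_0_range: "c \<in> {0<..<int p} \<Longrightarrow> \<not> [c = 0] (mod int p)"
  by (simp add: cong_0_iff zdvd_not_zless)

lemma make_monic:
  assumes p: "prime p" and "\<not> cong_poly p F 0"
  obtains c F' where "coprime c (int p)" "lead_coeff F' = 1" "reduced p F'"
    "degree F' \<le> degree F" "cong_poly p (smult c F) F'"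
proof -
  have p0: "p > 0" using p prime_gt_0_nat by blast
  have p1: "int p > 1" using prime_gt_1_nat[OF p] by simp
  define a where "a = lead_coeff (reduce_poly p F)"
  have a: "a \<in> {0<..<int p}" unfolding a_def by (rule red_lead[OF p0 assms(2)])
  have cop: "coprime a (int p)" using prime_int_coprime[OF p, of a] a by auto
  define c where "c = modular_inverse (int p) a"
  have ac: "[a * c = 1] (mod int p)" unfolding c_def by (rule cong_modular_inverse1[OF cop])
  then have copc: "coprime c (int p)"
    by (metis coprime_1_left coprime_mult_left_iff cong_imp_coprime cong_sym)
  define F' where "F' = reduce_poly p (smult c (reduce_poly p F))"
  have deg: "degree F' \<le> degree (reduce_poly p F)"
    unfolding F'_def using degree_red degree_smult_le le_trans by blast
  have co: "coeff F' (degree (reduce_poly p F)) = 1"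
    using ac p1 unfolding F'_def a_def by (simp add: Cong.cong_def mult.commute)
  then have "degree F' = degree (reduce_poly p F)"
    using deg by (metis le_antisym le_degree zero_neq_one)
  moreover have "cong_poly p (smult c F) F'"
  proof -
    have "cong_poly p ([:c:] * F) ([:c:] * reduce_poly p F)"
      by (intro cong_poly_mult red_cong) simp
    then show ?thesis unfolding F'_def using red_cong(2) cong_poly_trans by simp
  qed
  ultimately show ?thesis
    using that[of c F'] copc co degree_red[of p F] reduced_red[OF p0] unfolding F'_def by simp
qed

lemma degree_le_cong:
  assumes p: "prime p" and "lead_coeff G = 1" and T: "\<not> cong_poly p T 0"
    and c: "cong_poly p (G * T) H"
  shows "degree G + degree (reduce_poly p T) \<le> degree H"
proof -
  have p0: "p > 0" using p prime_gt_0_nat by blast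
  have "cong_poly p (G * reduce_poly p T) H"
    using cong_poly_mult[OF cong_poly_refl red_cong(1)] c cong_poly_trans by blast
  then have "[coeff (G * reduce_poly p T) (degree G + degree (reduce_poly p T))
      = coeff H (degree G + degree (reduce_poly p T))] (mod int p)"
    by (simp add: cong_poly_def)
  moreover have "coeff (G * reduce_poly p T) (degree G + degree (reduce_poly p T)) = lead_coeff (reduce_poly p T)"
    using assms(2) by (simp add: coeff_mult_degree_sum)
  ultimately have "coeff H (degree G + degree (reduce_poly p T)) \<noteq> 0"
    using not_cong_0_range[OF red_lead[OF p0 T]] by metis
  then show ?thesis by (rule le_degree)
qed

lemma monic_division:
  fixes F G :: "int poly"
  assumes "lead_coeff G = 1"
  obtains Q R where "F = G * Q + R" "R = 0 \<or> degree R < degree G"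
proof -
  obtain Q R where "pseudo_divmod F G = (Q, R)" by force
  moreover have "G \<noteq> 0" using assms by auto
  ultimately show ?thesis using that pseudo_divmod[of G F Q R] assms by simp
qed

lemma pair_unique:
  assumes p: "prime p"
    and F: "reduced p F" "lead_coeff F = 1" and G: "reduced p G" "lead_coeff G = 1"
    and cop: "coprime_mod p F G"
    and F1: "reduced p F1" and G1: "reduced p G1" "lead_coeff G1 = 1"
    and eq: "cong_poly p (F1 * G) (F * G1)" and le: "degree G1 \<le> degree G"
  shows "F1 = F \<and> G1 = G"
proof -
  define Q where "Q = (\<lambda>n. \<exists>F0 G0. lead_coeff G0 = 1 \<and> degree G0 = n \<and> cong_poly p (F0 * G) (F * G0))"
  define n where "n = (LEAST n. Q n)"
  have Q1: "Q (degree G1)" using G1 eq by (auto simp: Q_def)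
  have "Q n" unfolding n_def by (rule LeastI[of Q, OF Q1])
  have min: "cong_poly p R 0" if R: "cong_poly p (S * G) (F * R)" and lt: "R = 0 \<or> degree R < n" for R S
  proof (rule ccontr)
    assume n0: "\<not> cong_poly p R 0"
    then have "R \<noteq> 0" by auto
    then have lt: "degree R < n" using lt by simp
    obtain c R' where R': "lead_coeff R' = 1" "degree R' \<le> degree R" "cong_poly p (smult c R) R'"
      using make_monic[OF p n0] by metis
    have "cong_poly p ([:c:] * (S * G)) ([:c:] * (F * R))" by (intro cong_poly_mult R) simp
    also have "[:c:] * (F * R) = F * smult c R" by simp
    also have "cong_poly p (F * smult c R) (F * R')" by (intro cong_poly_mult R' cong_poly_refl)
    finally have "cong_poly p (smult c S * G) (F * R')" by simp
    then have "Q (degree R')" using R' unfolding Q_def by blast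
    then have "n \<le> degree R'" unfolding n_def by (rule Least_le[of Q])
    then show False using R' lt by linarith
  qed
  obtain F0 G0 where 0: "lead_coeff G0 = 1" "degree G0 = n" "cong_poly p (F0 * G) (F * G0)"
    using \<open>Q n\<close> by (auto simp: Q_def)
  obtain H R where H: "G = G0 * H + R" "R = 0 \<or> degree R < degree G0"
    using monic_division[OF 0(1)] by metis
  have FH: "cong_poly p ((F - H * F0) * G) (F * R)"
  proof -
    have "cong_poly p (F * G - H * (F0 * G)) (F * G - H * (F * G0))"
      by (intro cong_poly_diff cong_poly_mult 0 cong_poly_refl)
    moreover have "F * G - H * (F * G0) = F * R" by (subst H(1)) (simp add: algebra_simps)
    ultimately show ?thesis by (simp add: algebra_simps)
  qed
  have R0: "cong_poly p R 0" using min[OF FH] H 0 by simp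
  have "cong_poly p ((F - H * F0) * G) 0"
    using cong_poly_trans[OF FH cong_poly_mult[OF cong_poly_refl R0]] by simp
  then have "cong_poly p (F - H * F0) 0"
    using cong_poly_mult_0[OF p] not_cong_monic_0[OF p G(2)] by blast
  then have 1: "cong_poly p F (H * F0)" by (simp add: cong_poly_diff_0)
  have 2: "cong_poly p G (H * G0)"
  proof -
    have "cong_poly p (G0 * H + R) (G0 * H + 0)" by (intro cong_poly_add R0 cong_poly_refl)
    then show ?thesis using H(1) by (simp add: mult.commute)
  qed
  from 1 2 cop have "dvd_mod p H 1" unfolding coprime_mod_def dvd_mod_def by blast
  then obtain T where T: "cong_poly p 1 (H * T)" by (auto simp: dvd_mod_def)
  have "cong_poly p (G * T) (H * G0 * T)" by (intro cong_poly_mult 2 cong_poly_refl)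
  also have "H * G0 * T = (H * T) * G0" by (simp add: algebra_simps)
  also have "cong_poly p ((H * T) * G0) (1 * G0)"
    by (intro cong_poly_mult cong_poly_sym[OF T] cong_poly_refl)
  finally have GT: "cong_poly p (G * T) G0" by simp
  have "\<not> cong_poly p T 0"
  proof
    assume "cong_poly p T 0"
    then have "cong_poly p 1 (H * 0)" using T cong_poly_mult[OF cong_poly_refl] cong_poly_trans by blast
    then show False using not_cong_monic_0[OF p, of 1] by simp
  qed
  then have "degree G \<le> n" using degree_le_cong[OF p G(2) _ GT] 0 by linarith
  moreover have "n \<le> degree G1" unfolding n_def by (rule Least_le[of Q, OF Q1])
  ultimately have deg: "degree G1 = degree G" "n = degree G" using le by auto
  have D: "cong_poly p ((F1 - F) * G) (F * (G1 - G))"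
  proof -
    have "cong_poly p (F1 * G - F * G) (F * G1 - F * G)" by (intro cong_poly_diff eq cong_poly_refl)
    then show ?thesis by (simp add: algebra_simps)
  qed
  have lt: "G1 - G = 0 \<or> degree (G1 - G) < n"
  proof (cases "degree G = 0")
    case True
    then have "G = 1" "G1 = 1" using G G1 deg by (metis degree_eq_zeroE lead_coeff_pCons(2) one_pCons)+
    then show ?thesis by simp
  next
    case False
    have "coeff (G1 - G) (degree G) = 0" using G G1 deg by simp
    moreover have "degree (G1 - G) \<le> degree G" using deg degree_diff_le[of G1 "degree G" G] by simp
    ultimately show ?thesis using False deg
      by (metis le_neq_implies_less leading_coeff_0_iff)
  qed
  have G0: "cong_poly p (G1 - G) 0" by (rule min[OF D lt])
  then have GG: "G1 = G" using reduced_cong_eq G G1 by (simp add: cong_poly_diff_0)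
  have "cong_poly p ((F1 - F) * G) 0" using D GG by simp
  then have "cong_poly p F1 F"
    using cong_poly_mult_0[OF p] not_cong_monic_0[OF p G(2)] cong_poly_diff_0 by blast
  then show ?thesis using GG reduced_cong_eq F F1 by blast
qed

lemma cong_trunc_sym: "cong_trunc p n F G \<Longrightarrow> cong_trunc p n G F"
  by (simp add: cong_trunc_def cong_sym)

lemma cong_trunc_trans [trans]: "cong_trunc p n F G \<Longrightarrow> cong_trunc p n G H \<Longrightarrow> cong_trunc p n F H"
  by (meson cong_trunc_def cong_trans)

lemma cong_poly_imp_trunc: "cong_poly p F G \<Longrightarrow> cong_trunc p n F G"
  by (simp add: cong_poly_def cong_trunc_def)

lemma cong_trunc_mult_left: "cong_trunc p n F G \<Longrightarrow> cong_trunc p n (H * F) (H * G)"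
  unfolding cong_trunc_def coeff_mult by (auto intro!: cong_sum cong_scalar_left)

lemma cong_trunc_cancel:
  assumes cop: "coprime (coeff H 0) (int p)" and eq: "cong_trunc p n (H * F) (H * G)"
  shows "cong_trunc p n F G"
  unfolding cong_trunc_def
proof (intro allI impI)
  fix i assume "i < n"
  then show "[coeff F i = coeff G i] (mod int p)"
  proof (induction i rule: less_induct)
    case (less i)
    have e: "[coeff (H * F) i = coeff (H * G) i] (mod int p)"
      using eq less.prems by (simp add: cong_trunc_def)
    have s: "coeff (H * X) i = coeff H 0 * coeff X i + (\<Sum>j\<in>{1..i}. coeff H j * coeff X (i - j))" for X
      unfolding coeff_mult atMost_atLeast0 by (subst sum.atLeast_Suc_atMost) auto
    have "[(\<Sum>j\<in>{1..i}. coeff H j * coeff F (i - j)) = (\<Sum>j\<in>{1..i}. coeff H j * coeff G (i - j))] (mod int p)"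
      using less by (intro cong_sum cong_scalar_left) auto
    from cong_diff[OF e this] have "[coeff H 0 * coeff F i = coeff H 0 * coeff G i] (mod int p)"
      by (simp only: s add_diff_cancel_right')
    then show ?case using cong_mult_lcancel[OF cop] by blast
  qed
qed

lemma decoding_cross_mult:
  assumes "cong_trunc p l F (G * A)" "cong_trunc p l F' (G' * A)"
    and "lead_coeff F = 1" "lead_coeff G = 1" "lead_coeff F' = 1" "lead_coeff G' = 1"
    and "degree F + degree G \<le> l" "degree F' + degree G' \<le> l"
    and "int (degree F) - int (degree G) = m" "int (degree F') - int (degree G') = m"
  shows "cong_poly p (F * G') (F' * G)"
proof -
  have deg: "degree F + degree G' = degree F' + degree G" "degree F + degree G' \<le> l"
    using assms by linarith+
  have t: "cong_trunc p l (F * G') (F' * G)"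
  proof -
    have "cong_trunc p l (G' * F) (G' * (G * A))" by (rule cong_trunc_mult_left[OF assms(1)])
    also have "G' * (G * A) = G * (G' * A)" by (simp add: algebra_simps)
    also have "cong_trunc p l \<dots> (G * F')" by (rule cong_trunc_sym[OF cong_trunc_mult_left[OF assms(2)]])
    finally show ?thesis by (simp add: mult.commute)
  qed
  show ?thesis unfolding cong_poly_def
  proof
    fix i
    consider "i < l" | "i = degree F + degree G'" | "i > degree F + degree G'" using deg by linarith
    then show "[coeff (F * G') i = coeff (F' * G) i] (mod int p)"
    proof cases
      case 1
      then show ?thesis using t by (simp add: cong_trunc_def)
    next
      case 2
      then show ?thesis using assms deg(1) coeff_mult_degree_sum[of F G'] coeff_mult_degree_sum[of F' G] by simp
    next
      case 3
      have "coeff (F * G') i = 0" "coeff (F' * G) i = 0"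
        using 3 deg degree_mult_le[of F G'] degree_mult_le[of F' G] by (intro coeff_eq_0; linarith)+
      then show ?thesis by simp
    qed
  qed
qed


lemma row_dot_sum: "length xs \<le> length r \<Longrightarrow> row_dot r xs = (\<Sum>i<length xs. r ! i * xs ! i)"
proof (induction r arbitrary: xs)
  case (Cons a r)
  then show ?case by (cases xs) (simp_all add: sum.lessThan_Suc_shift del: sum.lessThan_Suc)
qed simp

lemma sum_lessThan_add:
  "(\<Sum>i<a + b. f i) = (\<Sum>i<a. f i) + (\<Sum>t<(b::nat). f (a + t) :: int)" for a :: nat
  by (induction b) (simp_all add: add_ac)

definition pair_system_sat :: "nat \<Rightarrow> int list \<Rightarrow> nat \<Rightarrow> nat \<Rightarrow> int list \<Rightarrow> bool" where
  "pair_system_sat p A a b xs \<longleftrightarrow> length xs = a + b \<and>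
     cong_trunc p (length A) (Poly (take a xs @ [1])) (Poly (drop a xs @ [1]) * Poly A)"

lemma sat_pair_row:
  assumes i: "i < length A" and len: "length xs = a + b"
  shows "row_sat p (pair_row p A a b i) xs \<longleftrightarrow>
    [coeff (Poly (take a xs @ [1])) i = coeff (Poly (drop a xs @ [1]) * Poly A) i] (mod int p)"
proof -
  define S where "S = (\<Sum>t<b. if t \<le> i then A ! (i - t) * xs ! (a + t) else 0)"
  define r where "r = (if b \<le> i then A ! (i - b) else 0)"
  define f where "f = (if i < a then xs ! i else 0)"
  define u where "u = (if i = a then 1 else 0 :: int)"
  let ?row = "pair_row p A a b i"
  have lr: "length ?row = Suc (a + b)" by (simp add: pair_row_def)
  have "row_dot ?row xs = (\<Sum>s<a. ?row ! s * xs ! s) + (\<Sum>t<b. ?row ! (a + t) * xs ! (a + t))"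
    using row_dot_sum[of xs ?row] lr len sum_lessThan_add[of "\<lambda>i. ?row ! i * xs ! i" a b] by simp
  also have "(\<Sum>s<a. ?row ! s * xs ! s) = (\<Sum>s<a. if s = i then xs ! s else 0)"
    by (intro sum.cong) (auto simp: pair_row_def nth_append)
  also have "\<dots> = f" by (simp add: f_def)
  finally have 1: "row_dot ?row xs = f + (\<Sum>t<b. ?row ! (a + t) * xs ! (a + t))" .
  have "[(\<Sum>t<b. ?row ! (a + t) * xs ! (a + t)) =
      (\<Sum>t<b. - (if t \<le> i then A ! (i - t) * xs ! (a + t) else 0))] (mod int p)"
  proof (rule cong_sum)
    fix t assume "t \<in> {..<b}"
    then have "?row ! (a + t) = (if t \<le> i then (- (A ! (i - t))) mod int p else 0)"
      by (simp add: pair_row_def nth_append)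
    then show "[?row ! (a + t) * xs ! (a + t) =
        - (if t \<le> i then A ! (i - t) * xs ! (a + t) else 0)] (mod int p)"
      by (simp add: Cong.cong_def mod_simps)
  qed
  then have 2: "[row_dot ?row xs = f - S] (mod int p)"
    unfolding 1 S_def sum_negf using cong_add[OF cong_refl[of f]] by fastforce
  have 3: "[last ?row = r - u] (mod int p)"
    by (simp add: pair_row_def r_def u_def Cong.cong_def)
  have 4: "coeff (Poly (take a xs @ [1])) i = f + u"
    using len by (auto simp: coeff_Poly_eq nth_default_def nth_append f_def u_def)
  have cG: "coeff (Poly (drop a xs @ [1])) t = (if t < b then xs ! (a + t) else if t = b then 1 else 0)" for t
    using len by (auto simp: coeff_Poly_eq nth_default_def nth_append)
  have cA: "coeff (Poly A) (i - t) = A ! (i - t)" for t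
    using i by (simp add: coeff_Poly_eq nth_default_def)
  have "coeff (Poly (drop a xs @ [1]) * Poly A) i =
      (\<Sum>t\<le>i. (if t < b then A ! (i - t) * xs ! (a + t) else 0) + (if t = b then A ! (i - t) else 0))"
    unfolding coeff_mult cG cA by (intro sum.cong) auto
  also have "\<dots> = (\<Sum>t\<le>i. if t < b then A ! (i - t) * xs ! (a + t) else 0) + r"
    by (simp add: sum.distrib r_def)
  also have "(\<Sum>t\<le>i. if t < b then A ! (i - t) * xs ! (a + t) else 0) = S"
  proof -
    have "S = (\<Sum>t\<in>{..<b} \<inter> {t. t \<le> i}. A ! (i - t) * xs ! (a + t))"
      unfolding S_def by (simp add: sum.inter_restrict)
    moreover have "(\<Sum>t\<le>i. if t < b then A ! (i - t) * xs ! (a + t) else 0) =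
        (\<Sum>t\<in>{..i} \<inter> {t. t < b}. A ! (i - t) * xs ! (a + t))"
      by (simp add: sum.inter_restrict)
    moreover have "{..<b} \<inter> {t. t \<le> i} = {..i} \<inter> {t. t < b}" by auto
    ultimately show ?thesis by simp
  qed
  finally have 5: "coeff (Poly (drop a xs @ [1]) * Poly A) i = S + r" .
  have "row_sat p ?row xs \<longleftrightarrow> [f - S = r - u] (mod int p)"
    unfolding row_sat_def using 2 3 cong_trans cong_sym by meson
  also have "\<dots> \<longleftrightarrow> [f + u = S + r] (mod int p)"
    unfolding cong_iff_dvd_diff by (simp add: algebra_simps)
  finally show ?thesis unfolding 4 5 .
qed

lemma solve_pair:
  assumes p: "prime p"
  shows "case val (solve p (a + b) (map (pair_row p A a b) [0..<length A])) of None \<Rightarrow> \<not> (\<exists>xs. pair_system_sat p A a b xs)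
    | Some xs \<Rightarrow> pair_system_sat p A a b xs \<and> set xs \<subseteq> {0..<int p}"
proof -
  let ?E = "map (pair_row p A a b) [0..<length A]"
  have p1: "p > 1" using prime_gt_1_nat[OF p] .
  have pre: "length r = Suc (a + b) \<and> set r \<subseteq> {0..<int p}" if "r \<in> set ?E" for r
    using that p1 by (auto simp: pair_row_def)
  have "pair_system_sat p A a b xs \<longleftrightarrow> length xs = a + b \<and> (\<forall>r\<in>set ?E. row_sat p r xs)" for xs
    using sat_pair_row by (auto simp: pair_system_sat_def cong_trunc_def)
  then show ?thesis
    using solve_correct[OF p pre, of ?E] by (auto split: option.splits)
qed

lemma first_pair_cases:
  assumes p: "prime p"
  shows "val (first_pair p A degs) = None \<and> (\<forall>a b xs. (a, b) \<in> set degs \<longrightarrow> \<not> pair_system_sat p A a b xs) \<or>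
   (\<exists>pre a b post xs. degs = pre @ (a, b) # post \<and>
      (\<forall>a' b' ys. (a', b') \<in> set pre \<longrightarrow> \<not> pair_system_sat p A a' b' ys) \<and>
      pair_system_sat p A a b xs \<and> set xs \<subseteq> {0..<int p} \<and>
      val (first_pair p A degs) = (if hd (drop a xs @ [1]) \<noteq> 0
        then Some (take a xs @ [1], drop a xs @ [1]) else None))"
  (is "?N degs \<or> ?S degs")
proof (induction degs)
  case (Cons d degs)
  obtain a b where d: "d = (a, b)" by force
  show ?case
  proof (cases "val (solve p (a + b) (map (pair_row p A a b) [0..<length A]))")
    case (Some xs)
    have "pair_system_sat p A a b xs \<and> set xs \<subseteq> {0..<int p}" using solve_pair[OF p, of A a b] Some by simp
    then have "?S (d # degs)"
      using Some d by (intro exI[of _ "[]"] exI[of _ a] exI[of _ b] exI[of _ degs] exI[of _ xs]) simp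
    then show ?thesis by blast
  next
    case None
    have no: "\<not> pair_system_sat p A a b xs" for xs using solve_pair[OF p, of A a b] None by simp
    have eq: "val (first_pair p A (d # degs)) = val (first_pair p A degs)" using None d by simp
    show ?thesis using Cons.IH
    proof
      assume "?N degs"
      then show ?thesis using eq no d by auto
    next
      assume "?S degs"
      then obtain pre a' b' post xs where *: "degs = pre @ (a', b') # post"
        "\<forall>a' b' ys. (a', b') \<in> set pre \<longrightarrow> \<not> pair_system_sat p A a' b' ys"
        "pair_system_sat p A a' b' xs" "set xs \<subseteq> {0..<int p}"
        "val (first_pair p A degs) = (if hd (drop a' xs @ [1]) \<noteq> 0
          then Some (take a' xs @ [1], drop a' xs @ [1]) else None)"
        by blast
      have "?S (d # degs)"
        using * eq no d
        by (intro exI[of _ "d # pre"] exI[of _ a'] exI[of _ b'] exI[of _ post] exI[of _ xs]) auto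
      then show ?thesis by blast
    qed
  qed
qed simp

lemma degree_pairs_mem: "(a, b) \<in> set (degree_pairs l m) \<longleftrightarrow> int a - int b = m \<and> a + b \<le> l"
  by (auto simp: degree_pairs_def image_iff)

lemma degree_pairs_sorted: "sorted (map snd (degree_pairs l m))"
  by (simp add: degree_pairs_def comp_def sorted_wrt_filter)

lemma coeffs_monic:
  "lead_coeff F = 1 \<Longrightarrow> coeffs F = map (coeff F) [0..<degree F] @ [1]" for F :: "int poly"
  by (auto simp: coeffs_def)

lemma Poly_monic [simp]:
  fixes ys :: "int list"
  shows "coeffs (Poly (ys @ [1])) = ys @ [1]" "degree (Poly (ys @ [1])) = length ys"
    "lead_coeff (Poly (ys @ [1])) = 1"
proof -
  show c: "coeffs (Poly (ys @ [1])) = ys @ [1]" by simp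
  then show d: "degree (Poly (ys @ [1])) = length ys" by (simp add: degree_eq_length_coeffs)
  show "lead_coeff (Poly (ys @ [1])) = 1"
    unfolding d by (simp add: coeff_Poly_eq nth_default_def nth_append)
qed

lemma pair_system_sat_of_polys:
  assumes "lead_coeff F = 1" "lead_coeff G = 1" "cong_trunc p (length A) F (G * Poly A)"
  shows "pair_system_sat p A (degree F) (degree G) (map (coeff F) [0..<degree F] @ map (coeff G) [0..<degree G])"
proof -
  have "Poly (map (coeff F) [0..<degree F] @ [1]) = F" "Poly (map (coeff G) [0..<degree G] @ [1]) = G"
    using assms coeffs_monic by (metis Poly_coeffs)+
  then show ?thesis using assms by (simp add: pair_system_sat_def)
qed

lemma quotient_monic:
  assumes p: "prime p" and M: "lead_coeff M = 1" and G: "lead_coeff G = 1"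
    and eq: "cong_poly p G (M * T)"
  obtains T' where "lead_coeff T' = 1" "degree G = degree M + degree T'" "cong_poly p G (M * T')"
proof -
  have p0: "p > 0" using p prime_gt_0_nat by blast
  have p1: "int p > 1" using prime_gt_1_nat[OF p] by simp
  define T' where "T' = reduce_poly p T"
  have eq': "cong_poly p G (M * T')"
    unfolding T'_def using cong_poly_trans[OF eq cong_poly_mult[OF cong_poly_refl red_cong(2)]] .
  have n0: "\<not> cong_poly p T 0"
  proof
    assume "cong_poly p T 0"
    then have "cong_poly p G (M * 0)" using eq cong_poly_mult[OF cong_poly_refl] cong_poly_trans by blast
    then show False using not_cong_monic_0[OF p G] by simp
  qed
  have le: "degree M + degree T' \<le> degree G"
    unfolding T'_def by (rule degree_le_cong[OF p M n0 cong_poly_sym[OF eq]])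
  have "degree M + degree T' = degree G"
  proof (rule ccontr)
    assume "degree M + degree T' \<noteq> degree G"
    then have "coeff (M * T') (degree G) = 0"
      using le degree_mult_le[of M T'] by (intro coeff_eq_0) linarith
    moreover have "[coeff G (degree G) = coeff (M * T') (degree G)] (mod int p)"
      using eq' unfolding cong_poly_def by blast
    ultimately show False using G p1 by (simp add: Cong.cong_def)
  qed
  moreover have "lead_coeff T' = 1"
  proof -
    have "[coeff G (degree M + degree T') = coeff (M * T') (degree M + degree T')] (mod int p)"
      using eq' unfolding cong_poly_def by blast
    then have "[1 = 1 * lead_coeff T'] (mod int p)"
      using G M calculation coeff_mult_degree_sum[of M T'] by metis
    moreover have "lead_coeff T' \<in> {0<..<int p}" unfolding T'_def by (rule red_lead[OF p0 n0])
    ultimately show ?thesis using p1 by (simp add: Cong.cong_def)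
  qed
  ultimately show ?thesis using that eq' by metis
qed

lemma find_pair_correct:
  assumes p: "prime p"
  shows "val (find_pair p m A) = Some FG \<longleftrightarrow>
    (\<exists>F G. FG = (coeffs F, coeffs G) \<and> decoding_pair p (length A) m A F G)"
proof -
  have p0: "p > 0" and p1: "int p > 1" using prime_gt_1_nat[OF p] by simp_all
  define l where "l = length A"
  define degs where "degs = degree_pairs l m"
  have val: "val (find_pair p m A) = val (first_pair p A degs)"
    by (simp add: find_pair_def degs_def l_def)
  have dec_good: "(degree F, degree G) \<in> set degs \<and> (\<exists>xs. pair_system_sat p A (degree F) (degree G) xs)"
    if "decoding_pair p l m A F G" for F G
    using that pair_system_sat_of_polys[of F G p A]
    by (auto simp: degs_def degree_pairs_mem decoding_pair_def l_def)
  show ?thesis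
    using first_pair_cases[OF p, of A degs]
  proof
    assume "val (first_pair p A degs) = None \<and> (\<forall>a b xs. (a, b) \<in> set degs \<longrightarrow> \<not> pair_system_sat p A a b xs)"
    then show ?thesis using val dec_good unfolding l_def by fastforce
  next
    assume "\<exists>pre a b post xs. degs = pre @ (a, b) # post \<and>
      (\<forall>a' b' ys. (a', b') \<in> set pre \<longrightarrow> \<not> pair_system_sat p A a' b' ys) \<and>
      pair_system_sat p A a b xs \<and> set xs \<subseteq> {0..<int p} \<and>
      val (first_pair p A degs) = (if hd (drop a xs @ [1]) \<noteq> 0
        then Some (take a xs @ [1], drop a xs @ [1]) else None)"
    then obtain pre a b post xs where degs: "degs = pre @ (a, b) # post"
      and pre: "\<And>a' b' ys. (a', b') \<in> set pre \<Longrightarrow> \<not> pair_system_sat p A a' b' ys"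
      and gd: "pair_system_sat p A a b xs" and xs: "set xs \<subseteq> {0..<int p}"
      and res: "val (first_pair p A degs) = (if hd (drop a xs @ [1]) \<noteq> 0
        then Some (take a xs @ [1], drop a xs @ [1]) else None)"
      by blast
    define F where "F = Poly (take a xs @ [1])"
    define G where "G = Poly (drop a xs @ [1])"
    have len: "length xs = a + b" and FG: "cong_trunc p l F (G * Poly A)"
      using gd by (simp_all add: pair_system_sat_def F_def G_def l_def)
    have F: "coeffs F = take a xs @ [1]" "degree F = a" "lead_coeff F = 1"
      unfolding F_def using Poly_monic[of "take a xs"] len by auto
    have G: "coeffs G = drop a xs @ [1]" "degree G = b" "lead_coeff G = 1"
      unfolding G_def using Poly_monic[of "drop a xs"] len by auto
    have nth_mem: "nth_default 0 (ys @ [1]) i \<in> {0..<int p}" if "set ys \<subseteq> set xs" for ys i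
    proof (cases "i < length (ys @ [1])")
      case True
      then have "(ys @ [1]) ! i \<in> set (ys @ [1])" by (rule nth_mem)
      then show ?thesis using True that xs p1 by (auto simp: nth_default_def)
    qed (use p0 in \<open>simp add: nth_default_def\<close>)
    have reduce_poly: "reduced p F" "reduced p G"
      using nth_mem[of "take a xs"] nth_mem[of "drop a xs"] set_take_subset[of a xs] set_drop_subset[of a xs]
      unfolding reduced_def F_def G_def coeff_Poly_eq by blast+
    have ab: "int a - int b = m" "a + b \<le> l"
      using degree_pairs_mem[of a b l m] degs unfolding degs_def by auto
    have hd: "hd (drop a xs @ [1]) = coeff G 0"
      unfolding G_def coeff_Poly_eq by (cases "drop a xs") (simp_all add: nth_default_def)
    have earlier: "\<not> pair_system_sat p A a' b' ys" if "(a', b') \<in> set degs" "b' < b" for a' b' ys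
    proof -
      have "sorted (map snd degs)" unfolding degs_def by (rule degree_pairs_sorted)
      then have "\<forall>d\<in>set post. b \<le> snd d" unfolding degs by (simp add: sorted_append)
      then have "(a', b') \<in> set pre" using that unfolding degs by fastforce
      then show ?thesis by (rule pre)
    qed
    have unique: "F' = F \<and> G' = G" if dp: "decoding_pair p l m A F' G'" for F' G'
    proof -
      have "b \<le> degree G'"
        using dec_good[OF dp] earlier by (meson not_le_imp_less)
      moreover have "cong_poly p (F * G') (F' * G)"
        using dp FG F G ab unfolding decoding_pair_def
        by (intro decoding_cross_mult[where l = l and m = m and A = "Poly A"]) auto
      ultimately show ?thesis
        using pair_unique[OF p, of F' G' F G] dp reduce_poly F G unfolding decoding_pair_def by auto
    qed
    have dec: "decoding_pair p l m A F G" if G0: "coeff G 0 \<noteq> 0"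
    proof -
      have G0': "coprime (coeff G 0) (int p)"
        using prime_int_coprime[OF p _ G0] reduce_poly(2) unfolding reduced_def by blast
      have "coprime_mod p F G"
        unfolding coprime_mod_def
      proof (intro allI impI)
        fix D assume "dvd_mod p D F" "dvd_mod p D G"
        then obtain Q1 Q2 where Q: "cong_poly p F (D * Q1)" "cong_poly p G (D * Q2)"
          by (auto simp: dvd_mod_def)
        have "\<not> cong_poly p D 0"
        proof
          assume "cong_poly p D 0"
          then have "cong_poly p G (0 * Q2)"
            using Q cong_poly_mult[OF _ cong_poly_refl] cong_poly_trans by blast
          then show False using not_cong_monic_0[OF p G(3)] by simp
        qed
        then obtain c M where M: "coprime c (int p)" "lead_coeff M = 1" "cong_poly p (smult c D) M"
          using make_monic[OF p] by metis
        define ci where "ci = modular_inverse (int p) c"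
        have ci: "[ci * c = 1] (mod int p)"
          unfolding ci_def by (rule cong_modular_inverse2[OF M(1)])
        have DM: "cong_poly p D (smult ci M)"
        proof -
          have "[coeff D i = c * ci * coeff D i] (mod int p)" for i
            using cong_scalar_right[OF cong_sym[OF ci], of "coeff D i"]
            by (simp only: mult_1 mult.commute[of c])
          then have "cong_poly p D ([:ci:] * smult c D)"
            by (simp add: cong_poly_def)
          also have "cong_poly p \<dots> ([:ci:] * M)" by (intro cong_poly_mult M cong_poly_refl)
          finally show ?thesis by simp
        qed
        have MQ: "cong_poly p H (M * smult ci Q)" if "cong_poly p H (D * Q)" for H Q
          using cong_poly_trans[OF that cong_poly_mult[OF DM cong_poly_refl]] by simp
        obtain T1 where T1: "lead_coeff T1 = 1" "degree F = degree M + degree T1" "cong_poly p F (M * T1)"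
          using quotient_monic[OF p M(2) F(3) MQ[OF Q(1)]] .
        obtain T2 where T2: "lead_coeff T2 = 1" "degree G = degree M + degree T2" "cong_poly p G (M * T2)"
          using quotient_monic[OF p M(2) G(3) MQ[OF Q(2)]] .
        have "[coeff G 0 = coeff M 0 * coeff T2 0] (mod int p)"
          using T2(3) unfolding cong_poly_def by (metis coeff_mult_0)
        then have M0: "coprime (coeff M 0) (int p)"
          using G0' by (metis cong_imp_coprime coprime_mult_left_iff)
        have "cong_trunc p l (M * T1) (M * (T2 * Poly A))"
        proof -
          have "cong_trunc p l (M * T1) F" by (rule cong_poly_imp_trunc[OF cong_poly_sym[OF T1(3)]])
          also note FG
          also have "cong_trunc p l (G * Poly A) (M * T2 * Poly A)"
            by (intro cong_poly_imp_trunc cong_poly_mult T2 cong_poly_refl)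
          finally show ?thesis by (simp add: mult.assoc)
        qed
        then have T: "cong_trunc p l T1 (T2 * Poly A)" by (rule cong_trunc_cancel[OF M0])
        have "degree M = 0"
        proof (rule ccontr)
          assume "degree M \<noteq> 0"
          then have "degree T2 < b" using T2 G by simp
          moreover have "(degree T1, degree T2) \<in> set degs"
            unfolding degs_def degree_pairs_mem using T1 T2 F G ab by simp
          ultimately show False
            using earlier pair_system_sat_of_polys[OF T1(1) T2(1)] T unfolding l_def by blast
        qed
        then have "M = 1" using M(2) by (metis degree_eq_zeroE lead_coeff_pCons(2) one_pCons)
        then have "cong_poly p 1 (D * [:c:])" using cong_poly_sym[OF M(3)] by simp
        then show "dvd_mod p D 1" unfolding dvd_mod_def by blast
      qed
      then show ?thesis
        using reduce_poly F G ab FG G0 unfolding decoding_pair_def by simp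
    qed
    show ?thesis
    proof
      assume "val (find_pair p m A) = Some FG"
      then have "coeff G 0 \<noteq> 0" "FG = (coeffs F, coeffs G)"
        using res val hd F G by (auto split: if_splits)
      then show "\<exists>F G. FG = (coeffs F, coeffs G) \<and> decoding_pair p (length A) m A F G"
        using dec unfolding l_def by blast
    next
      assume "\<exists>F G. FG = (coeffs F, coeffs G) \<and> decoding_pair p (length A) m A F G"
      then have "FG = (coeffs F, coeffs G)" "coeff G 0 \<noteq> 0"
        using unique unfolding l_def decoding_pair_def by blast+
      then show "val (find_pair p m A) = Some FG" using res val hd F G by simp
    qed
  qed
qed


section \<open>XYZ-Sketch\<close>

subsection \<open>Parameters and public randomness\<close>

record params =
  modulus :: nat     \<comment> \<open>\<open>p\<close>\<close>
  hashes :: nat      \<comment> \<open>\<open>k\<close>\<close>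
  terms :: nat       \<comment> \<open>\<open>\<ell>\<close>\<close>
  cells :: nat       \<comment> \<open>\<open>M\<close>\<close>
  coupling :: real   \<comment> \<open>\<open>z\<close>\<close>
  fp_modulus :: nat  \<comment> \<open>\<open>q\<close>\<close>

definition universe :: "params \<Rightarrow> int set" where
  "universe P = {1..<int (modulus P)}"

text \<open>The components are \<open>\<phi>\<close>, \<open>g\<^sub>0\<close>, \<open>(g\<^sub>1, \<dots>, g\<^sub>k)\<close> (uncurried) and \<open>h\<^sub>f\<^sub>p\<close>.\<close>

type_synonym public = "(int \<Rightarrow> int) \<times> (int \<Rightarrow> real) \<times> (nat \<times> int \<Rightarrow> real) \<times> (int \<Rightarrow> int)"

definition relabel :: "public \<Rightarrow> int \<Rightarrow> int" where "relabel = (\<lambda>(\<phi>, g0, g, h). \<phi>)"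
definition shift :: "public \<Rightarrow> int \<Rightarrow> real" where "shift = (\<lambda>(\<phi>, g0, g, h). g0)"
definition offset :: "public \<Rightarrow> nat \<times> int \<Rightarrow> real" where "offset = (\<lambda>(\<phi>, g0, g, h). g)"
definition fingerprint :: "public \<Rightarrow> int \<Rightarrow> int" where "fingerprint = (\<lambda>(\<phi>, g0, g, h). h)"

definition uniform_real :: "real \<Rightarrow> real measure" where
  "uniform_real b = uniform_measure (restrict_space lborel {0..<b}) {0..<b}"

definition public_space :: "params \<Rightarrow> public measure" where
  "public_space P =
     uniform_count_measure {\<phi>. \<phi> permutes universe P} \<Otimes>\<^sub>M
     PiM (universe P) (\<lambda>x. uniform_real (coupling P)) \<Otimes>\<^sub>M
     PiM ({1..hashes P} \<times> universe P) (\<lambda>ix. uniform_real 1) \<Otimes>\<^sub>M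
     PiM (universe P) (\<lambda>x. uniform_count_measure {0..<int (fp_modulus P)})"

definition cell_index :: "params \<Rightarrow> public \<Rightarrow> nat \<Rightarrow> int \<Rightarrow> nat" where
  "cell_index P \<omega> i x =
     nat (1 + \<lfloor>(shift \<omega> x + offset \<omega> (i, x)) / (coupling P + 1) * real (cells P)\<rfloor>)"

definition support :: "params \<Rightarrow> public \<Rightarrow> int \<Rightarrow> nat set" where
  "support P \<omega> x = (\<lambda>i. cell_index P \<omega> i x) ` {1..hashes P}"


subsection \<open>Cells and sketches\<close>

record cell =
  cell_count :: int
  cell_poly :: "int list"  \<comment> \<open>the \<open>\<ell>\<close> coefficients, constant term first\<close>
  cell_fp :: int

text \<open>For \<open>f\<close> with values in \<open>{- 1, 0, 1}\<close>; the equation for \<open>\<Prod>x. (Z - x) ^ f x\<close> is cross-multiplied.\<close>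

definition represents :: "params \<Rightarrow> public \<Rightarrow> (int \<Rightarrow> int) \<Rightarrow> cell \<Rightarrow> bool" where
  "represents P \<omega> f c \<longleftrightarrow>
     cell_count c = (\<Sum>x\<in>universe P. f x) mod (2 * int (terms P) + 1) \<and>
     length (cell_poly c) = terms P \<and> set (cell_poly c) \<subseteq> {0..<int (modulus P)} \<and>
     cong_trunc (modulus P) (terms P)
       (Poly (cell_poly c) * linear_prod {x \<in> universe P. f x = - 1})
       (linear_prod {x \<in> universe P. f x = 1}) \<and>
     cell_fp c = (\<Sum>x\<in>universe P. f x * fingerprint \<omega> x) mod int (fp_modulus P)"

type_synonym sketch = "nat \<Rightarrow> cell"

definition sketch :: "params \<Rightarrow> public \<Rightarrow> int set \<Rightarrow> sketch" where
  "sketch P \<omega> S = (\<lambda>j. THE c. represents P \<omega> (\<lambda>x. if x \<in> S \<and> j \<in> support P \<omega> x then 1 else 0) c)"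

lemma sketch_represents:
  assumes "modulus P > 0"
  shows "represents P \<omega> (\<lambda>x. if x \<in> S \<and> j \<in> support P \<omega> x then 1 else 0) (sketch P \<omega> S j)"
    (is "represents P \<omega> ?f _")
proof -
  have no_neg: "{x \<in> universe P. ?f x = - 1} = {}" by auto
  define F where "F = linear_prod {x \<in> universe P. ?f x = 1}"
  define cs where "cs = map (\<lambda>i. coeff F i mod int (modulus P)) [0..<terms P]"
  define c where "c = \<lparr>cell_count = (\<Sum>x\<in>universe P. ?f x) mod (2 * int (terms P) + 1), cell_poly = cs,
    cell_fp = (\<Sum>x\<in>universe P. ?f x * fingerprint \<omega> x) mod int (fp_modulus P)\<rparr>"
  have iff: "represents P \<omega> ?f c' \<longleftrightarrow> c' = c" for c'
  proof -
    have "length ds = terms P \<and> set ds \<subseteq> {0..<int (modulus P)} \<and>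
        cong_trunc (modulus P) (terms P) (Poly ds) F \<longleftrightarrow> ds = cs" for ds
    proof
      assume *: "length ds = terms P \<and> set ds \<subseteq> {0..<int (modulus P)} \<and>
        cong_trunc (modulus P) (terms P) (Poly ds) F"
      show "ds = cs"
      proof (rule nth_equalityI)
        show "length ds = length cs" using * by (simp add: cs_def)
        fix i assume i: "i < length ds"
        then have "[ds ! i = coeff F i] (mod int (modulus P))"
          using * by (auto simp: cong_trunc_def coeff_Poly_eq nth_default_def)
        moreover have "ds ! i \<in> {0..<int (modulus P)}" using * i nth_mem by blast
        ultimately show "ds ! i = cs ! i" using * i by (simp add: cs_def Cong.cong_def)
      qed
    next
      assume "ds = cs"
      then show "length ds = terms P \<and> set ds \<subseteq> {0..<int (modulus P)} \<and>
        cong_trunc (modulus P) (terms P) (Poly ds) F"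
        using assms by (auto simp: cs_def cong_trunc_def coeff_Poly_eq nth_default_def Cong.cong_def)
    qed
    then show ?thesis
      unfolding represents_def no_neg F_def[symmetric] c_def
      by (cases c') (auto simp: linear_prod_def)
  qed
  show ?thesis unfolding sketch_def by (rule theI') (simp add: iff)
qed

definition relabeled_sketch :: "params \<Rightarrow> public \<Rightarrow> int set \<Rightarrow> sketch" where
  "relabeled_sketch P \<omega> S = sketch P \<omega> (relabel \<omega> ` S)"

definition empty_cell :: "params \<Rightarrow> cell" where
  "empty_cell P = \<lparr>cell_count = 0, cell_poly = 1 # replicate (terms P - 1) 0, cell_fp = 0\<rparr>"


subsection \<open>The transmitted message\<close>

definition width :: "nat \<Rightarrow> nat" where
  "width n = (LEAST w. n \<le> 2 ^ w)"

definition to_bits :: "nat \<Rightarrow> int \<Rightarrow> bool list" where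
  "to_bits w x = map (bit x) [0..<w]"

definition cell_bits :: "params \<Rightarrow> cell \<Rightarrow> bool list" where
  "cell_bits P c =
     to_bits (width (2 * terms P + 1)) (cell_count c) @
     concat (map (\<lambda>i. to_bits (width (modulus P)) (cell_poly c ! i)) [0..<terms P]) @
     to_bits (width (fp_modulus P)) (cell_fp c)"

definition message :: "params \<Rightarrow> sketch \<Rightarrow> bool list" where
  "message P s = concat (map (\<lambda>j. cell_bits P (s j)) [1..<Suc (cells P)])"

definition sketch_bits :: "params \<Rightarrow> nat" where
  "sketch_bits P =
     cells P * (width (2 * terms P + 1) + terms P * width (modulus P) + width (fp_modulus P))"

lemma length_cell_bits: "length (cell_bits P c) =
    width (2 * terms P + 1) + terms P * width (modulus P) + width (fp_modulus P)"
  by (simp add: cell_bits_def to_bits_def length_concat comp_def sum_list_triv)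

lemma length_message: "length (message P s) = sketch_bits P"
  by (simp add: message_def sketch_bits_def length_cell_bits length_concat comp_def sum_list_triv)

definition valid_cell :: "params \<Rightarrow> cell \<Rightarrow> bool" where
  "valid_cell P c \<longleftrightarrow>
     cell_count c \<in> {0..<int (2 * terms P + 1)} \<and>
     length (cell_poly c) = terms P \<and> set (cell_poly c) \<subseteq> {0..<int (modulus P)} \<and>
     cell_fp c \<in> {0..<int (fp_modulus P)}"

lemma to_bits_inj:
  assumes "to_bits (width n) x = to_bits (width n) y" "x \<in> {0..<int n}" "y \<in> {0..<int n}"
  shows "x = y"
proof -
  have "\<exists>w. n \<le> 2 ^ w" using less_exp[of n] less_imp_le by blast
  then have w: "n \<le> 2 ^ width n" unfolding width_def by (rule LeastI_ex)
  then have "int n \<le> 2 ^ width n" by (metis of_nat_le_iff of_nat_numeral of_nat_power)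
  then have "x < 2 ^ width n" "y < 2 ^ width n"
    using assms by (meson atLeastLessThan_iff less_le_trans)+
  then have t: "take_bit (width n) x = x" "take_bit (width n) y = y"
    using assms by (auto simp: take_bit_int_eq_self)
  have "bit x i = bit y i" if "i < width n" for i
    using assms(1) that by (auto simp: to_bits_def)
  then have "take_bit (width n) x = take_bit (width n) y"
    by (intro bit_eqI) (auto simp: bit_take_bit_iff)
  then show ?thesis using t by simp
qed

lemma concat_map_inj:
  assumes "concat (map f xs) = concat (map g xs)" "\<And>x. length (f x) = n" "\<And>x. length (g x) = n"
    and "x \<in> set xs"
  shows "f x = g x"
  using assms(1,4) by (induction xs) (auto simp: append_eq_append_conv assms(2,3))

lemma cell_bits_inj:
  assumes "cell_bits P c = cell_bits P c'" "valid_cell P c" "valid_cell P c'"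
  shows "c = c'"
proof -
  let ?f = "\<lambda>c i. to_bits (width (modulus P)) (cell_poly c ! i)"
  have len: "length (to_bits w x) = w" for w x by (simp add: to_bits_def)
  have lc: "length (concat (map (?f c) [0..<terms P])) = length (concat (map (?f c') [0..<terms P]))"
    by (simp add: length_concat comp_def len)
  have *: "to_bits (width (2 * terms P + 1)) (cell_count c) = to_bits (width (2 * terms P + 1)) (cell_count c')"
    "concat (map (?f c) [0..<terms P]) = concat (map (?f c') [0..<terms P])"
    "to_bits (width (fp_modulus P)) (cell_fp c) = to_bits (width (fp_modulus P)) (cell_fp c')"
    using assms(1) lc by (simp_all add: cell_bits_def len append_eq_append_conv)
  have "cell_poly c ! i = cell_poly c' ! i" if "i < terms P" for i
  proof (rule to_bits_inj)
    show "?f c i = ?f c' i" using concat_map_inj[OF *(2), of "width (modulus P)" i] len that by simp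
  qed (use assms that in \<open>auto simp: valid_cell_def subset_iff\<close>)
  then have "cell_poly c = cell_poly c'"
    using assms by (intro nth_equalityI) (auto simp: valid_cell_def)
  moreover have "cell_count c = cell_count c'" "cell_fp c = cell_fp c'"
    using to_bits_inj * assms unfolding valid_cell_def by blast+
  ultimately show ?thesis by simp
qed

lemma message_inj:
  assumes "message P s = message P s'"
    and "\<And>j. j \<in> {1..cells P} \<Longrightarrow> valid_cell P (s j) \<and> valid_cell P (s' j)"
    and "j \<in> {1..cells P}"
  shows "s j = s' j"
  using concat_map_inj[OF assms(1)[unfolded message_def], of _ j] assms length_cell_bits cell_bits_inj
  by (metis atLeastAtMost_iff le_imp_less_Suc set_upt atLeastLessThan_iff)

text \<open>\<open>L V\<close> bits are \<open>(c + o(1)) log\<^sub>2 V\<close> bits, as \<open>V\<close> tends to infinity through the primes.\<close>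

definition communication_cost :: "(nat \<Rightarrow> nat) \<Rightarrow> real \<Rightarrow> bool" where
  "communication_cost L c \<longleftrightarrow>
     ((\<lambda>V. real (L V) / log 2 (real V)) \<longlongrightarrow> c) (inf at_top (principal {V. prime V}))"


subsection \<open>Updates\<close>

fun support_list_aux :: "params \<Rightarrow> public \<Rightarrow> int \<Rightarrow> nat list \<Rightarrow> nat list timed" where
  "support_list_aux P \<omega> x [] = ret []"
| "support_list_aux P \<omega> x (i # is) = do {
     a \<leftarrow> step (shift \<omega> x);
     b \<leftarrow> step (offset \<omega> (i, x));
     j \<leftarrow> steps 5 (nat (1 + \<lfloor>(a + b) / (coupling P + 1) * real (cells P)\<rfloor>));
     js \<leftarrow> support_list_aux P \<omega> x is;
     dup \<leftarrow> steps (length js) (j \<in> set js);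
     ret (if dup then js else j # js) }"

definition support_list :: "params \<Rightarrow> public \<Rightarrow> int \<Rightarrow> nat list timed" where
  "support_list P \<omega> x = support_list_aux P \<omega> x [1..<Suc (hashes P)]"

text \<open>Add \<open>\<sigma>\<close> times the contribution of \<open>x\<close>, whose fingerprint is \<open>h\<close>, to a cell.\<close>

definition add_signed :: "params \<Rightarrow> int \<Rightarrow> int \<Rightarrow> int \<Rightarrow> cell \<Rightarrow> cell timed" where
  "add_signed P x \<sigma> h c = do {
     n \<leftarrow> steps 2 ((cell_count c + \<sigma>) mod (2 * int (terms P) + 1));
     cs \<leftarrow> mul_power_linear (modulus P) x \<sigma> (cell_poly c);
     t \<leftarrow> steps 3 ((cell_fp c + \<sigma> * h) mod int (fp_modulus P));
     ret \<lparr>cell_count = n, cell_poly = cs, cell_fp = t\<rparr> }"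

definition update_cells ::
    "params \<Rightarrow> public \<Rightarrow> int \<Rightarrow> int \<Rightarrow> nat list \<Rightarrow> sketch \<Rightarrow> sketch timed" where
  "update_cells P \<omega> x \<sigma> js s = do {
     h \<leftarrow> step (fingerprint \<omega> x);
     fold_timed (\<lambda>j s. do {
       c \<leftarrow> step (s j);
       c' \<leftarrow> add_signed P x \<sigma> h c;
       step (s(j := c')) }) js s }"

definition insert_item :: "params \<Rightarrow> public \<Rightarrow> int \<Rightarrow> sketch \<Rightarrow> sketch timed" where
  "insert_item P \<omega> x s = do {
     y \<leftarrow> step (relabel \<omega> x);
     js \<leftarrow> support_list P \<omega> y;
     update_cells P \<omega> y 1 js s }"


subsection \<open>Decoding\<close>

text \<open>
  A root-finding routine maps a prime \<open>p\<close> and a monic polynomial over \<open>F\<^sub>p\<close> to the random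
  result of its run. It never errs, and for constant degree it takes expected time \<open>O(log p)\<close>.
  Expectations are Lebesgue integrals in \<open>ennreal\<close>, so that the bound includes finiteness.
\<close>

type_synonym root_routine = "nat \<Rightarrow> int poly \<Rightarrow> int list timed pmf"

definition root_finder :: "root_routine \<Rightarrow> bool" where
  "root_finder rf \<longleftrightarrow>
     (\<forall>p F. prime p \<longrightarrow> reduced p F \<longrightarrow> lead_coeff F = 1 \<longrightarrow>
        (\<forall>r\<in>set_pmf (rf p F).
           distinct (val r) \<and> set (val r) = {x \<in> {0..<int p}. [poly F x = 0] (mod int p)})) \<and>
     (\<forall>D. \<exists>C. \<forall>p F. prime p \<longrightarrow> reduced p F \<longrightarrow> lead_coeff F = 1 \<longrightarrow> degree F \<le> D \<longrightarrow>
        (\<integral>\<^sup>+r. of_nat (cost r) \<partial>rf p F) \<le> ennreal (C * log 2 (real p)))"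

text \<open>
  Whether the polynomial \<open>F\<close> with roots \<open>R\<close> is a product of distinct linear factors with
  nonzero roots.
\<close>

definition splits :: "nat \<Rightarrow> int list \<Rightarrow> int list \<Rightarrow> bool timed" where
  "splits p F R = do {
     E \<leftarrow> fold_timed (\<lambda>x cs. mul_linear p x 0 (cs @ [0])) R [1];
     eq \<leftarrow> steps (length F) (E = F);
     nz \<leftarrow> steps (length R) (0 \<notin> set R);
     ret (eq \<and> nz) }"

definition confirm :: "params \<Rightarrow> public \<Rightarrow> nat \<Rightarrow> int \<Rightarrow> (int \<times> int) list \<Rightarrow> bool timed" where
  "confirm P \<omega> j t cand = do {
     oks \<leftarrow> map_timed (\<lambda>(x, \<sigma>). do {
              js \<leftarrow> support_list P \<omega> x;
              steps (length js) (j \<in> set js) }) cand;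
     u \<leftarrow> fold_timed (\<lambda>(x, \<sigma>) u. do {
              h \<leftarrow> step (fingerprint \<omega> x);
              steps 3 ((u + \<sigma> * h) mod int (fp_modulus P)) }) cand 0;
     eq \<leftarrow> step (u = t);
     ret (list_all id oks \<and> eq) }"

definition decode_cell ::
    "root_routine \<Rightarrow> params \<Rightarrow> public \<Rightarrow> nat \<Rightarrow> cell \<Rightarrow> (int \<times> int) list option rtimed" where
  "decode_cell rf P \<omega> j c = do {
     m \<leftarrow> det (steps 2 (if cell_count c \<le> int (terms P) then cell_count c
                        else cell_count c - (2 * int (terms P) + 1)));
     FG \<leftarrow> det (find_pair (modulus P) m (cell_poly c));
     case FG of
       None \<Rightarrow> det (ret None)
     | Some (F, G) \<Rightarrow> do {
         R \<leftarrow> RTimed (rf (modulus P) (Poly F));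
         okF \<leftarrow> det (splits (modulus P) F R);
         R' \<leftarrow> RTimed (rf (modulus P) (Poly G));
         okG \<leftarrow> det (splits (modulus P) G R');
         if okF \<and> okG then do {
           let cand = map (\<lambda>x. (x, 1)) R @ map (\<lambda>x. (x, - 1)) R';
           acc \<leftarrow> det (confirm P \<omega> j (cell_fp c) cand);
           det (ret (if acc then Some cand else None)) }
         else det (ret None) } }"

definition remove_signed ::
    "params \<Rightarrow> public \<Rightarrow> int \<times> int \<Rightarrow> nat list \<times> sketch \<Rightarrow> (nat list \<times> sketch) timed" where
  "remove_signed P \<omega> = (\<lambda>(x, \<sigma>) (queue, s). do {
     js \<leftarrow> support_list P \<omega> x;
     s' \<leftarrow> update_cells P \<omega> x (- \<sigma>) js s;
     queue' \<leftarrow> steps (length js) (queue @ js);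
     ret (queue', s') })"

text \<open>\<open>peel\<close> fails when the queue is nonempty after the given number of pops.\<close>

fun peel ::
    "root_routine \<Rightarrow> params \<Rightarrow> public \<Rightarrow> nat \<Rightarrow> nat list \<Rightarrow> sketch \<Rightarrow> (int \<times> int) list \<Rightarrow>
     ((int \<times> int) list \<times> sketch) option rtimed" where
  "peel rf P \<omega> n [] s found = det (step (Some (found, s)))"
| "peel rf P \<omega> 0 (j # queue) s found = det (step None)"
| "peel rf P \<omega> (Suc n) (j # queue) s found = do {
     c \<leftarrow> det (steps 3 (s j));
     res \<leftarrow> decode_cell rf P \<omega> j c;
     case res of
       None \<Rightarrow> peel rf P \<omega> n queue s found
     | Some cand \<Rightarrow> do {
         found' \<leftarrow> det (steps (length cand) (cand @ found));
         next \<leftarrow> det (fold_timed (remove_signed P \<omega>) cand (queue, s));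
         peel rf P \<omega> n (fst next) (snd next) found' } }"

definition subtract_cell :: "params \<Rightarrow> cell \<Rightarrow> cell \<Rightarrow> cell timed" where
  "subtract_cell P c c' = do {
     n \<leftarrow> steps 2 ((cell_count c - cell_count c') mod (2 * int (terms P) + 1));
     cs \<leftarrow> div_series (modulus P) (cell_poly c) (cell_poly c');
     t \<leftarrow> steps 2 ((cell_fp c - cell_fp c') mod int (fp_modulus P));
     ret \<lparr>cell_count = n, cell_poly = cs, cell_fp = t\<rparr> }"

definition subtract :: "params \<Rightarrow> sketch \<Rightarrow> sketch \<Rightarrow> sketch timed" where
  "subtract P s1 s2 = fold_timed (\<lambda>j s. do {
     c1 \<leftarrow> step (s1 j);
     c2 \<leftarrow> step (s2 j);
     c \<leftarrow> subtract_cell P c1 c2;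
     step (s(j := c)) }) [1..<Suc (cells P)] s1"

definition decode ::
    "root_routine \<Rightarrow> params \<Rightarrow> public \<Rightarrow> nat \<Rightarrow> sketch \<Rightarrow> sketch \<Rightarrow>
     (int set \<times> int set) option rtimed" where
  "decode rf P \<omega> d s1 s2 = do {
     s \<leftarrow> det (subtract P s1 s2);
     queue \<leftarrow> det (steps (cells P) [1..<Suc (cells P)]);
     res \<leftarrow> peel rf P \<omega> (cells P + hashes P * d) queue s [];
     case res of
       None \<Rightarrow> det (ret None)
     | Some (found, s') \<Rightarrow> do {
         oks \<leftarrow> det (map_timed (\<lambda>j. steps (terms P + 3) (s' j = empty_cell P)) queue);
         if list_all id oks then do {
           out \<leftarrow> det (map_timed (\<lambda>(x, \<sigma>). step (inv (relabel \<omega>) x, \<sigma>)) found);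
           det (ret (Some ({x. (x, 1) \<in> set out}, {x. (x, - 1) \<in> set out}))) }
         else det (ret None) } }"

definition solves :: "root_routine \<Rightarrow> params \<Rightarrow> public \<Rightarrow> nat \<Rightarrow> int set \<Rightarrow> int set \<Rightarrow> bool" where
  "solves rf P \<omega> d A B \<longleftrightarrow>
     (\<forall>r\<in>set_pmf (run (decode rf P \<omega> d (relabeled_sketch P \<omega> A) (relabeled_sketch P \<omega> B))).
        val r = Some (A - B, B - A))"

definition decoding_time ::
    "root_routine \<Rightarrow> params \<Rightarrow> public \<Rightarrow> nat \<Rightarrow> int set \<Rightarrow> int set \<Rightarrow> ennreal" where
  "decoding_time rf P \<omega> d A B =
     (\<integral>\<^sup>+r. of_nat (cost r)
        \<partial>run (decode rf P \<omega> d (relabeled_sketch P \<omega> A) (relabeled_sketch P \<omega> B)))"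

end

theory Submission
  imports Defs "HOL-Real_Asymp.Real_Asymp"
begin

text \<open>
  Two hash functions suffice. A difference that cannot be decoded contains a nonempty \<^emph>\<open>stuck\<close> set of
  items, which puts more than \<open>\<ell>\<close> of its members into every cell it touches. Cut the cells into a
  constant number of blocks and scan them from the left. The expected number of items at a cell
  whose other cell is not in an earlier block is a constant factor below \<open>\<ell>\<close>: this is where the
  shift \<open>g\<^sub>0\<close> helps, because most cells see their items at a uniform position of the window of
  length \<open>1\<close>. So the cells overfull with such items are a fraction of the cells that is exponentially
  small in \<open>\<ell>\<close>, and every other stuck cell holds a constant fraction of \<open>\<ell>\<close> items that touch stuck cells
  of earlier blocks. Hence the fraction of stuck cells grows by at most a constant factor per block
  and stays small, and small stuck sets are excluded by a union bound.

  A cell with more than \<open>\<ell>\<close> items has at most one candidate. If the candidate has two elements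
  outside the cell, both would have to be hashed to it by chance. Otherwise the candidate congruence is a
  coincidence of the random relabeling, which has probability \<open>O(1 / p\<^sup>2)\<close>.
\<close>

section \<open>Arithmetic of cells\<close>

text \<open>The communication budget forces the cells to be overloaded: an item is counted in up to
  two cells while \<open>M * l\<close> is only about \<open>(1 + e) * d\<close>, so the mean load is
  close to \<open>2 * l / (1 + e)\<close>. Dropping the items that reach an earlier block halves it,
  and the margin \<open>e\<close> must pay for three losses: endpoints up to
  \<open>(z + 1) / z\<close> times denser than on average, the rounding to cells, and the comparison
  of blocks instead of cells. Hence a large \<open>z\<close>, and then a large \<open>B\<close>. The
  expected numbers of overfull cells and of excess incidences are of order \<open>M\<close>.
  Markov's inequality leaves a failure probability that does not decrease with \<open>d\<close>, so
  \<open>l\<close> has to depend on \<open>\<delta>\<close> as well. For false decodings, a cell may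
  contain any of exponentially many sets \<open>S\<close>. But \<open>S\<close> falls into one cell
  with probability at most \<open>(2 * hit) ^ card S\<close>, and the sum over all \<open>S\<close>
  is at most \<open>exp (2 * hit * d)\<close>, a constant depending on \<open>l\<close>. Far
  candidates then cost \<open>M\<close> cells times \<open>O(1 / M^2)\<close>. Near ones cost
  \<open>O(1 / p^2)\<close> for each cell and each of \<open>O(p)\<close> outside elements, and such
  an element reaches the cell with probability \<open>O(1 / M)\<close>: in total
  \<open>O(1 / p)\<close>.\<close>

lemma cong_trunc_refl [simp, intro!]: "cong_trunc p n F F"
  by (simp add: cong_trunc_def)

lemma cong_trunc_mult:
  assumes "cong_trunc p n F G" "cong_trunc p n F' G'"
  shows "cong_trunc p n (F * F') (G * G')"
  using cong_trunc_mult_left[OF assms(1), of F'] cong_trunc_mult_left[OF assms(2), of G]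
  by (metis cong_trunc_trans mult.commute)

lemma cong_trunc_add:
  "cong_trunc p n F G \<Longrightarrow> cong_trunc p n F' G' \<Longrightarrow> cong_trunc p n (F + F') (G + G')"
  by (simp add: cong_trunc_def cong_add)

lemma cong_trunc_0 [simp]: "cong_trunc p 0 F G"
  by (simp add: cong_trunc_def)

section \<open>Multiplication and division of truncated power series\<close>

lemma cong_trunc_Suc_pCons:
  "cong_trunc p (Suc n) (pCons a F) (pCons b G) \<longleftrightarrow> [a = b] (mod int p) \<and> cong_trunc p n F G"
  by (auto simp: cong_trunc_def coeff_pCons less_Suc_eq_0_disj split: nat.splits)

text \<open>\<open>prev\<close> is the coefficient that precedes \<open>cs\<close>, so
  \<open>[:prev:]\<close> is the carry into the first position. The induction needs it arbitrary;
  the applications take 0.\<close>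

lemma mul_linear_correct:
  assumes "p > 0"
  shows "length (val (mul_linear p x prev cs)) = length cs \<and>
    set (val (mul_linear p x prev cs)) \<subseteq> {0..<int p} \<and>
    cong_trunc p (length cs) (Poly (val (mul_linear p x prev cs))) ([:- x, 1:] * Poly cs + [:prev:])"
proof (induction cs arbitrary: prev)
  case (Cons c cs)
  have eq: "[:- x, 1:] * Poly (c # cs) + [:prev:] = pCons (prev - x * c) ([:- x, 1:] * Poly cs + [:c:])"
    by (simp add: algebra_simps)
  have "[(prev - x * c mod int p) mod int p = prev - x * c] (mod int p)"
    by (simp add: Cong.cong_def mod_simps)
  then show ?case unfolding eq using Cons.IH[of c] assms
    by (simp del: mult_pCons_left mult_pCons_right add: cong_trunc_Suc_pCons)
qed simp

text \<open>Comparing coefficients in \<open>(Z - x) * Q = C\<close> gives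
  \<open>b = (prev - c) / x\<close>, where \<open>prev\<close> is the preceding coefficient of the
  quotient. A nonzero root is what makes \<open>Z - x\<close> invertible modulo a power of
  \<open>Z\<close>.\<close>

lemma div_linear_correct:
  assumes "p > 0" and inv: "[xinv * x = 1] (mod int p)"
  shows "length (val (div_linear p xinv prev cs)) = length cs \<and>
    set (val (div_linear p xinv prev cs)) \<subseteq> {0..<int p} \<and>
    cong_trunc p (length cs) ([:- x, 1:] * Poly (val (div_linear p xinv prev cs)) + [:prev:]) (Poly cs)"
proof (induction cs arbitrary: prev)
  case (Cons c cs)
  define b where "b = (prev - c) mod int p * xinv mod int p"
  have eq: "[:- x, 1:] * Poly (b # bs) + [:prev:] = pCons (prev - x * b) ([:- x, 1:] * Poly bs + [:b:])" for bs
    by (simp add: algebra_simps)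
  have "[x * b = (prev - c) * (xinv * x)] (mod int p)"
    unfolding b_def by (simp add: Cong.cong_def mod_simps algebra_simps)
  also have "[(prev - c) * (xinv * x) = (prev - c) * 1] (mod int p)"
    by (rule cong_scalar_left[OF inv])
  finally have "[prev - x * b = prev - (prev - c)] (mod int p)"
    by (intro cong_diff) auto
  moreover have v: "val (div_linear p xinv prev (c # cs)) = b # val (div_linear p xinv b cs)"
    by (simp add: b_def)
  ultimately show ?case using Cons.IH[of b] assms(1) unfolding v eq
    by (simp del: mult_pCons_left mult_pCons_right Poly.simps(2) add: cong_trunc_Suc_pCons Poly.simps(2)[of c]) (simp add: b_def)
qed simp

text \<open>One elimination step of the long division of power series. The tail of the divisor may
  be longer than what is left of the dividend, whence an inequality between the lengths.\<close>

lemma Poly_map2_cong: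
  assumes "length us \<le> length vs"
  shows "cong_trunc p (length us)
     (Poly (map (\<lambda>(u, v). (u - a * v mod int p) mod int p) (zip us vs)) + smult a (Poly vs)) (Poly us)"
  using assms
proof (induction us arbitrary: vs)
  case (Cons u us)
  then obtain v vs' where vs: "vs = v # vs'" by (cases vs) auto
  have "[(u - a * v mod int p) mod int p + a * v = u - a * v + a * v] (mod int p)"
    by (intro cong_add) (simp_all add: Cong.cong_def mod_simps)
  then show ?case using Cons.IH[of vs'] Cons.prems by (simp add: vs cong_trunc_Suc_pCons)
qed simp

lemma div_series_aux_correct:
  assumes "p > 0" and inv: "[binv * hd bs = 1] (mod int p)"
    and "length as = n" "n \<le> length bs"
  shows "length (val (div_series_aux p binv bs n as)) = n \<and>
    set (val (div_series_aux p binv bs n as)) \<subseteq> {0..<int p} \<and>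
    cong_trunc p n (Poly bs * Poly (val (div_series_aux p binv bs n as))) (Poly as)"
  using assms(3,4)
proof (induction n arbitrary: as)
  case (Suc n)
  obtain a as1 where as: "as = a # as1" "length as1 = n" using Suc.prems by (cases as) auto
  obtain b bs1 where bs: "bs = b # bs1" "n \<le> length bs1" using Suc.prems by (cases bs) auto
  define c where "c = a * binv mod int p"
  define as' where "as' = val (sub_scaled p c as1 bs1)"
  have as': "length as' = n" "cong_trunc p n (Poly as' + smult c (Poly bs1)) (Poly as1)"
    using Poly_map2_cong[of as1 bs1 p c] as bs by (auto simp: as'_def val_sub_scaled)
  define cs where "cs = val (div_series_aux p binv bs n as')"
  have IH: "length cs = n" "set cs \<subseteq> {0..<int p}" "cong_trunc p n (Poly bs * Poly cs) (Poly as')"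
    using Suc.IH[of as'] as' Suc.prems unfolding cs_def by auto
  have "[c * b = a * (binv * b)] (mod int p)"
    unfolding c_def by (simp add: Cong.cong_def mod_simps algebra_simps)
  also have "[a * (binv * b) = a * 1] (mod int p)" using inv bs by (intro cong_scalar_left) auto
  finally have cb: "[c * b = a] (mod int p)" by simp
  have eq: "Poly bs * Poly (c # cs) = pCons (c * b) (smult c (Poly bs1) + Poly bs * Poly cs)"
    by (simp add: bs)
  have "cong_trunc p n (smult c (Poly bs1) + Poly bs * Poly cs) (smult c (Poly bs1) + Poly as')"
    by (intro cong_trunc_add IH) simp
  then have "cong_trunc p n (smult c (Poly bs1) + Poly bs * Poly cs) (Poly as1)"
    using as'(2) by (metis add.commute cong_trunc_trans)
  then have "cong_trunc p (Suc n) (Poly bs * Poly (c # cs)) (Poly as)"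
    unfolding eq using cb by (simp add: as cong_trunc_Suc_pCons)
  moreover have v: "val (div_series_aux p binv bs (Suc n) as) = c # cs"
    by (simp add: c_def cs_def as'_def as bs)
  ultimately show ?case using IH assms(1) unfolding v by (simp add: c_def del: Poly.simps)
qed simp

lemma div_series_correct:
  assumes "p > 0" and "coprime (hd bs) (int p)" "length as = length bs"
  shows "length (val (div_series p as bs)) = length as \<and>
    set (val (div_series p as bs)) \<subseteq> {0..<int p} \<and>
    cong_trunc p (length as) (Poly bs * Poly (val (div_series p as bs))) (Poly as)"
  using div_series_aux_correct[OF assms(1) cong_modular_inverse2[OF assms(2)] refl, of as] assms(3)
  by (simp add: div_series_def)

section \<open>Products of linear factors with nonzero roots\<close>

lemma linear_prod_insert:
  "finite X \<Longrightarrow> x \<notin> X \<Longrightarrow> linear_prod (insert x X) = [:- x, 1:] * linear_prod X"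
  by (simp add: linear_prod_def)

lemma linear_prod_empty [simp]: "linear_prod {} = 1"
  by (simp add: linear_prod_def)

lemma linear_prod_Un:
  "finite X \<Longrightarrow> finite Y \<Longrightarrow> X \<inter> Y = {} \<Longrightarrow> linear_prod (X \<union> Y) = linear_prod X * linear_prod Y"
  by (simp add: linear_prod_def prod.union_disjoint)

lemma poly_linear_prod: "poly (linear_prod X) y = (\<Prod>x\<in>X. y - x)"
  by (simp add: linear_prod_def poly_prod)

lemma lead_coeff_linear_prod [simp]: "lead_coeff (linear_prod X) = 1"
  by (simp add: linear_prod_def lead_coeff_prod)

lemma linear_prod_nz [simp]: "linear_prod X \<noteq> 0"
  by (metis lead_coeff_linear_prod leading_coeff_0_iff zero_neq_one)

lemma degree_linear_prod [simp]: "degree (linear_prod X) = card X"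
  unfolding linear_prod_def by (cases "finite X") (subst degree_prod_eq_sum_degree; auto)+

lemma universe_coprime:
  assumes "prime (modulus P)" "x \<in> universe P" shows "coprime x (int (modulus P))"
  using prime_int_coprime[OF assms(1), of x] assms(2) by (auto simp: universe_def)

lemma universe_cong_eq:
  assumes "x \<in> universe P" "y \<in> universe P" "[x = y] (mod int (modulus P))" shows "x = y"
  using assms by (auto simp: universe_def Cong.cong_def)

lemma finite_universe [simp]: "finite (universe P)"
  by (simp add: universe_def)

text \<open>A unit constant term is the hypothesis of \<open>cong_trunc_cancel\<close>: products
  over parts of the universe are units modulo every power of \<open>Z\<close> and can be cancelled
  from any cell equation.\<close>

lemma linear_prod_coprime:
  assumes "prime (modulus P)" "X \<subseteq> universe P"
  shows "coprime (coeff (linear_prod X) 0) (int (modulus P))"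
  using universe_coprime[OF assms(1)] assms(2)
  by (auto simp: poly_0_coeff_0[symmetric] poly_linear_prod intro!: prod_coprime_left)

lemma linear_prod_root:
  assumes "prime (modulus P)" "X \<subseteq> universe P" "y \<in> universe P"
  shows "[poly (linear_prod X) y = 0] (mod int (modulus P)) \<longleftrightarrow> y \<in> X"
proof -
  have fin: "finite X" using assms(2) finite_subset finite_universe by blast
  have "prime (int (modulus P))" using assms(1) by simp
  then have "[poly (linear_prod X) y = 0] (mod int (modulus P)) \<longleftrightarrow> (\<exists>x\<in>X. [y - x = 0] (mod int (modulus P)))"
    unfolding poly_linear_prod cong_0_iff using fin by (simp add: prime_dvd_prod_iff)
  also have "\<dots> \<longleftrightarrow> y \<in> X"
    unfolding cong_diff_iff_cong_0 using universe_cong_eq[OF assms(3)] assms(2) cong_refl by blast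
  finally show ?thesis .
qed

lemma cong_poly_eval:
  assumes "cong_poly p F G" shows "[poly F y = poly G y] (mod int p)"
proof -
  obtain Q where "F - G = [:int p:] * Q" using assms by (auto simp: cong_poly_iff_dvd dvd_def)
  then have "poly F y - poly G y = int p * poly Q y"
    by (metis poly_diff poly_mult poly_pCons poly_0 mult_zero_right add.right_neutral)
  then show ?thesis by (simp add: cong_iff_dvd_diff)
qed

text \<open>The denominator is a unit modulo \<open>Z ^ terms P\<close>, so the cross-multiplied
  equation fixes the coefficients modulo p, and they are stored in reduced form. Equality of cells
  is always proved through this.\<close>

lemma represents_unique:
  assumes p: "prime (modulus P)" and "represents P \<omega> f c" "represents P \<omega> f c'"
  shows "c = c'"
proof -
  let ?N = "linear_prod {x \<in> universe P. f x = - 1}"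
  have len: "length (cell_poly c) = terms P" "length (cell_poly c') = terms P"
    using assms by (auto simp: represents_def)
  have "cong_trunc (modulus P) (terms P) (?N * Poly (cell_poly d)) (linear_prod {x \<in> universe P. f x = 1})"
    if "represents P \<omega> f d" for d
    using that by (simp add: represents_def mult.commute)
  from cong_trunc_trans[OF this[OF assms(2)] cong_trunc_sym[OF this[OF assms(3)]]]
  have "cong_trunc (modulus P) (terms P) (?N * Poly (cell_poly c)) (?N * Poly (cell_poly c'))" .
  then have *: "cong_trunc (modulus P) (terms P) (Poly (cell_poly c)) (Poly (cell_poly c'))"
    by (rule cong_trunc_cancel[OF linear_prod_coprime[OF p], rotated]) auto
  have "cell_poly c = cell_poly c'"
  proof (rule nth_equalityI)
    fix i assume i: "i < length (cell_poly c)"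
    then have "[cell_poly c ! i = cell_poly c' ! i] (mod int (modulus P))"
      using * len by (auto simp: cong_trunc_def coeff_Poly_eq nth_default_def)
    moreover have "cell_poly c ! i \<in> {0..<int (modulus P)}" "cell_poly c' ! i \<in> {0..<int (modulus P)}"
      using i len assms(2,3) by (auto simp: represents_def subset_iff)
    ultimately show "cell_poly c ! i = cell_poly c' ! i" by (auto simp: Cong.cong_def)
  qed (use len in simp)
  then show ?thesis using assms(2,3) by (simp add: represents_def)
qed

section \<open>Effect of signed updates and of subtraction on the represented function\<close>

lemma mul_power_linear_correct:
  assumes p: "prime (modulus P)" "x \<in> universe P"
  shows "length (val (mul_power_linear (modulus P) x \<sigma> cs)) = length cs"
    "set (val (mul_power_linear (modulus P) x \<sigma> cs)) \<subseteq> {0..<int (modulus P)}"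
    "\<sigma> = 1 \<Longrightarrow> cong_trunc (modulus P) (length cs) (Poly (val (mul_power_linear (modulus P) x \<sigma> cs))) ([:- x, 1:] * Poly cs)"
    "\<sigma> \<noteq> 1 \<Longrightarrow> cong_trunc (modulus P) (length cs) ([:- x, 1:] * Poly (val (mul_power_linear (modulus P) x \<sigma> cs))) (Poly cs)"
proof -
  have p0: "modulus P > 0" using p prime_gt_0_nat by blast
  note mul = mul_linear_correct[OF p0, of x 0 cs]
  note dv = div_linear_correct[OF p0 cong_modular_inverse2[OF universe_coprime[OF p]], of 0 cs]
  show "length (val (mul_power_linear (modulus P) x \<sigma> cs)) = length cs"
    "set (val (mul_power_linear (modulus P) x \<sigma> cs)) \<subseteq> {0..<int (modulus P)}"
    "\<sigma> = 1 \<Longrightarrow> cong_trunc (modulus P) (length cs) (Poly (val (mul_power_linear (modulus P) x \<sigma> cs))) ([:- x, 1:] * Poly cs)"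
    "\<sigma> \<noteq> 1 \<Longrightarrow> cong_trunc (modulus P) (length cs) ([:- x, 1:] * Poly (val (mul_power_linear (modulus P) x \<sigma> cs))) (Poly cs)"
    using mul dv by (auto simp: mul_power_linear_def simp del: mult_pCons_left mult_pCons_right)
qed

text \<open>Four cases: \<open>x\<close> enters the numerator, leaves the denominator, enters the
  denominator or leaves the numerator. Only the last one has to cancel the factor
  \<open>Z - x\<close>.\<close>

lemma add_signed_correct:
  assumes p: "prime (modulus P)" and x: "x \<in> universe P" and rep: "represents P \<omega> f c"
    and \<sigma>: "\<sigma> = 1 \<or> \<sigma> = - 1" and f: "f x \<in> {-1, 0, 1}" "f x + \<sigma> \<in> {-1, 0, 1}"
  shows "represents P \<omega> (f(x := f x + \<sigma>)) (val (add_signed P x \<sigma> (fingerprint \<omega> x) c))"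
proof -
  let ?p = "modulus P"
  let ?L = "[:- x, 1:]"
  define g where "g = f(x := f x + \<sigma>)"
  have gx: "g x = f x + \<sigma>" and gy: "\<And>y. y \<noteq> x \<Longrightarrow> g y = f y" by (simp_all add: g_def)
  define pos neg where "pos = {y \<in> universe P - {x}. f y = 1}" and "neg = {y \<in> universe P - {x}. f y = - 1}"
  have fin: "finite pos" "finite neg" "x \<notin> pos" "x \<notin> neg"
    by (auto simp: pos_def neg_def)
  have sets:
     "{y \<in> universe P. f y = s} = (if f x = s then insert x {y \<in> universe P - {x}. f y = s} else {y \<in> universe P - {x}. f y = s})"
     "{y \<in> universe P. g y = s} = (if g x = s then insert x {y \<in> universe P - {x}. f y = s} else {y \<in> universe P - {x}. f y = s})" for s
    unfolding g_def using x by auto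
  note sets = sets[of 1, folded pos_def] sets[of "- 1", folded neg_def]
  have sum: "(\<Sum>y\<in>universe P. g y * w y) = (\<Sum>y\<in>universe P. f y * w y) + \<sigma> * w x" for w
  proof -
    have "(\<Sum>y\<in>universe P. g y * w y) = (f x + \<sigma>) * w x + (\<Sum>y\<in>universe P - {x}. f y * w y)"
      using x gx by (subst sum.remove[of _ x]) (auto intro!: sum.cong simp: gy)
    also have "\<dots> = (\<Sum>y\<in>universe P. f y * w y) + \<sigma> * w x"
      using x by (subst (2) sum.remove[of _ x]) (auto simp: algebra_simps)
    finally show ?thesis .
  qed
  define A where "A = Poly (cell_poly c)"
  define A' where "A' = Poly (val (mul_power_linear ?p x \<sigma> (cell_poly c)))"
  have len: "length (cell_poly c) = terms P" using rep by (simp add: represents_def)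
  note mp = mul_power_linear_correct[OF p x, of \<sigma> "cell_poly c", unfolded len, folded A_def A'_def]
  have r: "cong_trunc ?p (terms P) (A * linear_prod {y \<in> universe P. f y = - 1}) (linear_prod {y \<in> universe P. f y = 1})"
    using rep by (simp add: represents_def A_def)
  have copL: "coprime (coeff ?L 0) (int ?p)" using universe_coprime[OF p x] by simp
  note lpi = linear_prod_insert[OF fin(1,3)] linear_prod_insert[OF fin(2,4)]
  have "cong_trunc ?p (terms P) (A' * linear_prod {y \<in> universe P. g y = - 1}) (linear_prod {y \<in> universe P. g y = 1})"
  proof (cases "\<sigma> = 1")
    case True
    have LA: "cong_trunc ?p (terms P) A' (?L * A)" using mp(3) True by simp
    show ?thesis
    proof (cases "f x = 0")
      case f0: True
      have "cong_trunc ?p (terms P) (A' * linear_prod neg) ((?L * A) * linear_prod neg)"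
        by (intro cong_trunc_mult LA cong_trunc_refl)
      also have "(?L * A) * linear_prod neg = ?L * (A * linear_prod neg)" by (simp only: mult.assoc)
      also have "cong_trunc ?p (terms P) \<dots> (?L * linear_prod pos)"
        using r f0 by (intro cong_trunc_mult_left) (simp add: sets)
      finally show ?thesis using True f0 by (simp add: sets gx lpi del: mult_pCons_left)
    next
      case False
      then have f1: "f x = - 1" using f True by auto
      have "cong_trunc ?p (terms P) (A' * linear_prod neg) ((?L * A) * linear_prod neg)"
        by (intro cong_trunc_mult LA cong_trunc_refl)
      also have "(?L * A) * linear_prod neg = A * (?L * linear_prod neg)" by (simp only: ac_simps)
      also have "cong_trunc ?p (terms P) \<dots> (linear_prod pos)"
        using r f1 by (simp add: sets gx lpi del: mult_pCons_left)
      finally show ?thesis using True f1 by (simp add: sets gx lpi del: mult_pCons_left)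
    qed
  next
    case False
    then have s: "\<sigma> = - 1" using \<sigma> by simp
    have LA: "cong_trunc ?p (terms P) (?L * A') A" using mp(4) False by simp
    have LA': "cong_trunc ?p (terms P) (?L * A' * linear_prod neg) (A * linear_prod neg)"
      by (intro cong_trunc_mult LA cong_trunc_refl)
    show ?thesis
    proof (cases "f x = 0")
      case f0: True
      have "A' * (?L * linear_prod neg) = ?L * A' * linear_prod neg" by (simp only: ac_simps)
      also note LA'
      also have "cong_trunc ?p (terms P) (A * linear_prod neg) (linear_prod pos)"
        using r f0 by (simp add: sets)
      finally show ?thesis using s f0 by (simp add: sets gx lpi del: mult_pCons_left)
    next
      case False
      then have f1: "f x = 1" using f s by auto
      have "?L * (A' * linear_prod neg) = ?L * A' * linear_prod neg" by (simp only: ac_simps)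
      also note LA'
      also have "cong_trunc ?p (terms P) (A * linear_prod neg) (?L * linear_prod pos)"
        using r f1 by (simp add: sets gx lpi del: mult_pCons_left)
      finally have "cong_trunc ?p (terms P) (A' * linear_prod neg) (linear_prod pos)"
        by (rule cong_trunc_cancel[OF copL])
      then show ?thesis using s f1 by (simp add: sets gx)
    qed
  qed
  then show ?thesis
    using rep mp(1,2) sum[of "\<lambda>_. 1"] sum[of "fingerprint \<omega>"]
    unfolding represents_def add_signed_def A'_def g_def[symmetric] by (simp add: mod_simps)
qed

text \<open>The common items contribute the same factor to both products. Cancelling it leaves the
  product over \<open>S - S'\<close> divided by the product over \<open>S' - S\<close>.\<close>

lemma subtract_cell_correct:
  assumes p: "prime (modulus P)" and l: "terms P \<ge> 1"
    and c: "represents P \<omega> (\<lambda>x. if x \<in> S then 1 else 0) c"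
    and c': "represents P \<omega> (\<lambda>x. if x \<in> S' then 1 else 0) c'"
  shows "represents P \<omega> (\<lambda>x. (if x \<in> S then 1 else 0) - (if x \<in> S' then 1 else 0)) (val (subtract_cell P c c'))"
proof -
  let ?p = "modulus P" and ?U = "universe P"
  have p0: "modulus P > 0" using p prime_gt_0_nat by blast
  have [simp]: "{x \<in> ?U. (if x \<in> X then 1 else 0 :: int) = 1} = ?U \<inter> X"
    "{x \<in> ?U. (if x \<in> X then 1 else 0 :: int) = - 1} = {}" for X by auto
  have len: "length (cell_poly c) = terms P" "length (cell_poly c') = terms P"
    using c c' by (auto simp: represents_def)
  have A: "cong_trunc ?p (terms P) (Poly (cell_poly c)) (linear_prod (?U \<inter> S))"
    and A': "cong_trunc ?p (terms P) (Poly (cell_poly c')) (linear_prod (?U \<inter> S'))"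
    using c c' by (auto simp: represents_def)
  have "[hd (cell_poly c') = coeff (linear_prod (?U \<inter> S')) 0] (mod int ?p)"
    using A' l len by (cases "cell_poly c'") (auto simp: cong_trunc_def dest!: spec[of _ 0])
  then have cop: "coprime (hd (cell_poly c')) (int ?p)"
    using linear_prod_coprime[OF p, of "?U \<inter> S'"] by (metis cong_imp_coprime cong_sym inf_le1)
  define Q where "Q = val (div_series ?p (cell_poly c) (cell_poly c'))"
  have Q: "length Q = terms P" "set Q \<subseteq> {0..<int ?p}"
    "cong_trunc ?p (terms P) (Poly (cell_poly c') * Poly Q) (Poly (cell_poly c))"
    using div_series_correct[OF p0 cop, of "cell_poly c"] len by (auto simp: Q_def)
  have s1: "{x \<in> ?U. (if x \<in> S then 1 else 0) - (if x \<in> S' then 1 else 0) = (1::int)} = ?U \<inter> S - S'"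
    and s2: "{x \<in> ?U. (if x \<in> S then 1 else 0) - (if x \<in> S' then 1 else 0) = (-1::int)} = ?U \<inter> S' - S"
    by auto
  have e1: "linear_prod (?U \<inter> S) = linear_prod (?U \<inter> S \<inter> S') * linear_prod (?U \<inter> S - S')"
    by (subst linear_prod_Un[symmetric]) (auto intro!: arg_cong[of _ _ linear_prod])
  have e2: "linear_prod (?U \<inter> S') = linear_prod (?U \<inter> S \<inter> S') * linear_prod (?U \<inter> S' - S)"
    by (subst linear_prod_Un[symmetric]) (auto intro!: arg_cong[of _ _ linear_prod])
  have "linear_prod (?U \<inter> S \<inter> S') * (Poly Q * linear_prod (?U \<inter> S' - S)) = linear_prod (?U \<inter> S') * Poly Q"
    unfolding e2 by (simp add: ac_simps)
  also have "cong_trunc ?p (terms P) \<dots> (Poly (cell_poly c') * Poly Q)"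
    by (intro cong_trunc_mult cong_trunc_sym[OF A'] cong_trunc_refl)
  also note Q(3)
  also note A
  also note e1
  finally have "cong_trunc ?p (terms P) (Poly Q * linear_prod (?U \<inter> S' - S)) (linear_prod (?U \<inter> S - S'))"
    by (rule cong_trunc_cancel[OF linear_prod_coprime[OF p], rotated]) auto
  then show ?thesis
    using c c' Q(1,2) unfolding represents_def subtract_cell_def Q_def
    by (simp add: s1 s2 mod_simps sum_subtractf left_diff_distrib)
qed

text \<open>\<open>solves\<close> demands the right output in every run of the root finder.
  Correctness therefore needs only the set of possible results, and this set is compositional under
  \<open>bind_rtimed\<close>.\<close>

definition results :: "'a rtimed \<Rightarrow> 'a set" where
  "results m = val ` set_pmf (run m)"

lemma results_simps [simp]:
  "results (det t) = {val t}"
  "results (RTimed q) = val ` set_pmf q"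
  "results (bind_rtimed m f) = (\<Union>a\<in>results m. results (f a))"
  by (simp_all add: results_def det_def bind_rtimed_def image_UN image_image)

lemma solves_iff_results:
  "solves rf P \<omega> d A B \<longleftrightarrow>
     (\<forall>r\<in>results (decode rf P \<omega> d (relabeled_sketch P \<omega> A) (relabeled_sketch P \<omega> B)). r = Some (A - B, B - A))"
  by (simp add: solves_def results_def)

section \<open>Supports, insertion of an item, and recognition of split polynomials\<close>

lemma support_list_aux_correct:
  "set (val (support_list_aux P \<omega> x is)) = (\<lambda>i. cell_index P \<omega> i x) ` set is \<and>
   distinct (val (support_list_aux P \<omega> x is)) \<and> length (val (support_list_aux P \<omega> x is)) \<le> length is"
  by (induction "is") (auto simp: cell_index_def)

lemma support_list_correct:
  "set (val (support_list P \<omega> x)) = support P \<omega> x"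
  "distinct (val (support_list P \<omega> x))"
  "length (val (support_list P \<omega> x)) \<le> hashes P"
  using support_list_aux_correct[of P \<omega> x "[1..<Suc (hashes P)]"]
  by (auto simp: support_list_def support_def)

declare support_list_correct(1,2) [simp]

lemma update_cells_val:
  assumes "distinct js"
  shows "val (update_cells P \<omega> x \<sigma> js s) =
    (\<lambda>j. if j \<in> set js then val (add_signed P x \<sigma> (fingerprint \<omega> x) (s j)) else s j)"
proof -
  have "val (fold_timed (\<lambda>j s. do { c \<leftarrow> step (s j); c' \<leftarrow> add_signed P x \<sigma> h c; step (s(j := c')) }) js s) =
    (\<lambda>j. if j \<in> set js then val (add_signed P x \<sigma> h (s j)) else s j)" for h
    using assms by (induction js arbitrary: s) (auto simp: fun_eq_iff)
  then show ?thesis by (simp add: update_cells_def)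
qed

lemma insert_item_correct:
  assumes p: "prime (modulus P)" and \<phi>: "relabel \<omega> permutes universe P"
    and S: "S \<subseteq> universe P" "x \<in> universe P - S"
  shows "val (insert_item P \<omega> x (relabeled_sketch P \<omega> S)) = relabeled_sketch P \<omega> (insert x S)"
proof
  fix j
  define y where "y = relabel \<omega> x"
  define S' where "S' = relabel \<omega> ` S"
  have p0: "modulus P > 0" using p prime_gt_0_nat by blast
  have y: "y \<in> universe P" "y \<notin> S'"
    using S permutes_in_image[OF \<phi>] permutes_inj[OF \<phi>] by (auto simp: y_def S'_def inj_def)
  let ?f = "\<lambda>S x. if x \<in> S \<and> j \<in> support P \<omega> x then 1 else 0 :: int"
  have img: "relabel \<omega> ` insert x S = insert y S'" by (simp add: y_def S'_def)
  note rep = sketch_represents[OF p0, of \<omega> S' j]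
  have "represents P \<omega> (?f (insert y S')) (val (insert_item P \<omega> x (relabeled_sketch P \<omega> S)) j)"
  proof (cases "j \<in> support P \<omega> y")
    case True
    have "(?f S')(y := ?f S' y + 1) = ?f (insert y S')" using y True by auto
    then show ?thesis
      using add_signed_correct[OF p y(1) rep, of 1] True y
      by (simp add: insert_item_def update_cells_val relabeled_sketch_def y_def[symmetric] S'_def[symmetric])
  next
    case False
    then have "?f S' = ?f (insert y S')" by auto
    then show ?thesis using rep False
      by (simp add: insert_item_def update_cells_val relabeled_sketch_def y_def[symmetric] S'_def[symmetric])
  qed
  then show "val (insert_item P \<omega> x (relabeled_sketch P \<omega> S)) j = relabeled_sketch P \<omega> (insert x S) j"
    unfolding relabeled_sketch_def img
    using represents_unique[OF p _ sketch_represents[OF p0, of \<omega> "insert y S'" j]] by simp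
qed

text \<open>The appended 0 reserves a place for the new leading coefficient. The truncated
  multiplication by \<open>Z - x\<close> then loses nothing, and the truncated congruence becomes a
  congruence of polynomials.\<close>

lemma expand_linear_factors:
  assumes "p > 0"
  shows "length (val (fold_timed (\<lambda>x cs. mul_linear p x 0 (cs @ [0])) R cs)) = length R + length cs \<and>
    (set cs \<subseteq> {0..<int p} \<longrightarrow>
      set (val (fold_timed (\<lambda>x cs. mul_linear p x 0 (cs @ [0])) R cs)) \<subseteq> {0..<int p}) \<and>
    cong_poly p (Poly (val (fold_timed (\<lambda>x cs. mul_linear p x 0 (cs @ [0])) R cs)))
      (Poly cs * (\<Prod>x\<leftarrow>R. [:- x, 1:]))"
proof (induction R arbitrary: cs)
  case (Cons x R)
  define cs' where "cs' = val (mul_linear p x 0 (cs @ [0]))"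
  have len: "length cs' = Suc (length cs)" and rng: "set cs' \<subseteq> {0..<int p}"
    and t: "cong_trunc p (Suc (length cs)) (Poly cs') ([:- x, 1:] * Poly cs)"
    using mul_linear_correct[OF assms, of x 0 "cs @ [0]"]
    by (simp_all add: cs'_def Poly_append del: mult_pCons_left)
  have "cong_poly p (Poly cs') ([:- x, 1:] * Poly cs)"
    unfolding cong_poly_def
  proof
    fix i
    show "[coeff (Poly cs') i = coeff ([:- x, 1:] * Poly cs) i] (mod int p)"
    proof (cases "i < Suc (length cs)")
      case False
      then have "coeff (Poly cs') i = 0" "coeff ([:- x, 1:] * Poly cs) i = 0"
        using len by (auto simp: coeff_Poly_eq nth_default_def coeff_pCons split: nat.splits)
      then show ?thesis by simp
    qed (use t in \<open>simp add: cong_trunc_def\<close>)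
  qed
  then have "cong_poly p (Poly cs' * (\<Prod>x\<leftarrow>R. [:- x, 1:])) ([:- x, 1:] * Poly cs * (\<Prod>x\<leftarrow>R. [:- x, 1:]))"
    by (rule cong_poly_mult) simp
  then have "cong_poly p (Poly cs' * (\<Prod>x\<leftarrow>R. [:- x, 1:])) (Poly cs * (\<Prod>x\<leftarrow>x # R. [:- x, 1:]))"
    by (simp only: list.map prod_list.Cons ac_simps)
  then show ?case using Cons.IH[of cs'] rng len
    by (auto simp: cs'_def[symmetric] simp del: mult_pCons_left mult_pCons_right intro: cong_poly_trans)
qed simp

text \<open>The test compares coefficient lists. In the second part both lists belong to monic
  reduced polynomials that are congruent modulo p, hence they are equal and the test cannot
  reject.\<close>

lemma splits_correct:
  assumes p: "prime p" and F: "reduced p F" "lead_coeff F = 1"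
    and R: "distinct R" "set R = {x \<in> {0..<int p}. [poly F x = 0] (mod int p)}"
  shows "val (splits p (coeffs F) R) \<Longrightarrow> 0 \<notin> set R \<and> cong_poly p F (linear_prod (set R))"
    and "X \<subseteq> {1..<int p} \<Longrightarrow> cong_poly p F (linear_prod X) \<Longrightarrow> set R = X \<and> val (splits p (coeffs F) R)"
proof -
  have p0: "p > 0" and p1: "int p > 1" using prime_gt_1_nat[OF p] by auto
  define E where "E = val (fold_timed (\<lambda>x cs. mul_linear p x 0 (cs @ [0])) R [1])"
  have lp: "(\<Prod>x\<leftarrow>R. [:- x, 1:]) = linear_prod (set R)"
    using R(1) by (simp add: linear_prod_def prod.distinct_set_conv_list)
  have E: "length E = Suc (length R)" "set E \<subseteq> {0..<int p}" "cong_poly p (Poly E) (linear_prod (set R))"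
    using expand_linear_factors[OF p0, of R "[1]"] p1 by (auto simp: E_def lp)
  have iff: "val (splits p (coeffs F) R) \<longleftrightarrow> E = coeffs F \<and> 0 \<notin> set R"
    by (simp add: splits_def E_def)
  show "0 \<notin> set R \<and> cong_poly p F (linear_prod (set R))" if "val (splits p (coeffs F) R)"
    using that E(3) iff by auto
  show "set R = X \<and> val (splits p (coeffs F) R)"
    if X: "X \<subseteq> {1..<int p}" and FX: "cong_poly p F (linear_prod X)"
  proof -
    \<comment> \<open>An auxiliary record whose modulus is \<open>p\<close>, so that the facts about
      \<open>universe\<close> apply.\<close>
    define P :: params where "P = undefined\<lparr>modulus := p\<rparr>"
    have P: "modulus P = p" "universe P = {1..<int p}" by (simp_all add: P_def universe_def)
    have ev: "[poly F y = poly (linear_prod X) y] (mod int p)" for y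
      by (rule cong_poly_eval[OF FX])
    have "coprime (coeff (linear_prod X) 0) (int p)"
      using linear_prod_coprime[of P X] p P X by simp
    then have "\<not> [poly (linear_prod X) 0 = 0] (mod int p)"
      using p1 unfolding cong_0_iff poly_0_coeff_0
      by (metis coprime_common_divisor dvd_refl int_dvd_int_iff not_prime_unit p of_nat_1)
    then have n0: "0 \<notin> set R" unfolding R(2) using ev[of 0] by (auto dest: cong_trans cong_sym)
    have "y \<in> set R \<longleftrightarrow> y \<in> X" if "y \<in> {1..<int p}" for y
      using linear_prod_root[of P X y] P p X that ev[of y] unfolding R(2)
      by (auto dest: cong_trans cong_sym)
    moreover have "set R \<subseteq> {1..<int p}"
    proof
      fix y assume "y \<in> set R"
      then have "y \<noteq> 0" "y \<in> {0..<int p}" using n0 R(2) by auto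
      then show "y \<in> {1..<int p}" by simp
    qed
    ultimately have RX: "set R = X" using X by blast
    have c: "cong_poly p (Poly E) F" using E(3) FX cong_poly_sym cong_poly_trans RX by blast
    have "Poly E = F"
      by (rule reduced_cong_eq[OF _ F(1) c]) (use E(2) p0 in \<open>auto simp: reduced_def coeff_Poly_eq nth_default_def subset_iff\<close>)
    \<comment> \<open>\<open>coeffs\<close> drops trailing zeros, so \<open>E\<close> can be
      recovered from \<open>Poly E\<close> only once its last entry is known to be nonzero.\<close>
    have "last E = 1"
    proof -
      have d: "degree (linear_prod (set R)) = length R" using R(1) by (simp add: distinct_card)
      have "[coeff (Poly E) (length R) = coeff (linear_prod (set R)) (length R)] (mod int p)"
        using E(3) by (simp add: cong_poly_def)
      then have "[last E = 1] (mod int p)"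
        using lead_coeff_linear_prod[of "set R"] E(1) unfolding d
        by (simp add: coeff_Poly_eq nth_default_def last_conv_nth flip: length_0_conv)
      moreover have "last E \<in> {0..<int p}" using E(1,2) last_in_set[of E] by (metis length_0_conv nat.distinct(1) subsetD)
      ultimately show ?thesis using p1 by (simp add: Cong.cong_def)
    qed
    then have "E = butlast E @ [1]" using E(1) by (metis append_butlast_last_id length_0_conv nat.distinct(1))
    then have "coeffs (Poly E) = E" by (metis Poly_monic(1))
    then show ?thesis using RX n0 iff \<open>Poly E = F\<close> by auto
  qed
qed

section \<open>Decoding\<close>

text \<open>A divisor \<open>D\<close> of \<open>G\<close> cannot vanish at a root \<open>x\<close>
  of the product, since \<open>G\<close> would vanish there. In \<open>linear_prod X = D * Q\<close>
  it is thus \<open>Q\<close> that has the root \<open>x\<close>, and the factor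
  \<open>Z - x\<close> can be removed from both sides until the left side is 1.\<close>

lemma coprime_mod_linear_prod:
  assumes p: "prime p" and G: "\<And>x. x \<in> X \<Longrightarrow> \<not> [poly G x = 0] (mod int p)"
  shows "coprime_mod p (linear_prod X) G"
  unfolding coprime_mod_def
proof (intro allI impI)
  fix D assume DG: "dvd_mod p D G" and "dvd_mod p D (linear_prod X)"
  have "finite X \<Longrightarrow> dvd_mod p D (linear_prod X) \<Longrightarrow> (\<And>x. x \<in> X \<Longrightarrow> \<not> [poly G x = 0] (mod int p)) \<Longrightarrow> dvd_mod p D 1"
  proof (induction X rule: finite_induct)
    case (insert x X)
    obtain Q where Q: "cong_poly p (linear_prod (insert x X)) (D * Q)" using insert.prems by (auto simp: dvd_mod_def)
    obtain Q2 where Q2: "cong_poly p G (D * Q2)" using DG by (auto simp: dvd_mod_def)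
    have "\<not> [poly D x = 0] (mod int p)"
    proof
      assume "[poly D x = 0] (mod int p)"
      then have "[poly (D * Q2) x = 0] (mod int p)" by (simp add: cong_0_iff)
      then show False using cong_poly_eval[OF Q2, of x] insert.prems(2) cong_trans by blast
    qed
    moreover have "[poly (D * Q) x = 0] (mod int p)"
      using cong_sym[OF cong_poly_eval[OF Q, of x]] insert.hyps by (simp add: linear_prod_insert)
    ultimately have Qx: "[poly Q x = 0] (mod int p)"
      using p by (simp add: cong_0_iff prime_dvd_mult_iff)
    obtain Q' where "Q - [:poly Q x:] = [:- x, 1:] * Q'"
      using poly_eq_0_iff_dvd[of "Q - [:poly Q x:]" x] by (auto simp: dvd_def)
    then have Qeq: "Q = [:- x, 1:] * Q' + [:poly Q x:]" by (metis diff_add_cancel)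
    have "cong_poly p [:poly Q x:] 0" using Qx by (simp add: cong_poly_def coeff_pCons split: nat.splits)
    then have "cong_poly p ([:- x, 1:] * Q' + [:poly Q x:]) ([:- x, 1:] * Q' + 0)"
      by (intro cong_poly_add) auto
    then have "cong_poly p Q ([:- x, 1:] * Q')" using Qeq by simp
    then have "cong_poly p (linear_prod (insert x X)) (D * ([:- x, 1:] * Q'))"
      using Q cong_poly_mult[OF cong_poly_refl] cong_poly_trans by blast
    also have "D * ([:- x, 1:] * Q') = [:- x, 1:] * (D * Q')" by (simp only: ac_simps)
    finally have "cong_poly p ([:- x, 1:] * linear_prod X - [:- x, 1:] * (D * Q')) 0"
      unfolding linear_prod_insert[OF insert.hyps(1,2)] cong_poly_diff_0 .
    then have "cong_poly p ([:- x, 1:] * (linear_prod X - D * Q')) 0" by (simp only: right_diff_distrib)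
    then have "cong_poly p (linear_prod X - D * Q') 0"
      using cong_poly_mult_0[OF p] not_cong_monic_0[OF p, of "[:- x, 1:]"] by (metis lead_coeff_pCons(1) lead_coeff_1 one_pCons pCons_eq_0_iff zero_neq_one)
    then have "dvd_mod p D (linear_prod X)" unfolding dvd_mod_def cong_poly_diff_0 by blast
    then show ?case using insert by blast
  qed simp
  then show "dvd_mod p D 1" using \<open>dvd_mod p D (linear_prod X)\<close> G
    by (cases "finite X") (auto simp: linear_prod_def)
qed

definition centered :: "nat \<Rightarrow> int \<Rightarrow> int" where
  "centered l n = (if n mod (2 * int l + 1) \<le> int l then n mod (2 * int l + 1)
                   else n mod (2 * int l + 1) - (2 * int l + 1))"

lemma centered_small: "\<bar>n\<bar> \<le> int l \<Longrightarrow> centered l n = n"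
proof -
  assume n: "\<bar>n\<bar> \<le> int l"
  show ?thesis
  proof (cases "n \<ge> 0")
    case False
    have "n mod (2 * int l + 1) = (n + (2 * int l + 1)) mod (2 * int l + 1)" by simp
    also have "\<dots> = n + (2 * int l + 1)" using False n by (intro mod_pos_pos_trivial) auto
    finally show ?thesis using False n by (simp add: centered_def)
  qed (use n in \<open>simp add: centered_def\<close>)
qed

definition signed_set :: "int set \<Rightarrow> int set \<Rightarrow> (int \<times> int) set" where
  "signed_set X Y = (\<lambda>x. (x, 1)) ` X \<union> (\<lambda>x. (x, - 1)) ` Y"

section \<open>Decoding of a single cell\<close>

locale xyz =
  fixes rf :: root_routine and P :: params and \<omega> :: public
  assumes rf: "root_finder rf" and p: "prime (modulus P)" and l: "terms P \<ge> 1"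
begin

abbreviation "U \<equiv> universe P"
abbreviation "L \<equiv> terms P"

lemma root_results:
  assumes "reduced (modulus P) F" "lead_coeff F = 1" "R \<in> results (RTimed (rf (modulus P) F))"
  shows "distinct R" "set R = {x \<in> {0..<int (modulus P)}. [poly F x = 0] (mod int (modulus P))}"
  using rf assms p unfolding root_finder_def by auto

lemma decode_cell_results:
  "results (decode_cell rf P \<omega> j c) =
    (case val (find_pair (modulus P) (centered L (cell_count c)) (cell_poly c)) of
      None \<Rightarrow> {None}
    | Some (F, G) \<Rightarrow> (\<Union>R\<in>results (RTimed (rf (modulus P) (Poly F))). \<Union>R'\<in>results (RTimed (rf (modulus P) (Poly G))).
        {if val (splits (modulus P) F R) \<and> val (splits (modulus P) G R') then
           (let cand = map (\<lambda>x. (x, 1)) R @ map (\<lambda>x. (x, - 1)) R' in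
            if val (confirm P \<omega> j (cell_fp c) cand) then Some cand else None)
         else None}))"
  if "cell_count c \<in> {0..<2 * int L + 1}"
proof -
  have m: "(if cell_count c \<le> int L then cell_count c else cell_count c - (2 * int L + 1)) = centered L (cell_count c)"
    using that by (simp add: centered_def)
  note unf = decode_cell_def results_simps(1,3) timed_simps(3) m UN_insert UN_empty Un_empty_right
  show ?thesis
  proof (cases "val (find_pair (modulus P) (centered L (cell_count c)) (cell_poly c))")
    case None
    then show ?thesis unfolding unf None by simp
  next
    case (Some FG)
    obtain F G where FG: "FG = (F, G)" by force
    show ?thesis
      unfolding unf FG Some option.case prod.case timed_simps Let_def if_distrib[of results]
      by (intro SUP_cong refl) simp
  qed
qed

lemma val_confirm:
  "val (confirm P \<omega> j t cand) \<longleftrightarrow>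
    (\<forall>(x, \<sigma>)\<in>set cand. j \<in> support P \<omega> x) \<and>
    (if cand = [] then 0 else (\<Sum>(x, \<sigma>)\<leftarrow>cand. \<sigma> * fingerprint \<omega> x) mod int (fp_modulus P)) = t"
proof -
  have *: "val (fold_timed (\<lambda>(x, \<sigma>) u. do { h \<leftarrow> step (fingerprint \<omega> x);
     steps 3 ((u + \<sigma> * h) mod int (fp_modulus P)) }) cand u) =
     (if cand = [] then u else (u + (\<Sum>(x, \<sigma>)\<leftarrow>cand. \<sigma> * fingerprint \<omega> x)) mod int (fp_modulus P))" for u
    by (induction cand arbitrary: u) (auto simp: mod_simps algebra_simps)
  show ?thesis
    unfolding confirm_def timed_simps *
    by (auto simp: list_all_iff case_prod_unfold)
qed

text \<open>Applies to every accepted candidate, right or wrong. Its conclusions are the constraints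
  from which wrong acceptances are later shown to be improbable.\<close>

lemma decode_cell_sound:
  assumes c: "cell_count c \<in> {0..<2 * int L + 1}" "length (cell_poly c) = L"
    and r: "Some cand \<in> results (decode_cell rf P \<omega> j c)"
  obtains X Y where "X \<subseteq> U" "Y \<subseteq> U" "X \<inter> Y = {}" "card X + card Y \<le> L"
    "int (card X) - int (card Y) = centered L (cell_count c)"
    "cong_trunc (modulus P) L (linear_prod X) (linear_prod Y * Poly (cell_poly c))"
    "\<forall>x\<in>X \<union> Y. j \<in> support P \<omega> x" "set cand = signed_set X Y"
proof -
  let ?p = "modulus P"
  obtain F' G' where FG': "val (find_pair ?p (centered L (cell_count c)) (cell_poly c)) = Some (F', G')"
    using r by (auto simp: decode_cell_results[OF c(1)] split: option.splits)
  then obtain F G where FG: "F' = coeffs F" "G' = coeffs G" and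
    dp: "decoding_pair ?p L (centered L (cell_count c)) (cell_poly c) F G"
    using find_pair_correct[OF p] c(2) by auto
  note d = dp[unfolded decoding_pair_def]
  obtain R R' where R: "R \<in> results (RTimed (rf ?p F))" "R' \<in> results (RTimed (rf ?p G))"
    and s: "val (splits ?p (coeffs F) R)" "val (splits ?p (coeffs G) R')"
    and cand: "cand = map (\<lambda>x. (x, 1)) R @ map (\<lambda>x. (x, - 1)) R'"
    and conf: "val (confirm P \<omega> j (cell_fp c) cand)"
    using r FG' FG by (fastforce simp: decode_cell_results[OF c(1)] Let_def split: if_splits)
  have dF: "reduced ?p F" "lead_coeff F = 1" and dG: "reduced ?p G" "lead_coeff G = 1" using d by auto
  note RF = root_results[OF dF R(1)] and RG = root_results[OF dG R(2)]
  define X Y where "X = set R" and "Y = set R'"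
  have sF: "0 \<notin> X" "cong_poly ?p F (linear_prod X)" using splits_correct(1)[OF p dF RF s(1)] by (auto simp: X_def)
  have sG: "0 \<notin> Y" "cong_poly ?p G (linear_prod Y)" using splits_correct(1)[OF p dG RG s(2)] by (auto simp: Y_def)
  have "Z \<subseteq> U" if "0 \<notin> Z" "Z \<subseteq> {0..<int ?p}" for Z
  proof
    fix x assume "x \<in> Z"
    then have "x \<noteq> 0" "x \<in> {0..<int ?p}" using that by auto
    then show "x \<in> U" by (simp add: universe_def)
  qed
  then have XU: "X \<subseteq> U" "Y \<subseteq> U" using sF(1) sG(1) RF(2) RG(2) unfolding X_def Y_def by blast+
  have red: "F = reduce_poly ?p (linear_prod X)" "G = reduce_poly ?p (linear_prod Y)"
    using sF sG dF dG red_cong reduced_red prime_gt_0_nat[OF p] by (meson cong_poly_trans reduced_cong_eq)+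
  have deg: "degree F = card X" "degree G = card Y"
  proof -
    have *: "degree (reduce_poly ?p (linear_prod Z)) = card Z" for Z
    proof (rule antisym)
      show "degree (reduce_poly ?p (linear_prod Z)) \<le> card Z" using degree_red[of ?p "linear_prod Z"] by simp
      have "coeff (reduce_poly ?p (linear_prod Z)) (card Z) = 1"
        using lead_coeff_linear_prod[of Z] prime_gt_1_nat[OF p] by simp
      then show "card Z \<le> degree (reduce_poly ?p (linear_prod Z))" by (intro le_degree) simp
    qed
    show "degree F = card X" "degree G = card Y" using red * by auto
  qed
  have "X \<inter> Y = {}"
  proof (rule ccontr)
    assume "X \<inter> Y \<noteq> {}"
    then obtain x where x: "x \<in> X" "x \<in> Y" by auto
    have D: "dvd_mod ?p [:- x, 1:] H" if "cong_poly ?p H (linear_prod Z)" "x \<in> Z" "Z \<subseteq> U" for H Z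
    proof -
      have "finite Z" using that finite_subset finite_universe by blast
      then have "linear_prod Z = [:- x, 1:] * linear_prod (Z - {x})"
        using that linear_prod_insert[of "Z - {x}" x] by (simp add: insert_absorb)
      then show ?thesis using that unfolding dvd_mod_def by metis
    qed
    have "dvd_mod ?p [:- x, 1:] 1"
      using d D[OF sF(2) x(1) XU(1)] D[OF sG(2) x(2) XU(2)] unfolding coprime_mod_def by blast
    then obtain Q where "cong_poly ?p 1 ([:- x, 1:] * Q)" by (auto simp: dvd_mod_def)
    from cong_poly_eval[OF this, of x] have "[1 = 0] (mod int ?p)" by simp
    then show False using prime_gt_1_nat[OF p] by (simp add: Cong.cong_def)
  qed
  moreover have "cong_trunc ?p L (linear_prod X) (linear_prod Y * Poly (cell_poly c))"
  proof -
    have "cong_trunc ?p L (linear_prod X) F" by (rule cong_poly_imp_trunc[OF cong_poly_sym[OF sF(2)]])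
    also have "cong_trunc ?p L F (G * Poly (cell_poly c))" using d by simp
    also have "cong_trunc ?p L (G * Poly (cell_poly c)) (linear_prod Y * Poly (cell_poly c))"
      by (intro cong_trunc_mult cong_poly_imp_trunc[OF sG(2)] cong_trunc_refl)
    finally show ?thesis .
  qed
  moreover have "\<forall>x\<in>X \<union> Y. j \<in> support P \<omega> x"
    using conf unfolding val_confirm cand by (auto simp: X_def Y_def)
  moreover have "set cand = signed_set X Y" by (simp add: cand signed_set_def X_def Y_def)
  ultimately show ?thesis using that[of X Y] XU d deg by simp
qed

text \<open>The decoding pair is unique, so it is enough to exhibit the reduced products over
  \<open>X\<close> and \<open>Y\<close> as one: this determines the result of
  \<open>find_pair\<close>. Every run of the root finder then leads to the same candidate up to
  order.\<close>

lemma decode_cell_complete: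
  assumes c: "cell_count c \<in> {0..<2 * int L + 1}" "length (cell_poly c) = L"
    and XY: "X \<subseteq> U" "Y \<subseteq> U" "X \<inter> Y = {}" "card X + card Y \<le> L"
    and m: "int (card X) - int (card Y) = centered L (cell_count c)"
    and tr: "cong_trunc (modulus P) L (linear_prod X) (linear_prod Y * Poly (cell_poly c))"
    and sup: "\<And>x. x \<in> X \<union> Y \<Longrightarrow> j \<in> support P \<omega> x"
    and fp: "cell_fp c = ((\<Sum>x\<in>X. fingerprint \<omega> x) - (\<Sum>x\<in>Y. fingerprint \<omega> x)) mod int (fp_modulus P)"
    and r: "res \<in> results (decode_cell rf P \<omega> j c)"
  obtains cand where "res = Some cand" "set cand = signed_set X Y" "distinct (map fst cand)"
proof -
  let ?p = "modulus P"
  have p0: "?p > 0" using p prime_gt_0_nat by blast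
  have p1: "int ?p > 1" using prime_gt_1_nat[OF p] by auto
  define F G where "F = reduce_poly ?p (linear_prod X)" and "G = reduce_poly ?p (linear_prod Y)"
  have *: "degree (reduce_poly ?p (linear_prod Z)) = card Z \<and> lead_coeff (reduce_poly ?p (linear_prod Z)) = 1" for Z
  proof -
    have 1: "coeff (reduce_poly ?p (linear_prod Z)) (card Z) = 1"
      using lead_coeff_linear_prod[of Z] prime_gt_1_nat[OF p] by simp
    have "degree (reduce_poly ?p (linear_prod Z)) = card Z"
    proof (rule antisym)
      show "degree (reduce_poly ?p (linear_prod Z)) \<le> card Z" using degree_red[of ?p "linear_prod Z"] by simp
      show "card Z \<le> degree (reduce_poly ?p (linear_prod Z))" by (rule le_degree) (simp only: 1)
    qed
    then show ?thesis using 1 by (simp only:)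
  qed
  have dF: "reduced ?p F" "lead_coeff F = 1" "degree F = card X" "cong_poly ?p F (linear_prod X)"
    and dG: "reduced ?p G" "lead_coeff G = 1" "degree G = card Y" "cong_poly ?p G (linear_prod Y)"
    unfolding F_def G_def using * reduced_red[OF p0] red_cong(1) by blast+
  have notroot: "\<not> [poly (linear_prod Y) x = 0] (mod int ?p)" if "x \<in> X" for x
    using linear_prod_root[OF p XY(2), of x] that XY by blast
  have "coprime_mod ?p (linear_prod X) (linear_prod Y)"
    by (rule coprime_mod_linear_prod[OF p notroot])
  then have cop: "coprime_mod ?p F G"
    using dF(4) dG(4) unfolding coprime_mod_def dvd_mod_def by (meson cong_poly_sym cong_poly_trans)
  have "cong_trunc ?p L F (G * Poly (cell_poly c))"
  proof -
    note cong_poly_imp_trunc[OF dF(4)]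
    also note tr
    also have "cong_trunc ?p L (linear_prod Y * Poly (cell_poly c)) (G * Poly (cell_poly c))"
      by (intro cong_trunc_mult cong_poly_imp_trunc[OF cong_poly_sym[OF dG(4)]] cong_trunc_refl)
    finally show ?thesis .
  qed
  moreover have "coeff G 0 \<noteq> 0"
  proof
    assume "coeff G 0 = 0"
    then have "[coeff (linear_prod Y) 0 = 0] (mod int ?p)"
      unfolding G_def by (simp add: Cong.cong_def)
    then show False using linear_prod_coprime[OF p XY(2)] p1 unfolding cong_0_iff
      by (metis coprime_common_divisor dvd_refl int_dvd_int_iff not_prime_unit p of_nat_1)
  qed
  ultimately have "decoding_pair ?p L (centered L (cell_count c)) (cell_poly c) F G"
    unfolding decoding_pair_def using dF dG cop XY m by simp
  then have fpair: "val (find_pair ?p (centered L (cell_count c)) (cell_poly c)) = Some (coeffs F, coeffs G)"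
    using find_pair_correct[OF p] c(2) by auto
  obtain R R' where R: "R \<in> results (RTimed (rf ?p F))" "R' \<in> results (RTimed (rf ?p G))"
    and res: "res = (if val (splits ?p (coeffs F) R) \<and> val (splits ?p (coeffs G) R') then
           (let cand = map (\<lambda>x. (x, 1)) R @ map (\<lambda>x. (x, - 1)) R' in
            if val (confirm P \<omega> j (cell_fp c) cand) then Some cand else None)
         else None)"
    using r unfolding decode_cell_results[OF c(1)] fpair by auto
  note RF = root_results[OF dF(1,2) R(1)] and RG = root_results[OF dG(1,2) R(2)]
  have U: "U = {1..<int ?p}" by (simp add: universe_def)
  have RX: "set R = X" "val (splits ?p (coeffs F) R)"
    using splits_correct(2)[OF p dF(1,2) RF _ dF(4)] XY U by auto
  have RY: "set R' = Y" "val (splits ?p (coeffs G) R')"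
    using splits_correct(2)[OF p dG(1,2) RG _ dG(4)] XY U by auto
  define cand where "cand = map (\<lambda>x. (x, 1)) R @ map (\<lambda>x. (x, - 1 :: int)) R'"
  have sum: "(\<Sum>(x, \<sigma>)\<leftarrow>cand. \<sigma> * fingerprint \<omega> x) = (\<Sum>x\<in>X. fingerprint \<omega> x) - (\<Sum>x\<in>Y. fingerprint \<omega> x)"
    using RF(1) RG(1) RX(1) RY(1)
    by (simp add: cand_def comp_def sum_list_distinct_conv_sum_set sum_negf)
  have "val (confirm P \<omega> j (cell_fp c) cand)"
    unfolding val_confirm sum fp using sup RX(1) RY(1)
    by (auto simp: cand_def)
  then have "res = Some cand" unfolding res using RX RY by (simp add: cand_def Let_def)
  moreover have "set cand = signed_set X Y" using RX RY by (simp add: cand_def signed_set_def)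
  moreover have "distinct (map fst cand)" using RF(1) RG(1) RX RY XY by (simp add: cand_def comp_def)
  ultimately show ?thesis using that by blast
qed

end

text \<open>A nonempty \<open>I\<close> that violates this is a stopping set in the sense of peeling
  decoders. All subsets are quantified over because the items that remain when the queue runs empty
  are not known in advance.\<close>

definition no_stopping :: "('a \<Rightarrow> 'b set) \<Rightarrow> nat \<Rightarrow> 'a set \<Rightarrow> bool" where
  "no_stopping \<Gamma> l T \<longleftrightarrow> (\<forall>I\<subseteq>T. I \<noteq> {} \<longrightarrow> (\<exists>x\<in>I. \<exists>j\<in>\<Gamma> x. card {y \<in> I. j \<in> \<Gamma> y} \<le> l))"

text \<open>
  The congruence \<open>F \<equiv> G P\<close> for a cell with positive items \<open>S\<^sub>1\<close> and negative items \<open>S\<^sub>2\<close>, with the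
  denominator of \<open>P\<close> multiplied out.
\<close>

definition miscandidate :: "nat \<Rightarrow> nat \<Rightarrow> int set \<Rightarrow> int set \<Rightarrow> int set \<Rightarrow> int set \<Rightarrow> bool" where
  "miscandidate p l S\<^sub>1 S\<^sub>2 X Y \<longleftrightarrow> X \<subseteq> {1..<int p} \<and> Y \<subseteq> {1..<int p} \<and> X \<inter> Y = {} \<and>
     card X + card Y \<le> l \<and>
     int (card X) - int (card Y) = centered l (int (card S\<^sub>1) - int (card S\<^sub>2)) \<and>
     cong_trunc p l (linear_prod X * linear_prod S\<^sub>2) (linear_prod Y * linear_prod S\<^sub>1)"

text \<open>\<open>S\<close> is any large subset of the difference, not the full contents of the
  cell: peeling may already have removed some items. The event is thereby independent of the order
  of decoding.\<close>

definition false_decoding ::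
    "nat \<Rightarrow> nat \<Rightarrow> nat \<Rightarrow> (int \<Rightarrow> nat set) \<Rightarrow> int set \<Rightarrow> int set \<Rightarrow> bool" where
  "false_decoding p l m \<Gamma> T\<^sub>1 T\<^sub>2 \<longleftrightarrow> (\<exists>j\<in>{1..m}. \<exists>S\<subseteq>T\<^sub>1 \<union> T\<^sub>2. \<exists>X Y. l < card S \<and>
     (\<forall>x\<in>S \<union> X \<union> Y. j \<in> \<Gamma> x) \<and> miscandidate p l (S \<inter> T\<^sub>1) (S \<inter> T\<^sub>2) X Y)"

section \<open>Peeling of the set difference\<close>

locale xyz_difference = xyz +
  fixes T\<^sub>1 T\<^sub>2 :: "int set"
  assumes T: "T\<^sub>1 \<subseteq> U" "T\<^sub>2 \<subseteq> U" "T\<^sub>1 \<inter> T\<^sub>2 = {}"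
    and support_range: "\<And>x. x \<in> U \<Longrightarrow> support P \<omega> x \<subseteq> {1..cells P}"
begin

definition sg :: "int \<Rightarrow> int" where
  "sg x = (if x \<in> T\<^sub>1 then 1 else if x \<in> T\<^sub>2 then - 1 else 0)"

definition signed_part :: "int set \<Rightarrow> int \<Rightarrow> int" where
  "signed_part S = (\<lambda>x. if x \<in> S then sg x else 0)"

definition in_cell :: "int set \<Rightarrow> nat \<Rightarrow> int set" where
  "in_cell R j = {x \<in> R. j \<in> support P \<omega> x}"

text \<open>The invariant of peeling, with \<open>R\<close> the items not yet removed. A
  \<open>sketch\<close> is a function on all of \<open>nat\<close>, but only the indices of actual
  cells are constrained.\<close>

definition sketch_of :: "int set \<Rightarrow> sketch \<Rightarrow> bool" where
  "sketch_of R s \<longleftrightarrow> (\<forall>j\<in>{1..cells P}. represents P \<omega> (signed_part (in_cell R j)) (s j))"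

lemma finite_T: "finite T\<^sub>1" "finite T\<^sub>2"
  using T finite_subset finite_universe by blast+

lemma signed_part_sets:
  assumes "S \<subseteq> T\<^sub>1 \<union> T\<^sub>2"
  shows "{x \<in> U. signed_part S x = 1} = S \<inter> T\<^sub>1" "{x \<in> U. signed_part S x = - 1} = S \<inter> T\<^sub>2"
  using assms T by (auto simp: signed_part_def sg_def split: if_splits)

lemma signed_part_sum:
  assumes "S \<subseteq> T\<^sub>1 \<union> T\<^sub>2"
  shows "(\<Sum>x\<in>U. signed_part S x * w x) = (\<Sum>x\<in>S \<inter> T\<^sub>1. w x) - (\<Sum>x\<in>S \<inter> T\<^sub>2. w x)"
proof -
  have fin: "finite (S \<inter> T\<^sub>1)" "finite (S \<inter> T\<^sub>2)" using finite_T by auto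
  have "(\<Sum>x\<in>U. signed_part S x * w x) = (\<Sum>x\<in>S \<inter> T\<^sub>1 \<union> S \<inter> T\<^sub>2. signed_part S x * w x)"
    using assms T by (intro sum.mono_neutral_right) (auto simp: signed_part_def)
  also have "\<dots> = (\<Sum>x\<in>S \<inter> T\<^sub>1. signed_part S x * w x) + (\<Sum>x\<in>S \<inter> T\<^sub>2. signed_part S x * w x)"
    using fin T by (intro sum.union_disjoint) auto
  also have "(\<Sum>x\<in>S \<inter> T\<^sub>1. signed_part S x * w x) = (\<Sum>x\<in>S \<inter> T\<^sub>1. w x)"
    by (intro sum.cong) (auto simp: signed_part_def sg_def)
  also have "(\<Sum>x\<in>S \<inter> T\<^sub>2. signed_part S x * w x) = - (\<Sum>x\<in>S \<inter> T\<^sub>2. w x)"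
    unfolding sum_negf[symmetric] using T by (intro sum.cong) (auto simp: signed_part_def sg_def)
  finally show ?thesis by simp
qed

lemma represents_signed_part:
  assumes S: "S \<subseteq> T\<^sub>1 \<union> T\<^sub>2" and rep: "represents P \<omega> (signed_part S) c"
  shows "cell_count c = (int (card (S \<inter> T\<^sub>1)) - int (card (S \<inter> T\<^sub>2))) mod (2 * int L + 1)"
    "cell_count c \<in> {0..<2 * int L + 1}" "length (cell_poly c) = L"
    "cong_trunc (modulus P) L (linear_prod (S \<inter> T\<^sub>1)) (linear_prod (S \<inter> T\<^sub>2) * Poly (cell_poly c))"
    "cell_fp c = ((\<Sum>x\<in>S \<inter> T\<^sub>1. fingerprint \<omega> x) - (\<Sum>x\<in>S \<inter> T\<^sub>2. fingerprint \<omega> x)) mod int (fp_modulus P)"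
  using rep signed_part_sum[OF S, of "\<lambda>_. 1"] signed_part_sum[OF S, of "fingerprint \<omega>"]
    pos_mod_bound[of "2 * int L + 1" "int (card (S \<inter> T\<^sub>1)) - int (card (S \<inter> T\<^sub>2))"]
  unfolding represents_def signed_part_sets[OF S] by (auto intro: cong_trunc_sym simp: mult.commute)

lemma centered_mod: "centered l (n mod (2 * int l + 1)) = centered l n"
  by (simp add: centered_def)

text \<open>With at most \<open>L\<close> items the signed count has absolute value at most
  \<open>L\<close>, so \<open>centered\<close> recovers it from its residue modulo
  \<open>2 * L + 1\<close>, and the true contents satisfy all tests.\<close>

lemma decode_small:
  assumes S: "S \<subseteq> T\<^sub>1 \<union> T\<^sub>2" "card S \<le> L" "\<And>x. x \<in> S \<Longrightarrow> j \<in> support P \<omega> x"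
    and rep: "represents P \<omega> (signed_part S) c" and r: "res \<in> results (decode_cell rf P \<omega> j c)"
  obtains cand where "res = Some cand" "set cand = (\<lambda>x. (x, sg x)) ` S" "distinct (map fst cand)"
proof -
  note c = represents_signed_part[OF S(1) rep]
  have fin: "finite S" using S(1) finite_T finite_subset by blast
  have "S = S \<inter> T\<^sub>1 \<union> S \<inter> T\<^sub>2" using S by auto
  then have cardS: "card S = card (S \<inter> T\<^sub>1) + card (S \<inter> T\<^sub>2)"
    using fin T by (metis card_Un_disjoint finite_Int Int_assoc inf.left_commute inf_bot_right)
  have m: "int (card (S \<inter> T\<^sub>1)) - int (card (S \<inter> T\<^sub>2)) = centered L (cell_count c)"
    unfolding c(1) centered_mod using cardS S(2) by (intro centered_small[symmetric]) auto
  have "signed_set (S \<inter> T\<^sub>1) (S \<inter> T\<^sub>2) = (\<lambda>x. (x, sg x)) ` S"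
    using S(1) T by (auto simp: signed_set_def sg_def image_def)
  note eq = this
  show ?thesis
  proof (rule decode_cell_complete[OF c(2,3) _ _ _ _ m c(4) _ c(5) r])
    show "S \<inter> T\<^sub>1 \<subseteq> U" "S \<inter> T\<^sub>2 \<subseteq> U" "S \<inter> T\<^sub>1 \<inter> (S \<inter> T\<^sub>2) = {}" using T by auto
    show "card (S \<inter> T\<^sub>1) + card (S \<inter> T\<^sub>2) \<le> L" using cardS S(2) by simp
  qed (use that S(3) in \<open>auto simp: eq\<close>)
qed

text \<open>Multiplying the candidate congruence by the denominator of the cell polynomial turns an
  acceptance into a \<open>miscandidate\<close>, whatever part of the difference is still in the
  cell.\<close>

lemma decode_large:
  assumes nf: "\<not> false_decoding (modulus P) L (cells P) (support P \<omega>) T\<^sub>1 T\<^sub>2"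
    and j: "j \<in> {1..cells P}"
    and S: "S \<subseteq> T\<^sub>1 \<union> T\<^sub>2" "card S > L" "\<And>x. x \<in> S \<Longrightarrow> j \<in> support P \<omega> x"
    and rep: "represents P \<omega> (signed_part S) c" and r: "res \<in> results (decode_cell rf P \<omega> j c)"
  shows "res = None"
proof (rule ccontr)
  assume "res \<noteq> None"
  then obtain cand where cand: "Some cand \<in> results (decode_cell rf P \<omega> j c)" using r by auto
  note c = represents_signed_part[OF S(1) rep]
  obtain X Y where XY: "X \<subseteq> U" "Y \<subseteq> U" "X \<inter> Y = {}" "card X + card Y \<le> L"
    "int (card X) - int (card Y) = centered L (cell_count c)"
    "cong_trunc (modulus P) L (linear_prod X) (linear_prod Y * Poly (cell_poly c))"
    "\<forall>x\<in>X \<union> Y. j \<in> support P \<omega> x"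
    using decode_cell_sound[OF c(2,3) cand] by metis
  have "cong_trunc (modulus P) L (linear_prod X * linear_prod (S \<inter> T\<^sub>2))
      (linear_prod Y * Poly (cell_poly c) * linear_prod (S \<inter> T\<^sub>2))"
    by (intro cong_trunc_mult XY cong_trunc_refl)
  also have "linear_prod Y * Poly (cell_poly c) * linear_prod (S \<inter> T\<^sub>2)
      = linear_prod Y * (linear_prod (S \<inter> T\<^sub>2) * Poly (cell_poly c))" by (simp only: ac_simps)
  also have "cong_trunc (modulus P) L \<dots> (linear_prod Y * linear_prod (S \<inter> T\<^sub>1))"
    by (intro cong_trunc_mult cong_trunc_sym[OF c(4)] cong_trunc_refl)
  finally have "miscandidate (modulus P) L (S \<inter> T\<^sub>1) (S \<inter> T\<^sub>2) X Y"
    using XY unfolding c(1) centered_mod by (simp add: miscandidate_def universe_def)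
  then have "false_decoding (modulus P) L (cells P) (support P \<omega>) T\<^sub>1 T\<^sub>2"
    unfolding false_decoding_def using j S XY(7)
    by (intro bexI[of _ j] exI[of _ S] conjI exI[of _ X] exI[of _ Y]) auto
  then show False using nf by simp
qed

lemma remove_signed_val:
  assumes R: "R \<subseteq> T\<^sub>1 \<union> T\<^sub>2" "x \<in> R" and s: "sketch_of R s"
  shows "val (remove_signed P \<omega> (x, sg x) (queue, s)) =
      (queue @ val (support_list P \<omega> x), snd (val (remove_signed P \<omega> (x, sg x) (queue, s))))"
    "sketch_of (R - {x}) (snd (val (remove_signed P \<omega> (x, sg x) (queue, s))))"
proof -
  show "val (remove_signed P \<omega> (x, sg x) (queue, s)) =
      (queue @ val (support_list P \<omega> x), snd (val (remove_signed P \<omega> (x, sg x) (queue, s))))"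
    by (simp add: remove_signed_def)
  have xU: "x \<in> U" and sx: "- sg x = 1 \<or> - sg x = - 1" using R T by (auto simp: sg_def)
  show "sketch_of (R - {x}) (snd (val (remove_signed P \<omega> (x, sg x) (queue, s))))"
    unfolding sketch_of_def
  proof
    fix j assume j: "j \<in> {1..cells P}"
    let ?f = "signed_part (in_cell R j)"
    have rep: "represents P \<omega> ?f (s j)" using s j by (simp add: sketch_of_def)
    show "represents P \<omega> (signed_part (in_cell (R - {x}) j)) (snd (val (remove_signed P \<omega> (x, sg x) (queue, s))) j)"
    proof (cases "j \<in> support P \<omega> x")
      case True
      have fx: "?f x = sg x" using R True by (simp add: signed_part_def in_cell_def)
      have eq: "?f(x := ?f x + - sg x) = signed_part (in_cell (R - {x}) j)"
        unfolding fx by (auto simp: signed_part_def in_cell_def)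
      show ?thesis
        using add_signed_correct[OF p xU rep sx] sx fx True unfolding eq
        by (auto simp: remove_signed_def update_cells_val)
    next
      case False
      then have "in_cell (R - {x}) j = in_cell R j" by (auto simp: in_cell_def)
      then show ?thesis using rep False by (simp add: remove_signed_def update_cells_val)
    qed
  qed
qed

lemma remove_all_val:
  assumes "R \<subseteq> T\<^sub>1 \<union> T\<^sub>2" "set cand = (\<lambda>x. (x, sg x)) ` S" "S \<subseteq> R" "distinct (map fst cand)" "sketch_of R s"
  obtains Q where "fst (val (fold_timed (remove_signed P \<omega>) cand (queue, s))) = queue @ Q"
    "sketch_of (R - S) (snd (val (fold_timed (remove_signed P \<omega>) cand (queue, s))))"
    "length Q \<le> hashes P * card S" "set Q = (\<Union>x\<in>S. support P \<omega> x)"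
proof -
  have "\<exists>Q. fst (val (fold_timed (remove_signed P \<omega>) cand (queue, s))) = queue @ Q \<and>
    sketch_of (R - S) (snd (val (fold_timed (remove_signed P \<omega>) cand (queue, s)))) \<and>
    length Q \<le> hashes P * card S \<and> set Q = (\<Union>x\<in>S. support P \<omega> x)"
    using assms
  proof (induction cand arbitrary: R S queue s)
    case (Cons y cand)
    have "y \<in> (\<lambda>x. (x, sg x)) ` S" using Cons.prems(2) by auto
    then obtain x where x: "y = (x, sg x)" "x \<in> S" by auto
    define S' where "S' = S - {x}"
    have S: "S = insert x S'" "x \<notin> S'" using x by (auto simp: S'_def)
    have xn: "x \<notin> fst ` set cand" using Cons.prems(4) x by auto
    have finS: "finite S"
      using Cons.prems(1,3) finite_T by (meson finite_UnI finite_subset order_trans)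
    have c: "set cand = (\<lambda>x. (x, sg x)) ` S'"
    proof -
      have "y \<notin> set cand" using xn x by force
      moreover have "(x, sg x) \<notin> (\<lambda>x. (x, sg x)) ` S'" using S by auto
      ultimately show ?thesis using Cons.prems(2) x S by (auto simp: insert_ident)
    qed
    define s' where "s' = snd (val (remove_signed P \<omega> (x, sg x) (queue, s)))"
    have xR: "x \<in> R" using x Cons.prems by auto
    note rs = remove_signed_val[OF Cons.prems(1) xR Cons.prems(5), of queue, folded s'_def]
    obtain Q where Q: "fst (val (fold_timed (remove_signed P \<omega>) cand (queue @ val (support_list P \<omega> x), s'))) = queue @ val (support_list P \<omega> x) @ Q"
      "sketch_of (R - {x} - S') (snd (val (fold_timed (remove_signed P \<omega>) cand (queue @ val (support_list P \<omega> x), s'))))"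
      "length Q \<le> hashes P * card S'" "set Q = (\<Union>x\<in>S'. support P \<omega> x)"
      using Cons.IH[of "R - {x}" S' s' "queue @ val (support_list P \<omega> x)"] Cons.prems c rs(2) S by fastforce
    have "R - {x} - S' = R - S" using S by auto
    moreover have "card S = Suc (card S')" using S finS by simp
    moreover have "length (val (support_list P \<omega> x) @ Q) \<le> hashes P + hashes P * card S'"
      unfolding length_append by (intro add_mono Q(3) support_list_correct(3))
    ultimately show ?case using Q
      by (intro exI[of _ "val (support_list P \<omega> x) @ Q"]) (simp add: x rs(1) S(1))
  qed auto
  then show ?thesis using that by blast
qed

text \<open>Two invariants carry the induction. A cell outside the queue is empty or holds more than
  \<open>L\<close> remaining items; when the queue is empty, \<open>R\<close> would therefore be a
  stopping set unless it is empty. And \<open>length queue + hashes P * card R\<close> bounds the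
  pops still to come: a pop lowers it by one, while the removal of \<open>S\<close> pushes at most
  \<open>hashes P * card S\<close> cells and lowers the second summand by that amount.\<close>

lemma peel_correct:
  assumes ns: "no_stopping (support P \<omega>) L (T\<^sub>1 \<union> T\<^sub>2)"
    and nf: "\<not> false_decoding (modulus P) L (cells P) (support P \<omega>) T\<^sub>1 T\<^sub>2"
    and R: "R \<subseteq> T\<^sub>1 \<union> T\<^sub>2" and s: "sketch_of R s"
    and Q: "set queue \<subseteq> {1..cells P}"
    and stuck: "\<And>j. j \<in> {1..cells P} - set queue \<Longrightarrow> in_cell R j = {} \<or> L < card (in_cell R j)"
    and found: "set found = (\<lambda>x. (x, sg x)) ` (T\<^sub>1 \<union> T\<^sub>2 - R)"
    and fuel: "length queue + hashes P * card R \<le> n"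
    and res: "res \<in> results (peel rf P \<omega> n queue s found)"
  obtains found' s' where "res = Some (found', s')" "sketch_of {} s'"
    "set found' = (\<lambda>x. (x, sg x)) ` (T\<^sub>1 \<union> T\<^sub>2)"
proof -
  have "\<exists>found' s'. res = Some (found', s') \<and> sketch_of {} s' \<and> set found' = (\<lambda>x. (x, sg x)) ` (T\<^sub>1 \<union> T\<^sub>2)"
    using R s Q stuck found fuel res
  proof (induction n arbitrary: R s queue found)
    case (0 R s queue found)
    then have "queue = []" by simp
    moreover have "R = {}"
    proof (rule ccontr)
      assume "R \<noteq> {}"
      then obtain x j where x: "x \<in> R" "j \<in> support P \<omega> x" "card (in_cell R j) \<le> L"
        using ns "0.prems"(1) unfolding no_stopping_def in_cell_def by metis
      then have "j \<in> {1..cells P}" using support_range[of x] "0.prems"(1) T by (meson Un_least subsetD)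
      then show False using "0.prems"(4)[of j] x \<open>queue = []\<close> by (auto simp: in_cell_def)
    qed
    ultimately show ?case using "0.prems" by auto
  next
    case (Suc n R s queue found)
    show ?case
    proof (cases queue)
      case Nil
      have "R = {}"
      proof (rule ccontr)
        assume "R \<noteq> {}"
        then obtain x j where x: "x \<in> R" "j \<in> support P \<omega> x" "card (in_cell R j) \<le> L"
          using ns Suc.prems(1) unfolding no_stopping_def in_cell_def by metis
        then have "j \<in> {1..cells P}" using support_range[of x] Suc.prems(1) T by (meson Un_least subsetD)
        then show False using Suc.prems(4)[of j] x Nil by (auto simp: in_cell_def)
      qed
      then show ?thesis using Suc.prems Nil by auto
    next
      case (Cons j queue')
      have j: "j \<in> {1..cells P}" using Suc.prems(3) Cons by auto
      define S where "S = in_cell R j"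
      have S: "S \<subseteq> T\<^sub>1 \<union> T\<^sub>2" "S \<subseteq> R" "\<And>x. x \<in> S \<Longrightarrow> j \<in> support P \<omega> x"
        using Suc.prems(1) by (auto simp: S_def in_cell_def)
      have finR: "finite R" using Suc.prems(1) finite_T by (meson finite_UnI finite_subset)
      have rep: "represents P \<omega> (signed_part S) (s j)" using Suc.prems(2) j by (simp add: sketch_of_def S_def)
      obtain r where r: "r \<in> results (decode_cell rf P \<omega> j (s j))"
        and res: "res \<in> results (case r of None \<Rightarrow> peel rf P \<omega> n queue' s found
          | Some cand \<Rightarrow> do {
         found' \<leftarrow> det (steps (length cand) (cand @ found));
         next \<leftarrow> det (fold_timed (remove_signed P \<omega>) cand (queue', s));
         peel rf P \<omega> n (fst next) (snd next) found' })"
        using Suc.prems(7) unfolding Cons by auto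
      show ?thesis
      proof (cases "card S \<le> L")
        case True
        obtain cand where cand: "r = Some cand" "set cand = (\<lambda>x. (x, sg x)) ` S" "distinct (map fst cand)"
          using decode_small[OF S(1) True S(3) rep r] by blast
        obtain Q where Q: "fst (val (fold_timed (remove_signed P \<omega>) cand (queue', s))) = queue' @ Q"
          "sketch_of (R - S) (snd (val (fold_timed (remove_signed P \<omega>) cand (queue', s))))"
          "length Q \<le> hashes P * card S" "set Q = (\<Union>x\<in>S. support P \<omega> x)"
          using remove_all_val[OF Suc.prems(1) cand(2) S(2) cand(3) Suc.prems(2)] by blast
        define s' where "s' = snd (val (fold_timed (remove_signed P \<omega>) cand (queue', s)))"
        have res': "res \<in> results (peel rf P \<omega> n (queue' @ Q) s' (cand @ found))"
          using res cand(1) Q(1) by (simp add: s'_def)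
        show ?thesis
        proof (rule Suc.IH[OF _ _ _ _ _ _ res'])
          show "R - S \<subseteq> T\<^sub>1 \<union> T\<^sub>2" using Suc.prems(1) by auto
          show "sketch_of (R - S) s'" using Q by (simp add: s'_def)
          show "set (queue' @ Q) \<subseteq> {1..cells P}"
            using Suc.prems(3) Cons Q(4) S(1) T support_range by fastforce
          show "in_cell (R - S) i = {} \<or> L < card (in_cell (R - S) i)"
            if i: "i \<in> {1..cells P} - set (queue' @ Q)" for i
          proof (cases "i = j")
            case True
            then show ?thesis by (auto simp: S_def in_cell_def)
          next
            case False
            have "in_cell (R - S) i = in_cell R i" using i Q(4) by (auto simp: in_cell_def)
            then show ?thesis using Suc.prems(4)[of i] i False Cons by auto
          qed
          show "set (cand @ found) = (\<lambda>x. (x, sg x)) ` (T\<^sub>1 \<union> T\<^sub>2 - (R - S))"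
            using cand(2) Suc.prems(5) S(1,2) by auto
          have "card R = card S + card (R - S)"
            using S(2) finR by (metis card_Diff_subset card_mono finite_subset le_add_diff_inverse)
          then show "length (queue' @ Q) + hashes P * card (R - S) \<le> n"
            using Suc.prems(6) Q(3) Cons by (simp add: algebra_simps)
        qed
      next
        case False
        have "r = None" using decode_large[OF nf j S(1) _ S(3) rep r] False by simp
        then have res': "res \<in> results (peel rf P \<omega> n queue' s found)" using res by simp
        show ?thesis
        proof (rule Suc.IH[OF Suc.prems(1,2) _ _ Suc.prems(5) _ res'])
          show "set queue' \<subseteq> {1..cells P}" using Suc.prems(3) Cons by auto
          show "in_cell R i = {} \<or> L < card (in_cell R i)" if "i \<in> {1..cells P} - set queue'" for i
            using Suc.prems(4)[of i] that False Cons by (cases "i = j") (auto simp: S_def)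
          show "length queue' + hashes P * card R \<le> n" using Suc.prems(6) Cons by simp
        qed
      qed
    qed
  qed
  then show ?thesis using that by blast
qed

lemma empty_cell_represents: "represents P \<omega> (signed_part {}) (empty_cell P)"
proof -
  have p1: "int (modulus P) > 1" using prime_gt_1_nat[OF p] by auto
  have *: "{x \<in> U. signed_part {} x = 1} = {}" "{x \<in> U. signed_part {} x = - 1} = {}" "signed_part {} = (\<lambda>_. 0)"
    by (auto simp: signed_part_def)
  have "Poly (1 # replicate (L - 1) 0) = (1 :: int poly)" by (simp add: one_pCons)
  moreover have "cell_poly (empty_cell P) = 1 # replicate (L - 1) 0" by (simp add: empty_cell_def)
  ultimately have "Poly (cell_poly (empty_cell P)) = 1" by metis
  then have "cong_trunc (modulus P) L (Poly (cell_poly (empty_cell P)) * linear_prod {}) (linear_prod {})"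
    by (simp only: linear_prod_empty mult_1_right) simp
  moreover have "cell_count (empty_cell P) = 0" "cell_fp (empty_cell P) = 0"
    "length (cell_poly (empty_cell P)) = L" "set (cell_poly (empty_cell P)) \<subseteq> {0..<int (modulus P)}"
    using l p1 by (auto simp: empty_cell_def)
  ultimately show ?thesis unfolding represents_def * by auto
qed

end

lemma val_subtract:
  "val (subtract P s1 s2) = (\<lambda>j. if j \<in> {1..cells P} then val (subtract_cell P (s1 j) (s2 j)) else s1 j)"
proof -
  have "val (fold_timed (\<lambda>j s. do { c1 \<leftarrow> step (s1 j); c2 \<leftarrow> step (s2 j); c \<leftarrow> subtract_cell P c1 c2;
     step (s(j := c)) }) js s) = (\<lambda>j. if j \<in> set js then val (subtract_cell P (s1 j) (s2 j)) else s j)" for js s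
    by (induction js arbitrary: s) (auto simp: fun_eq_iff)
  then show ?thesis by (auto simp: subtract_def fun_eq_iff)
qed

text \<open>The deterministic core: whatever the root finder does, the public randomness can spoil
  the output only through a stopping set or a false decoding.\<close>

lemma (in xyz) solves_if_good:
  assumes \<phi>: "relabel \<omega> permutes U" and A: "A \<subseteq> U" "B \<subseteq> U" and d: "card ((A - B) \<union> (B - A)) \<le> d"
    and support_range: "\<And>x. x \<in> U \<Longrightarrow> support P \<omega> x \<subseteq> {1..cells P}"
    and ns: "no_stopping (support P \<omega>) L (relabel \<omega> ` ((A - B) \<union> (B - A)))"
    and nf: "\<not> false_decoding (modulus P) L (cells P) (support P \<omega>) (relabel \<omega> ` (A - B)) (relabel \<omega> ` (B - A))"
  shows "solves rf P \<omega> d A B"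
proof -
  define T1 T2 where "T1 = relabel \<omega> ` (A - B)" and "T2 = relabel \<omega> ` (B - A)"
  have inj: "inj (relabel \<omega>)" using permutes_inj[OF \<phi>] .
  have T12: "T1 \<union> T2 = relabel \<omega> ` ((A - B) \<union> (B - A))" by (auto simp: T1_def T2_def)
  interpret xyz_difference rf P \<omega> T1 T2
  proof
    show "T1 \<subseteq> U" "T2 \<subseteq> U" using A permutes_in_image[OF \<phi>] by (auto simp: T1_def T2_def)
    show "T1 \<inter> T2 = {}" using inj by (auto simp: T1_def T2_def inj_def)
  qed (rule support_range)
  have cardT: "card (T1 \<union> T2) \<le> d"
    unfolding T12 using d inj by (metis card_image inj_on_subset subset_UNIV)
  have p0: "modulus P > 0" using p prime_gt_0_nat by blast
  define s where "s = val (subtract P (relabeled_sketch P \<omega> A) (relabeled_sketch P \<omega> B))"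
  have diff: "x \<in> relabel \<omega> ` A \<and> x \<notin> relabel \<omega> ` B \<longleftrightarrow> x \<in> T1" "x \<in> relabel \<omega> ` B \<and> x \<notin> relabel \<omega> ` A \<longleftrightarrow> x \<in> T2" for x
    using inj by (auto simp: T1_def T2_def inj_def)
  have sk: "sketch_of (T1 \<union> T2) s"
    unfolding sketch_of_def
  proof
    fix j assume j: "j \<in> {1..cells P}"
    define SA SB where "SA = {x \<in> relabel \<omega> ` A. j \<in> support P \<omega> x}" and "SB = {x \<in> relabel \<omega> ` B. j \<in> support P \<omega> x}"
    have r: "represents P \<omega> (\<lambda>x. if x \<in> SA then 1 else 0) (relabeled_sketch P \<omega> A j)"
      "represents P \<omega> (\<lambda>x. if x \<in> SB then 1 else 0) (relabeled_sketch P \<omega> B j)"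
      using sketch_represents[OF p0, of \<omega> "relabel \<omega> ` A" j] sketch_represents[OF p0, of \<omega> "relabel \<omega> ` B" j]
      by (simp_all add: SA_def SB_def relabeled_sketch_def)
    have "(\<lambda>x. (if x \<in> SA then 1 else 0) - (if x \<in> SB then 1 else 0)) = signed_part (in_cell (T1 \<union> T2) j)"
    proof
      fix x show "(if x \<in> SA then 1 else 0) - (if x \<in> SB then 1 else 0) = signed_part (in_cell (T1 \<union> T2) j) x"
        using diff[of x] T(3) by (auto simp: SA_def SB_def signed_part_def in_cell_def sg_def)
    qed
    then show "represents P \<omega> (signed_part (in_cell (T1 \<union> T2) j)) (s j)"
      using subtract_cell_correct[OF p l r] j by (simp add: s_def val_subtract)
  qed
  show ?thesis unfolding solves_iff_results
  proof
    fix r assume "r \<in> results (decode rf P \<omega> d (relabeled_sketch P \<omega> A) (relabeled_sketch P \<omega> B))"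
    then obtain res where res: "res \<in> results (peel rf P \<omega> (cells P + hashes P * d) [1..<Suc (cells P)] s [])"
      and r: "r \<in> results (case res of None \<Rightarrow> det (ret None)
     | Some (found, s') \<Rightarrow> do {
         oks \<leftarrow> det (map_timed (\<lambda>j. steps (terms P + 3) (s' j = empty_cell P)) [1..<Suc (cells P)]);
         if list_all id oks then do {
           out \<leftarrow> det (map_timed (\<lambda>(x, \<sigma>). step (inv (relabel \<omega>) x, \<sigma>)) found);
           det (ret (Some ({x. (x, 1) \<in> set out}, {x. (x, - 1) \<in> set out}))) }
         else det (ret None) })"
      unfolding decode_def s_def results_simps(1,3) timed_simps(3) UN_insert UN_empty Un_empty_right
      by (rule UN_E)
    obtain found s' where fs: "res = Some (found, s')" "sketch_of {} s'"
      "set found = (\<lambda>x. (x, sg x)) ` (T1 \<union> T2)"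
    proof (rule peel_correct[OF ns[folded T12] nf[folded T1_def T2_def] subset_refl sk _ _ _ _ res])
      show "length [1..<Suc (cells P)] + hashes P * card (T1 \<union> T2) \<le> cells P + hashes P * d"
        using mult_le_mono2[OF cardT, of "hashes P"] by (simp del: upt_Suc)
    qed auto
    have ok: "list_all id (map (\<lambda>j. s' j = empty_cell P) [1..<Suc (cells P)])"
    proof -
      have "s' j = empty_cell P" if "j \<in> {1..cells P}" for j
        using fs(2) that represents_unique[OF p _ empty_cell_represents] by (simp add: sketch_of_def in_cell_def)
      then show ?thesis by (auto simp: list_all_iff)
    qed
    let ?out = "map (\<lambda>x. val (case x of (x, \<sigma>) \<Rightarrow> step (inv (relabel \<omega>) x, \<sigma>))) found"
    have out: "set ?out = (\<lambda>x. (inv (relabel \<omega>) x, sg x)) ` (T1 \<union> T2)"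
      unfolding set_map fs(3) image_image by simp
    have r': "r = Some ({x. (x, 1) \<in> set ?out}, {x. (x, - 1) \<in> set ?out})"
      using r ok unfolding fs(1) by (simp del: upt_Suc)
    have s1: "inv (relabel \<omega>) ` T1 = A - B" "inv (relabel \<omega>) ` T2 = B - A"
      using inj by (auto simp: T1_def T2_def image_image)
    have "{x. (x, 1) \<in> set ?out} = inv (relabel \<omega>) ` T1" "{x. (x, - 1) \<in> set ?out} = inv (relabel \<omega>) ` T2"
      unfolding out using T(3) by (auto simp: sg_def image_def split: if_splits)
    then show "r = Some (A - B, B - A)" unfolding r' s1 by simp
  qed
qed

section \<open>Running times\<close>

lemma cost_map_timed_le:
  "(\<And>x. x \<in> set xs \<Longrightarrow> cost (f x) \<le> c) \<Longrightarrow> cost (map_timed f xs) \<le> c * length xs"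
proof (induction xs)
  case (Cons x xs)
  then have "cost (f x) \<le> c" "cost (map_timed f xs) \<le> c * length xs" by auto
  then show ?case by simp
qed simp

lemma fold_timed_invariant:
  assumes "I s" "\<And>x s. x \<in> set xs \<Longrightarrow> I s \<Longrightarrow> I (val (f x s)) \<and> cost (f x s) \<le> c"
  shows "I (val (fold_timed f xs s)) \<and> cost (fold_timed f xs s) \<le> c * length xs"
  using assms
proof (induction xs arbitrary: s)
  case (Cons x xs)
  have 1: "I (val (f x s))" "cost (f x s) \<le> c" using Cons.prems by auto
  have "I (val (fold_timed f xs (val (f x s)))) \<and> cost (fold_timed f xs (val (f x s))) \<le> c * length xs"
    by (rule Cons.IH) (use 1 Cons.prems in auto)
  then show ?case using 1 by simp
qed simp

lemma cost_mul_linear [simp]: "cost (mul_linear p x prev cs) = 2 * length cs"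
  by (induction cs arbitrary: prev) auto

lemma length_mul_linear [simp]: "length (val (mul_linear p x prev cs)) = length cs"
  by (induction cs arbitrary: prev) auto

lemma cost_div_linear [simp]: "cost (div_linear p x prev cs) = 2 * length cs"
  by (induction cs arbitrary: prev) auto

lemma length_div_linear [simp]: "length (val (div_linear p x prev cs)) = length cs"
  by (induction cs arbitrary: prev) auto

lemma mul_power_linear_cost:
  "cost (mul_power_linear p x \<sigma> cs) \<le> 2 * length cs + 1"
  "length (val (mul_power_linear p x \<sigma> cs)) = length cs"
  by (auto simp: mul_power_linear_def)

lemma sub_scaled_cost:
  "cost (sub_scaled p a us vs) \<le> 2 * length us" "length (val (sub_scaled p a us vs)) \<le> length us"
proof -
  have "cost (sub_scaled p a us vs) \<le> 2 * length (zip us vs)"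
    unfolding sub_scaled_def by (rule cost_map_timed_le) auto
  then show "cost (sub_scaled p a us vs) \<le> 2 * length us" by simp
  show "length (val (sub_scaled p a us vs)) \<le> length us" by (simp add: val_sub_scaled)
qed

lemma div_series_aux_cost:
  "length as \<le> w \<Longrightarrow> cost (div_series_aux p b bs n as) \<le> n * (1 + 2 * w) \<and>
    length (val (div_series_aux p b bs n as)) = n"
proof (induction n arbitrary: as)
  case (Suc n)
  define as' where "as' = val (sub_scaled p (hd as * b mod int p) (tl as) (tl bs))"
  have "length as' \<le> length (tl as)" unfolding as'_def by (rule sub_scaled_cost)
  then have "length as' \<le> w" using Suc.prems by simp
  moreover have "cost (sub_scaled p (hd as * b mod int p) (tl as) (tl bs)) \<le> 2 * w"
    using sub_scaled_cost(1)[of p "hd as * b mod int p" "tl as" "tl bs"] Suc.prems by simp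
  ultimately show ?case using Suc.IH[of as'] by (simp add: as'_def[symmetric])
qed simp

lemma div_series_cost:
  "cost (div_series p as bs) \<le> 1 + length as * (1 + 2 * length as)"
  "length (val (div_series p as bs)) = length as"
  using div_series_aux_cost[of as "length as" p "modular_inverse (int p) (hd bs)" bs "length as"]
  by (simp_all add: div_series_def)

lemma find_pivot_cost:
  "cost (find_pivot rs) \<le> length rs"
  "val (find_pivot rs) = Some (r, rs') \<Longrightarrow> Suc (length rs') = length rs"
  by (induction rs arbitrary: r rs') (auto split: if_splits)

lemma solve_cost:
  assumes "\<And>r. r \<in> set eqs \<Longrightarrow> length r \<le> w" "length eqs \<le> e"
  shows "cost (solve p n eqs) \<le> Suc n * (2 * e + 1 + 3 * w + 2 * w * e)"
proof -
  \<comment> \<open>The work per unknown: pivot search, scaling of the pivot row, elimination in the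
    other rows and back substitution. Here \<open>w\<close> bounds the row lengths and
    \<open>e\<close> the number of rows.\<close>
  define K where "K = 2 * e + 1 + 3 * w + 2 * w * e"
  have K: "2 * e \<le> K" "e + (1 + (w + (2 * w * e + 2 * w))) \<le> K" by (simp_all add: K_def)
  have "cost (solve p n eqs) \<le> Suc n * K" using assms
proof (induction n arbitrary: eqs)
  case (Suc n)
  have fp: "cost (find_pivot eqs) \<le> e" using find_pivot_cost(1)[of eqs] Suc.prems by linarith
  show ?case
  proof (cases "val (find_pivot eqs)")
    case None
    have "cost (solve p n (map tl eqs)) \<le> Suc n * K"
      by (rule Suc.IH) (use Suc.prems in \<open>auto intro!: le_SucI simp: le_diff_conv\<close>)
    then show ?thesis using None fp Suc.prems(2) K(1) by simp
  next
    case (Some piv)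
    obtain r rs where piv: "piv = (r, rs)" by force
    have sets: "set eqs = insert r (set rs)" "length rs \<le> e"
      using find_pivot_Some[of eqs r rs] find_pivot_cost(2)[of eqs r rs] Some piv Suc.prems by auto
    define c where "c = modular_inverse (int p) (hd r)"
    define r' where "r' = map (\<lambda>a. a * c mod int p) (tl r)"
    have lr: "length r' \<le> w" using Suc.prems(1)[of r] sets by (simp add: r'_def)
    have c1: "cost (map_timed (\<lambda>a. step (a * c mod int p)) (tl r)) \<le> w"
      using cost_map_timed_le[of "tl r" "\<lambda>a. step (a * c mod int p)" 1] Suc.prems(1)[of r] sets by simp
    have c2: "cost (map_timed (\<lambda>row. sub_scaled p (hd row) (tl row) r') rs) \<le> 2 * w * e"
    proof -
      have "cost (map_timed (\<lambda>row. sub_scaled p (hd row) (tl row) r') rs) \<le> (2 * w) * length rs"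
      proof (rule cost_map_timed_le)
        fix row assume "row \<in> set rs"
        then have "length (tl row) \<le> w" using Suc.prems(1)[of row] sets by simp
        then show "cost (sub_scaled p (hd row) (tl row) r') \<le> 2 * w"
          using sub_scaled_cost(1)[of p "hd row" "tl row" r'] by linarith
      qed
      also have "\<dots> \<le> 2 * w * e" using sets by simp
      finally show ?thesis .
    qed
    define rs' where "rs' = map (\<lambda>row. val (sub_scaled p (hd row) (tl row) r')) rs"
    have c3: "cost (solve p n rs') \<le> Suc n * K"
    proof (rule Suc.IH)
      fix x assume "x \<in> set rs'"
      then obtain row where "row \<in> set rs" "x = val (sub_scaled p (hd row) (tl row) r')" by (auto simp: rs'_def)
      then show "length x \<le> w"
        using sub_scaled_cost(2)[of p "hd row" "tl row" r'] Suc.prems(1)[of row] sets by simp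
    qed (use sets in \<open>simp add: rs'_def\<close>)
    have c4: "cost (fold_timed (\<lambda>(a, y) s. do {
                   t \<leftarrow> step (a * y mod int p); step ((s - t) mod int p) }) (zip r' xs) s) \<le> 2 * w" for xs s
    proof -
      have "cost (fold_timed (\<lambda>(a, y) s. do {
                   t \<leftarrow> step (a * y mod int p); step ((s - t) mod int p) }) (zip r' xs) s) \<le> 2 * length (zip r' xs)"
        using fold_timed_invariant[where I = "\<lambda>_. True" and c = 2 and s = s and xs = "zip r' xs" and f = "\<lambda>(a, y) s. do {
                   t \<leftarrow> step (a * y mod int p); step ((s - t) mod int p) }"] by auto
      also have "\<dots> \<le> 2 * w" using lr by simp
      finally show ?thesis .
    qed
    have "cost (solve p (Suc n) eqs) \<le> e + (1 + (w + (2 * w * e + (cost (solve p n rs') + 2 * w))))"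
    proof (cases "val (solve p n rs')")
      case None
      show ?thesis using fp c1 c2 None
        by (simp add: Some piv c_def[symmetric] r'_def[symmetric] rs'_def[symmetric])
    next
      case (Some xs)
      show ?thesis using fp c1 c2 c4[of xs "last r'"] \<open>val (find_pivot eqs) = Some piv\<close> Some
        by (simp add: piv c_def[symmetric] r'_def[symmetric] rs'_def[symmetric])
    qed
    then show ?thesis using c3 K(2) by simp
  qed
next
  case 0
  then show ?case using K by simp
qed
  then show ?thesis by (simp only: K_def)
qed

lemma first_pair_cost:
  assumes "\<And>a b. (a, b) \<in> set degs \<Longrightarrow> a + b \<le> length A"
  shows "cost (first_pair p A degs) \<le> length degs *
    ((length A + 2) * length A + Suc (length A) * (2 * length A + 1 + 3 * Suc (length A) + 2 * Suc (length A) * length A) + 1)"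
  using assms
proof (induction degs)
  case (Cons d degs)
  obtain a b where d: "d = (a, b)" by force
  have ab: "a + b \<le> length A" using Cons.prems d by auto
  have c1: "cost (map_timed (\<lambda>i. steps (a + b + 2) (pair_row p A a b i)) [0..<length A]) \<le> (length A + 2) * length A"
    using cost_map_timed_le[of "[0..<length A]" "\<lambda>i. steps (a + b + 2) (pair_row p A a b i)" "length A + 2"] ab by simp
  have c2: "cost (solve p (a + b) (map (\<lambda>i. pair_row p A a b i) [0..<length A])) \<le>
      Suc (length A) * (2 * length A + 1 + 3 * Suc (length A) + 2 * Suc (length A) * length A)"
    by (rule order_trans[OF solve_cost[where w = "Suc (length A)" and e = "length A"]])
      (use ab in \<open>auto simp: pair_row_def intro!: mult_right_mono\<close>)
  have c3: "cost (first_pair p A degs) \<le> length degs *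
    ((length A + 2) * length A + Suc (length A) * (2 * length A + 1 + 3 * Suc (length A) + 2 * Suc (length A) * length A) + 1)"
    using Cons by auto
  show ?case using c1 c2 c3
    by (cases "val (solve p (a + b) (map (\<lambda>i. pair_row p A a b i) [0..<length A]))") (simp_all add: d)
qed simp

lemma find_pair_cost: "\<exists>c. \<forall>p m A. length A = l \<longrightarrow> cost (find_pair p m A) \<le> c"
proof -
  define K where "K = (l + 2) * l + Suc l * (2 * l + 1 + 3 * Suc l + 2 * Suc l * l) + 1"
  have "cost (find_pair p m A) \<le> Suc l + Suc l * K" if "length A = l" for p m A
  proof -
    have "length (degree_pairs l m) \<le> Suc l"
      unfolding degree_pairs_def length_map by (rule order_trans[OF length_filter_le]) simp
    then have "length (degree_pairs l m) * K \<le> Suc l * K" by (rule mult_right_mono) simp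
    moreover have "cost (first_pair p A (degree_pairs l m)) \<le> length (degree_pairs l m) * K"
      using first_pair_cost[of "degree_pairs l m" A p] degree_pairs_mem[of _ _ l m] unfolding K_def that by blast
    ultimately have "cost (first_pair p A (degree_pairs l m)) \<le> Suc l * K" by linarith
    then show ?thesis using that by (simp add: find_pair_def)
  qed
  then show ?thesis by blast
qed

lemma support_list_cost: "cost (support_list P \<omega> x) \<le> hashes P * (7 + hashes P)"
proof -
  have "cost (support_list_aux P \<omega> x is) \<le> length is * (7 + length is)" for "is"
  proof (induction "is")
    case (Cons i "is")
    have "length (val (support_list_aux P \<omega> x is)) \<le> length is"
      using support_list_aux_correct by blast
    then have "cost (support_list_aux P \<omega> x (i # is)) \<le> 7 + (length is * (7 + length is) + length is)"
      using Cons by simp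
    also have "\<dots> \<le> length (i # is) * (7 + length (i # is))" by (simp add: algebra_simps)
    finally show ?case .
  qed simp
  from this[of "[1..<Suc (hashes P)]"] show ?thesis by (simp add: support_list_def del: upt_Suc)
qed

text \<open>The time bounds hold for every choice of the public randomness, including failing runs.
  They therefore rest on the lengths of the coefficient lists alone and not on what the cells
  represent.\<close>

definition cells_sized :: "nat \<Rightarrow> sketch \<Rightarrow> bool" where
  "cells_sized l s \<longleftrightarrow> (\<forall>j. length (cell_poly (s j)) = l)"

lemma update_cells_cost:
  assumes "cells_sized l s"
  shows "cost (update_cells P \<omega> x \<sigma> js s) \<le> 1 + (2 * l + 8) * length js"
    "cells_sized l (val (update_cells P \<omega> x \<sigma> js s))"
proof -
  have "cells_sized l (val (fold_timed (\<lambda>j s. do { c \<leftarrow> step (s j); c' \<leftarrow> add_signed P x \<sigma> h c; step (s(j := c')) }) js s)) \<and>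
    cost (fold_timed (\<lambda>j s. do { c \<leftarrow> step (s j); c' \<leftarrow> add_signed P x \<sigma> h c; step (s(j := c')) }) js s) \<le> (2 * l + 8) * length js" for h
  proof (rule fold_timed_invariant[where I = "cells_sized l", OF assms])
    fix j s assume s: "cells_sized l s"
    have "cost (mul_power_linear (modulus P) x \<sigma> (cell_poly (s j))) \<le> 2 * l + 1"
      using mul_power_linear_cost(1)[of "modulus P" x \<sigma> "cell_poly (s j)"] s by (simp add: cells_sized_def)
    then show "cells_sized l (val (do { c \<leftarrow> step (s j); c' \<leftarrow> add_signed P x \<sigma> h c; step (s(j := c')) })) \<and>
      cost (do { c \<leftarrow> step (s j); c' \<leftarrow> add_signed P x \<sigma> h c; step (s(j := c')) }) \<le> 2 * l + 8"
      using s by (simp add: cells_sized_def add_signed_def mul_power_linear_cost)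
  qed
  then show "cost (update_cells P \<omega> x \<sigma> js s) \<le> 1 + (2 * l + 8) * length js"
    "cells_sized l (val (update_cells P \<omega> x \<sigma> js s))"
    by (auto simp: update_cells_def)
qed

lemma update_support_cost:
  assumes "cells_sized l s"
  shows "cost (update_cells P \<omega> x \<sigma> (val (support_list P \<omega> x)) s) \<le> 1 + (2 * l + 8) * hashes P"
proof -
  have "cost (update_cells P \<omega> x \<sigma> (val (support_list P \<omega> x)) s) \<le> 1 + (2 * l + 8) * length (val (support_list P \<omega> x))"
    by (rule update_cells_cost[OF assms])
  also have "\<dots> \<le> 1 + (2 * l + 8) * hashes P"
    by (intro add_mono mult_left_mono support_list_correct(3)) auto
  finally show ?thesis .
qed

lemma relabeled_sketch_sized:
  assumes "modulus P > 0" shows "cells_sized (terms P) (relabeled_sketch P \<omega> S)"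
  using sketch_represents[OF assms] unfolding cells_sized_def relabeled_sketch_def represents_def by blast

lemma insert_item_cost:
  assumes "modulus P > 0"
  shows "cost (insert_item P \<omega> x (relabeled_sketch P \<omega> S)) \<le>
    2 + hashes P * (7 + hashes P) + (2 * terms P + 8) * hashes P"
  using update_support_cost[OF relabeled_sketch_sized[OF assms], of P \<omega> "relabel \<omega> x" 1 \<omega> S]
    support_list_cost[of P \<omega> "relabel \<omega> x"]
  by (simp add: insert_item_def)

lemma remove_signed_cost:
  assumes "cells_sized l s"
  shows "cost (remove_signed P \<omega> y (queue, s)) \<le> 1 + hashes P * (7 + hashes P) + (2 * l + 9) * hashes P"
    "cells_sized l (snd (val (remove_signed P \<omega> y (queue, s))))"
proof -
  obtain x \<sigma> where y: "y = (x, \<sigma>)" by force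
  show "cost (remove_signed P \<omega> y (queue, s)) \<le> 1 + hashes P * (7 + hashes P) + (2 * l + 9) * hashes P"
    using update_support_cost[OF assms, of P \<omega> x "- \<sigma>"] support_list_cost[of P \<omega> x] support_list_correct(3)[of P \<omega> x]
    by (simp add: remove_signed_def y algebra_simps)
  show "cells_sized l (snd (val (remove_signed P \<omega> y (queue, s))))"
    using update_cells_cost(2)[OF assms] by (simp add: remove_signed_def y)
qed

lemma confirm_cost:
  "cost (confirm P \<omega> j t cand) \<le> (4 + hashes P + hashes P * (7 + hashes P)) * length cand + 1"
proof -
  have c1: "cost (map_timed (\<lambda>(x, \<sigma>). do {
              js \<leftarrow> support_list P \<omega> x;
              steps (length js) (j \<in> set js) }) cand) \<le> (hashes P + hashes P * (7 + hashes P)) * length cand"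
  proof (rule cost_map_timed_le)
    fix y assume "y \<in> set cand"
    show "cost (case y of (x, \<sigma>) \<Rightarrow> do { js \<leftarrow> support_list P \<omega> x; steps (length js) (j \<in> set js) })
      \<le> hashes P + hashes P * (7 + hashes P)"
      using support_list_cost[of P \<omega> "fst y"] support_list_correct(3)[of P \<omega> "fst y"]
      by (simp add: case_prod_unfold)
  qed
  have c2: "cost (fold_timed (\<lambda>(x, \<sigma>) u. do {
              h \<leftarrow> step (fingerprint \<omega> x);
              steps 3 ((u + \<sigma> * h) mod int (fp_modulus P)) }) cand 0) \<le> 4 * length cand"
    using fold_timed_invariant[where I = "\<lambda>_. True" and c = 4 and s = 0 and xs = cand and f = "\<lambda>(x, \<sigma>) u. do {
              h \<leftarrow> step (fingerprint \<omega> x);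
              steps 3 ((u + \<sigma> * h) mod int (fp_modulus P)) }"] by auto
  show ?thesis using c1 c2 by (simp add: confirm_def algebra_simps)
qed

lemma splits_cost: "cost (splits p F R) \<le> length R * (2 * (length R + 2)) + length F + length R"
proof -
  have "cost (fold_timed (\<lambda>x cs. mul_linear p x 0 (cs @ [0])) R cs) \<le> length R * (2 * (length R + length cs + 1))" for cs
  proof (induction R arbitrary: cs)
    case (Cons x R)
    have "cost (fold_timed (\<lambda>x cs. mul_linear p x 0 (cs @ [0])) R (val (mul_linear p x 0 (cs @ [0]))))
       \<le> length R * (2 * (length R + length (val (mul_linear p x 0 (cs @ [0]))) + 1))" by (rule Cons)
    then show ?case by simp
  qed simp
  from this[of "[1]"] show ?thesis by (simp add: splits_def)
qed

section \<open>Number of roots and expected cost of decoding\<close>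

lemma factor_root:
  assumes "[poly Q x = 0] (mod int p)"
  obtains Q' where "cong_poly p Q ([:- x, 1:] * Q')"
proof -
  obtain Q' where "Q - [:poly Q x:] = [:- x, 1:] * Q'"
    using poly_eq_0_iff_dvd[of "Q - [:poly Q x:]" x] by (auto simp: dvd_def)
  then have Qeq: "Q = [:- x, 1:] * Q' + [:poly Q x:]" by (metis diff_add_cancel)
  have "cong_poly p [:poly Q x:] 0" using assms by (simp add: cong_poly_def coeff_pCons split: nat.splits)
  then have "cong_poly p ([:- x, 1:] * Q' + [:poly Q x:]) ([:- x, 1:] * Q' + 0)"
    by (intro cong_poly_add) auto
  then show ?thesis using that[of Q'] Qeq by simp
qed

text \<open>Roots are split off one by one; as p is prime, the cofactor inherits the next root. This
  bounds the length of the lists that the root finder returns, and with it the size of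
  candidates.\<close>

lemma card_roots_le:
  assumes p: "prime p" and F: "lead_coeff F = 1"
    and X: "finite X" "X \<subseteq> {0..<int p}" "\<And>x. x \<in> X \<Longrightarrow> [poly F x = 0] (mod int p)"
  shows "card X \<le> degree F"
proof -
  have "\<exists>Q. cong_poly p F (linear_prod X * Q)"
    using X
  proof (induction X rule: finite_induct)
    case empty
    show ?case by (intro exI[of _ F]) simp
  next
    case (insert x X)
    then obtain Q where Q: "cong_poly p F (linear_prod X * Q)" by auto
    have "\<not> [poly (linear_prod X) x = 0] (mod int p)"
    proof
      assume "[poly (linear_prod X) x = 0] (mod int p)"
      then obtain y where "y \<in> X" "int p dvd x - y"
        using p insert.hyps(1) by (auto simp: poly_linear_prod cong_0_iff prime_dvd_prod_iff)
      then have "[x = y] (mod int p)" by (simp add: cong_iff_dvd_diff)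
      then show False using insert \<open>y \<in> X\<close> by (auto simp: Cong.cong_def)
    qed
    moreover have "[poly (linear_prod X * Q) x = 0] (mod int p)"
      using cong_sym[OF cong_poly_eval[OF Q, of x]] insert.prems(2)[of x] cong_trans by blast
    ultimately have "[poly Q x = 0] (mod int p)" using p by (simp add: cong_0_iff prime_dvd_mult_iff)
    then obtain Q' where "cong_poly p Q ([:- x, 1:] * Q')" using factor_root by blast
    then have "cong_poly p F (linear_prod X * ([:- x, 1:] * Q'))"
      using Q cong_poly_mult[OF cong_poly_refl] cong_poly_trans by blast
    also have "linear_prod X * ([:- x, 1:] * Q') = linear_prod (insert x X) * Q'"
      unfolding linear_prod_insert[OF insert.hyps(1,2)] by (simp only: ac_simps)
    finally show ?case by blast
  qed
  then obtain Q where Q: "cong_poly p F (linear_prod X * Q)" by blast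
  have "\<not> cong_poly p Q 0"
  proof
    assume "cong_poly p Q 0"
    then have "cong_poly p (linear_prod X * Q) (linear_prod X * 0)" by (intro cong_poly_mult) auto
    then show False using Q not_cong_monic_0[OF p F] cong_poly_trans by (metis mult_zero_right)
  qed
  from degree_le_cong[OF p lead_coeff_linear_prod this cong_poly_sym[OF Q]] show ?thesis by simp
qed

definition expected_cost :: "'a rtimed \<Rightarrow> ennreal" where
  "expected_cost m = (\<integral>\<^sup>+r. of_nat (cost r) \<partial>run m)"

lemma expected_cost_det [simp]: "expected_cost (det t) = of_nat (cost t)"
  by (simp add: expected_cost_def det_def)

text \<open>The continuation is bounded uniformly over the possible results of the first program,
  which keeps all cost bounds additive.\<close>

lemma expected_cost_bind_le:
  assumes "expected_cost m \<le> a" "\<And>x. x \<in> results m \<Longrightarrow> expected_cost (f x) \<le> b"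
  shows "expected_cost (bind_rtimed m f) \<le> a + b"
proof -
  have "expected_cost (bind_rtimed m f) =
      (\<integral>\<^sup>+r. \<integral>\<^sup>+r'. of_nat (cost r) + of_nat (cost r') \<partial>run (f (val r)) \<partial>run m)"
    by (simp add: expected_cost_def bind_rtimed_def)
  also have "\<dots> = (\<integral>\<^sup>+r. of_nat (cost r) + expected_cost (f (val r)) \<partial>run m)"
    by (simp add: expected_cost_def nn_integral_add measure_pmf.emeasure_space_1)
  also have "\<dots> \<le> (\<integral>\<^sup>+r. of_nat (cost r) + b \<partial>run m)"
    using assms(2) by (intro nn_integral_mono_AE) (auto simp: AE_measure_pmf_iff results_def)
  also have "\<dots> = expected_cost m + b"
    by (simp add: expected_cost_def nn_integral_add measure_pmf.emeasure_space_1)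
  also have "\<dots> \<le> a + b" using assms(1) by (rule add_right_mono)
  finally show ?thesis .
qed

text \<open>The root finder is called on degrees at most \<open>l\<close>, so it takes expected time
  \<open>O(log p)\<close>. Everything else is constant for fixed \<open>l\<close> and
  \<open>k\<close> and is absorbed by \<open>log 2 p >= 1\<close>. The bound on the candidates
  serves the cost of removals in \<open>peel\<close>.\<close>

lemma decode_cell_cost:
  assumes rf: "root_finder rf"
  shows "\<exists>C\<ge>0. \<forall>P \<omega> j c. prime (modulus P) \<longrightarrow> terms P = l \<longrightarrow> hashes P = k \<longrightarrow> length (cell_poly c) = l \<longrightarrow>
    expected_cost (decode_cell rf P \<omega> j c) \<le> ennreal (C * log 2 (real (modulus P))) \<and>
    (\<forall>cand. Some cand \<in> results (decode_cell rf P \<omega> j c) \<longrightarrow> length cand \<le> 2 * l)"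
proof -
  obtain cf where cf: "\<And>p m A. length A = l \<Longrightarrow> cost (find_pair p m A) \<le> cf" using find_pair_cost by blast
  obtain C where C: "\<And>p F. prime p \<Longrightarrow> reduced p F \<Longrightarrow> lead_coeff F = 1 \<Longrightarrow> degree F \<le> l \<Longrightarrow>
        (\<integral>\<^sup>+r. of_nat (cost r) \<partial>rf p F) \<le> ennreal (C * log 2 (real p))"
    using rf unfolding root_finder_def by meson
  define C' where "C' = max C 0"
  define cs where "cs = l * (2 * (l + 2)) + (l + 1) + l"
  define cc where "cc = (4 + k + k * (7 + k)) * (2 * l) + 1"
  define K where "K = real (2 + cf + 2 * cs + cc) + 2 * C'"
  have "expected_cost (decode_cell rf P \<omega> j c) \<le> ennreal (K * log 2 (real (modulus P))) \<and>
    (\<forall>cand. Some cand \<in> results (decode_cell rf P \<omega> j c) \<longrightarrow> length cand \<le> 2 * l)"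
    if p: "prime (modulus P)" and P: "terms P = l" "hashes P = k" and c: "length (cell_poly c) = l" for P \<omega> j c
  proof -
    let ?p = "modulus P"
    define lg where "lg = log 2 (real ?p)"
    have lg: "lg \<ge> 1" using prime_ge_2_nat[OF p] by (simp add: lg_def)
    define m where "m = (if cell_count c \<le> int (terms P) then cell_count c else cell_count c - (2 * int (terms P) + 1))"
    have dec: "\<exists>F0. F = coeffs F0 \<and> reduced ?p F0 \<and> lead_coeff F0 = 1 \<and> degree F0 \<le> l"
       "\<exists>G0. G = coeffs G0 \<and> reduced ?p G0 \<and> lead_coeff G0 = 1 \<and> degree G0 \<le> l"
      if "val (find_pair ?p m (cell_poly c)) = Some (F, G)" for F G
      using that c unfolding find_pair_correct[OF p] by (auto simp: decoding_pair_def)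
    have rfc: "expected_cost (RTimed (rf ?p (Poly F))) \<le> ennreal (C' * lg)"
      and rfl: "R \<in> results (RTimed (rf ?p (Poly F))) \<Longrightarrow> length R \<le> l"
      and spl: "R \<in> results (RTimed (rf ?p (Poly F))) \<Longrightarrow> cost (splits ?p F R) \<le> cs"
      if F: "\<exists>F0. F = coeffs F0 \<and> reduced ?p F0 \<and> lead_coeff F0 = 1 \<and> degree F0 \<le> l" for F R
    proof -
      obtain F0 where F0: "F = coeffs F0" "reduced ?p F0" "lead_coeff F0 = 1" "degree F0 \<le> l" using F by blast
      have PF: "Poly F = F0" by (simp add: F0)
      have "ennreal (C * lg) \<le> ennreal (C' * lg)"
        using lg by (intro ennreal_leI mult_right_mono) (auto simp: C'_def)
      then show "expected_cost (RTimed (rf ?p (Poly F))) \<le> ennreal (C' * lg)"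
        using C[OF p F0(2-4)] unfolding expected_cost_def PF lg_def by simp
      show len: "length R \<le> l" if R: "R \<in> results (RTimed (rf ?p (Poly F)))"
      proof -
        have d: "distinct R" "set R = {x \<in> {0..<int ?p}. [poly F0 x = 0] (mod int ?p)}"
          using R rf F0 p unfolding root_finder_def PF by auto
        have "card (set R) \<le> degree F0"
          by (rule card_roots_le[OF p F0(3) finite_set]) (auto simp: d(2))
        then show ?thesis using F0(4) d(1) by (simp add: distinct_card)
      qed
      show "cost (splits ?p F R) \<le> cs" if R: "R \<in> results (RTimed (rf ?p (Poly F)))"
      proof -
        have n0: "F0 \<noteq> 0" using F0(3) by auto
        have "length F \<le> l + 1" using F0(1,4) n0 by (simp add: length_coeffs_degree)
        moreover have "length R * (2 * (length R + 2)) \<le> l * (2 * (l + 2))"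
          using len[OF R] by (intro mult_mono) auto
        ultimately show ?thesis using splits_cost[of ?p F R] len[OF R] unfolding cs_def by linarith
      qed
    qed
    have conf: "cost (confirm P \<omega> j t cand) \<le> cc" if "length cand \<le> 2 * l" for t cand
    proof -
      have "(4 + k + k * (7 + k)) * length cand \<le> (4 + k + k * (7 + k)) * (2 * l)"
        using that by (intro mult_left_mono) auto
      then show ?thesis using confirm_cost[of P \<omega> j t cand] unfolding cc_def P by linarith
    qed
    have "expected_cost (decode_cell rf P \<omega> j c) \<le>
      of_nat 2 + (of_nat cf + (ennreal (C' * lg) + (of_nat cs + (ennreal (C' * lg) + (of_nat cs + (of_nat cc + 0))))))"
      unfolding decode_cell_def m_def[symmetric]
    proof (intro expected_cost_bind_le)
      fix m' FG assume m': "m' \<in> results (det (steps 2 m))" and FG: "FG \<in> results (det (find_pair ?p m' (cell_poly c)))"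
      then have FG: "val (find_pair ?p m (cell_poly c)) = FG" by simp
      show "expected_cost (case FG of None \<Rightarrow> det (ret None)
       | Some (F, G) \<Rightarrow> do {
         R \<leftarrow> RTimed (rf ?p (Poly F));
         okF \<leftarrow> det (splits ?p F R);
         R' \<leftarrow> RTimed (rf ?p (Poly G));
         okG \<leftarrow> det (splits ?p G R');
         if okF \<and> okG then do {
           let cand = map (\<lambda>x. (x, 1)) R @ map (\<lambda>x. (x, - 1)) R';
           acc \<leftarrow> det (confirm P \<omega> j (cell_fp c) cand);
           det (ret (if acc then Some cand else None)) }
         else det (ret None) }) \<le>
        ennreal (C' * lg) + (of_nat cs + (ennreal (C' * lg) + (of_nat cs + (of_nat cc + 0))))"
      proof (cases FG)
        case (Some FG')
        obtain F G where FG': "FG' = (F, G)" by force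
        note dF = dec(1)[OF FG[unfolded Some FG']] and dG = dec(2)[OF FG[unfolded Some FG']]
        show ?thesis unfolding Some FG' option.case prod.case
        proof (intro expected_cost_bind_le rfc dF dG)
          fix R okF R' okG
          assume R: "R \<in> results (RTimed (rf ?p (Poly F)))" "R' \<in> results (RTimed (rf ?p (Poly G)))"
          show "expected_cost (det (splits ?p G R')) \<le> of_nat cs"
            using spl[OF dG R(2)] by auto
          have len: "length (map (\<lambda>x. (x, 1 :: int)) R @ map (\<lambda>x. (x, - 1)) R') \<le> 2 * l"
            using rfl[OF dF R(1)] rfl[OF dG R(2)] by simp
          show "expected_cost (if okF \<and> okG then do {
               let cand = map (\<lambda>x. (x, 1)) R @ map (\<lambda>x. (x, - 1)) R';
               acc \<leftarrow> det (confirm P \<omega> j (cell_fp c) cand);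
               det (ret (if acc then Some cand else None)) }
             else det (ret None)) \<le> of_nat cc + 0"
          proof (cases "okF \<and> okG")
            case True
            have "expected_cost (do {
               acc \<leftarrow> det (confirm P \<omega> j (cell_fp c) (map (\<lambda>x. (x, 1)) R @ map (\<lambda>x. (x, - 1)) R'));
               det (ret (if acc then Some (map (\<lambda>x. (x, 1)) R @ map (\<lambda>x. (x, - 1)) R') else None)) }) \<le> of_nat cc + 0"
              by (rule expected_cost_bind_le) (use conf[OF len] in auto)
            then show ?thesis using True by (simp add: Let_def)
          next
            case False
            show ?thesis unfolding if_not_P[OF False] by simp
          qed
        next
          show "expected_cost (det (splits ?p F R)) \<le> of_nat cs" if "R \<in> results (RTimed (rf ?p (Poly F)))" for R
            using spl[OF dF that] by auto
        qed
      qed simp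
    qed (use cf c in auto)
    also have "\<dots> = ennreal (2 + cf + 2 * cs + cc + 2 * (C' * lg))"
      using lg by (simp add: ennreal_of_nat_eq_real_of_nat C'_def algebra_simps flip: ennreal_plus ennreal_numeral ennreal_1)
    also have "\<dots> \<le> ennreal (K * lg)"
    proof (rule ennreal_leI)
      have "real (2 + cf + 2 * cs + cc) * 1 \<le> real (2 + cf + 2 * cs + cc) * lg"
        using lg by (intro mult_left_mono) auto
      then show "2 + cf + 2 * cs + cc + 2 * (C' * lg) \<le> K * lg"
        unfolding K_def by (simp add: algebra_simps)
    qed
    finally have 1: "expected_cost (decode_cell rf P \<omega> j c) \<le> ennreal (K * log 2 (real ?p))" by (simp add: lg_def)
    have 2: "length cand \<le> 2 * l" if "Some cand \<in> results (decode_cell rf P \<omega> j c)" for cand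
    proof -
      have "Some cand \<in> results (case val (find_pair ?p m (cell_poly c)) of None \<Rightarrow> det (ret None)
       | Some (F, G) \<Rightarrow> do {
         R \<leftarrow> RTimed (rf ?p (Poly F));
         okF \<leftarrow> det (splits ?p F R);
         R' \<leftarrow> RTimed (rf ?p (Poly G));
         okG \<leftarrow> det (splits ?p G R');
         if okF \<and> okG then do {
           let cand = map (\<lambda>x. (x, 1)) R @ map (\<lambda>x. (x, - 1)) R';
           acc \<leftarrow> det (confirm P \<omega> j (cell_fp c) cand);
           det (ret (if acc then Some cand else None)) }
         else det (ret None) })"
        using that unfolding decode_cell_def m_def[symmetric] results_simps(1,3) timed_simps(3) UN_insert UN_empty Un_empty_right .
      then obtain F G where FG: "val (find_pair ?p m (cell_poly c)) = Some (F, G)" 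
        and "Some cand \<in> results (do {
         R \<leftarrow> RTimed (rf ?p (Poly F));
         okF \<leftarrow> det (splits ?p F R);
         R' \<leftarrow> RTimed (rf ?p (Poly G));
         okG \<leftarrow> det (splits ?p G R');
         if okF \<and> okG then do {
           let cand = map (\<lambda>x. (x, 1)) R @ map (\<lambda>x. (x, - 1)) R';
           acc \<leftarrow> det (confirm P \<omega> j (cell_fp c) cand);
           det (ret (if acc then Some cand else None)) }
         else det (ret None) })"
        by (cases "val (find_pair ?p m (cell_poly c))") auto
      then obtain R R' where "R \<in> results (RTimed (rf ?p (Poly F)))" "R' \<in> results (RTimed (rf ?p (Poly G)))"
        "cand = map (\<lambda>x. (x, 1)) R @ map (\<lambda>x. (x, - 1)) R'"
        by (auto simp: Let_def split: if_splits)
      then show ?thesis using rfl[OF dec(1)[OF FG]] rfl[OF dec(2)[OF FG]] by fastforce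
    qed
    from 1 2 show ?thesis by blast
  qed
  moreover have "K \<ge> 0" by (simp add: K_def C'_def)
  ultimately show ?thesis by blast
qed

lemma remove_all_cost:
  assumes "cells_sized l s"
  shows "cost (fold_timed (remove_signed P \<omega>) cand (queue, s)) \<le>
      (1 + hashes P * (7 + hashes P) + (2 * l + 9) * hashes P) * length cand"
    "cells_sized l (snd (val (fold_timed (remove_signed P \<omega>) cand (queue, s))))"
proof -
  have "cells_sized l (snd (val (fold_timed (remove_signed P \<omega>) cand (queue, s)))) \<and>
    cost (fold_timed (remove_signed P \<omega>) cand (queue, s)) \<le>
      (1 + hashes P * (7 + hashes P) + (2 * l + 9) * hashes P) * length cand"
  proof (rule fold_timed_invariant[where I = "\<lambda>qs :: nat list \<times> sketch. cells_sized l (snd qs)"])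
    fix x and qs :: "nat list \<times> sketch" assume "cells_sized l (snd qs)"
    then show "cells_sized l (snd (val (remove_signed P \<omega> x qs))) \<and>
        cost (remove_signed P \<omega> x qs) \<le> 1 + hashes P * (7 + hashes P) + (2 * l + 9) * hashes P"
      using remove_signed_cost[of l "snd qs" P \<omega> x "fst qs"] by simp
  qed (use assms in simp)
  then show "cost (fold_timed (remove_signed P \<omega>) cand (queue, s)) \<le>
      (1 + hashes P * (7 + hashes P) + (2 * l + 9) * hashes P) * length cand"
    "cells_sized l (snd (val (fold_timed (remove_signed P \<omega>) cand (queue, s))))" by auto
qed

text \<open>Each pop is charged the cost of a decoding and of \<open>2 * l\<close> removals, so
  wrong acceptances are covered too. The second part bounds the cost of undoing the relabeling at
  the end.\<close>

lemma peel_cost: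
  assumes D: "\<And>j c. length (cell_poly c) = l \<Longrightarrow> expected_cost (decode_cell rf P \<omega> j c) \<le> K"
    "\<And>j c cand. length (cell_poly c) = l \<Longrightarrow> Some cand \<in> results (decode_cell rf P \<omega> j c) \<Longrightarrow> length cand \<le> 2 * l"
    and s: "cells_sized l s"
  defines "r \<equiv> 1 + hashes P * (7 + hashes P) + (2 * l + 9) * hashes P"
  shows "expected_cost (peel rf P \<omega> n queue s found) \<le> of_nat n * (3 + K + of_nat (2 * l) + of_nat (r * (2 * l))) + 1"
    and "Some (found', s') \<in> results (peel rf P \<omega> n queue s found) \<Longrightarrow> length found' \<le> length found + n * (2 * l)"
proof -
  let ?B = "3 + K + of_nat (2 * l) + of_nat (r * (2 * l)) :: ennreal"
  have "expected_cost (peel rf P \<omega> n queue s found) \<le> of_nat n * ?B + 1 \<and>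
    (\<forall>found' s'. Some (found', s') \<in> results (peel rf P \<omega> n queue s found) \<longrightarrow> length found' \<le> length found + n * (2 * l))"
    using s
  proof (induction n arbitrary: queue s found)
    case 0
    then show ?case by (cases queue) auto
  next
    case (Suc n)
    show ?case
    proof (cases queue)
      case (Cons j queue')
      have len: "length (cell_poly (s j)) = l" using Suc.prems by (simp add: cells_sized_def)
      have 1: "expected_cost (peel rf P \<omega> (Suc n) queue s found) \<le>
         of_nat 3 + (K + (of_nat (2 * l) + (of_nat (r * (2 * l)) + (of_nat n * ?B + 1))))"
        unfolding Cons peel.simps
      proof (intro expected_cost_bind_le)
        fix c res assume c: "c \<in> results (det (steps 3 (s j)))" and res: "res \<in> results (decode_cell rf P \<omega> j c)"
        then have c: "c = s j" by simp
        show "expected_cost (case res of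
             None \<Rightarrow> peel rf P \<omega> n queue' s found
           | Some cand \<Rightarrow> do {
               found' \<leftarrow> det (steps (length cand) (cand @ found));
               next \<leftarrow> det (fold_timed (remove_signed P \<omega>) cand (queue', s));
               peel rf P \<omega> n (fst next) (snd next) found' }) \<le>
          of_nat (2 * l) + (of_nat (r * (2 * l)) + (of_nat n * ?B + 1))"
        proof (cases res)
          case None
          then show ?thesis using Suc.IH[OF Suc.prems, of queue' found]
            by (simp add: add_increasing)
        next
          case (Some cand)
          have cl: "length cand \<le> 2 * l" using D(2) len res c Some by blast
          show ?thesis unfolding Some option.case
          proof (intro expected_cost_bind_le)
            show "expected_cost (det (steps (length cand) (cand @ found))) \<le> of_nat (2 * l)" using cl
              unfolding expected_cost_det timed_simps of_nat_le_iff .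
            have "r * length cand \<le> r * (2 * l)" using cl by simp
            then show "expected_cost (det (fold_timed (remove_signed P \<omega>) cand (queue', s))) \<le> of_nat (r * (2 * l))"
              using remove_all_cost(1)[OF Suc.prems, of P \<omega> cand queue', folded r_def]
              unfolding expected_cost_det of_nat_le_iff by linarith
            fix next_state found'
            assume "next_state \<in> results (det (fold_timed (remove_signed P \<omega>) cand (queue', s)))"
            then show "expected_cost (peel rf P \<omega> n (fst next_state) (snd next_state) found') \<le> of_nat n * ?B + 1"
              using Suc.IH remove_all_cost(2)[OF Suc.prems] by auto
          qed
        qed
      next
        show "expected_cost (decode_cell rf P \<omega> j c) \<le> K" if "c \<in> results (det (steps 3 (s j)))" for c
          using D(1) len that by simp
      qed simp
      have 2: "length found' \<le> length found + Suc n * (2 * l)"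
        if mem: "Some (found', s') \<in> results (peel rf P \<omega> (Suc n) queue s found)" for found' s'
      proof -
        obtain res where res: "res \<in> results (decode_cell rf P \<omega> j (s j))"
          and r: "Some (found', s') \<in> results (case res of
             None \<Rightarrow> peel rf P \<omega> n queue' s found
           | Some cand \<Rightarrow> do {
               found' \<leftarrow> det (steps (length cand) (cand @ found));
               next \<leftarrow> det (fold_timed (remove_signed P \<omega>) cand (queue', s));
               peel rf P \<omega> n (fst next) (snd next) found' })"
          using mem unfolding Cons peel.simps results_simps(1,3) timed_simps(3) UN_insert UN_empty Un_empty_right
          by (rule UN_E)
        show ?thesis
        proof (cases res)
          case None
          have "length found' \<le> length found + n * (2 * l)"
            using r Suc.IH[OF Suc.prems, of queue' found] unfolding None option.case by blast
          then show ?thesis by simp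
        next
          case (Some cand)
          have "Some (found', s') \<in> results (peel rf P \<omega> n (fst (val (fold_timed (remove_signed P \<omega>) cand (queue', s))))
              (snd (val (fold_timed (remove_signed P \<omega>) cand (queue', s)))) (cand @ found))"
            using r unfolding Some by simp
          then have "length found' \<le> length (cand @ found) + n * (2 * l)"
            using Suc.IH[OF remove_all_cost(2)[OF Suc.prems]] by blast
          then show ?thesis using D(2)[OF len, of cand j] res Some by simp
        qed
      qed
      have "of_nat 3 + (K + (of_nat (2 * l) + (of_nat (r * (2 * l)) + (of_nat n * ?B + 1)))) = of_nat (Suc n) * ?B + 1"
        by (simp add: distrib_right add.assoc)
      then show ?thesis using 1 2 by metis
    qed simp
  qed
  then show "expected_cost (peel rf P \<omega> n queue s found) \<le> of_nat n * ?B + 1"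
    and "Some (found', s') \<in> results (peel rf P \<omega> n queue s found) \<Longrightarrow> length found' \<le> length found + n * (2 * l)"
    by blast+
qed

lemma subtract_cost:
  assumes "cells_sized (terms P) s1"
  shows "cost (subtract P s1 s2) \<le> (8 + terms P * (1 + 2 * terms P)) * cells P"
    "cells_sized (terms P) (val (subtract P s1 s2))"
proof -
  have sc: "cost (subtract_cell P c c') \<le> 5 + terms P * (1 + 2 * terms P)"
    "length (cell_poly (val (subtract_cell P c c'))) = terms P" if "length (cell_poly c) = terms P" for c c'
    using div_series_cost[of "modulus P" "cell_poly c" "cell_poly c'"] that
    by (simp_all add: subtract_cell_def)
  have "cells_sized (terms P) (val (subtract P s1 s2)) \<and>
     cost (subtract P s1 s2) \<le> (8 + terms P * (1 + 2 * terms P)) * length [1..<Suc (cells P)]"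
    unfolding subtract_def
  proof (rule fold_timed_invariant[where I = "cells_sized (terms P)", OF assms])
    fix j s assume s: "cells_sized (terms P) s"
    have "cost (subtract_cell P (s1 j) (s2 j)) \<le> 5 + terms P * (1 + 2 * terms P)"
      using sc(1) assms by (simp add: cells_sized_def)
    then show "cells_sized (terms P) (val (do { c1 \<leftarrow> step (s1 j); c2 \<leftarrow> step (s2 j);
        c \<leftarrow> subtract_cell P c1 c2; step (s(j := c)) })) \<and>
      cost (do { c1 \<leftarrow> step (s1 j); c2 \<leftarrow> step (s2 j); c \<leftarrow> subtract_cell P c1 c2; step (s(j := c)) })
        \<le> 8 + terms P * (1 + 2 * terms P)"
      using s sc(2) assms by (simp add: cells_sized_def)
  qed
  then show "cost (subtract P s1 s2) \<le> (8 + terms P * (1 + 2 * terms P)) * cells P"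
    "cells_sized (terms P) (val (subtract P s1 s2))" by (simp_all del: upt_Suc)
qed

text \<open>The constant is fixed before the modulus, the number of cells, the public randomness and
  \<open>d\<close>: it depends on the root finder, \<open>l\<close> and \<open>k\<close>
  only.\<close>

lemma decoding_time_le:
  assumes rf: "root_finder rf"
  shows "\<exists>C\<ge>0. \<forall>P \<omega> d A B. prime (modulus P) \<longrightarrow> terms P = l \<longrightarrow> hashes P = k \<longrightarrow>
    decoding_time rf P \<omega> d A B \<le> ennreal (C * real (cells P + d + 1) * log 2 (real (modulus P)))"
proof -
  obtain C where C0: "C \<ge> 0" and C: "\<And>P \<omega> j c. prime (modulus P) \<Longrightarrow> terms P = l \<Longrightarrow> hashes P = k \<Longrightarrow>
    length (cell_poly c) = l \<Longrightarrow>
    expected_cost (decode_cell rf P \<omega> j c) \<le> ennreal (C * log 2 (real (modulus P))) \<and>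
    (\<forall>cand. Some cand \<in> results (decode_cell rf P \<omega> j c) \<longrightarrow> length cand \<le> 2 * l)"
    using decode_cell_cost[OF rf, of l k] by blast
  define r where "r = 1 + k * (7 + k) + (2 * l + 9) * k"
  define a where "a = 8 + l * (1 + 2 * l) + 1 + (l + 3)"
  define b where "b = 3 + 2 * l + r * (2 * l) + 2 * l"
  define K where "K = real (a + (b + 1) * (k + 1)) + C * (k + 1)"
  have "decoding_time rf P \<omega> d A B \<le> ennreal (K * real (cells P + d + 1) * log 2 (real (modulus P)))"
    if p: "prime (modulus P)" and P: "terms P = l" "hashes P = k" for P \<omega> d A B
  proof -
    let ?p = "modulus P"
    define lg where "lg = log 2 (real ?p)"
    have lg: "lg \<ge> 1" using prime_ge_2_nat[OF p] by (simp add: lg_def)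
    define n where "n = cells P + hashes P * d"
    define sA sB where "sA = relabeled_sketch P \<omega> A" and "sB = relabeled_sketch P \<omega> B"
    have sz: "cells_sized l sA"
      using relabeled_sketch_sized[of P \<omega> A] p prime_gt_0_nat P by (simp add: sA_def)
    note sub = subtract_cost[of P sA sB, unfolded P, OF sz]
    note D = C[OF p P]
    note pc = peel_cost[of l rf P \<omega> "ennreal (C * lg)", OF _ _ sub(2), unfolded P, folded r_def]
    have pk: "expected_cost (peel rf P \<omega> n queue (val (subtract P sA sB)) []) \<le>
       of_nat n * (3 + ennreal (C * lg) + of_nat (2 * l) + of_nat (r * (2 * l))) + 1" for queue
      by (rule pc(1)) (use D in \<open>auto simp: lg_def\<close>)
    have pl: "length found \<le> n * (2 * l)"
      if "Some (found, s') \<in> results (peel rf P \<omega> n queue (val (subtract P sA sB)) [])" for queue found s'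
    proof -
      have "length found \<le> length ([] :: (int \<times> int) list) + n * (2 * l)"
        by (rule pc(2)[OF _ _ that]) (use D in \<open>auto simp: lg_def\<close>)
      then show ?thesis by simp
    qed
    have "expected_cost (decode rf P \<omega> d sA sB) \<le> of_nat ((8 + l * (1 + 2 * l)) * cells P) + (of_nat (cells P) +
       ((of_nat n * (3 + ennreal (C * lg) + of_nat (2 * l) + of_nat (r * (2 * l))) + 1) +
        (of_nat ((l + 3) * cells P) + (of_nat (n * (2 * l)) + 0))))"
      unfolding decode_def n_def[symmetric]
    proof (intro expected_cost_bind_le)
      show "expected_cost (det (subtract P sA sB)) \<le> of_nat ((8 + l * (1 + 2 * l)) * cells P)"
        unfolding expected_cost_det of_nat_le_iff by (rule sub(1))
      show "expected_cost (det (steps (cells P) [1..<Suc (cells P)])) \<le> of_nat (cells P)" by simp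
      show "expected_cost (peel rf P \<omega> n queue s []) \<le>
        of_nat n * (3 + ennreal (C * lg) + of_nat (2 * l) + of_nat (r * (2 * l))) + 1"
        if "s \<in> results (det (subtract P sA sB))" for s queue
        using pk[of queue] that by simp
      fix s queue res
      assume s: "s \<in> results (det (subtract P sA sB))" and queue: "queue \<in> results (det (steps (cells P) [1..<Suc (cells P)]))"
        and res: "res \<in> results (peel rf P \<omega> n queue s [])"
      show "expected_cost (case res of None \<Rightarrow> det (ret None)
       | Some (found, s') \<Rightarrow> do {
           oks \<leftarrow> det (map_timed (\<lambda>j. steps (terms P + 3) (s' j = empty_cell P)) queue);
           if list_all id oks then do {
             out \<leftarrow> det (map_timed (\<lambda>(x, \<sigma>). step (inv (relabel \<omega>) x, \<sigma>)) found);
             det (ret (Some ({x. (x, 1) \<in> set out}, {x. (x, - 1) \<in> set out}))) }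
           else det (ret None) }) \<le> of_nat ((l + 3) * cells P) + (of_nat (n * (2 * l)) + 0)"
      proof (cases res)
        case (Some fs)
        obtain found s' where fs: "fs = (found, s')" by force
        have fl: "length found \<le> n * (2 * l)" using pl[of found s' queue] res s Some fs by simp
        show ?thesis unfolding Some fs option.case prod.case
        proof (intro expected_cost_bind_le)
          have "cost (map_timed (\<lambda>j. steps (terms P + 3) (s' j = empty_cell P)) queue) \<le> (l + 3) * length queue"
            by (rule cost_map_timed_le) (simp add: P)
          then show "expected_cost (det (map_timed (\<lambda>j. steps (terms P + 3) (s' j = empty_cell P)) queue)) \<le> of_nat ((l + 3) * cells P)"
            using queue unfolding expected_cost_det of_nat_le_iff by (simp del: upt_Suc)
          show "expected_cost (if list_all id oks then do {
             out \<leftarrow> det (map_timed (\<lambda>(x, \<sigma>). step (inv (relabel \<omega>) x, \<sigma>)) found);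
             det (ret (Some ({x. (x, 1) \<in> set out}, {x. (x, - 1) \<in> set out}))) }
           else det (ret None)) \<le> of_nat (n * (2 * l)) + 0" for oks
          proof (cases "list_all id oks")
            case True
            have "cost (map_timed (\<lambda>(x, \<sigma>). step (inv (relabel \<omega>) x, \<sigma>)) found) \<le> 1 * length found"
              by (rule cost_map_timed_le) auto
            then have c: "cost (map_timed (\<lambda>(x, \<sigma>). step (inv (relabel \<omega>) x, \<sigma>)) found) \<le> n * (2 * l)" using fl by linarith
            show ?thesis unfolding if_P[OF True]
              by (rule expected_cost_bind_le) (use c in \<open>simp_all only: expected_cost_det of_nat_le_iff timed_simps of_nat_0\<close>)
          next
            case False
            show ?thesis unfolding if_not_P[OF False] by simp
          qed
        qed
      qed simp
    qed
    also have "\<dots> = ennreal (real (a * cells P) + real n * (real b + C * lg) + 1)"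
      using lg C0 unfolding a_def b_def
      by (simp add: ennreal_of_nat_eq_real_of_nat algebra_simps ennreal_mult'[symmetric] flip: ennreal_plus ennreal_numeral ennreal_1)
    also have "\<dots> \<le> ennreal (K * real (cells P + d + 1) * lg)"
    proof (rule ennreal_leI)
      let ?N = "real (cells P + d + 1)"
      have "real n \<le> real (k + 1) * ?N"
      proof -
        have "n \<le> (k + 1) * (cells P + d + 1)" by (simp add: n_def P algebra_simps)
        then show ?thesis by (metis of_nat_le_iff of_nat_mult)
      qed
      moreover have "real b + C * lg \<le> (real b + C) * lg" using lg mult_left_mono[of 1 lg "real b"] by (simp add: algebra_simps)
      moreover have nn: "0 \<le> real b + C * lg" using C0 lg by simp
      ultimately have 1: "real n * (real b + C * lg) \<le> (real (k + 1) * ?N) * ((real b + C) * lg)"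
        by (intro mult_mono) auto
      have N1: "1 \<le> ?N * lg" using lg mult_mono[of 1 ?N 1 lg] by simp
      have "real (a * cells P) \<le> real a * (?N * lg)"
      proof -
        have "real (cells P) * 1 \<le> ?N * lg" using lg by (intro mult_mono) auto
        then have "real a * real (cells P) \<le> real a * (?N * lg)" by (intro mult_left_mono) auto
        then show ?thesis by simp
      qed
      moreover have "1 \<le> real (k + 1) * (?N * lg)" using N1 mult_mono[of 1 "real (k + 1)" 1 "?N * lg"] by simp
      ultimately show "real (a * cells P) + real n * (real b + C * lg) + 1 \<le> K * ?N * lg"
        using 1 unfolding K_def by (simp add: algebra_simps)
    qed
    finally show ?thesis by (simp add: decoding_time_def expected_cost_def sA_def sB_def lg_def)
  qed
  moreover have "K \<ge> 0" using C0 by (simp add: K_def)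
  ultimately show ?thesis by blast
qed

section \<open>The joint law of the relabeling and the cells\<close>

lemma space_uniform_real [simp]: "space (uniform_real b) = {0..<b}"
  by (simp add: uniform_real_def space_restrict_space)

lemma sets_uniform_real [measurable_cong]: "sets (uniform_real b) = sets (restrict_space borel {0..<b})"
  by (simp add: uniform_real_def sets_restrict_space)

lemma emeasure_uniform_real:
  assumes "b > 0" "A \<in> sets (uniform_real b)"
  shows "emeasure (uniform_real b) A = emeasure lborel A / ennreal b"
proof -
  have A: "A \<subseteq> {0..<b}" "A \<in> sets (restrict_space lborel {0..<b})"
    using assms(2) sets.sets_into_space[OF assms(2)] by (auto simp: uniform_real_def)
  have "emeasure (uniform_real b) A = emeasure (restrict_space lborel {0..<b}) ({0..<b} \<inter> A) /
      emeasure (restrict_space lborel {0..<b}) {0..<b}"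
    using A unfolding uniform_real_def by (intro emeasure_uniform_measure) (auto simp: sets_restrict_space)
  also have "{0..<b} \<inter> A = A" using A by auto
  finally show ?thesis using A assms(1) by (simp add: emeasure_restrict_space)
qed

lemma prob_space_uniform_real:
  assumes "b > 0" shows "prob_space (uniform_real b)"
proof
  have "{0..<b} \<in> sets (uniform_real b)" using sets.top[of "uniform_real b"] by simp
  then show "emeasure (uniform_real b) (space (uniform_real b)) = 1"
    using assms by (simp add: emeasure_uniform_real ennreal_divide_self)
qed

lemma measurable_uniform_real [measurable]: "(\<lambda>x. x) \<in> borel_measurable (uniform_real b)"
  by (simp add: measurable_cong_sets[OF sets_uniform_real refl] measurable_restrict_space1)

definition cell_at :: "params \<Rightarrow> real \<Rightarrow> real \<Rightarrow> nat" where
  "cell_at P t v = nat (1 + \<lfloor>(t + v) / (coupling P + 1) * real (cells P)\<rfloor>)"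

lemma cell_index_eq: "cell_index P \<omega> i x = cell_at P (shift \<omega> x) (offset \<omega> (i, x))"
  by (simp add: cell_index_def cell_at_def)

lemma measurable_cell_at [measurable]:
  assumes "f \<in> borel_measurable N" "g \<in> borel_measurable N"
  shows "(\<lambda>x. cell_at P (f x) (g x)) \<in> N \<rightarrow>\<^sub>M count_space UNIV"
  unfolding cell_at_def using assms by measurable

lemma cell_at_range:
  assumes "coupling P > 0" "t \<in> {0..<coupling P}" "v \<in> {0..<1}" "cells P \<ge> 1"
  shows "cell_at P t v \<in> {1..cells P}"
proof -
  define y where "y = (t + v) / (coupling P + 1) * real (cells P)"
  have "(t + v) / (coupling P + 1) < 1" using assms by simp
  then have "y < 1 * real (cells P)" unfolding y_def using assms by (intro mult_strict_right_mono) auto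
  moreover have "y \<ge> 0" using assms by (simp add: y_def)
  ultimately have f: "0 \<le> \<lfloor>y\<rfloor>" "\<lfloor>y\<rfloor> < int (cells P)" by (simp_all add: floor_less_iff)
  then obtain n where "\<lfloor>y\<rfloor> = int n" using nonneg_int_cases by blast
  then show ?thesis using f unfolding cell_at_def y_def[symmetric] by (simp add: nat_add_distrib)
qed

definition item_space :: "params \<Rightarrow> (real \<times> real \<times> real) measure" where
  "item_space P = uniform_real (coupling P) \<Otimes>\<^sub>M uniform_real 1 \<Otimes>\<^sub>M uniform_real 1"

definition item_cells :: "params \<Rightarrow> real \<times> real \<times> real \<Rightarrow> nat \<times> nat" where
  "item_cells P = (\<lambda>(t, v, w). (cell_at P t v, cell_at P t w))"

text \<open>The two cells of an item are dependent through the common shift, but different items are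
  independent. So the law of this pair is all that later estimates need, and as a pmf it is free of
  measurability conditions.\<close>

definition item_law :: "params \<Rightarrow> (nat \<times> nat) pmf" where
  "item_law P = Abs_pmf (distr (item_space P) (count_space UNIV) (item_cells P))"

lemma measurable_item_cells [measurable]: "item_cells P \<in> item_space P \<rightarrow>\<^sub>M count_space UNIV"
proof -
  have "item_cells P \<in> item_space P \<rightarrow>\<^sub>M count_space UNIV \<Otimes>\<^sub>M count_space UNIV"
    unfolding item_cells_def item_space_def case_prod_unfold by measurable
  also have "count_space UNIV \<Otimes>\<^sub>M count_space UNIV = (count_space UNIV :: (nat \<times> nat) measure)"
    by (simp add: pair_measure_countable)
  finally show ?thesis .
qed

lemma prob_space_item_space:
  assumes "coupling P > 0" shows "prob_space (item_space P)"
proof -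
  interpret A: prob_space "uniform_real (coupling P)" by (rule prob_space_uniform_real[OF assms])
  interpret B: prob_space "uniform_real 1" by (rule prob_space_uniform_real) simp
  interpret BB: pair_prob_space "uniform_real 1" "uniform_real 1" ..
  interpret ABB: pair_prob_space "uniform_real (coupling P)" "uniform_real 1 \<Otimes>\<^sub>M uniform_real 1" ..
  show ?thesis unfolding item_space_def by (rule ABB.prob_space_axioms)
qed

lemma measure_item_law:
  assumes "coupling P > 0"
  shows "measure_pmf (item_law P) = distr (item_space P) (count_space UNIV) (item_cells P)"
proof -
  interpret prob_space "item_space P" by (rule prob_space_item_space[OF assms])
  interpret D: prob_space "distr (item_space P) (count_space UNIV) (item_cells P)"
    by (rule prob_space_distr) simp
  show ?thesis unfolding item_law_def
  proof (rule Abs_pmf_inverse, intro CollectI conjI D.prob_space_axioms)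
    show "AE x in distr (item_space P) (count_space UNIV) (item_cells P).
       Sigma_Algebra.measure (distr (item_space P) (count_space UNIV) (item_cells P)) {x} \<noteq> 0"
      by (subst D.AE_support_countable) (auto intro: exI[of _ UNIV])
  qed simp
qed

lemma emeasure_item_law:
  assumes "coupling P > 0"
  shows "emeasure (item_law P) A = emeasure (item_space P) {y \<in> space (item_space P). item_cells P y \<in> A}"
  unfolding measure_item_law[OF assms]
  by (subst emeasure_distr) (auto intro!: arg_cong[of _ _ "emeasure (item_space P)"])

text \<open>Given the shift \<open>t\<close> the two offsets are independent, so the law is a
  mixture of products over \<open>t\<close>.\<close>

lemma pmf_item_law:
  assumes z: "coupling P > 0"
  shows "ennreal (pmf (item_law P) (j1, j2)) =
    (\<integral>\<^sup>+t. emeasure (uniform_real 1) {v \<in> {0..<1}. cell_at P t v = j1} *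
          emeasure (uniform_real 1) {v \<in> {0..<1}. cell_at P t v = j2} \<partial>uniform_real (coupling P))"
proof -
  interpret B: prob_space "uniform_real 1" by (rule prob_space_uniform_real) simp
  interpret BB: pair_prob_space "uniform_real 1" "uniform_real 1" ..
  have m [measurable]: "{v \<in> {0..<1}. cell_at P t v = j} \<in> sets (uniform_real 1)" for t j
  proof -
    have "{v \<in> space (uniform_real 1). cell_at P t v = j} \<in> sets (uniform_real 1)" by measurable
    then show ?thesis by simp
  qed
  have "ennreal (pmf (item_law P) (j1, j2)) = emeasure (item_law P) {(j1, j2)}"
    by (simp add: emeasure_pmf_single)
  also have "\<dots> = emeasure (item_space P) {y \<in> space (item_space P). item_cells P y = (j1, j2)}"
    by (simp add: emeasure_item_law[OF z])
  also have "\<dots> = (\<integral>\<^sup>+t. emeasure (uniform_real 1 \<Otimes>\<^sub>M uniform_real 1)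
      (Pair t -` {y \<in> space (item_space P). item_cells P y = (j1, j2)}) \<partial>uniform_real (coupling P))"
  proof -
    have "{y \<in> space (item_space P). item_cells P y = (j1, j2)} \<in> sets (item_space P)"
      by measurable
    then show ?thesis unfolding item_space_def by (rule BB.emeasure_pair_measure_alt)
  qed
  also have "\<dots> = (\<integral>\<^sup>+t. emeasure (uniform_real 1) {v \<in> {0..<1}. cell_at P t v = j1} *
          emeasure (uniform_real 1) {v \<in> {0..<1}. cell_at P t v = j2} \<partial>uniform_real (coupling P))"
  proof (rule nn_integral_cong)
    fix t assume "t \<in> space (uniform_real (coupling P))"
    then have "Pair t -` {y \<in> space (item_space P). item_cells P y = (j1, j2)} =
      {v \<in> {0..<1}. cell_at P t v = j1} \<times> {v \<in> {0..<1}. cell_at P t v = j2}"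
      by (auto simp: item_space_def space_pair_measure item_cells_def)
    then show "emeasure (uniform_real 1 \<Otimes>\<^sub>M uniform_real 1)
      (Pair t -` {y \<in> space (item_space P). item_cells P y = (j1, j2)}) =
      emeasure (uniform_real 1) {v \<in> {0..<1}. cell_at P t v = j1} *
          emeasure (uniform_real 1) {v \<in> {0..<1}. cell_at P t v = j2}"
      using B.emeasure_pair_measure_Times[OF m m] by (simp only:)
  qed
  finally show ?thesis .
qed

text \<open>Off the universe the functions of the public space are \<open>undefined\<close>; the
  value \<open>(0, 0)\<close> matches the default of \<open>Pi_pmf\<close> in
  \<open>instance_law\<close>.\<close>

definition cell_pairs :: "params \<Rightarrow> public \<Rightarrow> int \<Rightarrow> nat \<times> nat" where
  "cell_pairs P \<omega> x = (if x \<in> universe P then (cell_index P \<omega> 1 x, cell_index P \<omega> 2 x) else (0, 0))"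

definition instance_law :: "params \<Rightarrow> ((int \<Rightarrow> int) \<times> (int \<Rightarrow> nat \<times> nat)) pmf" where
  "instance_law P = pair_pmf (pmf_of_set {\<phi>. \<phi> permutes universe P})
     (Pi_pmf (universe P) (0, 0) (\<lambda>_. item_law P))"

text \<open>For fixed shifts the event is a box in the offsets, so its measure is a product over the
  items in which each factor depends on one shift only. The integral over the independent shifts
  then factorizes, and each factor is \<open>pmf_item_law\<close>.\<close>

lemma emeasure_cell_pairs:
  fixes P :: params
  defines "U \<equiv> universe P"
  assumes z: "coupling P > 0"
  shows "{g \<in> space (PiM U (\<lambda>x. uniform_real (coupling P)) \<Otimes>\<^sub>M PiM ({1..2} \<times> U) (\<lambda>ix. uniform_real 1)).
        \<forall>x\<in>U. cell_at P (fst g x) (snd g (1, x)) = fst (v x) \<and> cell_at P (fst g x) (snd g (2, x)) = snd (v x)}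
      \<in> sets (PiM U (\<lambda>x. uniform_real (coupling P)) \<Otimes>\<^sub>M PiM ({1..2::nat} \<times> U) (\<lambda>ix. uniform_real 1))" (is "?E \<in> _")
    and "emeasure (PiM U (\<lambda>x. uniform_real (coupling P)) \<Otimes>\<^sub>M PiM ({1..2::nat} \<times> U) (\<lambda>ix. uniform_real 1))
      {g \<in> space (PiM U (\<lambda>x. uniform_real (coupling P)) \<Otimes>\<^sub>M PiM ({1..2} \<times> U) (\<lambda>ix. uniform_real 1)).
        \<forall>x\<in>U. cell_at P (fst g x) (snd g (1, x)) = fst (v x) \<and> cell_at P (fst g x) (snd g (2, x)) = snd (v x)} =
      (\<Prod>x\<in>U. ennreal (pmf (item_law P) (v x)))"
proof -
  let ?GA = "PiM U (\<lambda>x. uniform_real (coupling P))" and ?GB = "PiM ({1..2::nat} \<times> U) (\<lambda>ix. uniform_real 1)"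
  have fin: "finite U" by (simp add: U_def)
  interpret Z: prob_space "uniform_real (coupling P)" by (rule prob_space_uniform_real[OF z])
  interpret B: prob_space "uniform_real 1" by (rule prob_space_uniform_real) simp
  interpret G0: finite_product_prob_space "\<lambda>x. uniform_real (coupling P)" U by standard (rule fin)
  interpret G: finite_product_prob_space "\<lambda>ix. uniform_real 1" "{1..2::nat} \<times> U" by standard (use fin in simp)
  have c0: "(\<lambda>g. fst g x) \<in> borel_measurable (?GA \<Otimes>\<^sub>M ?GB)" if "x \<in> U" for x
    by (rule measurable_compose[OF measurable_compose[OF measurable_fst
      measurable_component_singleton[OF that, of "\<lambda>x. uniform_real (coupling P)"]] measurable_uniform_real])
  have c1: "(\<lambda>g. snd g (i, x)) \<in> borel_measurable (?GA \<Otimes>\<^sub>M ?GB)" if "x \<in> U" "i \<in> {1..2}" for i x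
    by (rule measurable_compose[OF measurable_compose[OF measurable_snd
      measurable_component_singleton[of "(i, x)" "{1..2} \<times> U" "\<lambda>x. uniform_real 1"]] measurable_uniform_real])
      (use that in auto)
  show meas: "?E \<in> sets (?GA \<Otimes>\<^sub>M ?GB)"
  proof (rule sets.sets_Collect_finite_All[OF _ fin])
    fix x assume x: "x \<in> U"
    have [measurable]: "(\<lambda>g. fst g x) \<in> borel_measurable (?GA \<Otimes>\<^sub>M ?GB)"
      "(\<lambda>g. snd g (1, x)) \<in> borel_measurable (?GA \<Otimes>\<^sub>M ?GB)" "(\<lambda>g. snd g (2, x)) \<in> borel_measurable (?GA \<Otimes>\<^sub>M ?GB)"
      using x by (auto intro: c0 c1)
    show "{g \<in> space (?GA \<Otimes>\<^sub>M ?GB). cell_at P (fst g x) (snd g (1, x)) = fst (v x) \<and>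
         cell_at P (fst g x) (snd g (2, x)) = snd (v x)} \<in> sets (?GA \<Otimes>\<^sub>M ?GB)"
      by measurable
  qed
  have m: "{v \<in> {0..<1}. cell_at P t v = j} \<in> sets (uniform_real 1)" for t j
  proof -
    have "{v \<in> space (uniform_real 1). cell_at P t v = j} \<in> sets (uniform_real 1)" by measurable
    then show ?thesis by simp
  qed
  define S where "S = (\<lambda>t j. {v \<in> {0..<1}. cell_at P t v = j})"
  define r where "r = (\<lambda>x t. emeasure (uniform_real 1) (S t (fst (v x))) * emeasure (uniform_real 1) (S t (snd (v x))))"
  have mS: "(\<lambda>t. emeasure (uniform_real 1) (S t j)) \<in> borel_measurable (uniform_real (coupling P))" for j
  proof -
    have "{y \<in> space (uniform_real (coupling P) \<Otimes>\<^sub>M uniform_real 1). cell_at P (fst y) (snd y) = j}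
        \<in> sets (uniform_real (coupling P) \<Otimes>\<^sub>M uniform_real 1)" by measurable
    from B.measurable_emeasure_Pair[OF this] show ?thesis
      by (rule measurable_cong[THEN iffD1, rotated])
        (auto intro!: arg_cong[of _ _ "emeasure (uniform_real 1)"] simp: S_def space_pair_measure)
  qed
  have "emeasure (?GA \<Otimes>\<^sub>M ?GB) ?E = (\<integral>\<^sup>+g0. emeasure ?GB (Pair g0 -` ?E) \<partial>?GA)"
    by (rule G.emeasure_pair_measure_alt[OF meas])
  also have "\<dots> = (\<integral>\<^sup>+g0. (\<Prod>x\<in>U. r x (g0 x)) \<partial>?GA)"
  proof (rule nn_integral_cong)
    fix g0 assume g0: "g0 \<in> space ?GA"
    define W where "W = (\<lambda>(i, x). S (g0 x) (if i = (1::nat) then fst (v x) else snd (v x)))"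
    have "Pair g0 -` ?E = PiE ({1..2} \<times> U) W"
    proof -
      have all2: "(\<forall>ix\<in>{1..2::nat} \<times> U. Q ix) \<longleftrightarrow> (\<forall>x\<in>U. Q (1, x) \<and> Q (2, x))" for Q
      proof -
        have "{1..2::nat} = {1, 2}" by auto
        then show ?thesis by auto
      qed
      have l: "x \<in> Pair g0 -` ?E \<longleftrightarrow> x \<in> space ?GB \<and>
          (\<forall>y\<in>U. cell_at P (g0 y) (x (1, y)) = fst (v y) \<and> cell_at P (g0 y) (x (2, y)) = snd (v y))" for x
        using g0 by (simp add: space_pair_measure)
      have sp: "x \<in> space ?GB \<longleftrightarrow> (\<forall>ix\<in>{1..2} \<times> U. x ix \<in> {0..<1}) \<and> x \<in> extensional ({1..2} \<times> U)" for x
        by (simp only: space_PiM PiE_iff space_uniform_real)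
      show ?thesis
        unfolding set_eq_iff l sp PiE_iff all2 by (auto simp: W_def S_def)
    qed
    also have "emeasure ?GB \<dots> = (\<Prod>ix\<in>{1..2} \<times> U. emeasure (uniform_real 1) (W ix))"
      by (rule G.emeasure_PiM) (use fin m in \<open>auto simp: W_def S_def\<close>)
    also have "\<dots> = (\<Prod>i\<in>{1..2}. \<Prod>x\<in>U. emeasure (uniform_real 1) (W (i, x)))"
      by (simp add: prod.cartesian_product)
    also have "\<dots> = (\<Prod>x\<in>U. r x (g0 x))"
      by (simp add: numeral_2_eq_2 W_def r_def prod.distrib)
    finally show "emeasure ?GB (Pair g0 -` ?E) = (\<Prod>x\<in>U. r x (g0 x))" .
  qed
  also have "\<dots> = (\<Prod>x\<in>U. \<integral>\<^sup>+t. r x t \<partial>uniform_real (coupling P))"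
    by (rule G0.product_nn_integral_prod) (use fin mS in \<open>auto simp: r_def\<close>)
  also have "\<dots> = (\<Prod>x\<in>U. ennreal (pmf (item_law P) (v x)))"
    unfolding r_def S_def pmf_item_law[OF z, symmetric] by simp
  finally show "emeasure (?GA \<Otimes>\<^sub>M ?GB) ?E = (\<Prod>x\<in>U. ennreal (pmf (item_law P) (v x)))" .
qed


text \<open>Measurability of the level sets of a finite-valued key is enough for every predicate of
  the key. This spares a measurability proof for the decoder itself.\<close>

lemma (in prob_space) finite_range_measure:
  assumes V: "finite V" "\<And>\<omega>. \<omega> \<in> space M \<Longrightarrow> key \<omega> \<in> V"
    and K: "\<And>v. v \<in> V \<Longrightarrow> {\<omega> \<in> space M. key \<omega> = v} \<in> events"
  shows "{\<omega> \<in> space M. Q (key \<omega>)} \<in> events"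
    and "prob {\<omega> \<in> space M. Q (key \<omega>)} = (\<Sum>v\<in>{v\<in>V. Q v}. prob {\<omega> \<in> space M. key \<omega> = v})"
proof -
  have eq: "{\<omega> \<in> space M. Q (key \<omega>)} = (\<Union>v\<in>{v\<in>V. Q v}. {\<omega> \<in> space M. key \<omega> = v})"
    using V(2) by auto
  show "{\<omega> \<in> space M. Q (key \<omega>)} \<in> events"
    unfolding eq using V(1) K by (intro sets.finite_UN) auto
  show "prob {\<omega> \<in> space M. Q (key \<omega>)} = (\<Sum>v\<in>{v\<in>V. Q v}. prob {\<omega> \<in> space M. key \<omega> = v})"
    unfolding eq using V(1) K by (intro finite_measure_finite_Union) (auto simp: disjoint_family_on_def)
qed

section \<open>Transfer from the public space to finite laws\<close>

locale sketch_params =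
  fixes P :: params
  assumes p: "prime (modulus P)" and z: "coupling P > 0" and M: "cells P \<ge> 1"
    and k: "hashes P = 2" and q: "fp_modulus P \<ge> 1"
begin

abbreviation "U \<equiv> universe P"
abbreviation "shift_space \<equiv> PiM U (\<lambda>x. uniform_real (coupling P))"
abbreviation "offset_space \<equiv> PiM ({1..2::nat} \<times> U) (\<lambda>ix. uniform_real 1)"
abbreviation "relabel_space \<equiv> uniform_count_measure {\<phi>. \<phi> permutes U}"
abbreviation "fingerprint_space \<equiv> PiM U (\<lambda>x. uniform_count_measure {0..<int (fp_modulus P)})"

lemma public_space_eq:
  "public_space P = relabel_space \<Otimes>\<^sub>M shift_space \<Otimes>\<^sub>M offset_space \<Otimes>\<^sub>M fingerprint_space"
  by (simp add: public_space_def k)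

lemma finite_relabelings: "finite {\<phi>. \<phi> permutes U}" "{\<phi>. \<phi> permutes U} \<noteq> {}"
  using finite_permutations[of U] by (auto intro: exI[of _ id] permutes_id)

lemma prob_spaces:
  "prob_space relabel_space" "prob_space shift_space" "prob_space offset_space" "prob_space fingerprint_space"
proof -
  show "prob_space relabel_space"
    using finite_relabelings by (intro prob_space_uniform_count_measure) auto
  show "prob_space shift_space" "prob_space offset_space" "prob_space fingerprint_space"
    using z q by (auto intro!: prob_space_PiM prob_space_uniform_real prob_space_uniform_count_measure)
qed

lemma prob_space_public: "prob_space (public_space P)"
proof -
  interpret A: prob_space relabel_space by (rule prob_spaces)
  interpret B: prob_space shift_space by (rule prob_spaces)
  interpret C: prob_space offset_space by (rule prob_spaces)
  interpret D: prob_space fingerprint_space by (rule prob_spaces)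
  interpret CD: pair_prob_space offset_space fingerprint_space ..
  interpret BCD: pair_prob_space shift_space "offset_space \<Otimes>\<^sub>M fingerprint_space" ..
  interpret ABCD: pair_prob_space relabel_space "shift_space \<Otimes>\<^sub>M offset_space \<Otimes>\<^sub>M fingerprint_space" ..
  show ?thesis unfolding public_space_eq by (rule ABCD.prob_space_axioms)
qed

lemma public_space_mem:
  assumes "\<omega> \<in> space (public_space P)"
  shows "relabel \<omega> permutes U" "shift \<omega> \<in> space shift_space" "offset \<omega> \<in> space offset_space"
    "fingerprint \<omega> \<in> space fingerprint_space"
  using assms
  by (auto simp: public_space_eq space_pair_measure space_uniform_count_measure relabel_def shift_def offset_def fingerprint_def)

lemma support_eq: "support P \<omega> x = {cell_index P \<omega> 1 x, cell_index P \<omega> 2 x}"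
proof -
  have "{1..2::nat} = {1, 2}" by auto
  then show ?thesis by (simp add: support_def k)
qed

lemma support_in_range:
  assumes "\<omega> \<in> space (public_space P)" "x \<in> U"
  shows "support P \<omega> x \<subseteq> {1..cells P}"
proof -
  have s: "shift \<omega> x \<in> {0..<coupling P}" and o: "offset \<omega> (1, x) \<in> {0..<1}" "offset \<omega> (2, x) \<in> {0..<1}"
    using public_space_mem(2,3)[OF assms(1)] assms(2) by (auto simp: space_PiM PiE_iff)
  show ?thesis
    unfolding support_eq cell_index_eq
    using cell_at_range[OF z s o(1) M] cell_at_range[OF z s o(2) M] by simp
qed

lemma cell_pairs_in_range:
  assumes "\<omega> \<in> space (public_space P)"
  shows "cell_pairs P \<omega> \<in> PiE_dflt U (0, 0) (\<lambda>_. {1..cells P} \<times> {1..cells P})"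
  using support_in_range[OF assms] unfolding PiE_dflt_def support_eq cell_pairs_def by auto

text \<open>The fingerprints are integrated out with total mass 1; what remains is the product of
  the relabeling mass with \<open>emeasure_cell_pairs\<close>.\<close>

lemma instance_level_sets:
  shows "{\<omega> \<in> space (public_space P). (relabel \<omega>, cell_pairs P \<omega>) = (f, v)} \<in> sets (public_space P)" (is "?E \<in> _")
    and "f permutes U \<Longrightarrow> v \<in> PiE_dflt U (0, 0) (\<lambda>_. {1..cells P} \<times> {1..cells P}) \<Longrightarrow>
      measure (public_space P) {\<omega> \<in> space (public_space P). (relabel \<omega>, cell_pairs P \<omega>) = (f, v)} =
        pmf (instance_law P) (f, v)"
proof -
  interpret A: prob_space relabel_space by (rule prob_spaces)
  interpret B: prob_space shift_space by (rule prob_spaces)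
  interpret C: prob_space offset_space by (rule prob_spaces)
  interpret D: prob_space fingerprint_space by (rule prob_spaces)
  interpret CD: pair_prob_space offset_space fingerprint_space ..
  interpret BC: pair_prob_space shift_space offset_space ..
  interpret BCD: pair_prob_space shift_space "offset_space \<Otimes>\<^sub>M fingerprint_space" ..
  note ec = emeasure_cell_pairs[OF z, of v]
  define G where "G = {g \<in> space (shift_space \<Otimes>\<^sub>M offset_space).
        \<forall>x\<in>U. cell_at P (fst g x) (snd g (1, x)) = fst (v x) \<and> cell_at P (fst g x) (snd g (2, x)) = snd (v x)}"
  have G: "G \<in> sets (shift_space \<Otimes>\<^sub>M offset_space)"
    "emeasure (shift_space \<Otimes>\<^sub>M offset_space) G = (\<Prod>x\<in>U. ennreal (pmf (item_law P) (v x)))"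
    unfolding G_def by (rule ec)+
  define H where "H = {g \<in> space (shift_space \<Otimes>\<^sub>M offset_space \<Otimes>\<^sub>M fingerprint_space). (fst g, fst (snd g)) \<in> G}"
  have mH: "H \<in> sets (shift_space \<Otimes>\<^sub>M offset_space \<Otimes>\<^sub>M fingerprint_space)"
    unfolding H_def using G(1) by measurable
  have "emeasure (shift_space \<Otimes>\<^sub>M offset_space \<Otimes>\<^sub>M fingerprint_space) H =
      (\<integral>\<^sup>+g. emeasure (offset_space \<Otimes>\<^sub>M fingerprint_space) (Pair g -` H) \<partial>shift_space)"
    by (rule CD.emeasure_pair_measure_alt[OF mH])
  also have "\<dots> = (\<integral>\<^sup>+g. emeasure offset_space (Pair g -` G) \<partial>shift_space)"
  proof (rule nn_integral_cong)
    fix g assume g: "g \<in> space shift_space"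
    have s: "Pair g -` G \<in> sets offset_space" using G(1) by (rule sets_Pair1)
    have "Pair g -` H = (Pair g -` G) \<times> space fingerprint_space"
      using g sets.sets_into_space[OF s] by (auto simp: H_def space_pair_measure)
    then show "emeasure (offset_space \<Otimes>\<^sub>M fingerprint_space) (Pair g -` H) = emeasure offset_space (Pair g -` G)"
      using D.emeasure_pair_measure_Times[OF s sets.top] D.emeasure_space_1 by simp
  qed
  also have "\<dots> = emeasure (shift_space \<Otimes>\<^sub>M offset_space) G"
    by (rule C.emeasure_pair_measure_alt[OF G(1), symmetric])
  finally have eH: "emeasure (shift_space \<Otimes>\<^sub>M offset_space \<Otimes>\<^sub>M fingerprint_space) H =
      (\<Prod>x\<in>U. ennreal (pmf (item_law P) (v x)))" using G(2) by simp
  \<comment> \<open>The level set is empty unless \<open>f\<close> is a relabeling and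
    \<open>v\<close> has the default value off the universe.\<close>
  have eq: "?E = (if f permutes U \<and> (\<forall>x. x \<notin> U \<longrightarrow> v x = (0, 0)) then {f} \<times> H else {})"
    by (auto simp: public_space_eq space_pair_measure space_uniform_count_measure relabel_def cell_pairs_def shift_def offset_def
        cell_index_eq H_def G_def fun_eq_iff[of _ v] prod_eq_iff split: if_splits)
  have f: "{f} \<in> sets relabel_space" if "f permutes U"
    using that by (simp add: sets_uniform_count_measure)
  show "?E \<in> sets (public_space P)"
    unfolding eq unfolding public_space_eq using f mH by auto
  assume fv: "f permutes U" "v \<in> PiE_dflt U (0, 0) (\<lambda>_. {1..cells P} \<times> {1..cells P})"
  have v0: "v x = (0, 0)" if "x \<notin> U" for x using fv(2) that by (auto simp: PiE_dflt_def)
  have "emeasure (public_space P) ?E = emeasure relabel_space {f} * (\<Prod>x\<in>U. ennreal (pmf (item_law P) (v x)))"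
    unfolding eq unfolding public_space_eq using fv v0 BCD.emeasure_pair_measure_Times[OF f mH] eH by simp
  also have "emeasure relabel_space {f} = ennreal (1 / card {\<phi>. \<phi> permutes U})"
    using finite_relabelings fv(1) by (subst emeasure_uniform_count_measure) auto
  also have "(\<Prod>x\<in>U. ennreal (pmf (item_law P) (v x))) = ennreal (\<Prod>x\<in>U. pmf (item_law P) (v x))"
    by (simp add: prod_ennreal)
  also have "ennreal (1 / card {\<phi>. \<phi> permutes U}) * ennreal (\<Prod>x\<in>U. pmf (item_law P) (v x)) =
      ennreal (pmf (instance_law P) (f, v))"
    using finite_relabelings fv(1) v0 unfolding instance_law_def pmf_pair
    by (subst pmf_Pi') (auto simp: ennreal_mult'[symmetric] prod_nonneg)
  finally show "measure (public_space P) ?E = pmf (instance_law P) (f, v)"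
    by (simp add: measure_def)
qed

text \<open>From here on probabilities over the public space are computed in
  \<open>instance_law\<close>.\<close>

theorem measure_instance:
  "{\<omega> \<in> space (public_space P). Q (relabel \<omega>) (cell_pairs P \<omega>)} \<in> sets (public_space P)" (is ?A)
  "measure (public_space P) {\<omega> \<in> space (public_space P). Q (relabel \<omega>) (cell_pairs P \<omega>)} =
    measure_pmf.prob (instance_law P) {(f, v). Q f v}" (is ?B)
proof -
  interpret prob_space "public_space P" by (rule prob_space_public)
  define V where "V = {\<phi>. \<phi> permutes U} \<times> PiE_dflt U (0 :: nat, 0 :: nat) (\<lambda>_. {1..cells P} \<times> {1..cells P})"
  have finV: "finite V"
    unfolding V_def using finite_relabelings by (auto intro!: finite_PiE_dflt)
  have key: "(relabel \<omega>, cell_pairs P \<omega>) \<in> V" if "\<omega> \<in> space (public_space P)" for \<omega>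
    using public_space_mem(1)[OF that] cell_pairs_in_range[OF that] by (simp add: V_def)
  note fr = finite_range_measure[where Q = "\<lambda>(f, v). Q f v" and key = "\<lambda>\<omega>. (relabel \<omega>, cell_pairs P \<omega>)", OF finV key]
  have lev: "{\<omega> \<in> space (public_space P). (relabel \<omega>, cell_pairs P \<omega>) = y} \<in> events" for y
    using instance_level_sets(1)[of "fst y" "snd y"] by simp
  have pm: "prob {\<omega> \<in> space (public_space P). (relabel \<omega>, cell_pairs P \<omega>) = y} = pmf (instance_law P) y" if "y \<in> V" for y
    using instance_level_sets(2)[of "fst y" "snd y"] that by (auto simp: V_def)
  show ?A using fr(1)[OF _ lev] by simp
  \<comment> \<open>The level sets over \<open>V\<close> exhaust the public space, so
    \<open>V\<close> has mass 1 under the law as well. This identifies the support without computing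
    it.\<close>
  have tot: "(\<Sum>y\<in>V. pmf (instance_law P) y) = 1"
  proof -
    have "(\<Sum>y\<in>{y \<in> V. True}. prob {\<omega> \<in> space (public_space P). (relabel \<omega>, cell_pairs P \<omega>) = y}) =
       prob {\<omega> \<in> space (public_space P). True}"
      using finite_range_measure(2)[where Q = "\<lambda>_. True" and key = "\<lambda>\<omega>. (relabel \<omega>, cell_pairs P \<omega>)", OF finV key lev] by simp
    then show ?thesis using pm prob_space by simp
  qed
  have sub: "set_pmf (instance_law P) \<subseteq> V"
  proof -
    have "measure_pmf.prob (instance_law P) V = 1"
      using tot finV by (simp add: measure_measure_pmf_finite)
    then show ?thesis by (simp add: measure_pmf.prob_eq_1 AE_measure_pmf_iff subset_iff)
  qed
  have "prob {\<omega> \<in> space (public_space P). Q (relabel \<omega>) (cell_pairs P \<omega>)} =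
      (\<Sum>y\<in>{y \<in> V. case y of (f, v) \<Rightarrow> Q f v}. pmf (instance_law P) y)"
    using fr(2)[OF _ lev] pm by simp
  also have "\<dots> = measure_pmf.prob (instance_law P) {y \<in> V. case y of (f, v) \<Rightarrow> Q f v}"
    using finV by (simp add: measure_measure_pmf_finite)
  also have "\<dots> = measure_pmf.prob (instance_law P) {(f, v). Q f v}"
    using sub by (intro measure_prob_cong_0) (auto simp: set_pmf_iff)
  finally show ?B .
qed


text \<open>Prepares the measurability of \<open>solves\<close>: a run reads the real-valued shifts
  and offsets only through the support lists.\<close>

lemma decode_cong:
  assumes "support_list P \<omega> = support_list P \<omega>'" "fingerprint \<omega> = fingerprint \<omega>'" "relabel \<omega> = relabel \<omega>'"
  shows "solves rf P \<omega> d A B = solves rf P \<omega>' d A B"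
proof -
  have sup: "support P \<omega> = support P \<omega>'"
    using assms(1) support_list_correct(1) by (metis ext)
  have sk: "relabeled_sketch P \<omega> S = relabeled_sketch P \<omega>' S" for S
    unfolding relabeled_sketch_def sketch_def represents_def sup assms(2,3) ..
  have conf: "confirm P \<omega> = confirm P \<omega>'"
    by (intro ext) (simp only: confirm_def assms)
  have dec: "decode_cell rf P \<omega> = decode_cell rf P \<omega>'"
    by (intro ext) (simp only: decode_cell_def conf)
  have upd: "update_cells P \<omega> = update_cells P \<omega>'"
    by (intro ext) (simp only: update_cells_def assms)
  have rem: "remove_signed P \<omega> = remove_signed P \<omega>'"
    by (simp only: remove_signed_def upd assms)
  have "peel rf P \<omega> n queue s found = peel rf P \<omega>' n queue s found" for n queue s found
  proof (induction n arbitrary: queue s found)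
    case 0
    then show ?case by (cases queue) simp_all
  next
    case (Suc n)
    then show ?case by (cases queue) (simp_all only: peel.simps dec rem)
  qed
  then show ?thesis
    by (simp only: solves_def decode_def sk assms)
qed

lemma support_list_cong:
  assumes \<omega>: "\<omega> \<in> space (public_space P)" "\<omega>' \<in> space (public_space P)"
    and eq: "cell_pairs P \<omega> = cell_pairs P \<omega>'"
  shows "support_list P \<omega> = support_list P \<omega>'"
proof
  fix x
  have ci: "cell_index P \<omega> i x = cell_index P \<omega>' i x" if "i \<in> {1..2}" for i
  proof (cases "x \<in> U")
    case True
    have "i = 1 \<or> i = 2" using that by auto
    then show ?thesis using fun_cong[OF eq, of x] True by (auto simp: cell_pairs_def)
  next
    case False
    \<comment> \<open>Points of the product spaces are extensional, so off the universe both
      outcomes have the same value and hence the same cells.\<close>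
    have "shift \<omega>'' x = undefined" "offset \<omega>'' (i, x) = undefined" if "\<omega>'' \<in> space (public_space P)" for \<omega>''
      using public_space_mem(2,3)[OF that] False by (auto simp: space_PiM PiE_iff extensional_def)
    then show ?thesis using \<omega> by (simp add: cell_index_def)
  qed
  have "support_list_aux P \<omega> x is = support_list_aux P \<omega>' x is" if "set is \<subseteq> {1..2}" for "is"
    using that
  proof (induction "is")
    case (Cons i "is")
    then have "support_list_aux P \<omega> x is = support_list_aux P \<omega>' x is" by simp
    then show ?case using ci[of i] Cons.prems
      by (intro timed.expand conjI) (simp_all add: cell_index_def)
  qed simp
  from this[of "[1..<Suc (hashes P)]"] show "support_list P \<omega> x = support_list P \<omega>' x"
    unfolding support_list_def by (rule meta_mp) (auto simp: k)
qed

lemma solves_measurable: "{\<omega> \<in> space (public_space P). solves rf P \<omega> d A B} \<in> sets (public_space P)"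
proof -
  interpret prob_space "public_space P" by (rule prob_space_public)
  define key where "key = (\<lambda>\<omega>. ((relabel \<omega>, cell_pairs P \<omega>), fingerprint \<omega>))"
  define V where "V = ({\<phi>. \<phi> permutes U} \<times> PiE_dflt U (0 :: nat, 0 :: nat) (\<lambda>_. {1..cells P} \<times> {1..cells P})) \<times>
      PiE U (\<lambda>_. {0..<int (fp_modulus P)})"
  have finV: "finite V"
    unfolding V_def using finite_relabelings(1) by (intro finite_cartesian_product finite_PiE_dflt finite_PiE) auto
  have key: "key \<omega> \<in> V" if "\<omega> \<in> space (public_space P)" for \<omega>
    using public_space_mem(1,4)[OF that] cell_pairs_in_range[OF that]
    by (simp add: V_def key_def space_PiM space_uniform_count_measure)
  have lev: "{\<omega> \<in> space (public_space P). key \<omega> = y} \<in> events" if "y \<in> V" for y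
  proof -
    obtain f v h where y: "y = ((f, v), h)" by (metis prod.collapse)
    have h: "h \<in> extensional U" using that by (auto simp: V_def y PiE_iff)
    have "{\<omega> \<in> space (public_space P). \<forall>x\<in>U. fingerprint \<omega> x = h x} \<in> events"
    proof (rule sets.sets_Collect_finite_All)
      fix x assume x: "x \<in> U"
      have "(\<lambda>\<omega>. fingerprint \<omega> x) \<in> public_space P \<rightarrow>\<^sub>M uniform_count_measure {0..<int (fp_modulus P)}"
        unfolding public_space_eq fingerprint_def case_prod_unfold
        by (rule measurable_compose[OF _ measurable_component_singleton[OF x]]) simp
      then have "(\<lambda>\<omega>. fingerprint \<omega> x) -` {h x} \<inter> space (public_space P) \<in> events"
        using that x by (intro measurable_sets) (auto simp: sets_uniform_count_measure V_def y)
      moreover have "(\<lambda>\<omega>. fingerprint \<omega> x) -` {h x} \<inter> space (public_space P) =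
          {\<omega> \<in> space (public_space P). fingerprint \<omega> x = h x}" by auto
      ultimately show "{\<omega> \<in> space (public_space P). fingerprint \<omega> x = h x} \<in> events" by simp
    qed simp
    then have "{\<omega> \<in> space (public_space P). (relabel \<omega>, cell_pairs P \<omega>) = (f, v)} \<inter>
        {\<omega> \<in> space (public_space P). \<forall>x\<in>U. fingerprint \<omega> x = h x} \<in> events"
      using instance_level_sets(1)[of f v] by blast
    moreover have "fingerprint \<omega> = h \<longleftrightarrow> (\<forall>x\<in>U. fingerprint \<omega> x = h x)" if "\<omega> \<in> space (public_space P)" for \<omega>
      using public_space_mem(4)[OF that] h
      by (auto simp: space_PiM PiE_iff intro: extensionalityI)
    then have "{\<omega> \<in> space (public_space P). key \<omega> = y} =
      {\<omega> \<in> space (public_space P). (relabel \<omega>, cell_pairs P \<omega>) = (f, v)} \<inter>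
        {\<omega> \<in> space (public_space P). \<forall>x\<in>U. fingerprint \<omega> x = h x}"
      by (auto simp: key_def y)
    ultimately show ?thesis by simp
  qed
  \<comment> \<open>The existential makes the predicate a function of the key; it has the same truth
    value because outcomes with equal keys are solved alike.\<close>
  have "{\<omega> \<in> space (public_space P). solves rf P \<omega> d A B} =
    {\<omega> \<in> space (public_space P). \<exists>\<omega>'\<in>space (public_space P). key \<omega>' = key \<omega> \<and> solves rf P \<omega>' d A B}"
  proof (intro Collect_cong conj_cong refl iffI)
    fix \<omega> assume \<omega>: "\<omega> \<in> space (public_space P)"
    assume "\<exists>\<omega>'\<in>space (public_space P). key \<omega>' = key \<omega> \<and> solves rf P \<omega>' d A B"
    then obtain \<omega>' where "\<omega>' \<in> space (public_space P)" "key \<omega>' = key \<omega>" "solves rf P \<omega>' d A B" by blast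
    moreover from this have "solves rf P \<omega>' d A B = solves rf P \<omega> d A B"
      using \<omega> by (intro decode_cong support_list_cong) (auto simp: key_def)
    ultimately show "solves rf P \<omega> d A B" by simp
  qed auto
  then show ?thesis
    using finite_range_measure(1)[where key = key and Q = "\<lambda>y. \<exists>\<omega>'\<in>space (public_space P). key \<omega>' = y \<and> solves rf P \<omega>' d A B",
        OF finV key lev] by simp
qed

end

section \<open>Estimates for the cells of one item\<close>

lemma emeasure_lborel_Ico_subset:
  assumes "A \<subseteq> {a..b :: real}" "a \<le> b" shows "emeasure lborel A \<le> ennreal (b - a)"
  using emeasure_mono[OF assms(1), of lborel] assms(2) by simp

text \<open>The values \<open>t\<close> that hit a given cell lie in an interval of one cell width.
  The range \<open>b\<close> is general because the bound is used for the shift, with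
  \<open>b = z\<close>, and by symmetry for an offset, with \<open>b = 1\<close>.\<close>

lemma emeasure_uniform_cell_le:
  assumes b: "b > 0" and v: "v \<ge> 0" and z: "coupling P > 0" and M: "cells P \<ge> 1"
  shows "emeasure (uniform_real b) {t \<in> {0..<b}. cell_at P t v = j} \<le> ennreal ((coupling P + 1) / real (cells P) / b)"
proof -
  define w where "w = (coupling P + 1) / real (cells P)"
  have w: "w > 0" using z M by (simp add: w_def)
  have "{t \<in> space (uniform_real b). cell_at P t v = j} \<in> sets (uniform_real b)" by measurable
  then have m: "{t \<in> {0..<b}. cell_at P t v = j} \<in> sets (uniform_real b)" by simp
  have "{t \<in> {0..<b}. cell_at P t v = j} \<subseteq> {(real j - 1) * w - v .. (real j - 1) * w - v + w}"
  proof
    fix t assume t: "t \<in> {t \<in> {0..<b}. cell_at P t v = j}"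
    define y where "y = (t + v) / (coupling P + 1) * real (cells P)"
    have yw: "t + v = y * w" using z M by (simp add: y_def w_def)
    have "y \<ge> 0" using t v z by (simp add: y_def)
    moreover have "j = nat (1 + \<lfloor>y\<rfloor>)" using t by (simp add: cell_at_def y_def)
    ultimately have "real j = 1 + of_int \<lfloor>y\<rfloor>" by simp
    then have "real j - 1 \<le> y" "y \<le> real j" by linarith+
    then have "(real j - 1) * w \<le> y * w" "y * w \<le> real j * w" using w by (auto intro: mult_right_mono)
    then show "t \<in> {(real j - 1) * w - v .. (real j - 1) * w - v + w}"
      using yw by (simp add: algebra_simps)
  qed
  from emeasure_lborel_Ico_subset[OF this] w
  have "emeasure lborel {t \<in> {0..<b}. cell_at P t v = j} \<le> ennreal w" by simp
  then have "emeasure lborel {t \<in> {0..<b}. cell_at P t v = j} / ennreal b \<le> ennreal w / ennreal b"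
    by (rule divide_right_mono_ennreal)
  then show ?thesis unfolding emeasure_uniform_real[OF b m] using w b by (simp add: w_def divide_ennreal)
qed

text \<open>Cuts the cells in order into \<open>B\<close> runs of nearly equal length;
  \<open>j - 1\<close> because cells are numbered from 1.\<close>

definition block :: "params \<Rightarrow> nat \<Rightarrow> nat \<Rightarrow> nat" where
  "block P B j = (j - 1) * B div cells P"

lemma block_less:
  assumes "j \<in> {1..cells P}" "B > 0" shows "block P B j < B"
proof -
  have "(j - 1) * B < cells P * B" using assms by (intro mult_strict_right_mono) auto
  then show ?thesis by (simp add: block_def less_mult_imp_div_less mult.commute)
qed

text \<open>The order of the blocks determines the order of the offsets up to one cell, lost by the
  floor, and one block, lost by comparing blocks. Measured in offsets these have lengths
  \<open>(z + 1) / M\<close> and \<open>(z + 1) / B\<close>.\<close>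

lemma block_le_offset:
  assumes z: "coupling P > 0" and M: "cells P \<ge> 1" and B: "B > 0"
    and t: "t \<ge> 0" "v \<ge> 0" "w \<ge> 0"
    and le: "block P B (cell_at P t v) \<le> block P B (cell_at P t w)"
  shows "v - (coupling P + 1) * (1 / real (cells P) + 1 / real B) \<le> w"
proof -
  let ?M = "real (cells P)"
  define c where "c = ?M / (coupling P + 1)"
  have c: "c > 0" using z M by (simp add: c_def)
  define n1 where "n1 = nat \<lfloor>(t + v) * c\<rfloor>"
  define n2 where "n2 = nat \<lfloor>(t + w) * c\<rfloor>"
  have n: "real n1 \<le> (t + v) * c" "(t + v) * c < real n1 + 1" "real n2 \<le> (t + w) * c"
    using t c unfolding n1_def n2_def by (auto simp: of_nat_nat)
  have "(t + v) * c \<ge> 0" "(t + w) * c \<ge> 0" using t c by auto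
  then have ca: "cell_at P t v = Suc n1" "cell_at P t w = Suc n2"
    by (simp_all add: cell_at_def n1_def n2_def c_def nat_add_distrib)
  have le': "n1 * B div cells P \<le> n2 * B div cells P" using le unfolding ca block_def by simp
  have "n1 * B < (n1 * B div cells P) * cells P + cells P"
    using M div_mult_mod_eq[of "n1 * B" "cells P"] mod_less_divisor[of "cells P" "n1 * B"] by linarith
  also have "\<dots> \<le> n2 * B + cells P"
    using le' div_times_less_eq_dividend[of "n2 * B" "cells P"] mult_le_mono1[OF le', of "cells P"] by linarith
  finally have "real (n1 * B) < real (n2 * B + cells P)" by (simp only: of_nat_less_iff)
  then have "real n1 * real B < (real n2 + ?M / real B) * real B" using B by (simp add: algebra_simps)
  then have "real n1 < real n2 + ?M / real B" using B by simp
  then have "(t + v) * c - 1 - ?M / real B \<le> (t + w) * c" using n by linarith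
  then have "v * c - (1 + ?M / real B) \<le> w * c" by (simp add: algebra_simps)
  then have "(v * c - (1 + ?M / real B)) / c \<le> w * c / c" using c by (intro divide_right_mono) auto
  then have "v - (1 + ?M / real B) / c \<le> w" using c by (simp add: diff_divide_distrib)
  moreover have "(1 + ?M / real B) / c = (coupling P + 1) * (1 / ?M + 1 / real B)"
    using z M by (simp add: c_def field_simps)
  ultimately show ?thesis by simp
qed

text \<open>The \<open>1 / 2\<close> is the gain on which the capacity bound rests: an offset
  \<open>x\<close> has the other offset above it with probability \<open>1 - x\<close>, on average
  one half; \<open>\<gamma>\<close> is the rounding loss.\<close>

lemma integral_below_diagonal:
  assumes "\<gamma> \<ge> 0"
  shows "(\<integral>\<^sup>+x. ennreal (1 - x + \<gamma>) \<partial>uniform_real 1) \<le> ennreal (1 / 2 + \<gamma>)"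
proof -
  have "(\<integral>\<^sup>+x. ennreal (1 - x + \<gamma>) \<partial>uniform_real 1) =
      (\<integral>\<^sup>+x. ennreal (1 - x + \<gamma>) * indicator {0..<1} x \<partial>restrict_space lborel {0..<1}) / emeasure (restrict_space lborel {0..<1 :: real}) {0..<1}"
    unfolding uniform_real_def
    by (intro nn_integral_uniform_measure) (auto intro!: measurable_restrict_space1 simp: sets_restrict_space)
  also have "emeasure (restrict_space lborel {0..<1 :: real}) {0..<1} = 1"
    by (subst emeasure_restrict_space) auto
  also have "(\<integral>\<^sup>+x. ennreal (1 - x + \<gamma>) * indicator {0..<1} x \<partial>restrict_space lborel {0..<1}) =
      (\<integral>\<^sup>+x. ennreal (1 - x + \<gamma>) * indicator {0..<1} x * indicator {0..<1} x \<partial>lborel)"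
    by (subst nn_integral_restrict_space) auto
  also have "\<dots> \<le> (\<integral>\<^sup>+x. ennreal (1 - x + \<gamma>) * indicator {0..1} x \<partial>lborel)"
    by (intro nn_integral_mono) (auto split: split_indicator)
  also have "\<dots> = ennreal ((1 + \<gamma>) * 1 - 1\<^sup>2 / 2 - ((1 + \<gamma>) * 0 - 0\<^sup>2 / 2))"
  proof (rule nn_integral_FTC_Icc)
    show "DERIV (\<lambda>x. (1 + \<gamma>) * x - x\<^sup>2 / 2) x :> 1 - x + \<gamma>" for x
      by (auto intro!: derivative_eq_intros)
  qed (use assms in auto)
  finally show ?thesis by (simp add: divide_ennreal_def algebra_simps)
qed

context sketch_params
begin

abbreviation "\<mu> \<equiv> item_law P"
abbreviation "pair_space \<equiv> uniform_real 1 \<Otimes>\<^sub>M uniform_real 1"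

text \<open>For fixed offsets, the shift moves the selected endpoint into cell \<open>j\<close> with
  probability at most the relative cell width, whatever the offsets are. Integrating over the shift
  first therefore separates this factor from the condition \<open>R\<close> on the offsets.\<close>

lemma emeasure_item_law_le:
  assumes R: "{y \<in> space pair_space. R y} \<in> sets pair_space"
    and sel: "\<And>y. y \<in> space pair_space \<Longrightarrow> sel y \<ge> (0 :: real)"
    and A: "\<And>t y. t \<in> {0..<coupling P} \<Longrightarrow> y \<in> space pair_space \<Longrightarrow> item_cells P (t, y) \<in> A \<Longrightarrow>
       R y \<and> cell_at P t (sel y) = j"
  shows "emeasure \<mu> A \<le> ennreal ((coupling P + 1) / (coupling P * real (cells P))) *
     emeasure pair_space {y \<in> space pair_space. R y}"
proof -
  interpret Z: prob_space "uniform_real (coupling P)" by (rule prob_space_uniform_real[OF z])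
  interpret B: prob_space "uniform_real 1" by (rule prob_space_uniform_real) simp
  interpret BB: pair_prob_space "uniform_real 1" "uniform_real 1" ..
  interpret ABB: pair_prob_space "uniform_real (coupling P)" pair_space ..
  let ?E = "{y \<in> space (item_space P). item_cells P y \<in> A}"
  let ?c = "ennreal ((coupling P + 1) / (coupling P * real (cells P)))"
  have E: "?E \<in> sets (item_space P)" by measurable
  have "emeasure \<mu> A = emeasure (item_space P) ?E" by (rule emeasure_item_law[OF z])
  also have "\<dots> = (\<integral>\<^sup>+y. emeasure (uniform_real (coupling P)) ((\<lambda>t. (t, y)) -` ?E) \<partial>pair_space)"
    using E unfolding item_space_def by (rule ABB.emeasure_pair_measure_alt2)
  also have "\<dots> \<le> (\<integral>\<^sup>+y. ?c * indicator {y \<in> space pair_space. R y} y \<partial>pair_space)"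
  proof (rule nn_integral_mono)
    fix y assume y: "y \<in> space pair_space"
    show "emeasure (uniform_real (coupling P)) ((\<lambda>t. (t, y)) -` ?E) \<le> ?c * indicator {y \<in> space pair_space. R y} y"
    proof (cases "R y")
      case True
      have sub: "(\<lambda>t. (t, y)) -` ?E \<subseteq> {t \<in> {0..<coupling P}. cell_at P t (sel y) = j}"
        using A y by (auto simp: item_space_def space_pair_measure)
      have "{t \<in> space (uniform_real (coupling P)). cell_at P t (sel y) = j} \<in> sets (uniform_real (coupling P))"
        by measurable
      then have "emeasure (uniform_real (coupling P)) ((\<lambda>t. (t, y)) -` ?E) \<le>
          emeasure (uniform_real (coupling P)) {t \<in> {0..<coupling P}. cell_at P t (sel y) = j}"
        by (intro emeasure_mono[OF sub]) simp
      also have "\<dots> \<le> ennreal ((coupling P + 1) / real (cells P) / coupling P)"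
        by (rule emeasure_uniform_cell_le[OF z sel[OF y] z M])
      finally show ?thesis using True y by (simp add: mult.commute)
    next
      case False
      then have E0: "(\<lambda>t. (t, y)) -` ?E = {}" using A y by (auto simp: item_space_def space_pair_measure)
      show ?thesis unfolding E0 by simp
    qed
  qed
  also have "\<dots> = ?c * emeasure pair_space {y \<in> space pair_space. R y}"
    using R by (rule nn_integral_cmult_indicator)
  finally show ?thesis .
qed

text \<open>The cell width \<open>(z + 1) / M\<close> relative to the range \<open>z\<close> of the
  shift, a bound valid for every cell. It exceeds the average \<open>1 / M\<close> by the factor
  \<open>1 + 1 / z\<close>, the price for the thinly used cells at both ends.\<close>

definition hit :: real where
  "hit = (coupling P + 1) / (coupling P * real (cells P))"

lemma hit_pos: "hit > 0"
  using z M by (simp add: hit_def)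

lemma prob_endpoint:
  "measure_pmf.prob \<mu> {c. fst c = j} \<le> hit" "measure_pmf.prob \<mu> {c. snd c = j} \<le> hit"
proof -
  interpret B: prob_space "uniform_real 1" by (rule prob_space_uniform_real) simp
  interpret BB: pair_prob_space "uniform_real 1" "uniform_real 1" ..
  have *: "{y \<in> space pair_space. True} = space pair_space" by simp
  have top: "{y \<in> space pair_space. True} \<in> sets pair_space" unfolding * by (rule sets.top)
  have "emeasure \<mu> {c. fst c = j} \<le> ennreal hit * emeasure pair_space {y \<in> space pair_space. True}"
    unfolding hit_def
    by (rule emeasure_item_law_le[where sel = fst and j = j, OF top]) (auto simp: space_pair_measure item_cells_def)
  then show "measure_pmf.prob \<mu> {c. fst c = j} \<le> hit"
    using hit_pos unfolding * BB.emeasure_space_1 by (simp add: measure_pmf.emeasure_eq_measure)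
  have "emeasure \<mu> {c. snd c = j} \<le> ennreal hit * emeasure pair_space {y \<in> space pair_space. True}"
    unfolding hit_def
    by (rule emeasure_item_law_le[where sel = snd and j = j, OF top]) (auto simp: space_pair_measure item_cells_def)
  then show "measure_pmf.prob \<mu> {c. snd c = j} \<le> hit"
    using hit_pos unfolding * BB.emeasure_space_1 by (simp add: measure_pmf.emeasure_eq_measure)
qed

lemma prob_in_cell: "measure_pmf.prob \<mu> {c. j = fst c \<or> j = snd c} \<le> 2 * hit"
proof -
  have "measure_pmf.prob \<mu> {c. j = fst c \<or> j = snd c} \<le> measure_pmf.prob \<mu> {c. fst c = j} + measure_pmf.prob \<mu> {c. snd c = j}"
    by (rule order_trans[OF measure_pmf.finite_measure_mono measure_Un_le]) auto
  then show ?thesis using prob_endpoint[of j] by linarith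
qed

lemma emeasure_below_diagonal:
  assumes "\<gamma> \<ge> 0"
  shows "{y \<in> space pair_space. fst y - \<gamma> \<le> snd y} \<in> sets pair_space"
    "emeasure pair_space {y \<in> space pair_space. fst y - \<gamma> \<le> snd y} \<le> ennreal (1 / 2 + \<gamma>)"
    "{y \<in> space pair_space. snd y - \<gamma> \<le> fst y} \<in> sets pair_space"
    "emeasure pair_space {y \<in> space pair_space. snd y - \<gamma> \<le> fst y} \<le> ennreal (1 / 2 + \<gamma>)"
proof -
  interpret B: prob_space "uniform_real 1" by (rule prob_space_uniform_real) simp
  interpret BB: pair_prob_space "uniform_real 1" "uniform_real 1" ..
  show m: "{y \<in> space pair_space. fst y - \<gamma> \<le> snd y} \<in> sets pair_space"
    and m': "{y \<in> space pair_space. snd y - \<gamma> \<le> fst y} \<in> sets pair_space" by measurable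
  have sec: "emeasure (uniform_real 1) {w \<in> {0..<1}. v - \<gamma> \<le> w} \<le> ennreal (1 - v + \<gamma>)" if "v \<in> {0..<1}" for v
  proof -
    have "{w \<in> space (uniform_real 1). v - \<gamma> \<le> w} \<in> sets (uniform_real 1)" by measurable
    then have s: "{w \<in> {0..<1}. v - \<gamma> \<le> w} \<in> sets (uniform_real 1)" by simp
    have "emeasure lborel {w \<in> {0..<1}. v - \<gamma> \<le> w} \<le> ennreal (1 - (v - \<gamma>))"
      by (rule emeasure_lborel_Ico_subset) (use that assms in auto)
    then show ?thesis using emeasure_uniform_real[OF _ s] by (simp add: divide_ennreal_def algebra_simps)
  qed
  have "emeasure pair_space {y \<in> space pair_space. fst y - \<gamma> \<le> snd y} =
     (\<integral>\<^sup>+v. emeasure (uniform_real 1) (Pair v -` {y \<in> space pair_space. fst y - \<gamma> \<le> snd y}) \<partial>uniform_real 1)"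
    by (rule B.emeasure_pair_measure_alt[OF m])
  also have "\<dots> \<le> (\<integral>\<^sup>+v. ennreal (1 - v + \<gamma>) \<partial>uniform_real 1)"
  proof (rule nn_integral_mono)
    fix v assume v: "v \<in> space (uniform_real 1)"
    then have "Pair v -` {y \<in> space pair_space. fst y - \<gamma> \<le> snd y} = {w \<in> {0..<1}. v - \<gamma> \<le> w}"
      by (auto simp: space_pair_measure)
    then show "emeasure (uniform_real 1) (Pair v -` {y \<in> space pair_space. fst y - \<gamma> \<le> snd y}) \<le> ennreal (1 - v + \<gamma>)"
      using sec v by simp
  qed
  also note integral_below_diagonal[OF assms]
  finally show "emeasure pair_space {y \<in> space pair_space. fst y - \<gamma> \<le> snd y} \<le> ennreal (1 / 2 + \<gamma>)" .
  have "emeasure pair_space {y \<in> space pair_space. snd y - \<gamma> \<le> fst y} =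
     (\<integral>\<^sup>+v. emeasure (uniform_real 1) ((\<lambda>w. (w, v)) -` {y \<in> space pair_space. snd y - \<gamma> \<le> fst y}) \<partial>uniform_real 1)"
    by (rule BB.emeasure_pair_measure_alt2[OF m'])
  also have "\<dots> \<le> (\<integral>\<^sup>+v. ennreal (1 - v + \<gamma>) \<partial>uniform_real 1)"
  proof (rule nn_integral_mono)
    fix v assume v: "v \<in> space (uniform_real 1)"
    then have "(\<lambda>w. (w, v)) -` {y \<in> space pair_space. snd y - \<gamma> \<le> fst y} = {w \<in> {0..<1}. v - \<gamma> \<le> w}"
      by (auto simp: space_pair_measure)
    then show "emeasure (uniform_real 1) ((\<lambda>w. (w, v)) -` {y \<in> space pair_space. snd y - \<gamma> \<le> fst y}) \<le> ennreal (1 - v + \<gamma>)"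
      using sec v by simp
  qed
  also note integral_below_diagonal[OF assms]
  finally show "emeasure pair_space {y \<in> space pair_space. snd y - \<gamma> \<le> fst y} \<le> ennreal (1 / 2 + \<gamma>)" .
qed

text \<open>The comparison is by block and not by cell: the propagation argument multiplies its
  bound by a constant in every step, so the number of steps has to stay bounded.\<close>

definition forward :: "nat \<Rightarrow> nat \<Rightarrow> (nat \<times> nat) set" where
  "forward B j = {c. fst c = j \<and> block P B j \<le> block P B (snd c) \<or> snd c = j \<and> block P B j \<le> block P B (fst c)}"

text \<open>Each of the two endpoints can be the one in cell \<open>j\<close>, with probability at
  most \<open>hit * (1 / 2 + \<gamma>)\<close>. The total is about \<open>hit\<close>, half of the
  bound in \<open>prob_in_cell\<close>.\<close>

lemma prob_forward:
  assumes B: "B > 0"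
  shows "measure_pmf.prob \<mu> (forward B j) \<le>
    hit * (1 + 2 * ((coupling P + 1) * (1 / real (cells P) + 1 / real B)))"
proof -
  define \<gamma> where "\<gamma> = (coupling P + 1) * (1 / real (cells P) + 1 / real B)"
  have \<gamma>: "\<gamma> \<ge> 0" using z by (simp add: \<gamma>_def)
  note d = emeasure_below_diagonal[OF \<gamma>]
  define A1 A2 where "A1 = {c. fst c = j \<and> block P B j \<le> block P B (snd c)}"
    and "A2 = {c. snd c = j \<and> block P B j \<le> block P B (fst c)}"
  have "emeasure \<mu> A1 \<le> ennreal hit * emeasure pair_space {y \<in> space pair_space. fst y - \<gamma> \<le> snd y}"
    unfolding hit_def
  proof (rule emeasure_item_law_le[where sel = fst and j = j, OF d(1)])
    show "0 \<le> fst y" if "y \<in> space pair_space" for y using that by (auto simp: space_pair_measure)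
    fix t y assume "t \<in> {0..<coupling P}" "y \<in> space pair_space" "item_cells P (t, y) \<in> A1"
    then show "fst y - \<gamma> \<le> snd y \<and> cell_at P t (fst y) = j"
      unfolding \<gamma>_def A1_def item_cells_def
      using block_le_offset[OF z M B, of t "fst y" "snd y"] by (auto simp: space_pair_measure)
  qed
  also have "\<dots> \<le> ennreal hit * ennreal (1 / 2 + \<gamma>)" by (intro mult_left_mono d) simp
  also have "\<dots> = ennreal (hit * (1 / 2 + \<gamma>))" using hit_pos \<gamma> by (intro ennreal_mult[symmetric]) auto
  finally have 1: "measure_pmf.prob \<mu> A1 \<le> hit * (1 / 2 + \<gamma>)"
    using hit_pos \<gamma> by (subst (asm) measure_pmf.emeasure_eq_measure) (subst (asm) ennreal_le_iff; simp)
  have "emeasure \<mu> A2 \<le> ennreal hit * emeasure pair_space {y \<in> space pair_space. snd y - \<gamma> \<le> fst y}"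
    unfolding hit_def
  proof (rule emeasure_item_law_le[where sel = snd and j = j, OF d(3)])
    show "0 \<le> snd y" if "y \<in> space pair_space" for y using that by (auto simp: space_pair_measure)
    fix t y assume "t \<in> {0..<coupling P}" "y \<in> space pair_space" "item_cells P (t, y) \<in> A2"
    then show "snd y - \<gamma> \<le> fst y \<and> cell_at P t (snd y) = j"
      unfolding \<gamma>_def A2_def item_cells_def
      using block_le_offset[OF z M B, of t "snd y" "fst y"] by (auto simp: space_pair_measure)
  qed
  also have "\<dots> \<le> ennreal hit * ennreal (1 / 2 + \<gamma>)" by (intro mult_left_mono d) simp
  also have "\<dots> = ennreal (hit * (1 / 2 + \<gamma>))" using hit_pos \<gamma> by (intro ennreal_mult[symmetric]) auto
  finally have 2: "measure_pmf.prob \<mu> A2 \<le> hit * (1 / 2 + \<gamma>)"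
    using hit_pos \<gamma> by (subst (asm) measure_pmf.emeasure_eq_measure) (subst (asm) ennreal_le_iff; simp)
  have "measure_pmf.prob \<mu> (forward B j) \<le> measure_pmf.prob \<mu> A1 + measure_pmf.prob \<mu> A2"
    by (rule order_trans[OF measure_pmf.finite_measure_mono measure_Un_le])
      (auto simp: forward_def A1_def A2_def)
  then show ?thesis using 1 2 unfolding \<gamma>_def[symmetric] by (simp add: algebra_simps)
qed

text \<open>Here the shift is fixed first: both offsets are then independent and each hits its cell
  with probability at most one cell width. The square is what makes items inside a small set of
  cells rare.\<close>

lemma pmf_item_law_le: "pmf \<mu> (j1, j2) \<le> ((coupling P + 1) / real (cells P))\<^sup>2"
proof -
  interpret Z: prob_space "uniform_real (coupling P)" by (rule prob_space_uniform_real[OF z])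
  define w where "w = (coupling P + 1) / real (cells P)"
  have w: "w \<ge> 0" using z by (simp add: w_def)
  have c: "emeasure (uniform_real 1) {v \<in> {0..<1}. cell_at P t v = j} \<le> ennreal w" if "t \<ge> 0" for t j
  proof -
    have "cell_at P t v = cell_at P v t" for v by (simp add: cell_at_def add.commute)
    then show ?thesis using emeasure_uniform_cell_le[of 1 t P j] that z M by (simp add: w_def)
  qed
  have "ennreal (pmf \<mu> (j1, j2)) \<le> (\<integral>\<^sup>+t. ennreal w * ennreal w \<partial>uniform_real (coupling P))"
    unfolding pmf_item_law[OF z] by (intro nn_integral_mono mult_mono c) auto
  also have "\<dots> = ennreal (w\<^sup>2)" using w Z.emeasure_space_1 by (simp add: power2_eq_square ennreal_mult)
  finally show ?thesis by (simp add: w_def)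
qed

lemma set_item_law: "set_pmf \<mu> \<subseteq> {1..cells P} \<times> {1..cells P}"
proof -
  have "emeasure \<mu> (- ({1..cells P} \<times> {1..cells P})) = 0"
  proof -
    have E0: "{y \<in> space (item_space P). item_cells P y \<in> - ({1..cells P} \<times> {1..cells P})} = {}"
      using cell_at_range[OF z _ _ M] by (auto simp: item_space_def space_pair_measure item_cells_def)
    show ?thesis unfolding emeasure_item_law[OF z] E0 by simp
  qed
  then have "measure_pmf.prob \<mu> (- ({1..cells P} \<times> {1..cells P})) = 0"
    by (simp add: measure_pmf.emeasure_eq_measure)
  then show ?thesis by (auto simp: measure_pmf_zero_iff)
qed

lemma prob_both_endpoints:
  assumes "finite J"
  shows "measure_pmf.prob \<mu> (J \<times> J) \<le> (real (card J) * ((coupling P + 1) / real (cells P)))\<^sup>2"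
proof -
  have "measure_pmf.prob \<mu> (J \<times> J) = (\<Sum>c\<in>J \<times> J. pmf \<mu> c)"
    using assms by (simp add: measure_measure_pmf_finite)
  also have "\<dots> \<le> (\<Sum>c\<in>J \<times> J. ((coupling P + 1) / real (cells P))\<^sup>2)"
    using pmf_item_law_le by (intro sum_mono) (auto simp: split_paired_all)
  finally show ?thesis by (simp add: card_cartesian_product power2_eq_square algebra_simps)
qed

end

section \<open>Stuck sets\<close>

lemma power_div_fact_le_exp: "x \<ge> 0 \<Longrightarrow> x ^ n / fact n \<le> exp (x :: real)"
proof -
  assume x: "x \<ge> 0"
  have "(\<Sum>i\<in>{n}. x ^ i /\<^sub>R fact i) \<le> exp x"
    unfolding exp_def using x summable_exp_generic[of x] by (intro sum_le_suminf) auto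
  then show ?thesis by (simp add: divide_inverse mult.commute)
qed

lemma binomial_le_exp_power:
  assumes "1 \<le> m"
  shows "real (n choose m) \<le> (exp 1 * real n / real m) ^ m"
proof -
  have "real ((n choose m) * fact m) \<le> real (n ^ m)" using binomial_fact_pow[of n m] by (simp only: of_nat_le_iff)
  then have "real (n choose m) \<le> real n ^ m / fact m" by (simp add: field_simps)
  also have "\<dots> = (real n / real m) ^ m * (real m ^ m / fact m)" using assms by (simp add: power_divide)
  also have "\<dots> \<le> (real n / real m) ^ m * exp (real m)"
    by (intro mult_left_mono power_div_fact_le_exp) auto
  also have "exp (real m) = exp 1 ^ m" by (simp add: exp_of_nat_mult[symmetric])
  finally show ?thesis by (simp add: power_mult_distrib[symmetric] mult.commute)
qed

locale iid_items =
  fixes \<mu> :: "'b pmf" and U :: "'a set" and dflt :: 'b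
  assumes finite_U: "finite U" and finite_\<mu>: "finite (set_pmf \<mu>)"
begin

abbreviation "law \<equiv> Pi_pmf U dflt (\<lambda>_. \<mu>)"

lemma finite_law: "finite (set_pmf law)"
  using finite_U finite_\<mu> by (auto simp: set_Pi_pmf intro!: finite_PiE_dflt)

lemma integrable_law [simp, intro]: "integrable (measure_pmf law) (f :: _ \<Rightarrow> real)"
  by (rule integrable_measure_pmf_finite[OF finite_law])

lemma integrable_\<mu> [simp, intro]: "integrable (measure_pmf \<mu>) (f :: _ \<Rightarrow> real)"
  by (rule integrable_measure_pmf_finite[OF finite_\<mu>])

lemma prob_all:
  assumes "S \<subseteq> U"
  shows "measure_pmf.prob law {c. \<forall>x\<in>S. c x \<in> A} = measure_pmf.prob \<mu> A ^ card S"
proof -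
  have "measure_pmf.prob law {c. \<forall>x\<in>S. c x \<in> A} =
      measure_pmf.prob law (Pi U (\<lambda>x. if x \<in> S then A else UNIV))"
    using assms by (intro arg_cong[of _ _ "measure_pmf.prob law"]) (auto simp: Pi_def)
  also have "\<dots> = (\<Prod>x\<in>U. measure_pmf.prob \<mu> (if x \<in> S then A else UNIV))"
    by (rule measure_Pi_pmf_Pi[OF finite_U])
  also have "\<dots> = (\<Prod>x\<in>S. measure_pmf.prob \<mu> A)"
    using assms finite_U by (intro prod.mono_neutral_cong_right) auto
  finally show ?thesis by simp
qed

text \<open>The moment generating function of a binomial count with base \<open>\<theta>\<close>,
  bounded by \<open>1 + y <= exp y\<close> for each item. It yields \<open>chernoff\<close>, and
  with \<open>\<theta> = 2\<close> the bound on excess degrees.\<close>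

lemma expectation_power_count:
  assumes T: "T \<subseteq> U" "card T \<le> n" and \<theta>: "\<theta> \<ge> 1" and a: "measure_pmf.prob \<mu> A \<le> a"
  shows "measure_pmf.expectation law (\<lambda>c. \<theta> ^ card {x \<in> T. c x \<in> A}) \<le> exp ((\<theta> - 1) * real n * a)"
proof -
  let ?f = "\<lambda>x v. if x \<in> T \<and> v \<in> A then \<theta> else 1"
  have finT: "finite T" using T finite_U finite_subset by blast
  have a0: "a \<ge> 0" using a by (meson measure_nonneg order_trans)
  have "\<theta> ^ card {x \<in> T. c x \<in> A} = (\<Prod>x\<in>U. ?f x (c x))" for c
  proof -
    have "(\<Prod>x\<in>U. ?f x (c x)) = (\<Prod>x\<in>{x \<in> T. c x \<in> A}. \<theta>)"
      using T finite_U by (intro prod.mono_neutral_cong_right) auto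
    then show ?thesis by simp
  qed
  then have "measure_pmf.expectation law (\<lambda>c. \<theta> ^ card {x \<in> T. c x \<in> A}) =
      (\<Prod>x\<in>U. measure_pmf.expectation \<mu> (?f x))"
    using \<theta> by (simp only:) (rule expectation_prod_Pi_pmf[OF finite_U], auto)
  also have "\<dots> = (\<Prod>x\<in>T. measure_pmf.expectation \<mu> (?f x))"
    using T finite_U by (intro prod.mono_neutral_right) auto
  also have "\<dots> \<le> (\<Prod>x\<in>T. exp ((\<theta> - 1) * a))"
  proof (intro prod_mono conjI)
    fix x assume x: "x \<in> T"
    have "?f x = (\<lambda>v. 1 + (\<theta> - 1) * indicator A v)" using x by (auto simp: indicator_def)
    then have "measure_pmf.expectation \<mu> (?f x) = 1 + (\<theta> - 1) * measure_pmf.prob \<mu> A"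
      by (simp add: Bochner_Integration.integral_add)
    also have "\<dots> \<le> 1 + (\<theta> - 1) * a" using \<theta> a by (intro add_left_mono mult_left_mono) auto
    also have "\<dots> \<le> exp ((\<theta> - 1) * a)" by (rule exp_ge_add_one_self)
    finally show "measure_pmf.expectation \<mu> (?f x) \<le> exp ((\<theta> - 1) * a)" .
    show "0 \<le> measure_pmf.expectation \<mu> (?f x)" using \<theta> by (intro Bochner_Integration.integral_nonneg) auto
  qed
  also have "\<dots> = exp (real (card T) * ((\<theta> - 1) * a))" by (simp add: exp_of_nat_mult)
  also have "\<dots> \<le> exp ((\<theta> - 1) * real n * a)"
  proof -
    have "real (card T) * ((\<theta> - 1) * a) \<le> real n * ((\<theta> - 1) * a)"
      using T \<theta> a0 by (intro mult_right_mono) auto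
    then show ?thesis by (simp add: algebra_simps)
  qed
  finally show ?thesis .
qed

lemma markov:
  assumes "\<And>c. u c \<ge> 0" "t > 0" "measure_pmf.expectation law u \<le> m"
  shows "measure_pmf.prob law {c. u c \<ge> t} \<le> m / t"
proof -
  have "measure_pmf.prob law {c \<in> space (measure_pmf law). u c \<ge> t} \<le> measure_pmf.expectation law u / t"
    using assms by (intro integral_Markov_inequality_measure[where A = "space (measure_pmf law)"]) auto
  also have "\<dots> \<le> m / t" using assms by (intro divide_right_mono) auto
  finally show ?thesis by simp
qed

lemma chernoff:
  assumes T: "T \<subseteq> U" "card T \<le> n" and \<theta>: "\<theta> \<ge> 1" and a: "measure_pmf.prob \<mu> A \<le> a"
  shows "measure_pmf.prob law {c. real (card {x \<in> T. c x \<in> A}) \<ge> \<beta>} \<le> exp ((\<theta> - 1) * real n * a) / \<theta> powr \<beta>"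
proof -
  have "measure_pmf.prob law {c. real (card {x \<in> T. c x \<in> A}) \<ge> \<beta>} \<le>
      measure_pmf.prob law {c. \<theta> ^ card {x \<in> T. c x \<in> A} \<ge> \<theta> powr \<beta>}"
  proof (intro measure_pmf.finite_measure_mono)
    show "{c. real (card {x \<in> T. c x \<in> A}) \<ge> \<beta>} \<subseteq> {c. \<theta> ^ card {x \<in> T. c x \<in> A} \<ge> \<theta> powr \<beta>}"
    proof (intro subsetI CollectI, elim CollectE)
      fix c assume "real (card {x \<in> T. c x \<in> A}) \<ge> \<beta>"
      then have "\<theta> powr \<beta> \<le> \<theta> powr real (card {x \<in> T. c x \<in> A})" using \<theta> by (intro powr_mono) auto
      then show "\<theta> powr \<beta> \<le> \<theta> ^ card {x \<in> T. c x \<in> A}" using \<theta> by (simp add: powr_realpow)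
    qed
  qed simp
  also have "\<dots> \<le> exp ((\<theta> - 1) * real n * a) / \<theta> powr \<beta>"
    using \<theta> by (intro markov expectation_power_count assms) auto
  finally show ?thesis .
qed

end

section \<open>Deterministic growth of a stuck set from block to block\<close>

definition ends :: "'b \<times> 'b \<Rightarrow> 'b set" where
  "ends c = {fst c, snd c}"

lemma card_ends_le: "card (ends c) \<le> 2"
  by (simp add: ends_def card_insert_if)

lemma finite_ends [simp]: "finite (ends c)"
  by (simp add: ends_def)

definition stuck :: "('a \<Rightarrow> 'b \<times> 'b) \<Rightarrow> nat \<Rightarrow> 'a set \<Rightarrow> bool" where
  "stuck c l I \<longleftrightarrow> (\<forall>x\<in>I. \<forall>j\<in>ends (c x). l < card {y \<in> I. j \<in> ends (c y)})"

definition touched :: "('a \<Rightarrow> 'b \<times> 'b) \<Rightarrow> 'a set \<Rightarrow> 'b set" where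
  "touched c I = (\<Union>x\<in>I. ends (c x))"

lemma no_stopping_iff: "no_stopping (\<lambda>x. ends (c x)) l T \<longleftrightarrow> (\<forall>I\<subseteq>T. stuck c l I \<longrightarrow> I = {})"
  unfolding no_stopping_def stuck_def by (meson not_le)

lemma sum_card_incidences:
  assumes "finite J" "finite N"
  shows "(\<Sum>j\<in>J. card {y \<in> N. j \<in> ends (c y)}) \<le> 2 * card N"
proof -
  have "(\<Sum>j\<in>J. card {y \<in> N. j \<in> ends (c y)}) = (\<Sum>y\<in>N. card {j \<in> J. j \<in> ends (c y)})"
    using assms by (intro sum_multicount_gen) auto
  also have "\<dots> \<le> (\<Sum>y\<in>N. 2)"
    by (intro sum_mono order_trans[OF card_mono card_ends_le]) auto
  finally show ?thesis by simp
qed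

text \<open>Double counting of incidences, each item having at most two ends. It makes small stuck
  sets dense: at least \<open>l * card J / 2\<close> items have both ends in the set
  \<open>J\<close> of touched cells.\<close>

lemma stuck_card:
  assumes "finite I" "stuck c l I"
  shows "l * card (touched c I) \<le> 2 * card I"
proof -
  have fin: "finite (touched c I)" using assms(1) by (simp add: touched_def)
  have "l * card (touched c I) = (\<Sum>j\<in>touched c I. l)" by simp
  also have "\<dots> \<le> (\<Sum>j\<in>touched c I. card {y \<in> I. j \<in> ends (c y)})"
    using assms(2) by (intro sum_mono) (force simp: touched_def stuck_def)
  also have "\<dots> \<le> 2 * card I" by (rule sum_card_incidences[OF fin assms(1)])
  finally show ?thesis .
qed

text \<open>
  The cells of a stuck set in block \<open>b\<close> are either overfull with the items that do not reach below
  \<open>b\<close>, or hold at least \<open>\<eta> * l\<close> items that touch stuck cells of lower blocks.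
\<close>

lemma stuck_block_step:
  fixes blk :: "nat \<Rightarrow> nat" and c :: "'a \<Rightarrow> nat \<times> nat" and D :: nat
  defines "clean \<equiv> \<lambda>j v. fst v = j \<and> blk j \<le> blk (snd v) \<or> snd v = j \<and> blk j \<le> blk (fst v)"
  assumes T: "finite T" "I \<subseteq> T" and st: "stuck c l I" and rng: "\<And>x. x \<in> T \<Longrightarrow> ends (c x) \<subseteq> {1..M}"
    and \<eta>: "\<eta> > 0" and l: "l > 0"
  defines "bad \<equiv> {j\<in>{1..M}. real (card {x \<in> T. clean j (c x)}) \<ge> (1 - \<eta>) * real l}"
    and "excess \<equiv> (\<Sum>j\<in>{1..M}. card {x \<in> T. j \<in> ends (c x)} - D)"
  shows "\<eta> * real l * real (card {j \<in> touched c I. blk j = b}) \<le>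
    \<eta> * real l * real (card bad) + 2 * (real D * real (card {j \<in> touched c I. blk j < b}) + real excess)"
proof -
  define J where "J = touched c I"
  have finI: "finite I" using T finite_subset by blast
  have J: "J \<subseteq> {1..M}" "finite J"
    using rng T finI by (auto simp: J_def touched_def)
  define N where "N = {y \<in> I. \<exists>j\<in>ends (c y). j \<in> J \<and> blk j < b}"
  have finN: "finite N" using finI by (simp add: N_def)
  \<comment> \<open>Every degree is capped at \<open>D\<close>; what lies above the cap is charged
    to \<open>excess\<close>, which is summed over all cells.\<close>
  have cardN: "card N \<le> D * card {j \<in> J. blk j < b} + excess"
  proof -
    have "N \<subseteq> (\<Union>j\<in>{j \<in> J. blk j < b}. {x \<in> T. j \<in> ends (c x)})" using T by (auto simp: N_def)
    then have "card N \<le> card (\<Union>j\<in>{j \<in> J. blk j < b}. {x \<in> T. j \<in> ends (c x)})"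
      using J T by (intro card_mono) auto
    also have "\<dots> \<le> (\<Sum>j\<in>{j \<in> J. blk j < b}. card {x \<in> T. j \<in> ends (c x)})"
      using J by (intro card_UN_le) auto
    also have "\<dots> \<le> (\<Sum>j\<in>{j \<in> J. blk j < b}. D + (card {x \<in> T. j \<in> ends (c x)} - D))"
      by (intro sum_mono) simp
    also have "\<dots> = D * card {j \<in> J. blk j < b} + (\<Sum>j\<in>{j \<in> J. blk j < b}. card {x \<in> T. j \<in> ends (c x)} - D)"
      by (simp add: sum.distrib)
    also have "(\<Sum>j\<in>{j \<in> J. blk j < b}. card {x \<in> T. j \<in> ends (c x)} - D) \<le> excess"
      unfolding excess_def using J by (intro sum_mono2) auto
    finally show ?thesis by simp
  qed
  \<comment> \<open>Cell \<open>j\<close> holds more than \<open>l\<close> items of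
    \<open>I\<close>. As it is not bad, fewer than \<open>(1 - \<eta>) * l\<close> of them are
    clean, and the others reach a lower block and so belong to \<open>N\<close>.\<close>
  have key: "\<eta> * real l \<le> real (card {y \<in> N. j \<in> ends (c y)})" if j: "j \<in> J" "blk j = b" "j \<notin> bad" for j
  proof -
    obtain x where x: "x \<in> I" "j \<in> ends (c x)" using j(1) by (auto simp: J_def touched_def)
    have "l < card {y \<in> I. j \<in> ends (c y)}" using st x by (auto simp: stuck_def)
    also have "\<dots> \<le> card ({y \<in> T. clean j (c y)} \<union> {y \<in> N. j \<in> ends (c y)})"
    proof (intro card_mono subsetI)
      fix y assume y: "y \<in> {y \<in> I. j \<in> ends (c y)}"
      show "y \<in> {y \<in> T. clean j (c y)} \<union> {y \<in> N. j \<in> ends (c y)}"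
      proof (cases "clean j (c y)")
        case False
        then obtain i where "i \<in> ends (c y)" "blk i < b" using y j(2) by (auto simp: clean_def ends_def not_le)
        moreover from this have "i \<in> J" using y by (auto simp: J_def touched_def)
        ultimately show ?thesis using y by (auto simp: N_def)
      qed (use y T in auto)
    qed (use T finN in auto)
    also have "\<dots> \<le> card {y \<in> T. clean j (c y)} + card {y \<in> N. j \<in> ends (c y)}" by (rule card_Un_le)
    finally have "real l < real (card {y \<in> T. clean j (c y)}) + real (card {y \<in> N. j \<in> ends (c y)})" by linarith
    moreover have "real (card {x \<in> T. clean j (c x)}) < (1 - \<eta>) * real l"
      using j J by (auto simp: bad_def)
    ultimately show ?thesis by (simp add: algebra_simps)
  qed
  have "\<eta> * real l * real (card ({j \<in> J. blk j = b} - bad)) = (\<Sum>j\<in>{j \<in> J. blk j = b} - bad. \<eta> * real l)" by simp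
  also have "\<dots> \<le> (\<Sum>j\<in>{j \<in> J. blk j = b} - bad. real (card {y \<in> N. j \<in> ends (c y)}))"
    using key by (intro sum_mono) auto
  also have "\<dots> = real (\<Sum>j\<in>{j \<in> J. blk j = b} - bad. card {y \<in> N. j \<in> ends (c y)})" by simp
  also have "\<dots> \<le> real (2 * card N)"
    using J finN by (intro of_nat_mono sum_card_incidences) auto
  also have "\<dots> \<le> 2 * (real D * real (card {j \<in> J. blk j < b}) + real excess)"
    using of_nat_mono[OF cardN, where 'a = real] by simp
  finally have 1: "\<eta> * real l * real (card ({j \<in> J. blk j = b} - bad)) \<le> 2 * (real D * real (card {j \<in> J. blk j < b}) + real excess)" .
  have finb: "finite bad" by (simp add: bad_def)
  have "card {j \<in> J. blk j = b} \<le> card (({j \<in> J. blk j = b} - bad) \<union> bad)"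
    using J finb by (intro card_mono) auto
  also have "\<dots> \<le> card ({j \<in> J. blk j = b} - bad) + card bad" by (rule card_Un_le)
  finally have "\<eta> * real l * real (card {j \<in> J. blk j = b}) \<le> \<eta> * real l * real (card ({j \<in> J. blk j = b} - bad) + card bad)"
    using \<eta> by (intro mult_left_mono of_nat_mono) auto
  then show ?thesis using 1 unfolding J_def by (simp add: algebra_simps)
qed

text \<open>With \<open>s b\<close> the number of touched cells in blocks below \<open>b\<close>,
  \<open>stuck_block_step\<close> is the recurrence \<open>s (Suc b) <= Q * s b + Y\<close>, and
  \<open>s b <= Y * b * Q ^ b\<close> follows. For \<open>D = 8 * l\<close> the factor
  \<open>Q\<close> is \<open>1 + 16 / \<eta>\<close>, independent of \<open>l\<close>.\<close>

lemma stuck_touched_small: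
  fixes blk :: "nat \<Rightarrow> nat" and c :: "'a \<Rightarrow> nat \<times> nat" and D :: nat
  defines "clean \<equiv> \<lambda>j v. fst v = j \<and> blk j \<le> blk (snd v) \<or> snd v = j \<and> blk j \<le> blk (fst v)"
  assumes T: "finite T" "I \<subseteq> T" and st: "stuck c l I" and rng: "\<And>x. x \<in> T \<Longrightarrow> ends (c x) \<subseteq> {1..M}"
    and \<eta>: "\<eta> > 0" and l: "l > 0" and blk: "\<And>j. j \<in> {1..M} \<Longrightarrow> blk j < B"
  defines "bad \<equiv> {j\<in>{1..M}. real (card {x \<in> T. clean j (c x)}) \<ge> (1 - \<eta>) * real l}"
    and "excess \<equiv> (\<Sum>j\<in>{1..M}. card {x \<in> T. j \<in> ends (c x)} - D)"
    and "Q \<equiv> 1 + 2 * real D / (\<eta> * real l)"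
  shows "real (card (touched c I)) \<le> (real (card bad) + 2 * real excess / (\<eta> * real l)) * real B * Q ^ B"
proof -
  define Y where "Y = real (card bad) + 2 * real excess / (\<eta> * real l)"
  define s where "s = (\<lambda>b. real (card {j \<in> touched c I. blk j < b}))"
  have Y0: "Y \<ge> 0" using \<eta> by (simp add: Y_def)
  have Q1: "Q \<ge> 1" using \<eta> by (simp add: Q_def)
  have finI: "finite I" using T finite_subset by blast
  then have finJ: "finite (touched c I)" by (simp add: touched_def)
  have step: "s (Suc b) \<le> Q * s b + Y" for b
  proof -
    have "{j \<in> touched c I. blk j < Suc b} = {j \<in> touched c I. blk j < b} \<union> {j \<in> touched c I. blk j = b}" by auto
    then have eq: "s (Suc b) = s b + real (card {j \<in> touched c I. blk j = b})"
      unfolding s_def using finJ by (subst card_Un_disjoint[symmetric, THEN arg_cong[of _ _ real], simplified]) auto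
    have nl: "\<eta> * real l > 0" using \<eta> l by simp
    have "\<eta> * real l * real (card {j \<in> touched c I. blk j = b}) \<le>
      \<eta> * real l * real (card bad) + 2 * (real D * s b + real excess)"
      unfolding s_def bad_def excess_def clean_def
      by (rule stuck_block_step[OF T st rng \<eta> l])
    then have "real (card {j \<in> touched c I. blk j = b}) \<le>
      (\<eta> * real l * real (card bad) + 2 * (real D * s b + real excess)) / (\<eta> * real l)"
      using nl by (simp add: pos_le_divide_eq mult.commute)
    also have "\<dots> = Y + (2 * real D / (\<eta> * real l)) * s b"
      unfolding Y_def using \<eta> l by (simp add: add_divide_distrib distrib_left)
    finally show ?thesis unfolding eq Q_def by (simp add: algebra_simps)
  qed
  have bound: "s b \<le> Y * real b * Q ^ b" for b
  proof (induction b)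
    case 0
    then show ?case by (simp add: s_def)
  next
    case (Suc b)
    have "s (Suc b) \<le> Q * (Y * real b * Q ^ b) + Y * 1"
      using add_mono[OF mult_left_mono[OF Suc, of Q] order_refl[of Y]] step[of b] Q1 by linarith
    also have "\<dots> \<le> Q * (Y * real b * Q ^ b) + Y * Q ^ Suc b"
      using Y0 Q1 one_le_power[of Q "Suc b"] by (intro add_left_mono mult_left_mono) auto
    finally show ?case by (simp add: algebra_simps)
  qed
  have "touched c I \<subseteq> {1..M}" using rng T by (auto simp: touched_def)
  then have "{j \<in> touched c I. blk j < B} = touched c I" using blk by auto
  then show ?thesis using bound[of B] by (simp add: s_def Y_def)
qed

section \<open>Probability that a stuck set exists\<close>

lemma iid_items_item_law: "sketch_params P \<Longrightarrow> iid_items (item_law P) (universe P)"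
proof
  assume "sketch_params P"
  then interpret sketch_params P .
  show "finite (set_pmf (item_law P))" by (rule finite_subset[OF set_item_law]) auto
qed simp

context sketch_params
begin

sublocale items: iid_items "item_law P" "universe P" "(0, 0)"
  using iid_items_item_law[OF sketch_params_axioms] .

lemma law_range:
  assumes "c \<in> set_pmf items.law" "x \<in> U"
  shows "ends (c x) \<subseteq> {1..cells P}"
proof -
  have "c x \<in> set_pmf \<mu>" using assms by (simp add: set_Pi_pmf PiE_dflt_def)
  then show ?thesis using set_item_law by (force simp: ends_def)
qed

definition overfull :: "real \<Rightarrow> nat \<Rightarrow> nat \<Rightarrow> int set \<Rightarrow> (int \<Rightarrow> nat \<times> nat) \<Rightarrow> nat set" where
  "overfull \<eta> l B T c = {j\<in>{1..cells P}. real (card {x \<in> T. c x \<in> forward B j}) \<ge> (1 - \<eta>) * real l}"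

definition excess_degree :: "nat \<Rightarrow> int set \<Rightarrow> (int \<Rightarrow> nat \<times> nat) \<Rightarrow> nat" where
  "excess_degree D T c = (\<Sum>j\<in>{1..cells P}. card {x \<in> T. j \<in> ends (c x)} - D)"

text \<open>Markov's inequality for the number of overfull cells. The cells are dependent; only
  linearity of expectation enters, with a Chernoff bound for a single cell.\<close>

lemma prob_overfull:
  assumes T: "T \<subseteq> U" "card T \<le> d" and \<eta>: "0 < \<eta>" "\<eta> < 1" and B: "B > 0" and u: "u > 0"
    and load: "real d * hit * (1 + 2 * ((coupling P + 1) * (1 / real (cells P) + 1 / real B))) \<le> (1 - 2 * \<eta>) * real l"
  shows "measure_pmf.prob items.law {c. u * real (cells P) \<le> real (card (overfull \<eta> l B T c))} \<le> exp (- (\<eta> ^ 3 * real l)) / u"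
proof -
  define \<gamma> where "\<gamma> = (coupling P + 1) * (1 / real (cells P) + 1 / real B)"
  let ?E = "\<lambda>j. {c. (1 - \<eta>) * real l \<le> real (card {x \<in> T. c x \<in> forward B j})}"
  have one: "measure_pmf.prob items.law (?E j) \<le> exp (- (\<eta> ^ 3 * real l))" for j
  proof -
    have "measure_pmf.prob items.law (?E j) \<le>
        exp ((1 + \<eta> - 1) * real d * (hit * (1 + 2 * \<gamma>))) / (1 + \<eta>) powr ((1 - \<eta>) * real l)"
      by (rule items.chernoff[OF T]) (use prob_forward[OF B] \<eta> in \<open>auto simp: \<gamma>_def\<close>)
    also have "\<dots> = exp (\<eta> * (real d * hit * (1 + 2 * \<gamma>)) - (1 - \<eta>) * real l * ln (1 + \<eta>))"
      using \<eta> by (simp add: powr_def exp_diff mult_ac)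
    also have "\<dots> \<le> exp (- (\<eta> ^ 3 * real l))"
    \<comment> \<open>By \<open>load\<close> and \<open>ln (1 + \<eta>) >= \<eta> - \<eta>^2\<close>
      the exponent is at most \<open>\<eta> * (1 - 2 * \<eta>) - (1 - \<eta>) * (\<eta> -
      \<eta>^2)\<close> times \<open>l\<close>, and this difference equals
      \<open>- \<eta>^3\<close>.\<close>
    proof -
      have "\<eta> * (real d * hit * (1 + 2 * \<gamma>)) \<le> \<eta> * ((1 - 2 * \<eta>) * real l)"
        using load \<eta> unfolding \<gamma>_def by (intro mult_left_mono) auto
      moreover have "(1 - \<eta>) * real l * (\<eta> - \<eta>\<^sup>2) \<le> (1 - \<eta>) * real l * ln (1 + \<eta>)"
        using \<eta> by (intro mult_left_mono ln_one_plus_pos_lower_bound) auto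
      ultimately show ?thesis by (simp add: algebra_simps power2_eq_square power3_eq_cube)
    qed
    finally show ?thesis .
  qed
  have card: "real (card (overfull \<eta> l B T c)) = (\<Sum>j\<in>{1..cells P}. indicator (?E j) c)" for c
    unfolding overfull_def by (simp add: indicator_def sum.If_cases Int_def)
  have "measure_pmf.expectation items.law (\<lambda>c. real (card (overfull \<eta> l B T c))) =
      (\<Sum>j\<in>{1..cells P}. measure_pmf.prob items.law (?E j))"
    unfolding card by (subst Bochner_Integration.integral_sum) auto
  also have "\<dots> \<le> (\<Sum>j\<in>{1..cells P}. exp (- (\<eta> ^ 3 * real l)))" by (intro sum_mono one)
  finally have "measure_pmf.expectation items.law (\<lambda>c. real (card (overfull \<eta> l B T c))) \<le>
      real (cells P) * exp (- (\<eta> ^ 3 * real l))" by simp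
  then have "measure_pmf.prob items.law {c. u * real (cells P) \<le> real (card (overfull \<eta> l B T c))} \<le>
      real (cells P) * exp (- (\<eta> ^ 3 * real l)) / (u * real (cells P))"
    using u M by (intro items.markov) auto
  then show ?thesis using M by simp
qed

text \<open>The cap \<open>8 * l\<close> is twice the bound \<open>4 * l\<close> on the mean degree.
  Since \<open>n - 8 * l <= 2 ^ n / 2 ^ (8 * l)\<close>, the expected excess of a cell is at most
  \<open>exp (4 * l) / 2 ^ (8 * l) = (exp 1 / 4) ^ (4 * l) <= 1\<close>.\<close>

lemma prob_excess:
  assumes T: "T \<subseteq> U" "card T \<le> d" and v: "v > 0" and load: "real d * (2 * hit) \<le> 4 * real l"
  shows "measure_pmf.prob items.law {c. v * real (cells P) \<le> real (excess_degree (8 * l) T c)} \<le> 1 / v"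
proof -
  have one: "measure_pmf.expectation items.law (\<lambda>c. real (card {x \<in> T. j \<in> ends (c x)} - 8 * l)) \<le> 1" for j
  proof -
    let ?A = "{c. j = fst c \<or> j = snd c}"
    have "real (n - 8 * l) \<le> 2 ^ n / 2 ^ (8 * l)" for n
    proof (cases "n \<ge> 8 * l")
      case True
      have "real (n - 8 * l) \<le> 2 ^ (n - 8 * l)" using of_nat_less_two_power by (rule less_imp_le)
      also have "(2 :: real) ^ (n - 8 * l) = 2 ^ n / 2 ^ (8 * l)" using True by (simp add: power_diff)
      finally show ?thesis .
    qed simp
    then have "measure_pmf.expectation items.law (\<lambda>c. real (card {x \<in> T. j \<in> ends (c x)} - 8 * l)) \<le>
        measure_pmf.expectation items.law (\<lambda>c. 2 ^ card {x \<in> T. c x \<in> ?A} / 2 ^ (8 * l))"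
      by (intro integral_mono) (auto simp: ends_def)
    also have "\<dots> = measure_pmf.expectation items.law (\<lambda>c. 2 ^ card {x \<in> T. c x \<in> ?A}) / 2 ^ (8 * l)"
      by simp
    also have "\<dots> \<le> exp ((2 - 1) * real d * (2 * hit)) / 2 ^ (8 * l)"
      by (intro divide_right_mono items.expectation_power_count[OF T] prob_in_cell) auto
    also have "\<dots> \<le> exp (4 * real l) / 2 ^ (8 * l)" using load by (intro divide_right_mono) auto
    also have "\<dots> = (exp 1 / 4) ^ (4 * l)"
      by (simp add: power_divide exp_of_nat_mult[symmetric] power_mult[symmetric]) (simp add: power_mult)
    also have "\<dots> \<le> 1" using exp_le by (intro power_le_one) auto
    finally show ?thesis .
  qed
  have "measure_pmf.expectation items.law (\<lambda>c. real (excess_degree (8 * l) T c)) =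
      (\<Sum>j\<in>{1..cells P}. measure_pmf.expectation items.law (\<lambda>c. real (card {x \<in> T. j \<in> ends (c x)} - 8 * l)))"
    unfolding excess_degree_def of_nat_sum by (subst Bochner_Integration.integral_sum) auto
  also have "\<dots> \<le> (\<Sum>j\<in>{1..cells P}. 1)" by (intro sum_mono one)
  finally have "measure_pmf.expectation items.law (\<lambda>c. real (excess_degree (8 * l) T c)) \<le> real (cells P)" by simp
  then have "measure_pmf.prob items.law {c. v * real (cells P) \<le> real (excess_degree (8 * l) T c)} \<le> real (cells P) / (v * real (cells P))"
    using v M by (intro items.markov) auto
  then show ?thesis using M by simp
qed

text \<open>The expected number of items inside \<open>J\<close> is smaller than the required number
  by a factor of order \<open>y = m / M\<close>. The Chernoff bound becomes
  \<open>(K * y) powr \<beta>\<close>. Half of the exponent absorbs the constant, by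
  \<open>K * sqrt y <= 1\<close>, and \<open>l >= 16\<close> leaves the exponent
  \<open>4 * m\<close>.\<close>

lemma prob_dense_set:
  assumes T: "T \<subseteq> U" "card T \<le> d" and d: "real d \<le> real l * real (cells P)" and l: "l \<ge> 16"
    and J: "finite J" "card J = m" "m \<ge> 1"
    and small: "real m / real (cells P) \<le> 1 / (2 * exp 1 * (coupling P + 1)\<^sup>2)\<^sup>2"
  shows "measure_pmf.prob items.law {c. real l * real m / 2 \<le> real (card {x \<in> T. c x \<in> J \<times> J})} \<le>
    (real m / real (cells P)) ^ (4 * m)"
proof -
  define K where "K = 2 * exp 1 * (coupling P + 1)\<^sup>2"
  define y where "y = real m / real (cells P)"
  define a where "a = (real m * ((coupling P + 1) / real (cells P)))\<^sup>2"
  define \<beta> where "\<beta> = real l * real m / 2"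
  \<comment> \<open>Chosen so that \<open>\<theta>\<close> times the bound \<open>l * M * a\<close>
    on the mean is exactly \<open>\<beta>\<close>.\<close>
  define \<theta> where "\<theta> = exp 1 / (K * y)"
  have K: "K \<ge> 1"
  proof -
    have "1 \<le> (coupling P + 1)\<^sup>2" using z by (simp add: one_le_power)
    moreover have "(1 :: real) \<le> 2 * exp 1" using exp_ge_add_one_self[of 1] by simp
    ultimately show ?thesis unfolding K_def using mult_mono[of 1 "2 * exp 1" 1 "(coupling P + 1)\<^sup>2"] by simp
  qed
  have y: "y > 0" using J M by (simp add: y_def)
  have yK: "y \<le> 1 / K\<^sup>2" using small by (simp add: y_def K_def)
  have K2: "K\<^sup>2 \<ge> 1" using K by (simp add: one_le_power)
  have y1: "y \<le> 1"
  proof -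
    have "1 / K\<^sup>2 \<le> 1 / 1" by (rule divide_left_mono) (use K2 in auto)
    then show ?thesis using yK by linarith
  qed
  have "sqrt y \<le> 1 / K"
  proof -
    have "sqrt y \<le> sqrt (1 / K\<^sup>2)" using yK by (rule real_sqrt_le_mono)
    then show ?thesis using K by (simp add: real_sqrt_divide)
  qed
  then have "K * sqrt y \<le> 1" using K by (simp add: field_simps)
  then have "K * sqrt y * sqrt y \<le> 1 * sqrt y" using y by (intro mult_right_mono) auto
  then have Ky: "K * y \<le> sqrt y" using y by (simp add: mult.assoc)
  have Kyp: "K * y > 0" using K y by simp
  have "sqrt y \<le> 1" using y1 by simp
  then have "K * y \<le> exp 1" using Ky exp_ge_add_one_self[of 1] by linarith
  then have "\<theta> \<ge> 1" unfolding \<theta>_def using Kyp by (simp add: le_divide_eq)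
  have "measure_pmf.prob items.law {c. \<beta> \<le> real (card {x \<in> T. c x \<in> J \<times> J})} \<le> exp ((\<theta> - 1) * real d * a) / \<theta> powr \<beta>"
    unfolding a_def using prob_both_endpoints[OF J(1)] J(2) by (intro items.chernoff T \<open>\<theta> \<ge> 1\<close>) simp
  also have "\<dots> \<le> exp \<beta> / \<theta> powr \<beta>"
  proof (rule divide_right_mono)
    have "(\<theta> - 1) * real d * a \<le> \<theta> * (real l * real (cells P)) * a"
      using d \<open>\<theta> \<ge> 1\<close> by (intro mult_right_mono mult_mono) (auto simp: a_def)
    also have "\<dots> = \<beta>"
    proof -
      have "e / (2 * e * s\<^sup>2 * (x / w)) * (r * w) * (x * (s / w))\<^sup>2 = r * x / 2"
        if "s > 0" "w > 0" "x > 0" "e > 0" for s w x e r :: real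
        using that by (simp add: field_simps power2_eq_square)
      from this[of "coupling P + 1" "real (cells P)" "real m" "exp 1" "real l"] show ?thesis
        using M z J unfolding \<theta>_def a_def \<beta>_def K_def y_def by simp
    qed
    finally show "exp ((\<theta> - 1) * real d * a) \<le> exp \<beta>" by simp
  qed simp
  also have "\<dots> = (K * y) powr \<beta>"
  proof -
    have "exp \<beta> = exp 1 powr \<beta>" by (simp add: powr_def)
    then have "exp \<beta> / \<theta> powr \<beta> = (exp 1 / \<theta>) powr \<beta>" using \<open>\<theta> \<ge> 1\<close> by (simp add: powr_divide)
    then show ?thesis using Kyp by (simp add: \<theta>_def)
  qed
  also have "\<dots> \<le> sqrt y powr \<beta>" using Ky Kyp by (intro powr_mono2) (auto simp: \<beta>_def)
  also have "\<dots> = y powr (\<beta> / 2)" using y by (simp add: powr_half_sqrt[symmetric] powr_powr)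
  also have "\<dots> \<le> y powr real (4 * m)"
  proof (rule powr_mono')
    have "16 * real m \<le> real l * real m" using l by (intro mult_right_mono) auto
    then show "real (4 * m) \<le> \<beta> / 2" by (simp add: \<beta>_def)
  qed (use y y1 in auto)
  also have "\<dots> = y ^ (4 * m)" by (rule powr_realpow[OF y])
  finally show ?thesis by (simp add: \<beta>_def y_def)
qed

text \<open>The binomial coefficient costs \<open>(exp 1 / y) ^ m\<close>, so that
  \<open>(exp 1 * y ^ 3) ^ m <= (y^2) ^ m\<close> remains of \<open>y ^ (4 * m)\<close>. One factor
  \<open>y^2 = m^2 / M^2\<close> is kept for the decay in \<open>M\<close>; the others are at most
  \<open>1 / 16\<close> each and make the sum over \<open>m\<close> geometric.\<close>

lemma prob_some_dense_set:
  assumes T: "T \<subseteq> U" "card T \<le> d" and d: "real d \<le> real l * real (cells P)" and l: "l \<ge> 16"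
    and \<zeta>: "\<zeta> \<le> 1 / 4" "\<zeta> \<le> 1 / (2 * exp 1 * (coupling P + 1)\<^sup>2)\<^sup>2"
  shows "measure_pmf.prob items.law {c. \<exists>J\<subseteq>{1..cells P}. J \<noteq> {} \<and> real (card J) \<le> \<zeta> * real (cells P) \<and>
     real l * real (card J) / 2 \<le> real (card {x \<in> T. c x \<in> J \<times> J})} \<le> 16 / (real (cells P))\<^sup>2"
proof -
  let ?M = "real (cells P)"
  define A where "A = (\<lambda>J :: nat set. {c. real l * real (card J) / 2 \<le> real (card {x \<in> T. c x \<in> J \<times> J})})"
  define S where "S = {m \<in> {1..cells P}. real m \<le> \<zeta> * ?M}"
  have M0: "?M > 0" using M by simp
  have term_le: "measure_pmf.prob items.law (\<Union>J\<in>{J. J \<subseteq> {1..cells P} \<and> card J = m}. A J) \<le> 16 / ?M\<^sup>2 * (1 / 4) ^ m"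
    if m: "m \<in> S" for m
  proof -
    define y where "y = real m / ?M"
    have m1: "m \<ge> 1" and my: "real m \<le> \<zeta> * ?M" using m by (auto simp: S_def)
    have y\<zeta>: "y \<le> \<zeta>" using my M0 by (simp add: y_def field_simps)
    have y0: "y > 0" using m1 M0 by (simp add: y_def)
    have "measure_pmf.prob items.law (\<Union>J\<in>{J. J \<subseteq> {1..cells P} \<and> card J = m}. A J) \<le>
        (\<Sum>J\<in>{J. J \<subseteq> {1..cells P} \<and> card J = m}. measure_pmf.prob items.law (A J))"
      by (rule measure_UNION_le) auto
    also have "\<dots> \<le> (\<Sum>J\<in>{J. J \<subseteq> {1..cells P} \<and> card J = m}. y ^ (4 * m))"
    proof (rule sum_mono)
      fix J assume J: "J \<in> {J. J \<subseteq> {1..cells P} \<and> card J = m}"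
      then have "finite J" "card J = m" using finite_subset by auto
      moreover have "real m / ?M \<le> 1 / (2 * exp 1 * (coupling P + 1)\<^sup>2)\<^sup>2"
        using y\<zeta> \<zeta>(2) unfolding y_def by (rule order_trans)
      ultimately show "measure_pmf.prob items.law (A J) \<le> y ^ (4 * m)"
        unfolding A_def y_def using prob_dense_set[OF T d l _ _ m1] by blast
    qed
    also have "\<dots> = real (cells P choose m) * y ^ (4 * m)" using n_subsets[of "{1..cells P}" m] by simp
    also have "\<dots> \<le> (exp 1 * ?M / real m) ^ m * y ^ (4 * m)"
      using y0 by (intro mult_right_mono binomial_le_exp_power m1) auto
    also have "\<dots> = (exp 1 * y ^ 3) ^ m"
    proof -
      have "exp 1 * ?M / real m * y ^ 4 = exp 1 * y ^ 3"
        using m1 M0 y0 by (simp add: y_def eval_nat_numeral)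
      then show ?thesis by (simp only: power_mult power_mult_distrib[symmetric])
    qed
    also have "\<dots> \<le> (y\<^sup>2) ^ m"
    proof (rule power_mono)
      have "exp 1 * y \<le> 4 * (1 / 4)" using exp_le y\<zeta> \<zeta>(1) y0 by (intro mult_mono) auto
      then have "exp 1 * y * y\<^sup>2 \<le> 1 * y\<^sup>2" by (intro mult_right_mono) auto
      then show "exp 1 * y ^ 3 \<le> y\<^sup>2" by (simp add: power3_eq_cube power2_eq_square mult.assoc)
    qed (use y0 in simp)
    also have "\<dots> = y\<^sup>2 * (y\<^sup>2) ^ (m - 1)" using m1 by (cases m) auto
    also have "\<dots> \<le> y\<^sup>2 * ((1 / 4)\<^sup>2) ^ (m - 1)"
      using y0 y\<zeta> \<zeta>(1) by (intro mult_left_mono power_mono) auto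
    also have "\<dots> = (real m)\<^sup>2 / ?M\<^sup>2 * (1 / 16) ^ (m - 1)" by (simp add: y_def power_divide)
    also have "\<dots> \<le> 4 ^ m / ?M\<^sup>2 * (1 / 16) ^ (m - 1)"
    proof -
      have "m \<le> 2 ^ m" using less_exp by (rule less_imp_le)
      then have "real m \<le> real (2 ^ m)" by (simp only: of_nat_le_iff)
      then have "(real m)\<^sup>2 \<le> (2 ^ m)\<^sup>2" by (intro power_mono) auto
      also have "(2 ^ m :: real)\<^sup>2 = 4 ^ m" by (simp add: power_mult[symmetric] mult.commute[of m]) (simp add: power_mult)
      finally show ?thesis using M0 by (intro mult_right_mono divide_right_mono) auto
    qed
    also have "\<dots> = 16 / ?M\<^sup>2 * (4 ^ m * (1 / 16) ^ m)" using m1 by (cases m) auto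
    also have "4 ^ m * (1 / 16) ^ m = (1 / 4 :: real) ^ m" by (simp add: power_mult_distrib[symmetric])
    finally show ?thesis .
  qed
  have "measure_pmf.prob items.law {c. \<exists>J\<subseteq>{1..cells P}. J \<noteq> {} \<and> real (card J) \<le> \<zeta> * ?M \<and>
     real l * real (card J) / 2 \<le> real (card {x \<in> T. c x \<in> J \<times> J})} \<le>
     measure_pmf.prob items.law (\<Union>m\<in>S. \<Union>J\<in>{J. J \<subseteq> {1..cells P} \<and> card J = m}. A J)"
  proof (rule measure_pmf.finite_measure_mono)
    show "{c. \<exists>J\<subseteq>{1..cells P}. J \<noteq> {} \<and> real (card J) \<le> \<zeta> * ?M \<and>
     real l * real (card J) / 2 \<le> real (card {x \<in> T. c x \<in> J \<times> J})} \<subseteq>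
     (\<Union>m\<in>S. \<Union>J\<in>{J. J \<subseteq> {1..cells P} \<and> card J = m}. A J)"
    proof
      fix c assume "c \<in> {c. \<exists>J\<subseteq>{1..cells P}. J \<noteq> {} \<and> real (card J) \<le> \<zeta> * ?M \<and>
        real l * real (card J) / 2 \<le> real (card {x \<in> T. c x \<in> J \<times> J})}"
      then obtain J where J: "J \<subseteq> {1..cells P}" "J \<noteq> {}" "real (card J) \<le> \<zeta> * ?M" "c \<in> A J"
        by (auto simp: A_def)
      have "card J \<le> cells P" using card_mono[OF _ J(1)] by simp
      moreover have "card J \<ge> 1" using J(1,2) finite_subset[OF J(1)] by (simp add: Suc_le_eq card_gt_0_iff)
      ultimately show "c \<in> (\<Union>m\<in>S. \<Union>J\<in>{J. J \<subseteq> {1..cells P} \<and> card J = m}. A J)"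
        using J by (auto simp: S_def)
    qed
  qed simp
  also have "\<dots> \<le> (\<Sum>m\<in>S. measure_pmf.prob items.law (\<Union>J\<in>{J. J \<subseteq> {1..cells P} \<and> card J = m}. A J))"
    by (rule measure_UNION_le) (auto simp: S_def)
  also have "\<dots> \<le> (\<Sum>m\<in>S. 16 / ?M\<^sup>2 * (1 / 4) ^ m)" by (intro sum_mono term_le)
  also have "\<dots> \<le> (\<Sum>m\<in>{1..cells P}. 16 / ?M\<^sup>2 * (1 / 4) ^ m)" by (intro sum_mono2) (auto simp: S_def)
  also have "\<dots> = 16 / ?M\<^sup>2 * (\<Sum>m\<in>{1..cells P}. (1 / 4) ^ m)" by (simp add: sum_distrib_left)
  also have "\<dots> \<le> 16 / ?M\<^sup>2 * 1"
  proof (rule mult_left_mono)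
    show "(\<Sum>m\<in>{1..cells P}. (1 / 4 :: real) ^ m) \<le> 1"
    proof -
      define q :: real where "q = 1 / 4"
      have "3 * (\<Sum>m\<in>{1..n}. q ^ m) = 1 - q ^ n" for n
      proof (induction n)
        case (Suc n)
        have "(\<Sum>m\<in>{1..Suc n}. q ^ m) = (\<Sum>m\<in>{1..n}. q ^ m) + q * q ^ n" by simp
        moreover have "q * q ^ n = q ^ n / 4" by (simp add: q_def)
        ultimately show ?case using Suc unfolding power_Suc by linarith
      qed simp
      moreover have "0 \<le> q ^ cells P" by (simp add: q_def)
      ultimately have "(\<Sum>m\<in>{1..cells P}. q ^ m) \<le> 1" by (smt (verit))
      then show ?thesis by (simp add: q_def)
    qed
  qed simp
  finally show ?thesis by simp
qed

text \<open>Outside \<open>E1\<close> and \<open>E2\<close> a stuck set touches at most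
  \<open>\<zeta> * M\<close> cells, by \<open>stuck_touched_small\<close>. By
  \<open>stuck_card\<close> these cells are dense, which is the event \<open>E3\<close>.\<close>

theorem prob_stopping:
  assumes T: "T \<subseteq> U" "card T \<le> d" and \<eta>: "0 < \<eta>" "\<eta> < 1" and B: "B > 0" and uv: "u > 0" "v > 0"
    and load: "real d * hit * (1 + 2 * ((coupling P + 1) * (1 / real (cells P) + 1 / real B))) \<le> (1 - 2 * \<eta>) * real l"
    and load': "real d * (2 * hit) \<le> 4 * real l" and d: "real d \<le> real l * real (cells P)" and l: "l \<ge> 16"
    and \<zeta>: "\<zeta> \<le> 1 / 4" "\<zeta> \<le> 1 / (2 * exp 1 * (coupling P + 1)\<^sup>2)\<^sup>2"
    and uv\<zeta>: "(u + 2 * v / (\<eta> * real l)) * real B * (1 + 16 / \<eta>) ^ B \<le> \<zeta>"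
  shows "measure_pmf.prob items.law {c. \<not> no_stopping (\<lambda>x. ends (c x)) l T} \<le>
    exp (- (\<eta> ^ 3 * real l)) / u + 1 / v + 16 / (real (cells P))\<^sup>2"
proof -
  let ?M = "real (cells P)"
  define E1 where "E1 = {c. u * ?M \<le> real (card (overfull \<eta> l B T c))}"
  define E2 where "E2 = {c. v * ?M \<le> real (excess_degree (8 * l) T c)}"
  define E3 where "E3 = {c. \<exists>J\<subseteq>{1..cells P}. J \<noteq> {} \<and> real (card J) \<le> \<zeta> * ?M \<and>
     real l * real (card J) / 2 \<le> real (card {x \<in> T. c x \<in> J \<times> J})}"
  have finT: "finite T" using T finite_subset finite_universe by blast
  have l0: "l > 0" using l by simp
  have "c \<in> E1 \<union> E2 \<union> E3" if c: "c \<in> set_pmf items.law" and ns: "\<not> no_stopping (\<lambda>x. ends (c x)) l T" for c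
  proof (rule ccontr)
    assume n: "c \<notin> E1 \<union> E2 \<union> E3"
    obtain I where I: "I \<subseteq> T" "stuck c l I" "I \<noteq> {}" using ns unfolding no_stopping_iff by blast
    have finI: "finite I" using I finT finite_subset by blast
    have rng: "ends (c x) \<subseteq> {1..cells P}" if "x \<in> T" for x using law_range[OF c] that T by blast
    define J where "J = touched c I"
    have J: "J \<subseteq> {1..cells P}" "J \<noteq> {}" using rng I by (auto simp: J_def touched_def ends_def)
    have fw: "c x \<in> forward B j \<longleftrightarrow> fst (c x) = j \<and> block P B j \<le> block P B (snd (c x)) \<or>
       snd (c x) = j \<and> block P B j \<le> block P B (fst (c x))" for x j by (simp add: forward_def)
    have "real (card J) \<le> (real (card (overfull \<eta> l B T c)) + 2 * real (excess_degree (8 * l) T c) / (\<eta> * real l)) *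
        real B * (1 + 2 * real (8 * l) / (\<eta> * real l)) ^ B"
      unfolding J_def overfull_def excess_degree_def fw
      by (rule stuck_touched_small[OF finT I(1,2) rng \<eta>(1) l0 block_less[OF _ B]])
    also have "1 + 2 * real (8 * l) / (\<eta> * real l) = 1 + 16 / \<eta>" using l0 \<eta> by simp
    also have "(real (card (overfull \<eta> l B T c)) + 2 * real (excess_degree (8 * l) T c) / (\<eta> * real l)) * real B * (1 + 16 / \<eta>) ^ B
       \<le> (u * ?M + 2 * (v * ?M) / (\<eta> * real l)) * real B * (1 + 16 / \<eta>) ^ B"
      using n \<eta> by (intro mult_right_mono add_mono divide_right_mono mult_left_mono) (auto simp: E1_def E2_def)
    also have "\<dots> = ((u + 2 * v / (\<eta> * real l)) * real B * (1 + 16 / \<eta>) ^ B) * ?M"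
      by (simp add: algebra_simps)
    also have "\<dots> \<le> \<zeta> * ?M" using uv\<zeta> by (intro mult_right_mono) auto
    finally have small: "real (card J) \<le> \<zeta> * ?M" .
    have "real (l * card J) \<le> real (2 * card I)" unfolding J_def of_nat_le_iff by (rule stuck_card[OF finI I(2)])
    moreover have "card I \<le> card {x \<in> T. c x \<in> J \<times> J}"
      using I(1) finT by (intro card_mono) (auto simp: J_def touched_def ends_def mem_Times_iff)
    ultimately have "real l * real (card J) / 2 \<le> real (card {x \<in> T. c x \<in> J \<times> J})" by simp
    then have "c \<in> E3" unfolding E3_def using J small by blast
    then show False using n by simp
  qed
  then have "{c. \<not> no_stopping (\<lambda>x. ends (c x)) l T} \<inter> set_pmf items.law \<subseteq> E1 \<union> E2 \<union> E3" by blast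
  then have "measure_pmf.prob items.law ({c. \<not> no_stopping (\<lambda>x. ends (c x)) l T} \<inter> set_pmf items.law) \<le>
      measure_pmf.prob items.law (E1 \<union> E2 \<union> E3)" by (intro measure_pmf.finite_measure_mono) auto
  also have "\<dots> \<le> measure_pmf.prob items.law (E1 \<union> E2) + measure_pmf.prob items.law E3" by (rule measure_Un_le) auto
  also have "measure_pmf.prob items.law (E1 \<union> E2) \<le> measure_pmf.prob items.law E1 + measure_pmf.prob items.law E2"
    by (rule measure_Un_le) auto
  finally show ?thesis
    using prob_overfull[OF T \<eta> B uv(1) load] prob_excess[OF T uv(2) load'] prob_some_dense_set[OF T d l \<zeta>]
    unfolding E1_def E2_def E3_def measure_Int_set_pmf by linarith
qed

end

section \<open>False decodings\<close>

lemma cong_trunc_small_degree: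
  assumes "cong_trunc p n F G" "degree F < n" "degree G < n"
  shows "cong_poly p F G"
  unfolding cong_poly_def
proof
  fix i show "[coeff F i = coeff G i] (mod int p)"
  proof (cases "i < n")
    case True
    then show ?thesis using assms(1) by (simp add: cong_trunc_def)
  next
    case False
    then have "coeff F i = 0" "coeff G i = 0" using assms(2,3) by (auto intro!: coeff_eq_0)
    then show ?thesis by simp
  qed
qed

text \<open>Indexed by the items before relabeling, so that exchanging the images of two items
  changes two factors and leaves the rest of the product alone.\<close>

definition power_prod :: "(int \<Rightarrow> int) \<Rightarrow> int set \<Rightarrow> (int \<Rightarrow> nat) \<Rightarrow> int poly" where
  "power_prod \<phi> S k = (\<Prod>x\<in>S. [:- \<phi> x, 1:] ^ k x)"

lemma coprime_power_prod:
  assumes "prime (modulus P)" "\<And>x. x \<in> S \<Longrightarrow> \<phi> x \<in> universe P"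
  shows "coprime (coeff (power_prod \<phi> S k) 0) (int (modulus P))"
  using universe_coprime[OF assms(1)] assms(2)
  by (auto simp: poly_0_coeff_0[symmetric] power_prod_def poly_prod poly_power intro!: prod_coprime_left)

text \<open>The uniqueness of Pade approximants. Cross multiplication and cancellation of the cell
  contents give \<open>X * Y' = X' * Y\<close> modulo \<open>Z ^ l\<close> for the products; both
  sides are monic of the same degree at most \<open>l\<close>, hence congruent modulo p. Comparing
  roots and using disjointness separates \<open>X\<close> from \<open>Y\<close>.\<close>

lemma miscandidate_unique:
  assumes p: "prime p" and S: "S1 \<subseteq> {1..<int p}" "S2 \<subseteq> {1..<int p}"
    and XY: "miscandidate p l S1 S2 X Y" and XY': "miscandidate p l S1 S2 X' Y'"
  shows "X = X' \<and> Y = Y'"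
proof -
  define P :: params where "P = undefined\<lparr>modulus := p\<rparr>"
  have P: "modulus P = p" "universe P = {1..<int p}" by (simp_all add: P_def universe_def)
  note m = XY[unfolded miscandidate_def] and m' = XY'[unfolded miscandidate_def]
  have cop: "coprime (coeff (linear_prod S1 * linear_prod S2) 0) (int p)"
    using linear_prod_coprime[of P] p P S by (simp add: coeff_mult_0)
  have "cong_trunc p l ((linear_prod X * linear_prod S2) * (linear_prod Y' * linear_prod S1))
      ((linear_prod Y * linear_prod S1) * (linear_prod X' * linear_prod S2))"
  proof -
    have "cong_trunc p l (linear_prod X * linear_prod S2) (linear_prod Y * linear_prod S1)"
      "cong_trunc p l (linear_prod X' * linear_prod S2) (linear_prod Y' * linear_prod S1)"
      using m m' by blast+
    then show ?thesis by (rule cong_trunc_mult[OF _ cong_trunc_sym])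
  qed
  then have "cong_trunc p l ((linear_prod S1 * linear_prod S2) * (linear_prod X * linear_prod Y'))
      ((linear_prod S1 * linear_prod S2) * (linear_prod X' * linear_prod Y))"
    by (simp only: ac_simps)
  then have t: "cong_trunc p l (linear_prod X * linear_prod Y') (linear_prod X' * linear_prod Y)"
    by (rule cong_trunc_cancel[OF cop])
  have deg: "degree (linear_prod X * linear_prod Y') = card X + card Y'"
    "degree (linear_prod X' * linear_prod Y) = card X' + card Y"
    by (simp_all add: degree_mult_eq)
  have eqd: "card X + card Y' = card X' + card Y" "card X + card Y' \<le> l" using m m' by linarith+
  have "cong_poly p (linear_prod X * linear_prod Y') (linear_prod X' * linear_prod Y)"
    unfolding cong_poly_def
  proof
    fix i
    consider "i < l" | "i = card X + card Y'" | "i > card X + card Y'" using eqd by linarith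
    then show "[coeff (linear_prod X * linear_prod Y') i = coeff (linear_prod X' * linear_prod Y) i] (mod int p)"
    proof cases
      case 1
      then show ?thesis using t by (simp add: cong_trunc_def)
    next
      \<comment> \<open>When the degree is \<open>l\<close>, its coefficient is beyond the
        truncation; it is 1 on both sides.\<close>
      case 2
      have "lead_coeff (linear_prod X * linear_prod Y') = 1" "lead_coeff (linear_prod X' * linear_prod Y) = 1"
        by (simp_all only: lead_coeff_mult lead_coeff_linear_prod mult_1)
      then show ?thesis using 2 eqd deg by simp
    next
      case 3
      then show ?thesis using deg eqd by (simp add: coeff_eq_0)
    qed
  qed
  then have ev: "[poly (linear_prod X) y * poly (linear_prod Y') y = poly (linear_prod X') y * poly (linear_prod Y) y] (mod int p)" for y
    unfolding poly_mult[symmetric] by (rule cong_poly_eval)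
  have pr: "prime (int p)" using p by simp
  have root: "[poly (linear_prod Z) y = 0] (mod int p) \<longleftrightarrow> y \<in> Z" if "Z \<subseteq> {1..<int p}" "y \<in> {1..<int p}" for Z y
    using linear_prod_root[of P Z y] p P that by simp
  have in_iff: "y \<in> X \<or> y \<in> Y' \<longleftrightarrow> y \<in> X' \<or> y \<in> Y" if "y \<in> {1..<int p}" for y
  proof -
    have "[poly (linear_prod X) y * poly (linear_prod Y') y = 0] (mod int p) \<longleftrightarrow>
        [poly (linear_prod X') y * poly (linear_prod Y) y = 0] (mod int p)"
      using ev[of y] cong_trans cong_sym by blast
    then show ?thesis
      using root that m m' pr by (simp add: cong_0_iff prime_dvd_mult_iff)
  qed
  then show ?thesis using m m' by blast
qed

text \<open>Cross multiplication cancels \<open>H\<close> and \<open>H'\<close> and leaves at most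
  four linear factors on a side, so for \<open>l >= 5\<close> the truncated congruence holds in
  full. At each of the two places exactly one of the exponents is positive, and comparing roots
  identifies the unordered pairs.\<close>

lemma swap_pair_unique:
  assumes p: "prime (modulus P)" and l: "5 \<le> l"
    and y: "y1 \<in> universe P" "y2 \<in> universe P" "y1' \<in> universe P" "y2' \<in> universe P" "y1 \<noteq> y2" "y1' \<noteq> y2'"
    and ab1: "a1 = 0 \<and> b1 \<in> {1, 2} \<or> b1 = 0 \<and> a1 \<in> {1, 2 :: nat}"
    and ab2: "a2 = 0 \<and> b2 \<in> {1, 2} \<or> b2 = 0 \<and> a2 \<in> {1, 2 :: nat}"
    and cop: "coprime (coeff H 0) (int (modulus P))" "coprime (coeff H' 0) (int (modulus P))"
    and eq: "cong_trunc (modulus P) l (H * ([:- y1, 1:] ^ a1 * [:- y2, 1:] ^ a2)) (H' * ([:- y1, 1:] ^ b1 * [:- y2, 1:] ^ b2))"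
    and eq': "cong_trunc (modulus P) l (H * ([:- y1', 1:] ^ a1 * [:- y2', 1:] ^ a2)) (H' * ([:- y1', 1:] ^ b1 * [:- y2', 1:] ^ b2))"
  shows "(y1, y2) = (y1', y2') \<or> (y1, y2) = (y2', y1')"
proof -
  let ?p = "modulus P"
  define A B where "A = [:- y1, 1:] ^ a1 * [:- y2, 1:] ^ a2" and "B = [:- y1, 1:] ^ b1 * [:- y2, 1:] ^ b2"
  define A' B' where "A' = [:- y1', 1:] ^ a1 * [:- y2', 1:] ^ a2" and "B' = [:- y1', 1:] ^ b1 * [:- y2', 1:] ^ b2"
  have "cong_trunc ?p l ((H * A) * (H' * B')) ((H' * B) * (H * A'))"
    unfolding A_def B_def A'_def B'_def by (rule cong_trunc_mult[OF eq cong_trunc_sym[OF eq']])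
  then have "cong_trunc ?p l ((H * H') * (A * B')) ((H * H') * (B * A'))" by (simp only: ac_simps)
  then have "cong_trunc ?p l (A * B') (B * A')"
    by (rule cong_trunc_cancel[rotated]) (use cop in \<open>simp add: coeff_mult_0\<close>)
  moreover have "degree (A * B') < l" "degree (B * A') < l"
  proof -
    have d: "degree ([:- u, 1:] ^ i * [:- v, 1:] ^ i' * ([:- w, 1:] ^ j * [:- x, 1:] ^ j')) = i + i' + (j + j')" for u v w x :: int and i i' j j'
      by (simp add: degree_mult_eq degree_power_eq)
    show "degree (A * B') < l" "degree (B * A') < l"
      unfolding A_def B_def A'_def B'_def d using ab1 ab2 l by auto
  qed
  ultimately have "cong_poly ?p (A * B') (B * A')" by (rule cong_trunc_small_degree)
  from cong_poly_eval[OF this]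
  have ev: "int ?p dvd poly (A * B') x \<longleftrightarrow> int ?p dvd poly (B * A') x" for x
    by (meson cong_dvd_iff cong_refl cong_0_iff cong_trans cong_sym)
  have pr: "prime (int ?p)" using p by simp
  have z: "int ?p dvd u - v \<longleftrightarrow> u = v" if "u \<in> universe P" "v \<in> universe P" for u v
    using universe_cong_eq[OF that] by (auto simp: cong_iff_dvd_diff)
  have zk: "int ?p dvd (u - v) ^ k \<longleftrightarrow> k > 0 \<and> u = v" if "u \<in> universe P" "v \<in> universe P" for u v k
  proof (cases "k = 0")
    case True
    then show ?thesis using prime_gt_1_nat[OF p] by auto
  next
    case False
    then show ?thesis using prime_dvd_power_iff[OF pr] z[OF that] by simp
  qed
  have ev': "int ?p dvd (x - y1) ^ a1 * (x - y2) ^ a2 * ((x - y1') ^ b1 * (x - y2') ^ b2) \<longleftrightarrow>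
    int ?p dvd (x - y1) ^ b1 * (x - y2) ^ b2 * ((x - y1') ^ a1 * (x - y2') ^ a2)" for x
    using ev[of x] by (simp add: A_def B_def A'_def B'_def poly_power)
  have "(a1 > 0 \<and> (x = y1) \<or> a2 > 0 \<and> x = y2 \<or> b1 > 0 \<and> x = y1' \<or> b2 > 0 \<and> x = y2') \<longleftrightarrow>
      (b1 > 0 \<and> x = y1 \<or> b2 > 0 \<and> x = y2 \<or> a1 > 0 \<and> x = y1' \<or> a2 > 0 \<and> x = y2')" if "x \<in> universe P" for x
    using ev'[of x] zk[OF that] y by (simp only: prime_dvd_mult_iff[OF pr] disj_assoc)
  note at = this[OF y(1)] this[OF y(2)] this[OF y(3)] this[OF y(4)]
  have n: "0 < a1 \<longleftrightarrow> \<not> 0 < b1" "0 < a2 \<longleftrightarrow> \<not> 0 < b2" using ab1 ab2 by auto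
  show ?thesis
    using at y(5,6) unfolding n prod.inject
    by (cases "0 < b1"; cases "0 < b2"; simp only: simp_thms) metis+
qed

section \<open>Counting the relabelings that produce a coincidence\<close>

context sketch_params
begin

text \<open>The candidate congruence with the sets of items fixed and the relabeling variable:
  \<open>a\<close> and \<open>b\<close> collect the multiplicities of the items in the cell,
  \<open>Q\<close> and \<open>N\<close> the candidate elements outside it.\<close>

definition relabeling_match ::
    "nat \<Rightarrow> int set \<Rightarrow> (int \<Rightarrow> nat) \<Rightarrow> (int \<Rightarrow> nat) \<Rightarrow> int set \<Rightarrow> int set \<Rightarrow> (int \<Rightarrow> int) \<Rightarrow> bool" where
  "relabeling_match l S a b Q N \<phi> \<longleftrightarrow> (Q \<union> N) \<inter> \<phi> ` S = {} \<and>
     cong_trunc (modulus P) l (power_prod \<phi> S a * linear_prod Q) (power_prod \<phi> S b * linear_prod N)"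

text \<open>All items but \<open>x\<close> contribute the same units to both sides and cancel. Of
  the remaining identity exactly one side vanishes at \<open>\<phi> x\<close>, because
  \<open>Q\<close> and \<open>N\<close> avoid the image of \<open>S\<close>.\<close>

lemma no_single_match:
  assumes \<phi>: "\<phi> permutes U" and S: "S \<subseteq> U" and l: "5 \<le> l"
    and x: "x \<in> S" "a x = 0 \<and> b x \<in> {1, 2} \<or> b x = 0 \<and> a x \<in> {1, 2}" and rest: "\<And>y. y \<in> S - {x} \<Longrightarrow> a y = b y"
    and Q: "Q \<subseteq> U" "N \<subseteq> U" "card Q + card N \<le> 1"
  shows "\<not> relabeling_match l S a b Q N \<phi>"
proof
  assume match: "relabeling_match l S a b Q N \<phi>"
  let ?p = "modulus P"
  have finS: "finite S" using S finite_subset finite_universe by blast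
  have U\<phi>: "\<phi> y \<in> U" if "y \<in> S" for y using permutes_in_image[OF \<phi>] S that by blast
  define H where "H = power_prod \<phi> (S - {x}) a"
  have eqa: "power_prod \<phi> S k = power_prod \<phi> (S - {x}) k * [:- \<phi> x, 1:] ^ k x" for k
    unfolding power_prod_def using finS x(1) by (subst prod.remove[of _ x]) (auto simp: mult.commute)
  have eqb: "power_prod \<phi> (S - {x}) b = H"
    unfolding H_def power_prod_def using rest by (intro prod.cong) auto
  have "cong_trunc ?p l (H * [:- \<phi> x, 1:] ^ a x * linear_prod Q) (H * [:- \<phi> x, 1:] ^ b x * linear_prod N)"
    using match unfolding relabeling_match_def eqa eqb H_def by simp
  then have "cong_trunc ?p l (H * ([:- \<phi> x, 1:] ^ a x * linear_prod Q)) (H * ([:- \<phi> x, 1:] ^ b x * linear_prod N))"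
    by (simp only: mult.assoc)
  then have "cong_trunc ?p l ([:- \<phi> x, 1:] ^ a x * linear_prod Q) ([:- \<phi> x, 1:] ^ b x * linear_prod N)"
    by (rule cong_trunc_cancel[rotated]) (use coprime_power_prod[OF p, of "S - {x}" \<phi> a] U\<phi> in \<open>auto simp: H_def\<close>)
  moreover have "degree ([:- \<phi> x, 1:] ^ a x * linear_prod Q) < l" "degree ([:- \<phi> x, 1:] ^ b x * linear_prod N) < l"
    using x(2) Q(3) l by (auto simp: degree_mult_eq degree_power_eq)
  ultimately have "cong_poly ?p ([:- \<phi> x, 1:] ^ a x * linear_prod Q) ([:- \<phi> x, 1:] ^ b x * linear_prod N)"
    by (rule cong_trunc_small_degree)
  from cong_poly_eval[OF this, of "\<phi> x"]
  have ev: "[0 ^ a x * poly (linear_prod Q) (\<phi> x) = 0 ^ b x * poly (linear_prod N) (\<phi> x)] (mod int ?p)"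
    by (simp add: poly_power)
  have nr: "\<not> [poly (linear_prod Q) (\<phi> x) = 0] (mod int ?p)" "\<not> [poly (linear_prod N) (\<phi> x) = 0] (mod int ?p)"
    using linear_prod_root[OF p Q(1) U\<phi>[OF x(1)]] linear_prod_root[OF p Q(2) U\<phi>[OF x(1)]] match x(1)
    by (auto simp: relabeling_match_def)
  show False using x(2) ev nr by (auto simp: power_0_left cong_sym_eq[of 0])
qed

text \<open>
  Double counting: exchange the images of two items of \<open>S\<close> at which \<open>a\<close> and \<open>b\<close> differ with those of two
  items outside \<open>S\<close>. Matches that agree elsewhere have the same images of the two items, up to order.
\<close>

lemma card_matches_le:
  assumes S: "S \<subseteq> U" and l: "5 \<le> l"
    and ab: "\<And>x. x \<in> S \<Longrightarrow> a x = b x \<or> a x = 0 \<and> b x \<in> {1, 2} \<or> b x = 0 \<and> a x \<in> {1, 2}"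
    and ne: "\<exists>x\<in>S. a x \<noteq> b x"
    and Q: "Q \<subseteq> U" "N \<subseteq> U" "card Q + card N \<le> 1"
  shows "card {\<phi>. \<phi> permutes U \<and> relabeling_match l S a b Q N \<phi>} * (card (U - S) * (card (U - S) - 1)) \<le>
    2 * card {\<phi>. \<phi> permutes U}"
proof (cases "\<exists>x1\<in>S. \<exists>x2\<in>S. x1 \<noteq> x2 \<and> a x1 \<noteq> b x1 \<and> a x2 \<noteq> b x2")
  case False
  then obtain x where x: "x \<in> S" "a x \<noteq> b x" "\<And>y. y \<in> S - {x} \<Longrightarrow> a y = b y" using ne by blast
  have "\<not> relabeling_match l S a b Q N \<phi>" if "\<phi> permutes U" for \<phi>
    by (rule no_single_match[where x = x]) (use that S l x ab[OF x(1)] Q in auto)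
  then have "{\<phi>. \<phi> permutes U \<and> relabeling_match l S a b Q N \<phi>} = {}" by blast
  then show ?thesis by (simp only: card.empty)
next
  case True
  then obtain x1 x2 where x: "x1 \<in> S" "x2 \<in> S" "x1 \<noteq> x2" "a x1 \<noteq> b x1" "a x2 \<noteq> b x2" by blast
  let ?G = "relabeling_match l S a b Q N" and ?Perm = "{\<phi>. \<phi> permutes U}"
  define pairs where "pairs = {(\<alpha>, \<beta>). \<alpha> \<in> U - S \<and> \<beta> \<in> U - S \<and> \<alpha> \<noteq> \<beta>}"
  define \<tau> where "\<tau> = (\<lambda>(\<alpha>, \<beta>). Transposition.transpose x1 \<alpha> \<circ> Transposition.transpose x2 \<beta>)"
  have finS: "finite S" using S finite_subset finite_universe by blast
  have finPerm: "finite ?Perm" by (rule finite_relabelings)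
  have finpairs: "finite pairs"
    by (rule finite_subset[of _ "U \<times> U"]) (auto simp: pairs_def)
  have cardpairs: "card pairs = card (U - S) * (card (U - S) - 1)"
  proof -
    have "pairs = Sigma (U - S) (\<lambda>\<alpha>. (U - S) - {\<alpha>})" by (auto simp: pairs_def)
    then show ?thesis by (simp add: card_Diff_singleton)
  qed
  have \<tau>: "\<tau> \<alpha>\<beta> permutes U" if "\<alpha>\<beta> \<in> pairs" for \<alpha>\<beta>
    using that x S unfolding pairs_def \<tau>_def
    by (auto intro!: permutes_compose permutes_swap_id)
  have shift: "card {\<phi> \<in> ?Perm. ?G (\<phi> \<circ> \<tau> \<alpha>\<beta>)} = card {\<phi> \<in> ?Perm. ?G \<phi>}" if "\<alpha>\<beta> \<in> pairs" for \<alpha>\<beta>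
  proof (rule bij_betw_same_card[of "\<lambda>\<phi>. \<phi> \<circ> \<tau> \<alpha>\<beta>"], rule bij_betw_byWitness[where f' = "\<lambda>\<phi>. \<phi> \<circ> inv (\<tau> \<alpha>\<beta>)"])
    note t = \<tau>[OF that]
    have i: "\<tau> \<alpha>\<beta> \<circ> inv (\<tau> \<alpha>\<beta>) = id" "inv (\<tau> \<alpha>\<beta>) \<circ> \<tau> \<alpha>\<beta> = id" using permutes_inv_o[OF t] by auto
    show "\<forall>\<phi>\<in>{\<phi> \<in> ?Perm. ?G (\<phi> \<circ> \<tau> \<alpha>\<beta>)}. \<phi> \<circ> \<tau> \<alpha>\<beta> \<circ> inv (\<tau> \<alpha>\<beta>) = \<phi>"
      "\<forall>\<phi>\<in>{\<phi> \<in> ?Perm. ?G \<phi>}. \<phi> \<circ> inv (\<tau> \<alpha>\<beta>) \<circ> \<tau> \<alpha>\<beta> = \<phi>"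
      using i by (simp_all add: comp_assoc)
    show "(\<lambda>\<phi>. \<phi> \<circ> \<tau> \<alpha>\<beta>) ` {\<phi> \<in> ?Perm. ?G (\<phi> \<circ> \<tau> \<alpha>\<beta>)} \<subseteq> {\<phi> \<in> ?Perm. ?G \<phi>}"
      using t by (auto intro: permutes_compose)
    show "(\<lambda>\<phi>. \<phi> \<circ> inv (\<tau> \<alpha>\<beta>)) ` {\<phi> \<in> ?Perm. ?G \<phi>} \<subseteq> {\<phi> \<in> ?Perm. ?G (\<phi> \<circ> \<tau> \<alpha>\<beta>)}"
      using permutes_inv[OF t] i by (auto intro: permutes_compose simp: comp_assoc)
  qed
  have two: "card {\<alpha>\<beta> \<in> pairs. ?G (\<phi> \<circ> \<tau> \<alpha>\<beta>)} \<le> 2" if \<phi>: "\<phi> permutes U" for \<phi>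
  proof -
    define K where "K = (\<lambda>(\<alpha>, \<beta>). (\<phi> \<alpha>, \<phi> \<beta>)) ` {\<alpha>\<beta> \<in> pairs. ?G (\<phi> \<circ> \<tau> \<alpha>\<beta>)}"
    have inj: "inj \<phi>" by (rule permutes_inj[OF \<phi>])
    have "card {\<alpha>\<beta> \<in> pairs. ?G (\<phi> \<circ> \<tau> \<alpha>\<beta>)} = card K"
      unfolding K_def using inj by (intro card_image[symmetric]) (auto simp: inj_on_def inj_def)
    also have "card K \<le> 2"
    proof -
      let ?R = "S - {x1, x2}"
      \<comment> \<open>The factors that the exchange leaves alone: they are the same for all pairs
        counted here.\<close>
      define H where "H = power_prod \<phi> ?R a * linear_prod Q"
      define H' where "H' = power_prod \<phi> ?R b * linear_prod N"
      have UR: "\<phi> y \<in> U" if "y \<in> ?R" for y using permutes_in_image[OF \<phi>] S that by blast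
      have cop: "coprime (coeff H 0) (int (modulus P))" "coprime (coeff H' 0) (int (modulus P))"
        unfolding H_def H'_def coeff_mult_0
        using coprime_power_prod[OF p, of ?R \<phi>] UR linear_prod_coprime[OF p] Q by simp_all
      have mem: "y1 \<in> U \<and> y2 \<in> U \<and> y1 \<noteq> y2 \<and>
        cong_trunc (modulus P) l (H * ([:- y1, 1:] ^ a x1 * [:- y2, 1:] ^ a x2)) (H' * ([:- y1, 1:] ^ b x1 * [:- y2, 1:] ^ b x2))"
        if y12: "(y1, y2) \<in> K" for y1 y2
      proof -
        obtain \<alpha> \<beta> where \<alpha>\<beta>: "(\<alpha>, \<beta>) \<in> pairs" "?G (\<phi> \<circ> \<tau> (\<alpha>, \<beta>))" "y1 = \<phi> \<alpha>" "y2 = \<phi> \<beta>"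
          using y12 by (auto simp: K_def)
        have \<alpha>: "\<alpha> \<in> U" "\<beta> \<in> U" "\<alpha> \<notin> S" "\<beta> \<notin> S" "\<alpha> \<noteq> \<beta>" using \<alpha>\<beta>(1) by (auto simp: pairs_def)
        define \<psi> where "\<psi> = \<phi> \<circ> \<tau> (\<alpha>, \<beta>)"
        have \<psi>: "\<psi> x1 = y1" "\<psi> x2 = y2" "\<And>y. y \<in> ?R \<Longrightarrow> \<psi> y = \<phi> y"
          using \<alpha> x by (auto simp: \<psi>_def \<tau>_def \<alpha>\<beta>(3,4) Transposition.transpose_def)
        have split: "power_prod \<psi> S k = power_prod \<phi> ?R k * ([:- y1, 1:] ^ k x1 * [:- y2, 1:] ^ k x2)" for k
        proof -
          have "power_prod \<psi> S k = [:- \<psi> x1, 1:] ^ k x1 * ([:- \<psi> x2, 1:] ^ k x2 * power_prod \<psi> (S - {x1} - {x2}) k)"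
            unfolding power_prod_def using finS x(1-3)
            by (subst prod.remove[of _ x1], simp, simp, subst prod.remove[of _ x2]) auto
          also have "S - {x1} - {x2} = ?R" by auto
          also have "power_prod \<psi> ?R k = power_prod \<phi> ?R k" unfolding power_prod_def using \<psi>(3) by (intro prod.cong) auto
          finally show ?thesis unfolding \<psi>(1,2) by (simp only: ac_simps)
        qed
        have "cong_trunc (modulus P) l (H * ([:- y1, 1:] ^ a x1 * [:- y2, 1:] ^ a x2)) (H' * ([:- y1, 1:] ^ b x1 * [:- y2, 1:] ^ b x2))"
          using \<alpha>\<beta>(2) unfolding relabeling_match_def \<psi>_def[symmetric] split H_def H'_def by (simp only: ac_simps)
        then show ?thesis using \<alpha> \<alpha>\<beta>(3,4) permutes_in_image[OF \<phi>] inj by (auto simp: inj_def)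
      qed
      have "K \<subseteq> {(u, v), (v, u)}" if "(u, v) \<in> K" for u v
      proof
        fix y assume "y \<in> K"
        then obtain y1 y2 where y: "y = (y1, y2)" "(y1, y2) \<in> K" by (cases y) auto
        have aa: "a x1 = 0 \<and> b x1 \<in> {1, 2} \<or> b x1 = 0 \<and> a x1 \<in> {1, 2}"
          "a x2 = 0 \<and> b x2 \<in> {1, 2} \<or> b x2 = 0 \<and> a x2 \<in> {1, 2}"
          using ab[OF x(1)] ab[OF x(2)] x(4,5) by blast+
        have "(y1, y2) = (u, v) \<or> (y1, y2) = (v, u)"
          using mem[OF y(2)] mem[OF that]
          by (intro swap_pair_unique[OF p l _ _ _ _ _ _ aa cop]) blast+
        then show "y \<in> {(u, v), (v, u)}" using y by auto
      qed
      then obtain u v where "K \<subseteq> {(u, v), (v, u)}" by (metis empty_subsetI equals0I prod.collapse)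
      then have "K \<subseteq> set [(u, v), (v, u)]" by (simp only: list.set)
      then have "card K \<le> card (set [(u, v), (v, u)])" by (rule card_mono[OF finite_set])
      also have "\<dots> \<le> length [(u, v), (v, u)]" by (rule card_length)
      finally show ?thesis by simp
    qed
    finally show ?thesis .
  qed
  \<comment> \<open>Composition with an exchange permutes the relabelings, so every pair accounts
    for the same number of matches; summing over relabelings first gives at most two each.\<close>
  have "card {\<phi> \<in> ?Perm. ?G \<phi>} * card pairs = (\<Sum>\<alpha>\<beta>\<in>pairs. card {\<phi> \<in> ?Perm. ?G (\<phi> \<circ> \<tau> \<alpha>\<beta>)})"
    using shift by simp
  also have "\<dots> = (\<Sum>\<phi>\<in>?Perm. card {\<alpha>\<beta> \<in> pairs. ?G (\<phi> \<circ> \<tau> \<alpha>\<beta>)})"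
    using finPerm finpairs by (intro sum_multicount_gen) auto
  also have "\<dots> \<le> (\<Sum>\<phi>\<in>?Perm. 2)" using two by (intro sum_mono) auto
  finally show ?thesis unfolding cardpairs by simp
qed

end

section \<open>Union bounds over cell contents and candidates\<close>

lemma sum_power_card_Pow:
  fixes y :: real
  assumes "finite D"
  shows "(\<Sum>S\<in>Pow D. y ^ card S) = (1 + y) ^ card D"
proof -
  have "(1 + y) ^ card D = (\<Prod>x\<in>D. y + 1)" by (simp add: add.commute)
  also have "\<dots> = (\<Sum>S\<in>Pow D. (\<Prod>x\<in>S. y) * (\<Prod>x\<in>D - S. 1))" by (rule prod_add[OF assms])
  finally show ?thesis by simp
qed

lemma one_plus_power_le_exp:
  fixes y :: real
  assumes "y \<ge> 0" "n \<le> d"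
  shows "(1 + y) ^ n \<le> exp (y * real d)"
proof -
  have "(1 + y) ^ n \<le> exp y ^ n" using assms(1) by (intro power_mono) auto
  also have "\<dots> = exp (real n * y)" by (simp add: exp_of_nat_mult)
  also have "\<dots> \<le> exp (y * real d)" using assms by (simp add: mult.commute mult_left_mono)
  finally show ?thesis .
qed

text \<open>Conditioning on the first component, here the relabeling: \<open>G\<close> is the
  condition on it that makes the event possible at all.\<close>

lemma prob_pair_pmf_le:
  assumes \<kappa>: "\<kappa> \<ge> 0" and *: "\<And>a. a \<in> set_pmf A \<Longrightarrow> measure_pmf.prob B {b. (a, b) \<in> E} \<le> \<kappa> * indicator G a"
  shows "measure_pmf.prob (pair_pmf A B) E \<le> \<kappa> * measure_pmf.prob A G"
proof -
  have "emeasure (pair_pmf A B) E = (\<integral>\<^sup>+y. indicator E y \<partial>pair_pmf A B)" by simp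
  also have "\<dots> = (\<integral>\<^sup>+a. \<integral>\<^sup>+b. indicator E (a, b) \<partial>B \<partial>A)" by (rule nn_integral_pair_pmf')
  also have "\<dots> = (\<integral>\<^sup>+a. emeasure B {b. (a, b) \<in> E} \<partial>A)"
    by (intro nn_integral_cong) (simp add: nn_integral_indicator[symmetric] indicator_def del: nn_integral_indicator)
  also have "\<dots> \<le> (\<integral>\<^sup>+a. ennreal \<kappa> * indicator G a \<partial>A)"
  proof (intro nn_integral_mono_AE AE_pmfI)
    fix a assume "a \<in> set_pmf A"
    from *[OF this] show "emeasure B {b. (a, b) \<in> E} \<le> ennreal \<kappa> * indicator G a"
      by (cases "a \<in> G") (auto simp: measure_pmf.emeasure_eq_measure measure_le_0_iff intro: ennreal_leI)
  qed
  also have "\<dots> = ennreal (\<kappa> * measure_pmf.prob A G)"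
    using \<kappa> by (simp add: nn_integral_cmult_indicator measure_pmf.emeasure_eq_measure ennreal_mult)
  finally show ?thesis using \<kappa> by (simp add: measure_pmf.emeasure_eq_measure)
qed

lemma prob_pair_pmf_const_le:
  assumes "\<kappa> \<ge> 0" "\<And>a. a \<in> set_pmf A \<Longrightarrow> measure_pmf.prob B {b. (a, b) \<in> E} \<le> \<kappa>"
  shows "measure_pmf.prob (pair_pmf A B) E \<le> \<kappa>"
  using prob_pair_pmf_le[of \<kappa> A B E UNIV] assms by simp

context sketch_params
begin

abbreviation "relabelings \<equiv> pmf_of_set {\<phi>. \<phi> permutes U}"

lemma set_relabelings: "set_pmf relabelings = {\<phi>. \<phi> permutes U}"
  using finite_relabelings by (rule set_pmf_of_set[rotated])

lemma prob_match_le: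
  assumes S: "S \<subseteq> U" "2 * card S \<le> modulus P" and l: "5 \<le> l" and p8: "8 \<le> modulus P"
    and ab: "\<And>x. x \<in> S \<Longrightarrow> a x = b x \<or> a x = 0 \<and> b x \<in> {1, 2} \<or> b x = 0 \<and> a x \<in> {1, 2}"
    and ne: "\<exists>x\<in>S. a x \<noteq> b x"
    and Q: "Q \<subseteq> U" "N \<subseteq> U" "card Q + card N \<le> 1"
  shows "measure_pmf.prob relabelings {\<phi>. relabeling_match l S a b Q N \<phi>} \<le> 32 / (real (modulus P))\<^sup>2"
proof -
  let ?G = "{\<phi>. \<phi> permutes U \<and> relabeling_match l S a b Q N \<phi>}" and ?Perm = "{\<phi>. \<phi> permutes U}"
  let ?p = "real (modulus P)"
  define n where "n = card (U - S)"
  have "card U = modulus P - 1" by (simp add: universe_def)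
  then have "n = modulus P - 1 - card S"
    unfolding n_def using S(1) finite_subset[OF S(1)] by (simp add: card_Diff_subset)
  then have "2 * real n \<ge> ?p - 2" using S(2) p8 by linarith
  moreover have "real (n - 1) = real n - 1" using calculation p8 by (cases n) auto
  ultimately have n: "real n \<ge> ?p / 2 - 1" "real (n - 1) \<ge> ?p / 2 - 2" by linarith+
  \<comment> \<open>At least \<open>p / 2 - 1\<close> elements lie outside \<open>S\<close>. The
    difference of the two sides is \<open>3 * p * (p - 8) / 16 + 2\<close>, which is positive for
    \<open>p >= 8\<close>.\<close>
  have "?p\<^sup>2 / 16 \<le> (?p / 2 - 1) * (?p / 2 - 2)"
  proof -
    have "0 \<le> (?p - 8) * (3 * ?p)" using p8 by simp
    then show ?thesis by (simp add: algebra_simps power2_eq_square)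
  qed
  also have "\<dots> \<le> real n * real (n - 1)" using n p8 by (intro mult_mono) auto
  finally have np: "?p\<^sup>2 / 16 \<le> real (n * (n - 1))" by simp
  have p0: "?p > 0" using p8 by simp
  have "real (card ?G * (n * (n - 1))) \<le> real (2 * card ?Perm)"
    unfolding n_def of_nat_le_iff by (rule card_matches_le[OF S(1) l ab ne Q])
  moreover have "real (card ?G) * (?p\<^sup>2 / 16) \<le> real (card ?G * (n * (n - 1)))"
    using np unfolding of_nat_mult[of "card ?G"] by (intro mult_left_mono) auto
  ultimately have "real (card ?G) * (?p\<^sup>2 / 16) \<le> 2 * real (card ?Perm)" by simp
  moreover have "card ?Perm > 0" using finite_relabelings by (simp add: card_gt_0_iff)
  ultimately have "real (card ?G) / real (card ?Perm) \<le> 32 / ?p\<^sup>2"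
    using p0 by (simp add: field_simps)
  moreover have "measure_pmf.prob relabelings {\<phi>. relabeling_match l S a b Q N \<phi>} =
      real (card (?Perm \<inter> {\<phi>. relabeling_match l S a b Q N \<phi>})) / real (card ?Perm)"
    using finite_relabelings by (intro measure_pmf_of_set) auto
  moreover have "?Perm \<inter> {\<phi>. relabeling_match l S a b Q N \<phi>} = ?G" by auto
  ultimately show ?thesis by simp
qed

definition far_false_decoding :: "nat \<Rightarrow> int set \<Rightarrow> int set \<Rightarrow> (int \<Rightarrow> nat \<times> nat) \<Rightarrow> bool" where
  "far_false_decoding l T\<^sub>1 T\<^sub>2 c \<longleftrightarrow> (\<exists>j\<in>{1..cells P}. \<exists>S\<subseteq>T\<^sub>1 \<union> T\<^sub>2. \<exists>X Y.
     (\<forall>x\<in>S \<union> X \<union> Y. j \<in> ends (c x)) \<and> miscandidate (modulus P) l (S \<inter> T\<^sub>1) (S \<inter> T\<^sub>2) X Y \<and>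
     2 \<le> card (X \<union> Y - S))"

text \<open>
  The candidate is determined by the contents \<open>S\<close> of the cell, so two fixed further elements would
  have to be hashed to it.
\<close>

lemma prob_far_false_decoding:
  assumes T: "T\<^sub>1 \<subseteq> U" "T\<^sub>2 \<subseteq> U" "card (T\<^sub>1 \<union> T\<^sub>2) \<le> d"
  shows "measure_pmf.prob items.law {c. far_false_decoding l T\<^sub>1 T\<^sub>2 c} \<le>
    real (cells P) * (2 * hit)\<^sup>2 * exp (2 * hit * real d)"
proof -
  let ?a = "2 * hit"
  have a: "?a \<ge> 0" using hit_pos by simp
  have finT: "finite (T\<^sub>1 \<union> T\<^sub>2)" using T finite_subset finite_universe by blast
  define E where "E = (\<lambda>j S. {c :: int \<Rightarrow> nat \<times> nat. \<exists>X Y. (\<forall>x\<in>S \<union> X \<union> Y. j \<in> ends (c x)) \<and>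
     miscandidate (modulus P) l (S \<inter> T\<^sub>1) (S \<inter> T\<^sub>2) X Y \<and> 2 \<le> card (X \<union> Y - S)})"
  have one: "measure_pmf.prob items.law (E j S) \<le> ?a\<^sup>2 * ?a ^ card S" if S: "S \<subseteq> T\<^sub>1 \<union> T\<^sub>2" for j S
  proof (cases "\<exists>X Y. miscandidate (modulus P) l (S \<inter> T\<^sub>1) (S \<inter> T\<^sub>2) X Y \<and> 2 \<le> card (X \<union> Y - S)")
    case False
    then have "E j S = {}" by (auto simp: E_def)
    then show ?thesis using a by simp
  next
    case True
    then obtain X Y where XY: "miscandidate (modulus P) l (S \<inter> T\<^sub>1) (S \<inter> T\<^sub>2) X Y" "2 \<le> card (X \<union> Y - S)" by blast
    obtain W where W: "W \<subseteq> X \<union> Y - S" "card W = 2" using XY(2) by (meson obtain_subset_with_card_n)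
    have U: "X \<subseteq> U" "Y \<subseteq> U" using XY(1) by (auto simp: miscandidate_def universe_def)
    have SU: "S \<union> W \<subseteq> U" using S T U W by blast
    have fin: "finite S" "finite W" using SU finite_subset[OF _ finite_universe[of P]] by auto
    have sub: "E j S \<subseteq> {c. \<forall>x\<in>S \<union> W. c x \<in> {c. j = fst c \<or> j = snd c}}"
    proof
      fix c assume "c \<in> E j S"
      then obtain X' Y' where "\<forall>x\<in>S \<union> X' \<union> Y'. j \<in> ends (c x)"
        "miscandidate (modulus P) l (S \<inter> T\<^sub>1) (S \<inter> T\<^sub>2) X' Y'" unfolding E_def by blast
      moreover from this(2) XY(1) have "X' = X \<and> Y' = Y"
        by (rule miscandidate_unique[OF p, rotated 2]) (use T in \<open>auto simp: universe_def\<close>)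
      ultimately show "c \<in> {c. \<forall>x\<in>S \<union> W. c x \<in> {c. j = fst c \<or> j = snd c}}"
        using W(1) by (auto simp: ends_def)
    qed
    have "measure_pmf.prob items.law (E j S) \<le> measure_pmf.prob items.law {c. \<forall>x\<in>S \<union> W. c x \<in> {c. j = fst c \<or> j = snd c}}"
      by (rule measure_pmf.finite_measure_mono[OF sub]) simp
    also have "\<dots> = measure_pmf.prob \<mu> {c. j = fst c \<or> j = snd c} ^ card (S \<union> W)"
      by (rule items.prob_all[OF SU])
    also have "\<dots> \<le> ?a ^ card (S \<union> W)" by (intro power_mono prob_in_cell) simp
    also have "card (S \<union> W) = card S + 2" using fin W by (subst card_Un_disjoint) auto
    finally show ?thesis by (simp add: power_add mult.commute power2_eq_square)
  qed
  have "{c. far_false_decoding l T\<^sub>1 T\<^sub>2 c} \<subseteq> (\<Union>j\<in>{1..cells P}. \<Union>S\<in>Pow (T\<^sub>1 \<union> T\<^sub>2). E j S)"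
    unfolding far_false_decoding_def E_def by blast
  then have "measure_pmf.prob items.law {c. far_false_decoding l T\<^sub>1 T\<^sub>2 c} \<le>
     measure_pmf.prob items.law (\<Union>j\<in>{1..cells P}. \<Union>S\<in>Pow (T\<^sub>1 \<union> T\<^sub>2). E j S)"
    by (rule measure_pmf.finite_measure_mono) simp
  also have "\<dots> \<le> (\<Sum>j\<in>{1..cells P}. measure_pmf.prob items.law (\<Union>S\<in>Pow (T\<^sub>1 \<union> T\<^sub>2). E j S))"
    by (rule measure_UNION_le) auto
  also have "\<dots> \<le> (\<Sum>j\<in>{1..cells P}. \<Sum>S\<in>Pow (T\<^sub>1 \<union> T\<^sub>2). measure_pmf.prob items.law (E j S))"
    using finT by (intro sum_mono measure_UNION_le) auto
  also have "\<dots> \<le> (\<Sum>j\<in>{1..cells P}. \<Sum>S\<in>Pow (T\<^sub>1 \<union> T\<^sub>2). ?a\<^sup>2 * ?a ^ card S)"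
    by (intro sum_mono one) auto
  also have "\<dots> = real (cells P) * ?a\<^sup>2 * (1 + ?a) ^ card (T\<^sub>1 \<union> T\<^sub>2)"
    by (simp only: sum_distrib_left[symmetric] sum_power_card_Pow[OF finT] sum_constant card_atLeastAtMost) simp
  also have "\<dots> \<le> real (cells P) * ?a\<^sup>2 * exp (?a * real d)"
    using a T(3) by (intro mult_left_mono one_plus_power_le_exp) auto
  finally show ?thesis .
qed

text \<open>
  A candidate with at most one element outside the cell contents is described by the sets \<open>X\<^sub>0\<close>, \<open>Y\<^sub>0\<close>
  of (unrelabeled) items it shares with them and the outside part \<open>Q\<close>, \<open>N\<close>; it needs a coincidence
  of the relabeling.
\<close>

definition near_event ::
    "nat \<Rightarrow> int set \<Rightarrow> int set \<Rightarrow> nat \<times> int set \<times> int set \<times> int set \<times> int set \<times> int set \<Rightarrow>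
     ((int \<Rightarrow> int) \<times> (int \<Rightarrow> nat \<times> nat)) set" where
  "near_event l D\<^sub>1 D\<^sub>2 = (\<lambda>(j, S, X, Y, Q, N). {(\<phi>, c).
     relabeling_match l S (\<lambda>x. of_bool (x \<in> X) + of_bool (x \<in> D\<^sub>2)) (\<lambda>x. of_bool (x \<in> Y) + of_bool (x \<in> D\<^sub>1)) Q N \<phi> \<and>
     (\<forall>x\<in>\<phi> ` S \<union> (Q \<union> N). j \<in> ends (c x))})"

text \<open>The pairs of total size at most one, written as images so that sums over them
  split.\<close>

definition outside_parts :: "(int set \<times> int set) set" where
  "outside_parts = insert ({}, {}) ((\<lambda>x. ({x}, {})) ` U \<union> (\<lambda>x. ({}, {x})) ` U)"

lemma outside_parts:
  assumes "(Q, N) \<in> outside_parts"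
  shows "Q \<subseteq> U" "N \<subseteq> U" "card Q + card N \<le> 1" "card (Q \<union> N) = card Q + card N" "finite (Q \<union> N)"
  using assms by (auto simp: outside_parts_def)

lemma outside_partsI:
  assumes "Q \<subseteq> U" "N \<subseteq> U" "Q \<inter> N = {}" "card (Q \<union> N) \<le> 1"
  shows "(Q, N) \<in> outside_parts"
proof -
  have fin: "finite (Q \<union> N)" using assms finite_subset finite_universe by blast
  consider "Q \<union> N = {}" | x where "Q \<union> N = {x}"
    using assms(4) fin by (metis card_0_eq card_1_singletonE le_antisym less_one linorder_not_le)
  then show ?thesis
  proof cases
    case 2
    then have "Q = {} \<or> Q = {x}" "N = {} \<or> N = {x}" by (auto dest: subset_singletonD)
    then have "x \<in> U" "Q = {x} \<and> N = {} \<or> Q = {} \<and> N = {x}" using 2 assms(1-3) by auto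
    then show ?thesis by (auto simp: outside_parts_def)
  qed (simp add: outside_parts_def)
qed

lemma sum_outside_parts:
  assumes "a \<ge> (0 :: real)"
  shows "(\<Sum>QN\<in>outside_parts. a ^ card (fst QN \<union> snd QN)) \<le> 1 + 2 * real (modulus P) * a"
proof -
  have cU: "real (card U) \<le> real (modulus P)" by (simp add: universe_def)
  let ?f = "\<lambda>QN :: int set \<times> int set. a ^ card (fst QN \<union> snd QN)"
  have i: "inj_on (\<lambda>x. ({x}, {} :: int set)) U" "inj_on (\<lambda>x. ({} :: int set, {x})) U" by (auto simp: inj_on_def)
  have "sum ?f outside_parts \<le> ?f ({}, {}) + sum ?f ((\<lambda>x. ({x}, {})) ` U \<union> (\<lambda>x. ({}, {x})) ` U)"
    unfolding outside_parts_def by (subst sum.insert) auto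
  also have "sum ?f ((\<lambda>x. ({x}, {})) ` U \<union> (\<lambda>x. ({}, {x})) ` U) = sum ?f ((\<lambda>x. ({x}, {})) ` U) + sum ?f ((\<lambda>x. ({}, {x})) ` U)"
    by (rule sum.union_disjoint) auto
  also have "sum ?f ((\<lambda>x. ({x}, {})) ` U) = real (card U) * a" using i(1) by (simp add: sum.reindex)
  also have "sum ?f ((\<lambda>x. ({}, {x})) ` U) = real (card U) * a" using i(2) by (simp add: sum.reindex)
  finally have "sum ?f outside_parts \<le> 1 + 2 * (real (card U) * a)" by (simp add: algebra_simps)
  also have "\<dots> \<le> 1 + 2 * (real (modulus P) * a)" using cU assms by (intro add_left_mono mult_left_mono mult_right_mono) auto
  finally show ?thesis by simp
qed

text \<open>For a fixed match the images of \<open>S\<close> and the elements of \<open>Q\<close>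
  and \<open>N\<close> are distinct items with independent cells, which gives the powers. An item of
  \<open>S\<close> outside \<open>X\<close> and \<open>Y\<close> has the exponents 0 and 1 in some
  order; membership in \<open>X\<close> or \<open>Y\<close> makes them 1 and 1, or 0 and 2. So
  \<open>X \<union> Y \<noteq> S\<close> provides an item at which the exponents differ, as
  \<open>prob_match_le\<close> requires.\<close>

lemma prob_near_event:
  assumes D: "D\<^sub>1 \<subseteq> U" "D\<^sub>2 \<subseteq> U" "D\<^sub>1 \<inter> D\<^sub>2 = {}" "2 * card (D\<^sub>1 \<union> D\<^sub>2) \<le> modulus P"
    and l: "5 \<le> l" and p8: "8 \<le> modulus P"
    and S: "S \<subseteq> D\<^sub>1 \<union> D\<^sub>2" "X \<subseteq> S" "Y \<subseteq> S" "X \<inter> Y = {}" "X \<union> Y \<noteq> S" and Q: "(Q, N) \<in> outside_parts"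
  shows "measure_pmf.prob (instance_law P) (near_event l D\<^sub>1 D\<^sub>2 (j, S, X, Y, Q, N)) \<le>
    (2 * hit) ^ card S * (2 * hit) ^ card (Q \<union> N) * (32 / (real (modulus P))\<^sup>2)"
proof -
  let ?a = "2 * hit"
  let ?G = "relabeling_match l S (\<lambda>x. of_bool (x \<in> X) + of_bool (x \<in> D\<^sub>2)) (\<lambda>x. of_bool (x \<in> Y) + of_bool (x \<in> D\<^sub>1)) Q N"
  have a: "?a \<ge> 0" using hit_pos by simp
  have finD: "finite (D\<^sub>1 \<union> D\<^sub>2)" using D finite_subset finite_universe by blast
  have SU: "S \<subseteq> U" and finS: "finite S" using S D finite_subset[OF S(1) finD] by auto
  note o = outside_parts[OF Q]
  have "measure_pmf.prob (instance_law P) (near_event l D\<^sub>1 D\<^sub>2 (j, S, X, Y, Q, N)) \<le>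
     (?a ^ card S * ?a ^ card (Q \<union> N)) * measure_pmf.prob relabelings {\<phi>. ?G \<phi>}"
    unfolding instance_law_def
  proof (rule prob_pair_pmf_le)
    fix \<phi> assume "\<phi> \<in> set_pmf relabelings"
    then have \<phi>: "\<phi> permutes U" by (simp add: set_relabelings)
    show "measure_pmf.prob items.law {c. (\<phi>, c) \<in> near_event l D\<^sub>1 D\<^sub>2 (j, S, X, Y, Q, N)} \<le>
      ?a ^ card S * ?a ^ card (Q \<union> N) * indicator {\<phi>. ?G \<phi>} \<phi>"
    proof (cases "?G \<phi>")
      case True
      have disj: "\<phi> ` S \<inter> (Q \<union> N) = {}" using True by (auto simp: relabeling_match_def)
      have sub: "\<phi> ` S \<union> (Q \<union> N) \<subseteq> U" using permutes_in_image[OF \<phi>] SU o by blast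
      have card: "card (\<phi> ` S \<union> (Q \<union> N)) = card S + card (Q \<union> N)"
        using disj finS o(5) permutes_inj[OF \<phi>] by (subst card_Un_disjoint) (auto simp: card_image inj_on_subset)
      have "{c. (\<phi>, c) \<in> near_event l D\<^sub>1 D\<^sub>2 (j, S, X, Y, Q, N)} = {c. \<forall>x\<in>\<phi> ` S \<union> (Q \<union> N). c x \<in> {c. j = fst c \<or> j = snd c}}"
        using True by (auto simp: near_event_def ends_def)
      then have "measure_pmf.prob items.law {c. (\<phi>, c) \<in> near_event l D\<^sub>1 D\<^sub>2 (j, S, X, Y, Q, N)} =
          measure_pmf.prob \<mu> {c. j = fst c \<or> j = snd c} ^ (card S + card (Q \<union> N))"
        by (simp only: items.prob_all[OF sub] card)
      also have "\<dots> \<le> ?a ^ (card S + card (Q \<union> N))" by (intro power_mono prob_in_cell) simp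
      finally show ?thesis using True by (simp add: power_add)
    next
      case False
      then have e: "{c. (\<phi>, c) \<in> near_event l D\<^sub>1 D\<^sub>2 (j, S, X, Y, Q, N)} = {}" by (auto simp: near_event_def)
      show ?thesis unfolding e using False by simp
    qed
  qed (use a in simp)
  also have "\<dots> \<le> (?a ^ card S * ?a ^ card (Q \<union> N)) * (32 / (real (modulus P))\<^sup>2)"
  proof (rule mult_left_mono[OF prob_match_le[OF SU _ l p8 _ _ o(1-3)]])
    have "card S \<le> card (D\<^sub>1 \<union> D\<^sub>2)" using S(1) finD by (rule card_mono[rotated])
    then show "2 * card S \<le> modulus P" using D(4) by linarith
    show "of_bool (x \<in> X) + of_bool (x \<in> D\<^sub>2) = (of_bool (x \<in> Y) + of_bool (x \<in> D\<^sub>1) :: nat) \<or>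
      of_bool (x \<in> X) + of_bool (x \<in> D\<^sub>2) = (0 :: nat) \<and> of_bool (x \<in> Y) + of_bool (x \<in> D\<^sub>1) \<in> {1, 2 :: nat} \<or>
      of_bool (x \<in> Y) + of_bool (x \<in> D\<^sub>1) = (0 :: nat) \<and> of_bool (x \<in> X) + of_bool (x \<in> D\<^sub>2) \<in> {1, 2 :: nat}" if "x \<in> S" for x
      using that S D(3) by (cases "x \<in> X"; cases "x \<in> Y"; cases "x \<in> D\<^sub>1"; cases "x \<in> D\<^sub>2") auto
    obtain x where x: "x \<in> S" "x \<notin> X" "x \<notin> Y" using S by blast
    then show "\<exists>x\<in>S. of_bool (x \<in> X) + of_bool (x \<in> D\<^sub>2) \<noteq> (of_bool (x \<in> Y) + of_bool (x \<in> D\<^sub>1) :: nat)"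
      using S(1) D(3) by (intro bexI[of _ x]) auto
  qed (use a in simp)
  finally show ?thesis .
qed

lemma power_prod_of_bool:
  assumes "inj \<phi>" "finite S" "X \<subseteq> S"
  shows "power_prod \<phi> S (\<lambda>x. of_bool (x \<in> X) + of_bool (x \<in> D)) = linear_prod (\<phi> ` X) * linear_prod (\<phi> ` (S \<inter> D))"
proof -
  have "linear_prod (\<phi> ` Z) = (\<Prod>x\<in>Z. [:- \<phi> x, 1:])" for Z
    unfolding linear_prod_def using assms(1) by (subst prod.reindex) (auto intro: inj_on_subset)
  moreover have "(\<Prod>x\<in>Z. [:- \<phi> x, 1:]) = (\<Prod>x\<in>S. [:- \<phi> x, 1:] ^ of_bool (x \<in> Z))" if "Z \<subseteq> S" for Z
    using that assms(2) by (intro prod.mono_neutral_cong_left) auto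
  moreover have "(\<Prod>x\<in>S. [:- \<phi> x, 1:] ^ of_bool (x \<in> S \<inter> D)) = (\<Prod>x\<in>S. [:- \<phi> x, 1:] ^ of_bool (x \<in> D))"
    by (intro prod.cong) auto
  ultimately show ?thesis
    using assms(3) unfolding power_prod_def power_add prod.distrib by simp
qed

text \<open>The contents of the cell and the shared part of the candidate are pulled back along
  \<open>\<phi>\<close>. Only then do they range over a family that does not depend on the
  relabeling, as a union bound needs.\<close>

lemma false_decoding_cases:
  assumes \<phi>: "\<phi> permutes U" and D: "D\<^sub>1 \<subseteq> U" "D\<^sub>2 \<subseteq> U" "D\<^sub>1 \<inter> D\<^sub>2 = {}"
    and fd: "false_decoding (modulus P) l (cells P) (\<lambda>x. ends (c x)) (\<phi> ` D\<^sub>1) (\<phi> ` D\<^sub>2)"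
    and near: "\<not> far_false_decoding l (\<phi> ` D\<^sub>1) (\<phi> ` D\<^sub>2) c"
  obtains j S X Y Q N where "j \<in> {1..cells P}" "S \<subseteq> D\<^sub>1 \<union> D\<^sub>2" "X \<subseteq> S" "Y \<subseteq> S" "X \<inter> Y = {}" "X \<union> Y \<noteq> S"
    "(Q, N) \<in> outside_parts" "(\<phi>, c) \<in> near_event l D\<^sub>1 D\<^sub>2 (j, S, X, Y, Q, N)"
proof -
  have inj: "inj \<phi>" by (rule permutes_inj[OF \<phi>])
  obtain j S' X' Y' where j: "j \<in> {1..cells P}" and S': "S' \<subseteq> \<phi> ` D\<^sub>1 \<union> \<phi> ` D\<^sub>2" "l < card S'"
    and inj_j: "\<forall>x\<in>S' \<union> X' \<union> Y'. j \<in> ends (c x)"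
    and mc: "miscandidate (modulus P) l (S' \<inter> \<phi> ` D\<^sub>1) (S' \<inter> \<phi> ` D\<^sub>2) X' Y'"
    using fd unfolding false_decoding_def by blast
  have few: "card (X' \<union> Y' - S') \<le> 1"
  proof (rule ccontr)
    assume "\<not> ?thesis"
    then have "2 \<le> card (X' \<union> Y' - S')" by simp
    then have "far_false_decoding l (\<phi> ` D\<^sub>1) (\<phi> ` D\<^sub>2) c"
      unfolding far_false_decoding_def using j S'(1) inj_j mc
      by (intro bexI[of _ j] exI[of _ S'] conjI exI[of _ X'] exI[of _ Y']) auto
    then show False using near by simp
  qed
  note m = mc[unfolded miscandidate_def]
  have U': "X' \<subseteq> U" "Y' \<subseteq> U" using m by (auto simp: universe_def)
  have fin': "finite X'" "finite Y'" using U' finite_subset finite_universe by blast+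
  define S where "S = {x \<in> D\<^sub>1 \<union> D\<^sub>2. \<phi> x \<in> S'}"
  define X where "X = {x \<in> S. \<phi> x \<in> X'}"
  define Y where "Y = {x \<in> S. \<phi> x \<in> Y'}"
  define Q where "Q = X' - S'"
  define N where "N = Y' - S'"
  have S: "\<phi> ` S = S'" using S'(1) by (auto simp: S_def)
  have X: "\<phi> ` X = X' \<inter> S'" and Y: "\<phi> ` Y = Y' \<inter> S'" using S by (auto simp: X_def Y_def)
  have finS: "finite S" using D finite_subset[of S U] by (auto simp: S_def)
  have D1: "\<phi> ` (S \<inter> D\<^sub>1) = S' \<inter> \<phi> ` D\<^sub>1" and D2: "\<phi> ` (S \<inter> D\<^sub>2) = S' \<inter> \<phi> ` D\<^sub>2"
    unfolding S[symmetric] by (simp_all add: image_Int[OF inj])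
  show ?thesis
  proof (rule that[of j S X Y Q N])
    \<comment> \<open>The cell holds more than \<open>l\<close> items and a candidate has at most
      \<open>l\<close> elements, so some item of the cell is not in the candidate.\<close>
    show "X \<union> Y \<noteq> S"
    proof
      assume "X \<union> Y = S"
      then have "S' \<subseteq> X' \<union> Y'" using S X Y by auto
      then have "card S' \<le> card (X' \<union> Y')" using fin' by (intro card_mono) auto
      also have "\<dots> \<le> card X' + card Y'" by (rule card_Un_le)
      also have "\<dots> \<le> l" using m by blast
      finally show False using S'(2) by simp
    qed
    have "X' \<inter> Y' = {}" using m by blast
    then show "(Q, N) \<in> outside_parts"
      using few U' by (intro outside_partsI) (auto simp: Q_def N_def Un_Diff)
    show "X \<inter> Y = {}" using \<open>X' \<inter> Y' = {}\<close> by (auto simp: X_def Y_def)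
    have e: "linear_prod X' = linear_prod (\<phi> ` X) * linear_prod Q" "linear_prod Y' = linear_prod (\<phi> ` Y) * linear_prod N"
      unfolding X Y Q_def N_def using fin'
      by (subst linear_prod_Un[symmetric]; (auto intro!: arg_cong[of _ _ linear_prod])[1])+
    have sub: "X \<subseteq> S" "Y \<subseteq> S" by (auto simp: X_def Y_def)
    have "cong_trunc (modulus P) l (linear_prod X' * linear_prod (S' \<inter> \<phi> ` D\<^sub>2)) (linear_prod Y' * linear_prod (S' \<inter> \<phi> ` D\<^sub>1))"
      using m by blast
    then have "cong_trunc (modulus P) l
        (power_prod \<phi> S (\<lambda>x. of_bool (x \<in> X) + of_bool (x \<in> D\<^sub>2)) * linear_prod Q)
        (power_prod \<phi> S (\<lambda>x. of_bool (x \<in> Y) + of_bool (x \<in> D\<^sub>1)) * linear_prod N)"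
      unfolding power_prod_of_bool[OF inj finS sub(1)] power_prod_of_bool[OF inj finS sub(2)] D1 D2 e
      by (simp only: ac_simps)
    then show "(\<phi>, c) \<in> near_event l D\<^sub>1 D\<^sub>2 (j, S, X, Y, Q, N)"
      using inj_j S unfolding near_event_def relabeling_match_def by (auto simp: Q_def N_def)
  qed (use j in \<open>auto simp: S_def X_def Y_def\<close>)
qed

text \<open>Inside \<open>S\<close> there are at most \<open>4 ^ card S\<close> choices of
  \<open>X\<close> and \<open>Y\<close>. With the probability \<open>(2 * hit) ^ card S\<close> the
  sum over \<open>S\<close> is \<open>(1 + 8 * hit) ^ card (D\<^sub>1 \<union> D\<^sub>2)\<close>,
  at most \<open>exp (8 * hit * d)\<close>. The factor \<open>1 + 4 * p * hit\<close> sums over the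
  outside parts.\<close>

theorem prob_false_decoding:
  assumes D: "D\<^sub>1 \<subseteq> U" "D\<^sub>2 \<subseteq> U" "D\<^sub>1 \<inter> D\<^sub>2 = {}" "card (D\<^sub>1 \<union> D\<^sub>2) \<le> d" "2 * d \<le> modulus P"
    and l: "5 \<le> l" and p8: "8 \<le> modulus P"
  shows "measure_pmf.prob (instance_law P)
      {(\<phi>, c). false_decoding (modulus P) l (cells P) (\<lambda>x. ends (c x)) (\<phi> ` D\<^sub>1) (\<phi> ` D\<^sub>2)} \<le>
    real (cells P) * (2 * hit)\<^sup>2 * exp (2 * hit * real d) +
    real (cells P) * exp (8 * hit * real d) * (1 + 4 * real (modulus P) * hit) * (32 / (real (modulus P))\<^sup>2)"
proof -
  let ?a = "2 * hit"
  let ?D = "D\<^sub>1 \<union> D\<^sub>2"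
  let ?c = "32 / (real (modulus P))\<^sup>2"
  have a: "?a \<ge> 0" using hit_pos by simp
  have finD: "finite ?D" using D finite_subset finite_universe by blast
  have finO: "finite outside_parts" by (simp add: outside_parts_def)
  define far where "far = {(\<phi>, c). far_false_decoding l (\<phi> ` D\<^sub>1) (\<phi> ` D\<^sub>2) c}"
  define I where "I = (\<lambda>S :: int set. {(X, Y). X \<subseteq> S \<and> Y \<subseteq> S \<and> X \<inter> Y = {} \<and> X \<union> Y \<noteq> S})"
  define ne where "ne = (\<lambda>j S XY QN. near_event l D\<^sub>1 D\<^sub>2 (j, S, fst XY, snd XY, fst QN, snd QN))"
  define near where "near = (\<Union>j\<in>{1..cells P}. \<Union>S\<in>Pow ?D. \<Union>XY\<in>I S. \<Union>QN\<in>outside_parts. ne j S XY QN)"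
  have finI: "finite (I S)" "card (I S) \<le> 4 ^ card S" if "S \<subseteq> ?D" for S
  proof -
    have finS: "finite S" using that finD finite_subset by blast
    have sub: "I S \<subseteq> Pow S \<times> Pow S" by (auto simp: I_def)
    show "finite (I S)" using finite_subset[OF sub] finS by simp
    have "card (I S) \<le> card (Pow S \<times> Pow S)" using sub finS by (intro card_mono) auto
    also have "\<dots> = 4 ^ card S" using finS by (simp add: card_cartesian_product card_Pow power_mult_distrib[symmetric])
    finally show "card (I S) \<le> 4 ^ card S" .
  qed
  have "{(\<phi>, c). false_decoding (modulus P) l (cells P) (\<lambda>x. ends (c x)) (\<phi> ` D\<^sub>1) (\<phi> ` D\<^sub>2)} \<inter> set_pmf (instance_law P) \<subseteq> far \<union> near"
  proof
    fix y assume "y \<in> {(\<phi>, c). false_decoding (modulus P) l (cells P) (\<lambda>x. ends (c x)) (\<phi> ` D\<^sub>1) (\<phi> ` D\<^sub>2)} \<inter> set_pmf (instance_law P)"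
    then obtain \<phi> c where y: "y = (\<phi>, c)" "\<phi> permutes U"
      "false_decoding (modulus P) l (cells P) (\<lambda>x. ends (c x)) (\<phi> ` D\<^sub>1) (\<phi> ` D\<^sub>2)"
      by (auto simp: instance_law_def set_relabelings)
    show "y \<in> far \<union> near"
    proof (cases "far_false_decoding l (\<phi> ` D\<^sub>1) (\<phi> ` D\<^sub>2) c")
      case False
      obtain j S X Y Q N where *: "j \<in> {1..cells P}" "S \<subseteq> ?D" "X \<subseteq> S" "Y \<subseteq> S" "X \<inter> Y = {}" "X \<union> Y \<noteq> S"
        "(Q, N) \<in> outside_parts" "(\<phi>, c) \<in> near_event l D\<^sub>1 D\<^sub>2 (j, S, X, Y, Q, N)"
        using false_decoding_cases[OF y(2) D(1-3) y(3) False] by blast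
      then have "(\<phi>, c) \<in> ne j S (X, Y) (Q, N)" "(X, Y) \<in> I S" by (auto simp: ne_def I_def)
      then show ?thesis unfolding y(1) near_def using *(1,2,7) by blast
    qed (simp add: far_def y)
  qed
  then have "measure_pmf.prob (instance_law P)
      ({(\<phi>, c). false_decoding (modulus P) l (cells P) (\<lambda>x. ends (c x)) (\<phi> ` D\<^sub>1) (\<phi> ` D\<^sub>2)} \<inter> set_pmf (instance_law P)) \<le>
      measure_pmf.prob (instance_law P) (far \<union> near)"
    by (rule measure_pmf.finite_measure_mono) simp
  also have "\<dots> \<le> measure_pmf.prob (instance_law P) far + measure_pmf.prob (instance_law P) near"
    by (rule measure_Un_le) auto
  also have "measure_pmf.prob (instance_law P) far \<le> real (cells P) * ?a\<^sup>2 * exp (?a * real d)"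
    unfolding instance_law_def
  proof (rule prob_pair_pmf_const_le)
    fix \<phi> assume "\<phi> \<in> set_pmf relabelings"
    then have \<phi>: "\<phi> permutes U" by (simp add: set_relabelings)
    have U: "\<phi> ` D\<^sub>1 \<subseteq> U" "\<phi> ` D\<^sub>2 \<subseteq> U" using permutes_in_image[OF \<phi>] D by blast+
    have "card (\<phi> ` D\<^sub>1 \<union> \<phi> ` D\<^sub>2) \<le> d"
      unfolding image_Un[symmetric] using D(4) permutes_inj[OF \<phi>] by (metis card_image inj_on_subset subset_UNIV)
    then show "measure_pmf.prob items.law {c. (\<phi>, c) \<in> far} \<le> real (cells P) * ?a\<^sup>2 * exp (?a * real d)"
      unfolding far_def using prob_far_false_decoding[OF U] by simp
  qed (use hit_pos in simp)
  also have "measure_pmf.prob (instance_law P) near \<le>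
      real (cells P) * exp (8 * hit * real d) * (1 + 4 * real (modulus P) * hit) * ?c"
  proof -
    have "measure_pmf.prob (instance_law P) near \<le> (\<Sum>j\<in>{1..cells P}.
        measure_pmf.prob (instance_law P) (\<Union>S\<in>Pow ?D. \<Union>XY\<in>I S. \<Union>QN\<in>outside_parts. ne j S XY QN))"
      unfolding near_def by (rule measure_UNION_le) auto
    also have "\<dots> \<le> (\<Sum>j\<in>{1..cells P}. \<Sum>S\<in>Pow ?D.
        measure_pmf.prob (instance_law P) (\<Union>XY\<in>I S. \<Union>QN\<in>outside_parts. ne j S XY QN))"
      using finD by (intro sum_mono measure_UNION_le) auto
    also have "\<dots> \<le> (\<Sum>j\<in>{1..cells P}. \<Sum>S\<in>Pow ?D. \<Sum>XY\<in>I S.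
        measure_pmf.prob (instance_law P) (\<Union>QN\<in>outside_parts. ne j S XY QN))"
      using finI by (intro sum_mono measure_UNION_le) auto
    also have "\<dots> \<le> (\<Sum>j\<in>{1..cells P}. \<Sum>S\<in>Pow ?D. \<Sum>XY\<in>I S. \<Sum>QN\<in>outside_parts.
        measure_pmf.prob (instance_law P) (ne j S XY QN))"
      using finO by (intro sum_mono measure_UNION_le) auto
    also have "\<dots> \<le> (\<Sum>j\<in>{1..cells P}. \<Sum>S\<in>Pow ?D. \<Sum>XY\<in>I S. \<Sum>QN\<in>outside_parts.
        ?a ^ card S * ?a ^ card (fst QN \<union> snd QN) * ?c)"
    proof (intro sum_mono)
      fix j S XY QN assume *: "S \<in> Pow ?D" "XY \<in> I S" "QN \<in> outside_parts"
      show "measure_pmf.prob (instance_law P) (ne j S XY QN) \<le> ?a ^ card S * ?a ^ card (fst QN \<union> snd QN) * ?c"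
        unfolding ne_def
        by (rule prob_near_event[OF D(1-3) _ l p8]) (use * D(4,5) in \<open>auto simp: I_def\<close>)
    qed
    also have "\<dots> = real (cells P) * (\<Sum>S\<in>Pow ?D. real (card (I S)) * (?a ^ card S * (\<Sum>QN\<in>outside_parts. ?a ^ card (fst QN \<union> snd QN)) * ?c))"
      by (simp only: sum_distrib_left[symmetric] sum_distrib_right[symmetric] sum_constant card_atLeastAtMost)
        (simp add: mult_ac)
    also have "\<dots> \<le> real (cells P) * (\<Sum>S\<in>Pow ?D. 4 ^ card S * (?a ^ card S * (1 + 2 * real (modulus P) * ?a) * ?c))"
    proof (intro mult_left_mono sum_mono mult_mono mult_right_mono sum_outside_parts a)
      fix S assume "S \<in> Pow ?D"
      then have "real (card (I S)) \<le> real (4 ^ card S)" using finI(2) by (simp only: of_nat_le_iff Pow_iff)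
      then show "real (card (I S)) \<le> 4 ^ card S" by simp
    qed (use a in \<open>auto intro!: sum_nonneg mult_nonneg_nonneg divide_nonneg_nonneg\<close>)
    also have "\<dots> = real (cells P) * (\<Sum>S\<in>Pow ?D. (4 * ?a) ^ card S) * (1 + 2 * real (modulus P) * ?a) * ?c"
      by (simp only: power_mult_distrib sum_distrib_left sum_distrib_right mult.assoc)
    also have "(\<Sum>S\<in>Pow ?D. (4 * ?a) ^ card S) = (1 + 4 * ?a) ^ card ?D" by (rule sum_power_card_Pow[OF finD])
    also have "real (cells P) * (1 + 4 * ?a) ^ card ?D * (1 + 2 * real (modulus P) * ?a) * ?c \<le>
        real (cells P) * exp (4 * ?a * real d) * (1 + 2 * real (modulus P) * ?a) * ?c"
      using a D(4) by (intro mult_right_mono mult_left_mono one_plus_power_le_exp) auto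
    finally show ?thesis by (simp add: mult.assoc)
  qed
  finally show ?thesis unfolding measure_Int_set_pmf by simp
qed

end

section \<open>Choice of the parameters\<close>

lemma no_stopping_cong:
  assumes "\<And>x. x \<in> T \<Longrightarrow> \<Gamma> x = \<Gamma>' x" "no_stopping \<Gamma> l T"
  shows "no_stopping \<Gamma>' l T"
  unfolding no_stopping_def
proof (intro allI impI)
  fix I assume I: "I \<subseteq> T" "I \<noteq> {}"
  then obtain x j where x: "x \<in> I" "j \<in> \<Gamma> x" "card {y \<in> I. j \<in> \<Gamma> y} \<le> l"
    using assms(2) unfolding no_stopping_def by blast
  have "{y \<in> I. j \<in> \<Gamma> y} = {y \<in> I. j \<in> \<Gamma>' y}" using assms(1) I(1) by blast
  moreover have "\<Gamma> x = \<Gamma>' x" using assms(1) I(1) x(1) by blast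
  ultimately show "\<exists>x\<in>I. \<exists>j\<in>\<Gamma>' x. card {y \<in> I. j \<in> \<Gamma>' y} \<le> l" using x by metis
qed

lemma false_decoding_cong:
  assumes "\<And>x. x \<in> {1..<int p} \<Longrightarrow> \<Gamma> x = \<Gamma>' x" "T\<^sub>1 \<subseteq> {1..<int p}" "T\<^sub>2 \<subseteq> {1..<int p}"
    and "false_decoding p l m \<Gamma> T\<^sub>1 T\<^sub>2"
  shows "false_decoding p l m \<Gamma>' T\<^sub>1 T\<^sub>2"
proof -
  obtain j S X Y where *: "j \<in> {1..m}" "S \<subseteq> T\<^sub>1 \<union> T\<^sub>2" "l < card S" "\<forall>x\<in>S \<union> X \<union> Y. j \<in> \<Gamma> x"
    "miscandidate p l (S \<inter> T\<^sub>1) (S \<inter> T\<^sub>2) X Y"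
    using assms(4) unfolding false_decoding_def by blast
  have "X \<subseteq> {1..<int p}" "Y \<subseteq> {1..<int p}" using *(5) by (auto simp: miscandidate_def)
  then have "\<forall>x\<in>S \<union> X \<union> Y. j \<in> \<Gamma>' x" using *(2,4) assms(1-3) by blast
  then show ?thesis unfolding false_decoding_def using * by blast
qed

context sketch_params
begin

lemma support_ends: "x \<in> U \<Longrightarrow> support P \<omega> x = ends (cell_pairs P \<omega> x)"
  by (simp add: support_eq cell_pairs_def ends_def)

text \<open>For a fixed relabeling the image of the difference is a fixed set, so stopping sets need
  only a bound uniform in \<open>T\<close>. False decodings depend on the relabeling itself and are
  bounded under the joint law.\<close>

theorem prob_solves:
  assumes rf: "root_finder rf" and l: "terms P = l" "l \<ge> 1"
    and AB: "A \<subseteq> U" "B \<subseteq> U" "card ((A - B) \<union> (B - A)) \<le> d"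
    and ns: "\<And>T. T \<subseteq> U \<Longrightarrow> card T \<le> d \<Longrightarrow>
      measure_pmf.prob items.law {c. \<not> no_stopping (\<lambda>x. ends (c x)) l T} \<le> \<kappa>"
    and fd: "measure_pmf.prob (instance_law P)
      {(\<phi>, c). false_decoding (modulus P) l (cells P) (\<lambda>x. ends (c x)) (\<phi> ` (A - B)) (\<phi> ` (B - A))} \<le> \<kappa>'"
  shows "measure (public_space P) {\<omega> \<in> space (public_space P). solves rf P \<omega> d A B} \<ge> 1 - (\<kappa> + \<kappa>')"
proof -
  interpret S: prob_space "public_space P" by (rule prob_space_public)
  let ?D = "(A - B) \<union> (B - A)"
  define bad1 :: "((int \<Rightarrow> int) \<times> (int \<Rightarrow> nat \<times> nat)) set"
    where "bad1 = {(\<phi>, c). \<not> no_stopping (\<lambda>x. ends (c x)) l (\<phi> ` ?D)}"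
  define bad2 :: "((int \<Rightarrow> int) \<times> (int \<Rightarrow> nat \<times> nat)) set"
    where "bad2 = {(\<phi>, c). false_decoding (modulus P) l (cells P) (\<lambda>x. ends (c x)) (\<phi> ` (A - B)) (\<phi> ` (B - A))}"
  have \<kappa>: "\<kappa> \<ge> 0" by (rule order_trans[OF measure_nonneg ns[of "{}"]]) auto
  have b1: "measure_pmf.prob (instance_law P) bad1 \<le> \<kappa>"
    unfolding instance_law_def
  proof (rule prob_pair_pmf_const_le[OF \<kappa>])
    fix \<phi> assume "\<phi> \<in> set_pmf relabelings"
    then have \<phi>: "\<phi> permutes U" by (simp add: set_relabelings)
    have "\<phi> ` ?D \<subseteq> U" using permutes_in_image[OF \<phi>] AB by blast
    moreover have "card (\<phi> ` ?D) \<le> d" using AB(3) permutes_inj[OF \<phi>] by (metis card_image inj_on_subset subset_UNIV)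
    ultimately show "measure_pmf.prob items.law {c. (\<phi>, c) \<in> bad1} \<le> \<kappa>"
      using ns unfolding bad1_def by simp
  qed
  have "measure_pmf.prob (instance_law P) (bad1 \<union> bad2) \<le> \<kappa> + \<kappa>'"
    using measure_Un_le[of bad1 "measure_pmf (instance_law P)" bad2] b1 fd unfolding bad2_def by simp
  moreover have "measure_pmf.prob (instance_law P) (- (bad1 \<union> bad2)) = 1 - measure_pmf.prob (instance_law P) (bad1 \<union> bad2)"
    using measure_pmf.prob_compl[of "bad1 \<union> bad2" "instance_law P"] by (simp add: Compl_eq_Diff_UNIV)
  moreover have eq: "{(\<phi>, c). (\<phi>, c) \<notin> bad1 \<union> bad2} = - (bad1 \<union> bad2)" by auto
  ultimately have good: "measure_pmf.prob (instance_law P) {(\<phi>, c). (\<phi>, c) \<notin> bad1 \<union> bad2} \<ge> 1 - (\<kappa> + \<kappa>')"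
    unfolding eq by linarith
  have "1 - (\<kappa> + \<kappa>') \<le> measure (public_space P) {\<omega> \<in> space (public_space P). (relabel \<omega>, cell_pairs P \<omega>) \<notin> bad1 \<union> bad2}"
    using good measure_instance(2)[of "\<lambda>\<phi> c. (\<phi>, c) \<notin> bad1 \<union> bad2"] by simp
  also have "\<dots> \<le> measure (public_space P) {\<omega> \<in> space (public_space P). solves rf P \<omega> d A B}"
  proof (rule S.finite_measure_mono[OF _ solves_measurable], intro subsetI CollectI, elim CollectE conjE, intro conjI)
    fix \<omega> assume \<omega>: "\<omega> \<in> space (public_space P)" and n: "(relabel \<omega>, cell_pairs P \<omega>) \<notin> bad1 \<union> bad2"
    have \<phi>: "relabel \<omega> permutes U" by (rule public_space_mem(1)[OF \<omega>])
    have X: "xyz rf P" by unfold_locales (use rf p l in auto)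
    have sub: "relabel \<omega> ` ?D \<subseteq> U" "relabel \<omega> ` (A - B) \<subseteq> U" "relabel \<omega> ` (B - A) \<subseteq> U"
      using permutes_in_image[OF \<phi>] AB by blast+
    show "solves rf P \<omega> d A B"
    proof (rule xyz.solves_if_good[OF X \<phi> AB support_in_range[OF \<omega>]])
      have "no_stopping (\<lambda>x. ends (cell_pairs P \<omega> x)) l (relabel \<omega> ` ?D)" using n by (simp add: bad1_def)
      then show "no_stopping (support P \<omega>) (terms P) (relabel \<omega> ` ?D)"
        unfolding l by (rule no_stopping_cong[rotated]) (use sub support_ends in blast)
      show "\<not> false_decoding (modulus P) (terms P) (cells P) (support P \<omega>) (relabel \<omega> ` (A - B)) (relabel \<omega> ` (B - A))"
      proof
        assume f: "false_decoding (modulus P) (terms P) (cells P) (support P \<omega>) (relabel \<omega> ` (A - B)) (relabel \<omega> ` (B - A))"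
        have "false_decoding (modulus P) (terms P) (cells P) (\<lambda>x. ends (cell_pairs P \<omega> x)) (relabel \<omega> ` (A - B)) (relabel \<omega> ` (B - A))"
          by (rule false_decoding_cong[OF _ _ _ f])
            (use sub support_ends in \<open>simp_all add: universe_def\<close>)
        then show False using n l by (simp add: bad2_def)
      qed
    qed
  qed (simp_all)
  finally show ?thesis .
qed

end

section \<open>Length of the message\<close>

lemma width_ge: "n \<le> 2 ^ width n"
proof -
  have "\<exists>w. n \<le> 2 ^ w" using less_exp[of n] less_imp_le by blast
  then show ?thesis unfolding width_def by (rule LeastI_ex)
qed

lemma width_bounds:
  assumes "n \<ge> 1"
  shows "log 2 (real n) \<le> real (width n)" "real (width n) \<le> log 2 (real n) + 1"
proof -
  have "real n \<le> real (2 ^ width n)" using width_ge[of n] by (simp only: of_nat_le_iff)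
  then show "log 2 (real n) \<le> real (width n)" using assms by (subst log_le_iff) (auto simp: powr_realpow)
  show "real (width n) \<le> log 2 (real n) + 1"
  proof (cases "width n")
    case (Suc w)
    have "\<not> n \<le> 2 ^ w" using Suc not_less_Least[of w "\<lambda>w. n \<le> 2 ^ w"] by (simp add: width_def)
    then have "real (2 ^ w) < real n" by (simp only: of_nat_less_iff)
    then have "2 powr real w < real n" by (simp add: powr_realpow)
    then have "real w < log 2 (real n)" using assms by (subst less_log_iff) auto
    then show ?thesis using Suc by simp
  qed (use assms in simp)
qed

lemma width_asymptotics: "((\<lambda>n. real (width n) / log 2 (real n)) \<longlongrightarrow> 1) at_top"
proof (rule tendsto_sandwich)
  show "\<forall>\<^sub>F n in at_top. 1 \<le> real (width n) / log 2 (real n)"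
    using eventually_ge_at_top[of 2]
    by eventually_elim (use width_bounds(1) in \<open>auto simp: le_divide_eq\<close>)
  show "\<forall>\<^sub>F n in at_top. real (width n) / log 2 (real n) \<le> 1 + 1 / log 2 (real n)"
    using eventually_ge_at_top[of 2]
  proof eventually_elim
    case (elim n)
    define L where "L = log 2 (real n)"
    have "L > 0" using elim by (simp add: L_def)
    moreover have "real (width n) \<le> L + 1" using width_bounds(2)[of n] elim by (simp add: L_def)
    ultimately show ?case unfolding L_def[symmetric] by (simp add: field_simps)
  qed
  have "((\<lambda>n. 1 / log 2 (real n)) \<longlongrightarrow> 0) at_top" by real_asymp
  then show "((\<lambda>n. 1 + 1 / log 2 (real n)) \<longlongrightarrow> 1) at_top"
    using tendsto_add[OF tendsto_const[of 1]] by fastforce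
qed simp

text \<open>The widths of count and fingerprint do not depend on the modulus and vanish after
  division by \<open>log 2 p\<close>; only the \<open>l\<close> coefficients of each cell
  remain.\<close>

lemma communication_cost_sketch_bits:
  assumes P: "\<And>p. modulus (P p) = p" "\<And>p. terms (P p) = l" "\<And>p. cells (P p) = M" "\<And>p. fp_modulus (P p) = q"
  shows "communication_cost (\<lambda>p. sketch_bits (P p)) (real M * real l)"
proof -
  let ?w = "real (width (2 * l + 1)) + real (width q)"
  have "((\<lambda>n. 1 / log 2 (real n)) \<longlongrightarrow> 0) at_top" by real_asymp
  then have "((\<lambda>n. real M * (?w * (1 / log 2 (real n)) + real l * (real (width n) / log 2 (real n)))) \<longlongrightarrow>
      real M * (?w * 0 + real l * 1)) at_top"
    by (intro tendsto_intros width_asymptotics)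
  then have "((\<lambda>n. real (sketch_bits (P n)) / log 2 (real n)) \<longlongrightarrow> real M * real l) at_top"
    by (simp add: sketch_bits_def P add_divide_distrib distrib_left ac_simps)
  then show ?thesis unfolding communication_cost_def by (rule tendsto_mono[rotated]) simp
qed

text \<open>
  The order of choice of the constants: the load margin \<open>\<eta>\<close>, the coupling \<open>z\<close> and the number \<open>B\<close>
  of blocks depend on \<open>\<epsilon>\<close> only; \<open>\<ell>\<close> then makes the fraction of overfull cells so small that it
  survives being amplified by a constant factor in each of the \<open>B\<close> blocks.
\<close>

lemma choose_terms:
  fixes \<eta> \<zeta> \<delta> :: real and B :: nat
  assumes "0 < \<eta>" "0 < \<zeta>" "0 < \<delta>" "0 < B"
  obtains u v :: real and l :: nat where "u > 0" "v > 0" "l \<ge> 16"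
    "(u + 2 * v / (\<eta> * real l)) * real B * (1 + 16 / \<eta>) ^ B \<le> \<zeta>"
    "exp (- (\<eta> ^ 3 * real l)) / u \<le> \<delta> / 6" "1 / v \<le> \<delta> / 6"
proof -
  define Q where "Q = real B * (1 + 16 / \<eta>) ^ B"
  have Q: "Q > 0" using assms by (simp add: Q_def zero_less_power add_pos_pos)
  \<comment> \<open>Half of \<open>\<zeta>\<close> is for the overfull cells and fixes
    \<open>u\<close>; the other half is for the excess degrees.\<close>
  define u where "u = \<zeta> / (2 * Q)"
  define v where "v = 6 / \<delta>"
  have uv: "u > 0" "v > 0" using assms Q by (simp_all add: u_def v_def)
  \<comment> \<open>The summands serve, in order, \<open>l >= 16\<close>, the share of
    \<open>v\<close> in the amplification bound, and the exponential bound, for which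
    \<open>y <= exp y\<close> suffices.\<close>
  define l where "l = nat \<lceil>16 + 4 * v * Q / (\<eta> * \<zeta>) + 6 / (u * \<delta> * \<eta> ^ 3)\<rceil>"
  have p: "0 \<le> 4 * v * Q / (\<eta> * \<zeta>)" "0 \<le> 6 / (u * \<delta> * \<eta> ^ 3)" using assms Q uv by simp_all
  have l: "16 + 4 * v * Q / (\<eta> * \<zeta>) + 6 / (u * \<delta> * \<eta> ^ 3) \<le> real l" unfolding l_def by (rule real_nat_ceiling_ge)
  have l1: "16 \<le> real l" "4 * v * Q / (\<eta> * \<zeta>) \<le> real l" "6 / (u * \<delta> * \<eta> ^ 3) \<le> real l" using l p by linarith+
  show ?thesis
  proof (rule that[OF uv])
    show "l \<ge> 16" using l1(1) by linarith
    have "4 * v * Q \<le> real l * (\<eta> * \<zeta>)" using l1(2) assms by (simp add: divide_le_eq)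
    then have "2 * v / (\<eta> * real l) * Q \<le> \<zeta> / 2" using assms l1(1) by (simp add: field_simps)
    moreover have "u * Q = \<zeta> / 2" using Q by (simp add: u_def)
    ultimately have "(u + 2 * v / (\<eta> * real l)) * Q \<le> \<zeta>" by (simp add: distrib_right)
    then show "(u + 2 * v / (\<eta> * real l)) * real B * (1 + 16 / \<eta>) ^ B \<le> \<zeta>" by (simp add: Q_def mult.assoc)
    have y: "\<eta> ^ 3 * real l > 0" using assms l1(1) by simp
    have "\<eta> ^ 3 * real l \<le> exp (\<eta> ^ 3 * real l)" using exp_ge_add_one_self[of "\<eta> ^ 3 * real l"] by linarith
    then have "exp (- (\<eta> ^ 3 * real l)) \<le> 1 / (\<eta> ^ 3 * real l)"
      using le_imp_inverse_le[OF _ y] by (simp only: exp_minus inverse_eq_divide)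
    also have "\<dots> \<le> u * \<delta> / 6"
      using l1(1,3) assms uv by (simp add: field_simps)
    finally show "exp (- (\<eta> ^ 3 * real l)) / u \<le> \<delta> / 6" using uv by (simp add: field_simps)
    show "1 / v \<le> \<delta> / 6" using assms by (simp add: v_def)
  qed
qed

text \<open>\<open>\<delta> / 2\<close> is spent on stopping sets, one \<open>\<delta> / 6\<close>
  for each event of \<open>prob_stopping\<close>, and \<open>\<delta> / 2\<close> on false
  decodings, \<open>\<delta> / 4\<close> each for far and near candidates. The first two sixths are
  paid for by \<open>l\<close>, everything else by \<open>M\<close> and \<open>d\<close>.\<close>

lemma sketch_success:
  fixes \<epsilon>\<^sub>1 \<delta> z :: real and B l d M q p :: nat
  defines "P \<equiv> \<lparr>modulus = p, hashes = 2, terms = l, cells = M, coupling = z, fp_modulus = q\<rparr>"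
  assumes rf: "root_finder rf" and q: "q \<ge> 1" and prime_p: "prime p" "real d \<le> real p / 2"
    and \<epsilon>\<^sub>1: "0 < \<epsilon>\<^sub>1" "\<epsilon>\<^sub>1 \<le> 1 / 2" and z_eq: "z = 8 / \<epsilon>\<^sub>1" and B: "B > 0" "(z + 1) / real B \<le> \<epsilon>\<^sub>1 / 32"
    and \<delta>: "\<delta> > 0" and uv: "u > 0" "v > 0" and l: "l \<ge> 16"
    and \<zeta>: "(u + 2 * v / (\<epsilon>\<^sub>1 / 16 * real l)) * real B * (1 + 16 / (\<epsilon>\<^sub>1 / 16)) ^ B \<le> \<zeta>"
      "\<zeta> \<le> 1 / 4" "\<zeta> \<le> 1 / (2 * exp 1 * (z + 1)\<^sup>2)\<^sup>2"
    and pr: "exp (- ((\<epsilon>\<^sub>1 / 16) ^ 3 * real l)) / u \<le> \<delta> / 6" "1 / v \<le> \<delta> / 6"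
    and M_bounds: "(1 + \<epsilon>\<^sub>1) * real d / real l \<le> real M" "M \<le> d"
      "32 * (z + 1) / \<epsilon>\<^sub>1 \<le> real M" "96 / \<delta> \<le> real M" "64 * exp (4 * real l) / \<delta> \<le> real M" "M \<ge> 1"
    and d: "1152 * exp (16 * real l) / \<delta> \<le> real d" "d \<ge> 4"
    and AB: "A \<subseteq> universe P" "B' \<subseteq> universe P" "card ((A - B') \<union> (B' - A)) \<le> d"
  shows "measure (public_space P) {\<omega> \<in> space (public_space P). solves rf P \<omega> d A B'} \<ge> 1 - \<delta>"
proof -
  have z16: "z \<ge> 16" using \<epsilon>\<^sub>1 by (simp add: z_eq le_divide_eq)
  have "sketch_params P" by unfold_locales (use prime_p q z16 M_bounds in \<open>auto simp: P_def\<close>)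
  then interpret sketch_params P .
  have P: "modulus P = p" "cells P = M" "coupling P = z" "terms P = l" by (simp_all add: P_def)
  define m where "m = real M"
  have m: "m \<ge> 1" using M_bounds by (simp add: m_def)
  have l0: "real l > 0" using l by simp
  have hit: "hit = (z + 1) / (z * m)" by (simp add: hit_def P m_def)
  have hit2: "hit \<le> 2 / m"
  proof -
    have "(z + 1) / z \<le> 2" using z16 by (simp add: divide_le_eq)
    then have "(z + 1) / z / m \<le> 2 / m" using m by (intro divide_right_mono) auto
    then show ?thesis by (simp add: hit)
  qed
  have dm: "(1 + \<epsilon>\<^sub>1) * (real d / m) \<le> real l"
    using M_bounds(1) m l0 by (simp add: m_def field_simps)
  have dm0: "0 \<le> real d / m" using m by simp
  have dml: "real d / m \<le> real l"
    using dm \<epsilon>\<^sub>1 mult_right_mono[of 1 "1 + \<epsilon>\<^sub>1" "real d / m"] dm0 by simp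
  \<comment> \<open>\<open>z = 8 / \<epsilon>\<^sub>1\<close> makes the density of endpoints
    \<open>1 + \<epsilon>\<^sub>1 / 8\<close> times the average, and rounding and block width cost
    another such factor. Their product is at most
    \<open>(1 - \<epsilon>\<^sub>1 / 8) * (1 + \<epsilon>\<^sub>1)\<close>, where
    \<open>1 + \<epsilon>\<^sub>1\<close> is the spare capacity; the margin that is left is
    \<open>2 * \<eta>\<close> for \<open>\<eta> = \<epsilon>\<^sub>1 / 16\<close>.\<close>
  have load: "real d * hit * (1 + 2 * ((coupling P + 1) * (1 / real (cells P) + 1 / real B))) \<le> (1 - 2 * (\<epsilon>\<^sub>1 / 16)) * real l"
  proof -
    have "(z + 1) / m \<le> \<epsilon>\<^sub>1 / 32"
      using M_bounds(3) m \<epsilon>\<^sub>1 by (simp add: m_def field_simps)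
    then have "(z + 1) * (1 / m + 1 / real B) \<le> \<epsilon>\<^sub>1 / 16" using B(2)
      unfolding distrib_left times_divide_eq_right mult_1_right by linarith
    then have g: "1 + 2 * ((z + 1) * (1 / m + 1 / real B)) \<le> 1 + \<epsilon>\<^sub>1 / 8" by linarith
    have hz: "real d * hit = real d / m * (1 + \<epsilon>\<^sub>1 / 8)"
      using z16 m \<epsilon>\<^sub>1 by (simp add: hit z_eq field_simps)
    have "real d * hit * (1 + 2 * ((z + 1) * (1 / m + 1 / real B))) \<le> real d / m * (1 + \<epsilon>\<^sub>1 / 8) * (1 + \<epsilon>\<^sub>1 / 8)"
      unfolding hz by (intro mult_left_mono mult_nonneg_nonneg) (use g dm0 \<epsilon>\<^sub>1 in linarith)+
    also have "\<dots> \<le> real d / m * ((1 - \<epsilon>\<^sub>1 / 8) * (1 + \<epsilon>\<^sub>1))"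
    proof -
      have "\<epsilon>\<^sub>1 * \<epsilon>\<^sub>1 \<le> \<epsilon>\<^sub>1 * (1 / 2)" using \<epsilon>\<^sub>1 by (intro mult_left_mono) auto
      then have "(1 + \<epsilon>\<^sub>1 / 8) * (1 + \<epsilon>\<^sub>1 / 8) \<le> (1 - \<epsilon>\<^sub>1 / 8) * (1 + \<epsilon>\<^sub>1)"
        using \<epsilon>\<^sub>1 by (simp only: distrib_left distrib_right left_diff_distrib)
      then have "real d / m * ((1 + \<epsilon>\<^sub>1 / 8) * (1 + \<epsilon>\<^sub>1 / 8)) \<le> real d / m * ((1 - \<epsilon>\<^sub>1 / 8) * (1 + \<epsilon>\<^sub>1))"
        using dm0 by (intro mult_left_mono) auto
      then show ?thesis by (simp only: mult.assoc)
    qed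
    also have "\<dots> = (1 - \<epsilon>\<^sub>1 / 8) * ((1 + \<epsilon>\<^sub>1) * (real d / m))" by (simp only: ac_simps)
    also have "\<dots> \<le> (1 - \<epsilon>\<^sub>1 / 8) * real l" using dm \<epsilon>\<^sub>1 by (intro mult_left_mono) auto
    finally show ?thesis by (simp add: P m_def)
  qed
  have dhit: "real d * hit \<le> 2 * real l"
  proof -
    have "real d * hit \<le> real d * (2 / m)" using hit2 by (intro mult_left_mono) auto
    also have "\<dots> = 2 * (real d / m)" by simp
    finally show ?thesis using dml by linarith
  qed
  have ns: "measure_pmf.prob items.law {c. \<not> no_stopping (\<lambda>x. ends (c x)) l T} \<le> \<delta> / 2"
    if T: "T \<subseteq> U" "card T \<le> d" for T
  proof -
    have "measure_pmf.prob items.law {c. \<not> no_stopping (\<lambda>x. ends (c x)) l T} \<le>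
      exp (- ((\<epsilon>\<^sub>1 / 16) ^ 3 * real l)) / u + 1 / v + 16 / (real (cells P))\<^sup>2"
    proof (rule prob_stopping[OF T _ _ B(1) uv load _ _ l \<zeta>(2) _ \<zeta>(1)])
      show "\<zeta> \<le> 1 / (2 * exp 1 * (coupling P + 1)\<^sup>2)\<^sup>2" using \<zeta>(3) by (simp add: P)
      show "real d \<le> real l * real (cells P)" using dml m by (simp add: P m_def field_simps)
    qed (use \<epsilon>\<^sub>1 dhit in auto)
    also have "16 / (real (cells P))\<^sup>2 \<le> \<delta> / 6"
    proof -
      have "m * 1 \<le> m * m" using m by (intro mult_left_mono) auto
      then have "96 / \<delta> \<le> m * m" using M_bounds(4) unfolding m_def by linarith
      then show ?thesis using \<delta> m by (simp add: P m_def power2_eq_square field_simps)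
    qed
    finally show ?thesis using pr by linarith
  qed
  have dp: "2 * d \<le> p" using prime_p(2) by linarith
  have pd: "p \<ge> 8" using d(2) dp by linarith
  have Mp: "m \<le> real p" using M_bounds(2) dp by (simp add: m_def)
  have D: "(A - B') \<union> (B' - A) = (B' - A) \<union> (A - B')" by blast
  have fd: "measure_pmf.prob (instance_law P)
      {(\<phi>, c). false_decoding (modulus P) l (cells P) (\<lambda>x. ends (c x)) (\<phi> ` (A - B')) (\<phi> ` (B' - A))} \<le> \<delta> / 2"
  proof -
    have "measure_pmf.prob (instance_law P)
      {(\<phi>, c). false_decoding (modulus P) l (cells P) (\<lambda>x. ends (c x)) (\<phi> ` (A - B')) (\<phi> ` (B' - A))} \<le>
      real (cells P) * (2 * hit)\<^sup>2 * exp (2 * hit * real d) +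
      real (cells P) * exp (8 * hit * real d) * (1 + 4 * real (modulus P) * hit) * (32 / (real (modulus P))\<^sup>2)"
      by (rule prob_false_decoding) (use AB dp pd l P in auto)
    also have "real (cells P) * (2 * hit)\<^sup>2 * exp (2 * hit * real d) \<le> \<delta> / 4"
    proof -
      have "m * (2 * hit)\<^sup>2 * exp (2 * hit * real d) \<le> m * (2 * (2 / m))\<^sup>2 * exp (4 * real l)"
        using hit2 hit_pos dhit m by (intro mult_mono power_mono) (auto simp: mult_ac)
      also have "\<dots> = 16 * exp (4 * real l) / m" using m by (simp add: power2_eq_square)
      also have "\<dots> \<le> \<delta> / 4" using M_bounds(5) m \<delta> by (simp add: m_def field_simps)
      finally show ?thesis by (simp add: P m_def)
    qed
    also have "real (cells P) * exp (8 * hit * real d) * (1 + 4 * real (modulus P) * hit) * (32 / (real (modulus P))\<^sup>2) \<le> \<delta> / 4"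
    proof -
      define r where "r = real p"
      have r: "r > 0" "m \<le> r" "1152 * exp (16 * real l) / \<delta> \<le> r" using pd Mp d(1) dp by (auto simp: r_def)
      \<comment> \<open>After \<open>hit <= 2 / m\<close> the sum over cells and outside elements is
        \<open>m + 8 * r\<close>, linear in \<open>r\<close> because of \<open>m <= r\<close>; one
        of the two powers of \<open>r\<close> in the denominator survives.\<close>
      have "m * exp (8 * hit * real d) * (1 + 4 * r * hit) * (32 / r\<^sup>2) \<le> m * exp (16 * real l) * (1 + 4 * r * (2 / m)) * (32 / r\<^sup>2)"
        using hit2 hit_pos dhit m r by (intro mult_right_mono mult_mono add_left_mono mult_left_mono) (auto simp: mult_ac)
      also have "\<dots> = exp (16 * real l) * (m * (1 + 4 * r * (2 / m))) * (32 / r\<^sup>2)" by (simp only: ac_simps)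
      also have "\<dots> = exp (16 * real l) * (m + 8 * r) * (32 / r\<^sup>2)" using m by (simp add: distrib_left)
      also have "\<dots> \<le> exp (16 * real l) * (9 * r) * (32 / r\<^sup>2)" using r by (intro mult_right_mono mult_left_mono) auto
      also have "\<dots> = 288 * exp (16 * real l) / r" using r by (simp add: power2_eq_square)
      also have "\<dots> \<le> \<delta> / 4" using r \<delta> by (simp add: field_simps)
      finally show ?thesis by (simp add: P m_def r_def)
    qed
    finally show ?thesis by linarith
  qed
  have "1 - (\<delta> / 2 + \<delta> / 2) \<le> measure (public_space P) {\<omega> \<in> space (public_space P). solves rf P \<omega> d A B'}"
    by (rule prob_solves[OF rf _ _ AB ns fd]) (use l P in auto)
  then show ?thesis by simp
qed

text \<open>The overhead per cell is \<open>w\<close> bits for count and fingerprint and at most one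
  bit of rounding per coefficient; it is small against \<open>log 2 p\<close> because
  \<open>p >= d\<close> is large. The ceiling in \<open>M\<close> adds at most one cell, which is
  small against \<open>d\<close>. Each of the two losses costs half of
  \<open>\<epsilon>\<^sub>1\<close>.\<close>

lemma sketch_bits_le:
  fixes \<epsilon>\<^sub>1 :: real
  assumes \<epsilon>\<^sub>1: "0 < \<epsilon>\<^sub>1" "\<epsilon>\<^sub>1 \<le> 1 / 2" and l: "l \<ge> 1"
    and M: "real M \<le> (1 + \<epsilon>\<^sub>1) * real d / real l + 1"
    and P: "modulus P = p" "terms P = l" "cells P = M" "fp_modulus P = q"
    and w: "w = real (width (2 * l + 1)) + real (width q)"
    and d: "2 * (2 * real l + w) / \<epsilon>\<^sub>1 \<le> real d" "2 powr (4 * (real l + w) / \<epsilon>\<^sub>1) \<le> real d" "d \<le> p" "d \<ge> 1"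
  shows "real (sketch_bits P) \<le> (1 + 2 * \<epsilon>\<^sub>1) * real d * log 2 (real p)"
proof -
  define x where "x = log 2 (real p)"
  have w0: "w \<ge> 0" by (simp add: w)
  have l1: "real l \<ge> 1" using l by simp
  have "2 powr (4 * (real l + w) / \<epsilon>\<^sub>1) \<le> real p" using d(2,3) by linarith
  then have x: "4 * (real l + w) / \<epsilon>\<^sub>1 \<le> x" unfolding x_def using d by (subst le_log_iff) auto
  have xl: "4 * (real l + w) \<le> \<epsilon>\<^sub>1 * x" using x \<epsilon>\<^sub>1 by (simp add: divide_le_eq mult.commute)
  have x1: "x \<ge> 1"
  proof -
    have "\<epsilon>\<^sub>1 \<le> 4 * (real l + w)" using w0 l1 \<epsilon>\<^sub>1 by simp
    then have "\<epsilon>\<^sub>1 * 1 \<le> \<epsilon>\<^sub>1 * x" using xl by simp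
    then show ?thesis using \<epsilon>\<^sub>1 by simp
  qed
  have wp: "real (width p) \<le> x + 1" using width_bounds(2)[of p] d by (simp add: x_def)
  have "real (sketch_bits P) = real M * (w + real l * real (width p))" by (simp add: sketch_bits_def P w algebra_simps)
  also have "\<dots> \<le> ((1 + \<epsilon>\<^sub>1) * real d / real l + 1) * (w + real l * (x + 1))"
    using M wp w0 by (intro mult_mono add_left_mono mult_left_mono) auto
  also have "\<dots> = (1 + \<epsilon>\<^sub>1) * real d * x + (1 + \<epsilon>\<^sub>1) * real d * ((w + real l) / real l) + (w + real l * (x + 1))"
    using l1 by (simp add: field_simps)
  also have "\<dots> \<le> (1 + \<epsilon>\<^sub>1) * real d * x + \<epsilon>\<^sub>1 * x / 2 * real d + \<epsilon>\<^sub>1 * real d / 2 * x"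
  proof (intro add_mono order_refl)
    have "(w + real l) / real l \<le> w + real l" using l1 w0 by (simp add: divide_le_eq mult_le_cancel_left1)
    then have "(1 + \<epsilon>\<^sub>1) * ((w + real l) / real l) \<le> 2 * (w + real l)" using \<epsilon>\<^sub>1 w0 l1 by (intro mult_mono) auto
    also have "\<dots> \<le> \<epsilon>\<^sub>1 * x / 2" using xl by simp
    finally have "(1 + \<epsilon>\<^sub>1) * ((w + real l) / real l) * real d \<le> \<epsilon>\<^sub>1 * x / 2 * real d" by (intro mult_right_mono) auto
    then show "(1 + \<epsilon>\<^sub>1) * real d * ((w + real l) / real l) \<le> \<epsilon>\<^sub>1 * x / 2 * real d" by (simp only: ac_simps)
    have "w + real l * (x + 1) \<le> (2 * real l + w) * x"
    proof -
      have "w * 1 \<le> w * x" "real l * 1 \<le> real l * x" using mult_left_mono[OF x1 w0] mult_left_mono[OF x1, of "real l"] by simp_all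
      then show ?thesis by (simp add: algebra_simps)
    qed
    also have "2 * real l + w \<le> \<epsilon>\<^sub>1 * real d / 2" using d(1) \<epsilon>\<^sub>1 by (simp add: divide_le_eq mult.commute)
    then have "(2 * real l + w) * x \<le> \<epsilon>\<^sub>1 * real d / 2 * x" using x1 by (intro mult_right_mono) auto
    finally show "w + real l * (x + 1) \<le> \<epsilon>\<^sub>1 * real d / 2 * x" .
  qed
  also have "\<dots> = (1 + 2 * \<epsilon>\<^sub>1) * real d * x" by (simp add: algebra_simps)
  finally show ?thesis by (simp add: x_def)
qed

theorem theorem13:
  fixes rf :: root_routine and q :: nat and \<epsilon> \<delta> :: real
  assumes "root_finder rf"
    and "q = 1 \<or> odd q \<and> q \<ge> 3"
    and "\<epsilon> > 0" and "\<delta> > 0"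
  shows "\<exists>k l. k \<ge> 1 \<and> l \<ge> 1 \<and> (\<exists>C\<^sub>1 C\<^sub>2 :: real. \<exists>d\<^sub>0 :: nat. \<forall>d\<ge>d\<^sub>0.
    \<exists>M z. M \<ge> 1 \<and> z > 0 \<and>
      (let P = (\<lambda>p. \<lparr>modulus = p, hashes = k, terms = l, cells = M,
                     coupling = z, fp_modulus = q\<rparr>) in
       (\<forall>p. prime p \<and> real d \<le> real p / 2 \<longrightarrow>
          (\<forall>A B. A \<subseteq> universe (P p) \<and> B \<subseteq> universe (P p) \<and> card ((A - B) \<union> (B - A)) \<le> d \<longrightarrow>
             measure (public_space (P p))
               {\<omega> \<in> space (public_space (P p)). solves rf (P p) \<omega> d A B} \<ge> 1 - \<delta> \<and>
             (\<forall>\<omega>\<in>space (public_space (P p)).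
                decoding_time rf (P p) \<omega> d A B \<le> ennreal (C\<^sub>2 * real d * log 2 (real p)))) \<and>
          (\<forall>\<omega>\<in>space (public_space (P p)). \<forall>S x. S \<subseteq> universe (P p) \<and> x \<in> universe (P p) - S \<longrightarrow>
             val (insert_item (P p) \<omega> x (relabeled_sketch (P p) \<omega> S))
               = relabeled_sketch (P p) \<omega> (insert x S) \<and>
             real (cost (insert_item (P p) \<omega> x (relabeled_sketch (P p) \<omega> S))) \<le> C\<^sub>1) \<and>
          int (sketch_bits (P p)) \<le> \<lceil>(1 + \<epsilon>) * real d * log 2 (real p)\<rceil>) \<and>
       (\<exists>c \<le> (1 + \<epsilon>) * real d. communication_cost (\<lambda>p. sketch_bits (P p)) c)))"
proof -
  \<comment> \<open>One share of \<open>e\<close> is for the spare cells and one for the overhead of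
    the message; together they stay within \<open>\<epsilon>\<close>.\<close>
  define e where "e = min \<epsilon> 1 / 2"
  define z where "z = 8 / e"
  define B where "B = nat \<lceil>32 * (z + 1) / e\<rceil> + 1"
  define \<zeta> :: real where "\<zeta> = min (1 / 4) (1 / (2 * exp 1 * (z + 1)\<^sup>2)\<^sup>2)"
  have e: "0 < e" "e \<le> 1 / 2" "2 * e \<le> \<epsilon>" using assms(3) by (auto simp: e_def)
  have z: "z > 0" using e by (simp add: z_def)
  have \<zeta>: "\<zeta> > 0" "\<zeta> \<le> 1 / 4" "\<zeta> \<le> 1 / (2 * exp 1 * (z + 1)\<^sup>2)\<^sup>2" using z by (auto simp: \<zeta>_def)
  have B: "B > 0" by (simp add: B_def)
  have "32 * (z + 1) / e \<le> real B" using real_nat_ceiling_ge[of "32 * (z + 1) / e"] by (simp add: B_def)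
  then have Bz: "(z + 1) / real B \<le> e / 32" using e B by (simp add: field_simps)
  have q: "q \<ge> 1" using assms(2) by auto
  obtain u v :: real and l :: nat where uv: "u > 0" "v > 0" and l: "l \<ge> 16"
    and amp: "(u + 2 * v / (e / 16 * real l)) * real B * (1 + 16 / (e / 16)) ^ B \<le> \<zeta>"
    and pr: "exp (- ((e / 16) ^ 3 * real l)) / u \<le> \<delta> / 6" "1 / v \<le> \<delta> / 6"
    using choose_terms[of "e / 16" \<zeta> \<delta> B] e \<zeta>(1) assms(4) B by auto
  obtain C where C: "C \<ge> 0" "\<And>P \<omega> d A B. prime (modulus P) \<Longrightarrow> terms P = l \<Longrightarrow> hashes P = 2 \<Longrightarrow>
      decoding_time rf P \<omega> d A B \<le> ennreal (C * real (cells P + d + 1) * log 2 (real (modulus P)))"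
    using decoding_time_le[OF assms(1), of l 2] by blast
  define w where "w = real (width (2 * l + 1)) + real (width q)"
  \<comment> \<open>Lower bounds that \<open>d\<close> has to meet. They are nonnegative, so their
    sum dominates each of them. The first three are bounds for \<open>M\<close>, multiplied by
    \<open>l\<close> because \<open>M >= d / l\<close>.\<close>
  define b where "b = [32 * (z + 1) / e * real l, 96 / \<delta> * real l, 64 * exp (4 * real l) / \<delta> * real l,
    1152 * exp (16 * real l) / \<delta>, 2 * (2 * real l + w) / e, 2 powr (4 * (real l + w) / e), real l / e, 4]"
  define d0 where "d0 = nat \<lceil>sum_list b\<rceil>"
  have b: "\<forall>y\<in>set b. 0 \<le> y" using e z assms(4) by (simp add: b_def w_def)
  define C1 :: real where "C1 = real (2 + 2 * (7 + 2) + (2 * l + 8) * 2)"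
  have main: "\<exists>M z. M \<ge> 1 \<and> z > 0 \<and>
      (let P = (\<lambda>p. \<lparr>modulus = p, hashes = 2, terms = l, cells = M,
                     coupling = z, fp_modulus = q\<rparr>) in
       (\<forall>p. prime p \<and> real d \<le> real p / 2 \<longrightarrow>
          (\<forall>A B. A \<subseteq> universe (P p) \<and> B \<subseteq> universe (P p) \<and> card ((A - B) \<union> (B - A)) \<le> d \<longrightarrow>
             measure (public_space (P p))
               {\<omega> \<in> space (public_space (P p)). solves rf (P p) \<omega> d A B} \<ge> 1 - \<delta> \<and>
             (\<forall>\<omega>\<in>space (public_space (P p)).
                decoding_time rf (P p) \<omega> d A B \<le> ennreal (3 * C * real d * log 2 (real p)))) \<and>
          (\<forall>\<omega>\<in>space (public_space (P p)). \<forall>S x. S \<subseteq> universe (P p) \<and> x \<in> universe (P p) - S \<longrightarrow>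
             val (insert_item (P p) \<omega> x (relabeled_sketch (P p) \<omega> S))
               = relabeled_sketch (P p) \<omega> (insert x S) \<and>
             real (cost (insert_item (P p) \<omega> x (relabeled_sketch (P p) \<omega> S))) \<le> C1) \<and>
          int (sketch_bits (P p)) \<le> \<lceil>(1 + \<epsilon>) * real d * log 2 (real p)\<rceil>) \<and>
       (\<exists>c \<le> (1 + \<epsilon>) * real d. communication_cost (\<lambda>p. sketch_bits (P p)) c))"
    if dd: "d0 \<le> d" for d
  proof -
    have "sum_list b \<le> real d" using dd unfolding d0_def by linarith
    then have "\<forall>y\<in>set b. y \<le> real d" using member_le_sum_list[of _ b] b by force
    then have d: "32 * (z + 1) / e * real l \<le> real d" "96 / \<delta> * real l \<le> real d"
      "64 * exp (4 * real l) / \<delta> * real l \<le> real d" "1152 * exp (16 * real l) / \<delta> \<le> real d"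
      "2 * (2 * real l + w) / e \<le> real d" "2 powr (4 * (real l + w) / e) \<le> real d" "real l / e \<le> real d" "4 \<le> real d"
      by (simp_all add: b_def)
    define M where "M = nat \<lceil>(1 + e) * real d / real l\<rceil>"
    have l1: "real l > 0" using l by simp
    have M1: "(1 + e) * real d / real l \<le> real M" unfolding M_def by (rule real_nat_ceiling_ge)
    have "0 \<le> (1 + e) * real d / real l" using e by simp
    then have M2: "real M \<le> (1 + e) * real d / real l + 1" unfolding M_def by linarith
    have "1 * real d \<le> (1 + e) * real d" using e by (intro mult_right_mono) auto
    then have "real d / real l \<le> real M" using M1 l1 divide_right_mono[of "real d" "(1 + e) * real d" "real l"] by simp
    then have M3: "y \<le> real M" if "y * real l \<le> real d" for y
      using that l1 pos_le_divide_eq[OF l1, of y "real d"] by linarith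
    \<comment> \<open>Fewer cells than items, since \<open>l >= 16\<close>: this makes the decoding
      time linear in \<open>d\<close> and gives \<open>M <= p\<close> in the bound for false
      decodings.\<close>
    have "(1 + e) * real d / real l \<le> 2 * real d / 16" using e l by (intro frac_le mult_right_mono) auto
    then have Md: "M \<le> d" using M2 d(8) by linarith
    have Mb: "32 * (z + 1) / e \<le> real M" "96 / \<delta> \<le> real M" "64 * exp (4 * real l) / \<delta> \<le> real M"
      using M3 d(1-3) by blast+
    have M0: "M \<ge> 1"
    proof -
      have "0 < 32 * (z + 1) / e" using z e by simp
      then show ?thesis using Mb(1) by linarith
    qed
    define P where "P = (\<lambda>p. \<lparr>modulus = p, hashes = 2, terms = l, cells = M, coupling = z, fp_modulus = q\<rparr>)"
    have P: "modulus (P p) = p" "hashes (P p) = 2" "terms (P p) = l" "cells (P p) = M" "coupling (P p) = z"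
      "fp_modulus (P p) = q" for p by (simp_all add: P_def)
    have success: "measure (public_space (P p)) {\<omega> \<in> space (public_space (P p)). solves rf (P p) \<omega> d A B'} \<ge> 1 - \<delta>"
      if "prime p" "real d \<le> real p / 2" "A \<subseteq> universe (P p)" "B' \<subseteq> universe (P p)" "card ((A - B') \<union> (B' - A)) \<le> d" for p A B'
      unfolding P_def
      by (rule sketch_success[OF assms(1) q that(1,2) e(1,2) z_def B Bz assms(4) uv l amp \<zeta>(2,3) pr M1 Md Mb M0 d(4)])
        (use that d(8) in \<open>auto simp: P_def\<close>)
    have time: "decoding_time rf (P p) \<omega> d A B' \<le> ennreal (3 * C * real d * log 2 (real p))" if "prime p" for p \<omega> A B'
    proof -
      have "C * real (M + d + 1) \<le> C * (3 * real d)" using C(1) Md d(8) by (intro mult_left_mono) auto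
      then have "C * real (M + d + 1) * log 2 (real p) \<le> C * (3 * real d) * log 2 (real p)"
        using prime_ge_2_nat[OF that] by (intro mult_right_mono) auto
      then have "ennreal (C * real (M + d + 1) * log 2 (real p)) \<le> ennreal (3 * C * real d * log 2 (real p))"
        by (intro ennreal_leI) (simp only: ac_simps)
      then show ?thesis using C(2)[of "P p" \<omega> d A B'] that by (simp add: P order_trans)
    qed
    have update: "val (insert_item (P p) \<omega> x (relabeled_sketch (P p) \<omega> S)) = relabeled_sketch (P p) \<omega> (insert x S)"
      "real (cost (insert_item (P p) \<omega> x (relabeled_sketch (P p) \<omega> S))) \<le> C1"
      if "prime p" "\<omega> \<in> space (public_space (P p))" "S \<subseteq> universe (P p)" "x \<in> universe (P p) - S" for p \<omega> S x
    proof -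
      have "sketch_params (P p)" by unfold_locales (use that z M0 q in \<open>auto simp: P\<close>)
      then show "val (insert_item (P p) \<omega> x (relabeled_sketch (P p) \<omega> S)) = relabeled_sketch (P p) \<omega> (insert x S)"
        using that by (intro insert_item_correct sketch_params.public_space_mem(1)) (auto simp: P)
      have "cost (insert_item (P p) \<omega> x (relabeled_sketch (P p) \<omega> S)) \<le> 2 + 2 * (7 + 2) + (2 * l + 8) * 2"
        using insert_item_cost[of "P p" \<omega> x S] prime_gt_0_nat[OF that(1)] by (simp add: P)
      then show "real (cost (insert_item (P p) \<omega> x (relabeled_sketch (P p) \<omega> S))) \<le> C1"
        unfolding C1_def by (simp only: of_nat_le_iff)
    qed
    have bits: "int (sketch_bits (P p)) \<le> \<lceil>(1 + \<epsilon>) * real d * log 2 (real p)\<rceil>" if "prime p" "real d \<le> real p / 2" for p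
    proof -
      have "real (sketch_bits (P p)) \<le> (1 + 2 * e) * real d * log 2 (real p)"
        by (rule sketch_bits_le[OF e(1,2) _ M2 P(1,3,4,6) w_def d(5,6)]) (use l that d(8) in auto)
      also have "\<dots> \<le> (1 + \<epsilon>) * real d * log 2 (real p)"
        using e prime_ge_2_nat[OF that(1)] by (intro mult_right_mono) auto
      finally show ?thesis by linarith
    qed
    have cost: "\<exists>c \<le> (1 + \<epsilon>) * real d. communication_cost (\<lambda>p. sketch_bits (P p)) c"
    proof (intro exI conjI)
      show "communication_cost (\<lambda>p. sketch_bits (P p)) (real M * real l)"
        by (rule communication_cost_sketch_bits) (rule P)+
      have "real M * real l \<le> ((1 + e) * real d / real l + 1) * real l" using M2 by (intro mult_right_mono) auto
      also have "\<dots> = (1 + e) * real d + real l" using l1 by (simp add: field_simps)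
      also have "\<dots> \<le> (1 + e) * real d + e * real d" using d(7) e by (simp add: divide_le_eq mult.commute)
      also have "\<dots> = (1 + 2 * e) * real d" by (simp add: algebra_simps)
      also have "\<dots> \<le> (1 + \<epsilon>) * real d" using e(3) by (intro mult_right_mono) auto
      finally show "real M * real l \<le> (1 + \<epsilon>) * real d" .
    qed
    show ?thesis
      by (rule exI[of _ M], rule exI[of _ z], unfold P_def[symmetric], unfold Let_def)
        (intro conjI allI impI ballI M0 z cost; elim conjE; (rule success time update bits; assumption))
  qed
  show ?thesis
  proof (rule exI[of _ 2], rule exI[of _ l], intro conjI)
    show "1 \<le> (2 :: nat)" "1 \<le> l" using l by auto
  qed (rule exI[of _ C1], rule exI[of _ "3 * C"], rule exI[of _ d0], intro allI impI main)
qed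

end
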